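(* Let $H$ be a Hopf algebra over a field $\mathbf{k}$ with a bijective antipode and $B/A$ a faithfully flat $H$-Galois extension. Let $L_\bullet=B_\bullet(\mathbf{k};H;H)$ be the one-sided bar resolution of the trivial right $H$-module $\mathbf{k}$ with its diagonal map $\varDelta^{L_\bullet}$, and let $K_\bullet=B^A_\bullet(\Gamma;\Gamma;A)$ be the relative one-sided bar resolution of the left $\Gamma$-module $A$ with its diagonal map $\varDelta^{K_\bullet}$ (all as given in the context). Let $K'_\bullet=B^e\otimes_{A^e}K_\bullet$ and $P_\bullet=\operatorname{Tot}(L_\bullet\otimes_HK'_\bullet)$. Then: (a) The map $\varDelta^{K'_\bullet}$ induced by $\varDelta^{K_\bullet}$ is a coassociative chain map. (b) The map $\varDelta^{P_\bullet}$ induced by $\varDelta^{K'_\bullet}$ and $\varDelta^{L_\bullet}$ is a coassociative chain map. (c) The exterior products $\times_\ell$ and $\times_r$ formed with these choices of $K_\bullet$, $L_\bullet$, $P_\bullet$ and of the diagonal maps $\varDelta^{K_\bullet}$, $\varDelta^{L_\bullet}$, $\varDelta^{P_\bullet}$ are associative and commute with differentials.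
   Context: Unadorned $\otimes$, $\operatorname{Hom}$ are over $\mathbf{k}$; $R^e=R\otimes R^{\mathrm{op}}$; Sweedler notation. $B$ is a right $H$-comodule algebra with coaction $\rho(b)=\sum b_{(0)}\otimes b_{(1)}$, $A=B^{\mathrm{co}H}=\{b\mid\rho(b)=b\otimes1\}$. $B/A$ is $H$-Galois if $\beta:B\otimes_AB\to B\otimes H$, $b\otimes_Ab'\mapsto\sum bb'_{(0)}\otimes b'_{(1)}$, is bijective; faithfully flat if moreover $B$ is faithfully flat as a left (equivalently right) $A$-module. Write $\beta^{-1}(1\otimes h)=\sum_il_i(h)\otimes_Ar_i(h)$. **$\Gamma$.** $\Gamma=\{\sum_pb_p\otimes b_p'^{\mathrm{op}}\in B^e\mid\sum_p(b_p)_{(0)}\otimes(b'_p)_{(0)}^{\mathrm{op}}\otimes(b_p)_{(1)}(b'_p)_{(1)}=\sum_pb_p\otimes b_p'^{\mathrm{op}}\otimes1_H\}$, a subalgebra of $B^e$ containing $A^e$. It is an $A$-coring with $\Delta_\Gamma(\sum_px_p\otimes y_p^{\mathrm{op}})=\sum(x_p)_{(0)}\otimes l_i((x_p)_{(1)})^{\mathrm{op}}\otimes_Ar_i((x_p)_{(1)})\otimes y_p^{\mathrm{op}}$, written $\gamma_{(1)}\otimes_A\gamma_{(2)}$, and $\epsilon_\Gamma(\sum_px_p\otimes y_p^{\mathrm{op}})=\sum_px_py_p\in A$. For a left $\Gamma$-module $M$ write $\sum_px_pmy_p$ for $(\sum_px_p\otimes y_p^{\mathrm{op}})\cdot m$.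 $A$ is a left $\Gamma$-module via $\sum_px_pay_p$; for left $\Gamma$-modules $K,K'$, $K\otimes_AK'$ (bimodule structures via $A^e\subseteq\Gamma$) is a left $\Gamma$-module via $\gamma\cdot(k\otimes_Ak')=\gamma_{(1)}k\otimes_A\gamma_{(2)}k'$. **$H$-actions.** For $h\in H$, $\sum_{i,j}l_i(h_{(1)})\otimes_A(r_i(h_{(1)})\otimes l_j(h_{(2)})^{\mathrm{op}})\otimes_Ar_j(h_{(2)})\in B\otimes_A\Gamma\otimes_AB$. For a left $\Gamma$-module $M$ and $(B,B)$-bimodule $N$: $\operatorname{Hom}_{A^e}(M,N)$ is a right $H$-module via $(f\leftharpoonup h)(m)=\sum_{i,j}l_i(h_{(1)})f(r_i(h_{(1)})ml_j(h_{(2)}))r_j(h_{(2)})$, and $B^e\otimes_{A^e}M$ is a left $H$-module via $h\rightharpoonup((b\otimes b'^{\mathrm{op}})\otimes m)=\sum_{i,j}(bl_i(h_{(1)})\otimes(r_j(h_{(2)})b')^{\mathrm{op}})\otimes(r_i(h_{(1)})ml_j(h_{(2)}))$. **$L_\bullet$.** $L_n=H^{\otimes n}\otimes H$ (right $H$-action on the last factor), $d(h_1\otimes\cdots\otimes h_{n+1})=\epsilon(h_1)h_2\otimes\cdots\otimes h_{n+1}+\sum_{i=1}^n(-1)^ih_1\otimes\cdots\otimes h_ih_{i+1}\otimes\cdots\otimes h_{n+1}$, and $\varDelta^{L_\bullet}_{p,q}:L_{p+q}\to L_p\otimes L_q$ sends $h_1\otimes\cdots\otimes h_{p+q+1}$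 to $(h_1\otimes\cdots\otimes h_p\otimes(h_{p+1})_{(1)}\cdots(h_{p+q+1})_{(1)})\otimes((h_{p+1})_{(2)}\otimes\cdots\otimes(h_{p+q+1})_{(2)})$. **$K_\bullet$.** $K_n=B_n^A(\Gamma;\Gamma;A)=\Gamma\otimes_{A^{\mathrm{op}}}\Gamma^{\otimes_{A^{\mathrm{op}}}n}$, where $a^{\mathrm{op}}\cdot(x\otimes y^{\mathrm{op}})=x\otimes(ya)^{\mathrm{op}}$ and $(x\otimes y^{\mathrm{op}})\cdot a^{\mathrm{op}}=x\otimes(ay)^{\mathrm{op}}$; $\Gamma$ acts by left multiplication on the leftmost factor; for $n\ge1$, $d_n(\gamma_0\otimes\cdots\otimes\gamma_n)=\sum_{i=0}^{n-1}(-1)^i\gamma_0\otimes\cdots\otimes\gamma_i\gamma_{i+1}\otimes\cdots\otimes\gamma_n+(-1)^n\gamma_0\otimes\cdots\otimes\gamma_{n-1}\cdot\epsilon_\Gamma(\gamma_n)^{\mathrm{op}}$; augmentation $\epsilon_\Gamma:K_0\to A$. The diagonal map is $\varDelta^{K_\bullet}_{r,s}(\gamma_0\otimes\cdots\otimes\gamma_{r+s})=((\gamma_0)_{(1)}\otimes\cdots\otimes(\gamma_r)_{(1)})\otimes_A((\gamma_0)_{(2)}\cdots(\gamma_r)_{(2)}\otimes\gamma_{r+1}\otimes\cdots\otimes\gamma_{r+s})$. **Induced maps.** Write $\varDelta^{L_\bullet}_{p,q}(l)=\sum l_p\otimes l_q$, $\varDelta^{K_\bullet}_{r,s}(k)=\sum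 k_r\otimes_Ak_s$. Then $\varDelta^{K'_\bullet}_{r,s}((b\otimes b'^{\mathrm{op}})\otimes k)=\sum((b\otimes1^{\mathrm{op}})\otimes k_r)\otimes_B((1\otimes b'^{\mathrm{op}})\otimes k_s)$, where $B$ acts on $B^e\otimes_{A^e}K$ by $c\cdot((b\otimes b'^{\mathrm{op}})\otimes k)\cdot c'=(cb\otimes(b'c')^{\mathrm{op}})\otimes k$. The differential of $K'_\bullet$ is $\mathrm{id}\otimes d^K$ and that of $P_\bullet$ is $d(l\otimes x)=d^Ll\otimes x+(-1)^pl\otimes d^{K'}x$ for $l\in L_p$. Put $$\varDelta^{P_\bullet}_{p,r;q,s}\bigl(l\otimes_H((b\otimes b'^{\mathrm{op}})\otimes k)\bigr)=\sum(-1)^{qr}\bigl(l_p\otimes_H((b\otimes1^{\mathrm{op}})\otimes k_r)\bigr)\otimes_B\bigl(l_q\otimes_H((1\otimes b'^{\mathrm{op}})\otimes k_s)\bigr)$$ and $\varDelta^{P_\bullet}_{u,v}=\sum_{p+r=u,\,q+s=v}\varDelta^{P_\bullet}_{p,r;q,s}:P_{u+v}\to P_u\otimes_BP_v$. A diagonal map $\varDelta$ on a complex $X_\bullet$ is a chain map if $\varDelta:X_\bullet\to\operatorname{Tot}(X_\bullet\otimes X_\bullet)$ commutes with differentials (usual Koszul signs on the tensor product), and coassociative if $(\varDelta\otimes\mathrm{id})\varDelta=(\mathrm{id}\otimes\varDelta)\varDelta$. **Exterior products.** For $(B,B)$-bimodules $M,N$: for $f\in\operatorname{Hom}_H(L_p,\operatorname{Hom}_{A^e}(K_r,M))$,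 $g\in\operatorname{Hom}_H(L_q,\operatorname{Hom}_{A^e}(K_s,N))$, $(f\times_\ell g)(l)(k)=\sum(-1)^{pq+ps+rs}f(l_p)(k_r)\otimes_Bg(l_q)(k_s)$. For $F\in\operatorname{Hom}_{B^e}(L_p\otimes_HK'_r,M)$, $G\in\operatorname{Hom}_{B^e}(L_q\otimes_HK'_s,N)$, $F\times_rG=(-1)^{(p+r)(q+s)}(F\otimes_BG)\circ\varDelta^{P_\bullet}_{p,r;q,s}$. Differentials: $(d_hf)(l)(k)=(-1)^{p+r}f(d^Ll)(k)$, $(d_vf)(l)(k)=(-1)^rf(l)(d^Kk)$ and $\delta_hF=(-1)^{p+r}F\circ(d^L\otimes\mathrm{id})$, $\delta_vF=(-1)^rF\circ(\mathrm{id}\otimes d^{K'})$. "Commute with differentials" means the Leibniz rule $d(f\times g)=df\times g+(-1)^{p+r}f\times dg$ for both the horizontal and vertical differentials. *)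

theory Defs
  imports Complex_Main "HOL-Library.Poly_Mapping"
begin

section \<open>Formal linear combinations and quotients\<close>

text \<open>
  \<^typ>\<open>'x \<Rightarrow>\<^sub>0 'k\<close> is the vector space with basis \<^typ>\<open>'x\<close>. A quotient of it by a subspace
  \<open>R\<close> is modelled by normal forms: \<open>nf R\<close> is a fixed linear choice of a representative in each coset
  of \<open>R\<close> (it exists because we work over a field, see \<open>is_nf_nf\<close>), so that \<open>nf R v = nf R w\<close>
  iff \<open>v - w \<in> R\<close>. Thus an element of a quotient is itself one of its representatives, and a
  Sweedler-type sum over a tensor \<open>t\<close> is the honest finite sum \<open>t \<bind> f\<close> over the terms of \<open>t\<close>;
  whenever \<open>f\<close> respects the relations, any other representative gives the same value
  (\<open>linext_nf\<close>).
\<close>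

abbreviation "keys \<equiv> Poly_Mapping.keys"
abbreviation "lookup \<equiv> Poly_Mapping.lookup"

definition fscale :: "'k::field \<Rightarrow> ('x \<Rightarrow>\<^sub>0 'k) \<Rightarrow> ('x \<Rightarrow>\<^sub>0 'k)" where
  "fscale c v = Poly_Mapping.map ((*) c) v"

definition ins :: "'x \<Rightarrow> ('x \<Rightarrow>\<^sub>0 'k::field)" where
  "ins x = Poly_Mapping.single x 1"

definition linext :: "('k::field \<Rightarrow> 'm::ab_group_add \<Rightarrow> 'm) \<Rightarrow> ('x \<Rightarrow>\<^sub>0 'k) \<Rightarrow> ('x \<Rightarrow> 'm) \<Rightarrow> 'm" where
  "linext s v f = (\<Sum>x\<in>keys v. s (lookup v x) (f x))"

definition bind :: "('x \<Rightarrow>\<^sub>0 'k::field) \<Rightarrow> ('x \<Rightarrow> ('y \<Rightarrow>\<^sub>0 'k)) \<Rightarrow> ('y \<Rightarrow>\<^sub>0 'k)"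
    (infixl \<open>\<bind>\<close> 60) where
  "v \<bind> f = linext fscale v f"

lemma lookup_fscale [simp]: "lookup (fscale c v) x = c * lookup v x"
  by (cases "lookup v x = 0") (simp_all add: fscale_def map.rep_eq)

global_interpretation fv: vector_space fscale
  by standard (auto intro!: poly_mapping_eqI simp: lookup_add algebra_simps)

definition is_nf :: "('x \<Rightarrow>\<^sub>0 'k::field) set \<Rightarrow> (('x \<Rightarrow>\<^sub>0 'k) \<Rightarrow> ('x \<Rightarrow>\<^sub>0 'k)) \<Rightarrow> bool" where
  "is_nf R q \<longleftrightarrow>
     Vector_Spaces.linear fscale fscale q \<and> (\<forall>v. q v - v \<in> R) \<and> (\<forall>v\<in>R. q v = 0)"

definition nf :: "('x \<Rightarrow>\<^sub>0 'k::field) set \<Rightarrow> ('x \<Rightarrow>\<^sub>0 'k) \<Rightarrow> ('x \<Rightarrow>\<^sub>0 'k)" where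
  "nf R = (SOME q. is_nf R q)"

lemma is_nf_nf:
  fixes R :: "('x \<Rightarrow>\<^sub>0 'k::field) set"
  assumes "fv.subspace R"
  shows "is_nf R (nf R)"
proof -
  interpret p: vector_space_pair "fscale :: 'k \<Rightarrow> ('x \<Rightarrow>\<^sub>0 'k) \<Rightarrow> _" "fscale :: 'k \<Rightarrow> ('x \<Rightarrow>\<^sub>0 'k) \<Rightarrow> _"
    by unfold_locales
  have "\<exists>g\<in>{g. range g \<subseteq> R}. Vector_Spaces.linear fscale fscale g \<and> (\<forall>v\<in>R. g (id v) = v)"
    using p.linear_exists_left_inverse_on[of id R] assms fv.linear_id by auto
  then obtain g where g: "range g \<subseteq> R" "Vector_Spaces.linear fscale fscale g" "\<forall>v\<in>R. g v = v"
    by auto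
  have "Vector_Spaces.linear fscale fscale (\<lambda>v. v - g v)"
    using p.linear_compose_sub[OF fv.linear_id g(2)] by simp
  moreover have "(v - g v) - v \<in> R" for v
    using fv.subspace_neg[OF assms, of "g v"] g(1) by auto
  ultimately have "is_nf R (\<lambda>v. v - g v)"
    using g(3) by (auto simp: is_nf_def)
  then show ?thesis
    unfolding nf_def by (rule someI[of "is_nf R"])
qed

lemma nf_eq_iff:
  assumes "fv.subspace R"
  shows "nf R v = nf R w \<longleftrightarrow> v - w \<in> R"
proof -
  interpret q: Vector_Spaces.linear fscale fscale "nf R"
    using is_nf_nf[OF assms] by (simp add: is_nf_def)
  have *: "nf R u = 0 \<longleftrightarrow> u \<in> R" for u
    using is_nf_nf[OF assms] fv.subspace_neg[OF assms] unfolding is_nf_def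
    by (metis diff_0 minus_minus)
  show ?thesis
    using *[of "v - w"] by (simp add: q.diff)
qed

lemma linear_linext:
  fixes s :: "'k::field \<Rightarrow> 'm::ab_group_add \<Rightarrow> 'm" and f :: "'x \<Rightarrow> 'm"
  assumes "vector_space s"
  shows "Vector_Spaces.linear fscale s (\<lambda>v. linext s v f)"
proof -
  interpret s: vector_space s by fact
  have ext: "linext s v f = (\<Sum>x\<in>S. s (lookup v x) (f x))" if "finite S" "keys v \<subseteq> S" for v :: "'x \<Rightarrow>\<^sub>0 'k" and S
    unfolding linext_def using that
    by (intro sum.mono_neutral_left) (auto simp: in_keys_iff)
  show ?thesis
  proof (intro Vector_Spaces.linear_iff[THEN iffD2] conjI allI)
    fix v w :: "'x \<Rightarrow>\<^sub>0 'k"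
    let ?S = "keys v \<union> keys w"
    have "keys (v + w) \<subseteq> ?S" by (rule keys_add)
    then show "linext s (v + w) f = linext s v f + linext s w f"
      by (simp add: ext[of ?S] lookup_add s.scale_left_distrib sum.distrib)
  next
    fix c and v :: "'x \<Rightarrow>\<^sub>0 'k"
    have "keys (fscale c v) \<subseteq> keys v" by (auto simp: in_keys_iff)
    then show "linext s (fscale c v) f = s c (linext s v f)"
      by (simp add: ext[of "keys v"] s.scale_sum_right)
  qed (fact fv.vector_space_axioms assms)+
qed

lemma linext_nf:
  assumes s: "vector_space s" and G: "\<And>v. v \<in> G \<Longrightarrow> linext s v f = 0"
  shows "linext s (nf (fv.span G) v) f = linext s v f"
proof -
  interpret l: Vector_Spaces.linear fscale s "\<lambda>v. linext s v f"
    using linear_linext[OF s] .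
  have "nf (fv.span G) v - v \<in> fv.span G"
    using is_nf_nf[OF fv.subspace_span, of G] unfolding is_nf_def by blast
  then have "linext s (nf (fv.span G) v - v) f = 0"
    using l.eq_0_on_span[of G "nf (fv.span G) v - v"] G by blast
  then show ?thesis by (simp add: l.diff)
qed


section \<open>Modules and tensor products\<close>

text \<open>
  A \<open>k\<close>-space with a left action of \<^typ>\<open>'l\<close> and a right action of \<^typ>\<open>'r\<close>. The carrier is a
  subset of the ambient additive group \<^typ>\<open>'m\<close>. A field that is irrelevant for a given use (such as
  the left action of a right module) is unconstrained.
\<close>

record ('k, 'l, 'm, 'r) bimod =
  car :: "'m set"
  scl :: "'k \<Rightarrow> 'm \<Rightarrow> 'm"
  lac :: "'l \<Rightarrow> 'm \<Rightarrow> 'm"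
  rac :: "'m \<Rightarrow> 'r \<Rightarrow> 'm"

definition vsp :: "'m set \<Rightarrow> ('k \<Rightarrow> 'm \<Rightarrow> 'm) \<Rightarrow> ('k, 'k, 'm, 'k) bimod" where
  "vsp C s = \<lparr>car = C, scl = s, lac = s, rac = (\<lambda>m c. s c m)\<rparr>"

definition tensor_rel ::
  "('k::field, 'l, 'm::ab_group_add, 'r) bimod \<Rightarrow> 'r set \<Rightarrow> ('k, 'r, 'n::ab_group_add, 's) bimod
     \<Rightarrow> ('m \<times> 'n \<Rightarrow>\<^sub>0 'k) set" where
  "tensor_rel M R N = module.span fscale (
     {ins (m + m', n) - ins (m, n) - ins (m', n) | m m' n. m \<in> car M \<and> m' \<in> car M \<and> n \<in> car N} \<union>
     {ins (m, n + n') - ins (m, n) - ins (m, n') | m n n'. m \<in> car M \<and> n \<in> car N \<and> n' \<in> car N} \<union>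
     {ins (scl M c m, n) - fscale c (ins (m, n)) | c m n. m \<in> car M \<and> n \<in> car N} \<union>
     {ins (m, scl N c n) - fscale c (ins (m, n)) | c m n. m \<in> car M \<and> n \<in> car N} \<union>
     {ins (rac M m r, n) - ins (m, lac N r n) | m r n. m \<in> car M \<and> r \<in> R \<and> n \<in> car N})"

text \<open>\<open>tns M R N m n\<close> is \<open>m \<otimes>\<^sub>R n\<close>; \<open>tensor M R N\<close> is \<open>M \<otimes>\<^sub>R N\<close> with the outer actions.\<close>

definition tns ::
  "('k::field, 'l, 'm::ab_group_add, 'r) bimod \<Rightarrow> 'r set \<Rightarrow> ('k, 'r, 'n::ab_group_add, 's) bimod
     \<Rightarrow> 'm \<Rightarrow> 'n \<Rightarrow> ('m \<times> 'n \<Rightarrow>\<^sub>0 'k)" where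
  "tns M R N m n = nf (tensor_rel M R N) (ins (m, n))"

definition tensor ::
  "('k::field, 'l, 'm::ab_group_add, 'r) bimod \<Rightarrow> 'r set \<Rightarrow> ('k, 'r, 'n::ab_group_add, 's) bimod
     \<Rightarrow> ('k, 'l, 'm \<times> 'n \<Rightarrow>\<^sub>0 'k, 's) bimod" where
  "tensor M R N =
     \<lparr>car = nf (tensor_rel M R N) ` {v. keys v \<subseteq> car M \<times> car N},
      scl = fscale,
      lac = (\<lambda>l t. t \<bind> (\<lambda>(m, n). tns M R N (lac M l m) n)),
      rac = (\<lambda>t s. t \<bind> (\<lambda>(m, n). tns M R N m (rac N n s)))\<rparr>"

text \<open>\<open>f \<otimes> g\<close> with values in \<open>M \<otimes>\<^sub>R N\<close>, and the associativity isomorphism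
  \<open>(M \<otimes>\<^sub>R N) \<otimes>\<^sub>S Q \<rightarrow> M \<otimes>\<^sub>R (N \<otimes>\<^sub>S Q)\<close>.\<close>

definition tmap ::
  "('k::field, 'l, 'm::ab_group_add, 'r) bimod \<Rightarrow> 'r set \<Rightarrow> ('k, 'r, 'n::ab_group_add, 's) bimod
     \<Rightarrow> ('x \<Rightarrow> 'm) \<Rightarrow> ('y \<Rightarrow> 'n) \<Rightarrow> ('x \<times> 'y \<Rightarrow>\<^sub>0 'k) \<Rightarrow> ('m \<times> 'n \<Rightarrow>\<^sub>0 'k)" where
  "tmap M R N f g t = t \<bind> (\<lambda>(x, y). tns M R N (f x) (g y))"

definition tassoc ::
  "('k::field, 'l, 'm::ab_group_add, 'r) bimod \<Rightarrow> 'r set \<Rightarrow> ('k, 'r, 'n::ab_group_add, 's) bimod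
     \<Rightarrow> 's set \<Rightarrow> ('k, 's, 'q::ab_group_add, 't) bimod
     \<Rightarrow> (('m \<times> 'n \<Rightarrow>\<^sub>0 'k) \<times> 'q \<Rightarrow>\<^sub>0 'k) \<Rightarrow> ('m \<times> ('n \<times> 'q \<Rightarrow>\<^sub>0 'k) \<Rightarrow>\<^sub>0 'k)" where
  "tassoc M R N S Q t =
     t \<bind> (\<lambda>(u, q). u \<bind> (\<lambda>(m, n). tns M R (tensor N S Q) m (tns N S Q n q)))"

text \<open>The \<open>n\<close>-fold tensor power \<open>M \<otimes>\<^sub>R \<cdots> \<otimes>\<^sub>R M\<close>, generated by the lists of length \<open>n\<close>.\<close>

definition tpow_rel ::
  "nat \<Rightarrow> ('k::field, 'r, 'm::ab_group_add, 'r) bimod \<Rightarrow> 'r set \<Rightarrow> ('m list \<Rightarrow>\<^sub>0 'k) set" where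
  "tpow_rel n M R = module.span fscale (
     {ins (xs @ (m + m') # ys) - ins (xs @ m # ys) - ins (xs @ m' # ys) | xs m m' ys.
        length xs + 1 + length ys = n \<and> set xs \<union> {m, m'} \<union> set ys \<subseteq> car M} \<union>
     {ins (xs @ scl M c m # ys) - fscale c (ins (xs @ m # ys)) | xs c m ys.
        length xs + 1 + length ys = n \<and> set xs \<union> {m} \<union> set ys \<subseteq> car M} \<union>
     {ins (xs @ rac M m r # m' # ys) - ins (xs @ m # lac M r m' # ys) | xs m r m' ys.
        r \<in> R \<and> length xs + 2 + length ys = n \<and> set xs \<union> {m, m'} \<union> set ys \<subseteq> car M})"

definition tpow_elt ::
  "nat \<Rightarrow> ('k::field, 'r, 'm::ab_group_add, 'r) bimod \<Rightarrow> 'r set \<Rightarrow> 'm list \<Rightarrow> ('m list \<Rightarrow>\<^sub>0 'k)" where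
  "tpow_elt n M R xs = nf (tpow_rel n M R) (ins xs)"

definition tpow_car ::
  "nat \<Rightarrow> ('k::field, 'r, 'm::ab_group_add, 'r) bimod \<Rightarrow> 'r set \<Rightarrow> ('m list \<Rightarrow>\<^sub>0 'k) set" where
  "tpow_car n M R =
     nf (tpow_rel n M R) ` {v. keys v \<subseteq> {xs. length xs = n \<and> set xs \<subseteq> car M}}"

definition bimod_hom ::
  "'l set \<Rightarrow> 'r set \<Rightarrow> ('k, 'l, 'm::ab_group_add, 'r) bimod \<Rightarrow> ('k, 'l, 'n::ab_group_add, 'r) bimod
     \<Rightarrow> ('m \<Rightarrow> 'n) \<Rightarrow> bool" where
  "bimod_hom R S M N f \<longleftrightarrow>
     (\<forall>m\<in>car M. f m \<in> car N) \<and>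
     (\<forall>m\<in>car M. \<forall>m'\<in>car M. f (m + m') = f m + f m') \<and>
     (\<forall>c. \<forall>m\<in>car M. f (scl M c m) = scl N c (f m)) \<and>
     (\<forall>r\<in>R. \<forall>m\<in>car M. f (lac M r m) = lac N r (f m)) \<and>
     (\<forall>s\<in>S. \<forall>m\<in>car M. f (rac M m s) = rac N (f m) s)"


section \<open>Hopf algebras and comodule algebras\<close>

record (overloaded) ('k::zero, 'h) hopf =
  hscale :: "'k \<Rightarrow> 'h \<Rightarrow> 'h"
  comul :: "'h \<Rightarrow> ('h \<times> 'h \<Rightarrow>\<^sub>0 'k)"
  counit :: "'h \<Rightarrow> 'k"
  antip :: "'h \<Rightarrow> 'h"

record (overloaded) ('k::zero, 'h, 'b) ext_data = "('k, 'h) hopf" +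
  bscale :: "'k \<Rightarrow> 'b \<Rightarrow> 'b"
  coact :: "'b \<Rightarrow> ('b \<times> 'h \<Rightarrow>\<^sub>0 'k)"

definition k_algebra :: "('k::field \<Rightarrow> 'a::{ring,monoid_mult} \<Rightarrow> 'a) \<Rightarrow> bool" where
  "k_algebra s \<longleftrightarrow> vector_space s \<and> (\<forall>c x y. s c (x * y) = s c x * y \<and> s c (x * y) = x * s c y)"

definition Hk :: "('k::field, 'h, 'z) hopf_scheme \<Rightarrow> ('k, 'k, 'h, 'k) bimod" where
  "Hk G = vsp UNIV (hscale G)"

abbreviation HH where "HH G \<equiv> tensor (Hk G) UNIV (Hk G)"

definition algmul ::
  "('k::field, 'k, 'a::{ring,monoid_mult}, 'k) bimod \<Rightarrow> ('k, 'k, 'c::{ring,monoid_mult}, 'k) bimod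
     \<Rightarrow> ('a \<times> 'c \<Rightarrow>\<^sub>0 'k) \<Rightarrow> ('a \<times> 'c \<Rightarrow>\<^sub>0 'k) \<Rightarrow> ('a \<times> 'c \<Rightarrow>\<^sub>0 'k)" where
  "algmul M N t u = t \<bind> (\<lambda>(a, c). u \<bind> (\<lambda>(a', c'). tns M UNIV N (a * a') (c * c')))"

definition hopf_algebra :: "('k::field, 'h::ring_1, 'z) hopf_scheme \<Rightarrow> bool" where
  "hopf_algebra G \<longleftrightarrow>
     k_algebra (hscale G) \<and>
     Vector_Spaces.linear (hscale G) fscale (comul G) \<and>
     (\<forall>h. comul G h \<in> car (HH G)) \<and>
     (\<forall>h. tassoc (Hk G) UNIV (Hk G) UNIV (Hk G) (tmap (HH G) UNIV (Hk G) (comul G) id (comul G h))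
        = tmap (Hk G) UNIV (HH G) id (comul G) (comul G h)) \<and>
     Vector_Spaces.linear (hscale G) (*) (counit G) \<and>
     (\<forall>h. linext (hscale G) (comul G h) (\<lambda>(h1, h2). hscale G (counit G h1) h2) = h) \<and>
     (\<forall>h. linext (hscale G) (comul G h) (\<lambda>(h1, h2). hscale G (counit G h2) h1) = h) \<and>
     comul G 1 = tns (Hk G) UNIV (Hk G) 1 1 \<and>
     (\<forall>h h'. comul G (h * h') = algmul (Hk G) (Hk G) (comul G h) (comul G h')) \<and>
     counit G 1 = 1 \<and>
     (\<forall>h h'. counit G (h * h') = counit G h * counit G h') \<and>
     Vector_Spaces.linear (hscale G) (hscale G) (antip G) \<and>
     (\<forall>h. linext (hscale G) (comul G h) (\<lambda>(h1, h2). antip G h1 * h2) = hscale G (counit G h) 1) \<and>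
     (\<forall>h. linext (hscale G) (comul G h) (\<lambda>(h1, h2). h1 * antip G h2) = hscale G (counit G h) 1)"

text \<open>The sort \<open>{ring,monoid_mult}\<close> is that of unital rings, possibly with \<open>0 = 1\<close>.\<close>

definition Bk :: "('k::field, 'h::ring_1, 'b::{ring,monoid_mult}) ext_data \<Rightarrow> ('k, 'k, 'b, 'k) bimod" where
  "Bk G = vsp UNIV (bscale G)"

abbreviation BH where "BH G \<equiv> tensor (Bk G) UNIV (Hk G)"

definition comodule_algebra ::
  "('k::field, 'h::ring_1, 'b::{ring,monoid_mult}) ext_data \<Rightarrow> bool" where
  "comodule_algebra G \<longleftrightarrow>
     k_algebra (bscale G) \<and>
     Vector_Spaces.linear (bscale G) fscale (coact G) \<and>
     (\<forall>b. coact G b \<in> car (BH G)) \<and>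
     (\<forall>b. tassoc (Bk G) UNIV (Hk G) UNIV (Hk G) (tmap (BH G) UNIV (Hk G) (coact G) id (coact G b))
        = tmap (Bk G) UNIV (HH G) id (comul G) (coact G b)) \<and>
     (\<forall>b. linext (bscale G) (coact G b) (\<lambda>(b0, h). bscale G (counit G h) b0) = b) \<and>
     coact G 1 = tns (Bk G) UNIV (Hk G) 1 1 \<and>
     (\<forall>b b'. coact G (b * b') = algmul (Bk G) (Hk G) (coact G b) (coact G b'))"

definition coinv :: "('k::field, 'h::ring_1, 'b::{ring,monoid_mult}) ext_data \<Rightarrow> 'b set" where
  "coinv G = {b. coact G b = tns (Bk G) UNIV (Hk G) b 1}"


section \<open>Faithfully flat Hopf--Galois extensions\<close>

definition Breg :: "('k::field, 'h::ring_1, 'b::{ring,monoid_mult}) ext_data \<Rightarrow> ('k, 'b, 'b, 'b) bimod" where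
  "Breg G = \<lparr>car = UNIV, scl = bscale G, lac = (*), rac = (*)\<rparr>"

abbreviation BAB where "BAB G \<equiv> tensor (Breg G) (coinv G) (Breg G)"

definition galois_map ::
  "('k::field, 'h::ring_1, 'b::{ring,monoid_mult}) ext_data \<Rightarrow> ('b \<times> 'b \<Rightarrow>\<^sub>0 'k) \<Rightarrow> ('b \<times> 'h \<Rightarrow>\<^sub>0 'k)" where
  "galois_map G t =
     t \<bind> (\<lambda>(b, b'). coact G b' \<bind> (\<lambda>(b0, h). tns (Bk G) UNIV (Hk G) (b * b0) h))"

definition hopf_galois :: "('k::field, 'h::ring_1, 'b::{ring,monoid_mult}) ext_data \<Rightarrow> bool" where
  "hopf_galois G \<longleftrightarrow> bij_betw (galois_map G) (car (BAB G)) (car (BH G))"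

text \<open>The tensor \<open>\<Sum>\<^sub>i l\<^sub>i(h) \<otimes>\<^sub>A r\<^sub>i(h)\<close>.\<close>

definition transl ::
  "('k::field, 'h::ring_1, 'b::{ring,monoid_mult}) ext_data \<Rightarrow> 'h \<Rightarrow> ('b \<times> 'b \<Rightarrow>\<^sub>0 'k)" where
  "transl G h = inv_into (car (BAB G)) (galois_map G) (tns (Bk G) UNIV (Hk G) 1 h)"

definition right_A_module ::
  "('k::field, 'h::ring_1, 'b::{ring,monoid_mult}) ext_data \<Rightarrow> ('k, 'l, 'z::ab_group_add, 'b) bimod \<Rightarrow> bool" where
  "right_A_module G M \<longleftrightarrow>
     0 \<in> car M \<and> (\<forall>m\<in>car M. \<forall>m'\<in>car M. m - m' \<in> car M) \<and>
     (\<forall>m\<in>car M. \<forall>a\<in>coinv G. rac M m a \<in> car M) \<and>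
     (\<forall>m\<in>car M. \<forall>m'\<in>car M. \<forall>a\<in>coinv G. rac M (m + m') a = rac M m a + rac M m' a) \<and>
     (\<forall>m\<in>car M. \<forall>a\<in>coinv G. \<forall>a'\<in>coinv G. rac M m (a + a') = rac M m a + rac M m a') \<and>
     (\<forall>m\<in>car M. \<forall>a\<in>coinv G. \<forall>a'\<in>coinv G. rac M m (a * a') = rac M (rac M m a) a') \<and>
     (\<forall>m\<in>car M. rac M m 1 = m) \<and>
     (\<forall>c. \<forall>m\<in>car M. scl M c m = rac M m (bscale G c 1))"

text \<open>
  \<open>B\<close> is faithfully flat as a left \<open>A\<close>-module: a sequence \<open>M \<rightarrow> N \<rightarrow> Q\<close> of right \<open>A\<close>-modules is
  exact iff \<open>M \<otimes>\<^sub>A B \<rightarrow> N \<otimes>\<^sub>A B \<rightarrow> Q \<otimes>\<^sub>A B\<close> is. HOL cannot quantify over all types, so the modules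
  range over those whose elements lie in a given type \<^typ>\<open>'z\<close>. Nothing is lost as soon as \<^typ>\<open>'z\<close>
  accommodates \<open>A\<close> and its submodules and quotients, since flatness is tested on the inclusions of
  right ideals in \<open>A\<close>, and faithfulness on cyclic modules.
\<close>

definition exact_at ::
  "('k, 'l, 'm, 'r) bimod \<Rightarrow> ('k, 'l, 'n::zero, 'r) bimod \<Rightarrow> ('m \<Rightarrow> 'n) \<Rightarrow> ('n \<Rightarrow> 'q::zero) \<Rightarrow> bool" where
  "exact_at M N f g \<longleftrightarrow> f ` car M = {n \<in> car N. g n = 0}"

definition faithfully_flat ::
  "'z::ab_group_add itself \<Rightarrow> ('k::field, 'h::ring_1, 'b::{ring,monoid_mult}) ext_data \<Rightarrow> bool" where
  "faithfully_flat _ G \<longleftrightarrow>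
     (\<forall>(M :: ('k, unit, 'z, 'b) bimod) (N :: ('k, unit, 'z, 'b) bimod) (Q :: ('k, unit, 'z, 'b) bimod) f g.
        right_A_module G M \<and> right_A_module G N \<and> right_A_module G Q \<and>
        bimod_hom {} (coinv G) M N f \<and> bimod_hom {} (coinv G) N Q g \<longrightarrow>
        (exact_at M N f g \<longleftrightarrow>
         exact_at (tensor M (coinv G) (Breg G)) (tensor N (coinv G) (Breg G))
           (tmap N (coinv G) (Breg G) f id) (tmap Q (coinv G) (Breg G) g id)))"

text \<open>The free vector space on lists over \<open>B\<close> and \<open>H\<close> has room for all subquotients, in
  particular, of the tensor powers of \<open>B\<close> and \<open>H\<close>.\<close>

definition faithfully_flat_galois ::
  "('k::field, 'h::ring_1, 'b::{ring,monoid_mult}) ext_data \<Rightarrow> bool" where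
  "faithfully_flat_galois G \<longleftrightarrow>
     comodule_algebra G \<and> hopf_galois G \<and> faithfully_flat TYPE(('b + 'h) list \<Rightarrow>\<^sub>0 'k) G"


section \<open>The coring \<open>\<Gamma>\<close>\<close>

text \<open>\<open>be G x y\<close> is \<open>x \<otimes> y\<^sup>o\<^sup>p \<in> B\<^sup>e\<close>.\<close>

type_synonym ('b, 'k) env = "'b \<times> 'b \<Rightarrow>\<^sub>0 'k"

definition be :: "('k::field, 'h::ring_1, 'b::{ring,monoid_mult}) ext_data \<Rightarrow> 'b \<Rightarrow> 'b \<Rightarrow> ('b, 'k) env" where
  "be G x y = tns (Bk G) UNIV (Bk G) x y"

definition Be_car :: "('k::field, 'h::ring_1, 'b::{ring,monoid_mult}) ext_data \<Rightarrow> ('b, 'k) env set" where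
  "Be_car G = car (tensor (Bk G) UNIV (Bk G))"

definition bemul ::
  "('k::field, 'h::ring_1, 'b::{ring,monoid_mult}) ext_data \<Rightarrow> ('b, 'k) env \<Rightarrow> ('b, 'k) env \<Rightarrow> ('b, 'k) env" where
  "bemul G u v = u \<bind> (\<lambda>(x, y). v \<bind> (\<lambda>(x', y'). be G (x * x') (y' * y)))"

definition Ae :: "('k::field, 'h::ring_1, 'b::{ring,monoid_mult}) ext_data \<Rightarrow> ('b, 'k) env set" where
  "Ae G = module.span fscale {be G a a' | a a'. a \<in> coinv G \<and> a' \<in> coinv G}"

definition Gam :: "('k::field, 'h::ring_1, 'b::{ring,monoid_mult}) ext_data \<Rightarrow> ('b, 'k) env set" where
  "Gam G = {u \<in> Be_car G.
     u \<bind> (\<lambda>(x, y). coact G x \<bind> (\<lambda>(x0, x1). coact G y \<bind> (\<lambda>(y0, y1).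
       tns (vsp (Be_car G) fscale) UNIV (Hk G) (be G x0 y0) (x1 * y1))))
     = tns (vsp (Be_car G) fscale) UNIV (Hk G) u 1}"

text \<open>The \<open>A\<close>-bimodule structure coming from left multiplication by \<open>A\<^sup>e\<close>, on \<open>B\<^sup>e\<close> and on \<open>\<Gamma>\<close>.\<close>

definition BeA ::
  "('k::field, 'h::ring_1, 'b::{ring,monoid_mult}) ext_data \<Rightarrow> ('k, 'b, ('b, 'k) env, 'b) bimod" where
  "BeA G = \<lparr>car = Be_car G, scl = fscale,
     lac = (\<lambda>a u. bemul G (be G a 1) u), rac = (\<lambda>u a. bemul G (be G 1 a) u)\<rparr>"

definition GamA ::
  "('k::field, 'h::ring_1, 'b::{ring,monoid_mult}) ext_data \<Rightarrow> ('k, 'b, ('b, 'k) env, 'b) bimod" where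
  "GamA G = (BeA G)\<lparr>car := Gam G\<rparr>"

text \<open>The right hand side is an element of \<open>B\<^sup>e \<otimes>\<^sub>A B\<^sup>e\<close>; by flatness \<open>\<Gamma> \<otimes>\<^sub>A \<Gamma>\<close> embeds there.\<close>

definition Gcomul ::
  "('k::field, 'h::ring_1, 'b::{ring,monoid_mult}) ext_data
     \<Rightarrow> ('b, 'k) env \<Rightarrow> (('b, 'k) env \<times> ('b, 'k) env \<Rightarrow>\<^sub>0 'k)" where
  "Gcomul G u = (THE t. t \<in> car (tensor (GamA G) (coinv G) (GamA G)) \<and>
     tmap (BeA G) (coinv G) (BeA G) id id t =
     u \<bind> (\<lambda>(x, y). coact G x \<bind> (\<lambda>(x0, x1). transl G x1 \<bind> (\<lambda>(l, r).
       tns (BeA G) (coinv G) (BeA G) (be G x0 l) (be G r y)))))"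

definition Gcounit :: "('k::field, 'h::ring_1, 'b::{ring,monoid_mult}) ext_data \<Rightarrow> ('b, 'k) env \<Rightarrow> 'b" where
  "Gcounit G u = linext (bscale G) u (\<lambda>(x, y). x * y)"

text \<open>
  \<open>tau G h\<close> is \<open>\<Sum> l\<^sub>i(h\<^sub>1) \<otimes>\<^sub>A (r\<^sub>i(h\<^sub>1) \<otimes> l\<^sub>j(h\<^sub>2)\<^sup>o\<^sup>p) \<otimes>\<^sub>A r\<^sub>j(h\<^sub>2)\<close> as an element of \<open>B \<otimes>\<^sub>A (\<Gamma> \<otimes>\<^sub>A B)\<close>,
  characterised by its image in \<open>B \<otimes>\<^sub>A (B\<^sup>e \<otimes>\<^sub>A B)\<close>. It is needed in \<open>B \<otimes>\<^sub>A (\<Gamma> \<otimes>\<^sub>A B)\<close> because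
  only \<open>\<Gamma>\<close>, not \<open>B\<^sup>e\<close>, acts on a \<open>\<Gamma>\<close>-module.
\<close>

definition tau ::
  "('k::field, 'h::ring_1, 'b::{ring,monoid_mult}) ext_data
     \<Rightarrow> 'h \<Rightarrow> ('b \<times> (('b, 'k) env \<times> 'b \<Rightarrow>\<^sub>0 'k) \<Rightarrow>\<^sub>0 'k)" where
  "tau G h = (THE t. t \<in> car (tensor (Breg G) (coinv G) (tensor (GamA G) (coinv G) (Breg G))) \<and>
     tmap (Breg G) (coinv G) (tensor (BeA G) (coinv G) (Breg G)) id
       (tmap (BeA G) (coinv G) (Breg G) id id) t =
     comul G h \<bind> (\<lambda>(h1, h2). transl G h1 \<bind> (\<lambda>(l, r). transl G h2 \<bind> (\<lambda>(l', r').
       tns (Breg G) (coinv G) (tensor (BeA G) (coinv G) (Breg G)) l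
         (tns (BeA G) (coinv G) (Breg G) (be G r l') r')))))"


section \<open>The resolution \<open>L\<close>\<close>

type_synonym ('h, 'k) Lelt = "'h list \<Rightarrow>\<^sub>0 'k"

definition Lp :: "('k::field, 'h::ring_1, 'z) hopf_scheme \<Rightarrow> nat \<Rightarrow> 'h list \<Rightarrow> ('h, 'k) Lelt" where
  "Lp G n hs = tpow_elt (n + 1) (Hk G) UNIV hs"

definition Lact :: "('k::field, 'h::ring_1, 'z) hopf_scheme \<Rightarrow> nat \<Rightarrow> ('h, 'k) Lelt \<Rightarrow> 'h \<Rightarrow> ('h, 'k) Lelt" where
  "Lact G n l h = l \<bind> (\<lambda>hs. Lp G n (butlast hs @ [last hs * h]))"

definition L_cx :: "('k::field, 'h::ring_1, 'z) hopf_scheme \<Rightarrow> nat \<Rightarrow> ('k, 'k, ('h, 'k) Lelt, 'h) bimod" where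
  "L_cx G n = \<lparr>car = tpow_car (n + 1) (Hk G) UNIV, scl = fscale, lac = fscale, rac = Lact G n\<rparr>"

abbreviation Lk where "Lk G n \<equiv> vsp (car (L_cx G n)) fscale"

definition dL :: "('k::field, 'h::ring_1, 'z) hopf_scheme \<Rightarrow> nat \<Rightarrow> ('h, 'k) Lelt \<Rightarrow> ('h, 'k) Lelt" where
  "dL G n l = (if n = 0 then 0 else l \<bind> (\<lambda>hs.
     fscale (counit G (hd hs)) (Lp G (n - 1) (tl hs)) +
     (\<Sum>i=1..n. fscale ((-1) ^ i)
        (Lp G (n - 1) (take (i - 1) hs @ (hs ! (i - 1) * hs ! i) # drop (i + 1) hs)))))"

text \<open>\<open>Hsplit G [h\<^sub>1, \<dots>, h\<^sub>n]\<close> is the formal sum of the \<open>(h\<^sub>1\<^sub>(\<^sub>1\<^sub>) \<cdots> h\<^sub>n\<^sub>(\<^sub>1\<^sub>), [h\<^sub>1\<^sub>(\<^sub>2\<^sub>), \<dots>, h\<^sub>n\<^sub>(\<^sub>2\<^sub>)])\<close>.\<close>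

fun Hsplit :: "('k::field, 'h::ring_1, 'z) hopf_scheme \<Rightarrow> 'h list \<Rightarrow> ('h \<times> 'h list \<Rightarrow>\<^sub>0 'k)" where
  "Hsplit G [] = ins (1, [])"
| "Hsplit G (h # hs) = comul G h \<bind> (\<lambda>(h1, h2). Hsplit G hs \<bind> (\<lambda>(g, gs). ins (h1 * g, h2 # gs)))"

definition DeltaL ::
  "('k::field, 'h::ring_1, 'z) hopf_scheme \<Rightarrow> nat \<Rightarrow> nat \<Rightarrow> ('h, 'k) Lelt
     \<Rightarrow> (('h, 'k) Lelt \<times> ('h, 'k) Lelt \<Rightarrow>\<^sub>0 'k)" where
  "DeltaL G p q l = l \<bind> (\<lambda>hs. Hsplit G (drop p hs) \<bind> (\<lambda>(g, gs).
     tns (Lk G p) UNIV (Lk G q) (Lp G p (take p hs @ [g])) (Lp G q gs)))"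


section \<open>The resolution \<open>K\<close>\<close>

type_synonym ('b, 'k) Kelt = "('b, 'k) env list \<Rightarrow>\<^sub>0 'k"

text \<open>\<open>\<Gamma>\<close> with the \<open>A\<^sup>o\<^sup>p\<close>-bimodule structure given by left and right multiplication by \<open>1 \<otimes> a\<^sup>o\<^sup>p\<close>.\<close>

definition GamAop ::
  "('k::field, 'h::ring_1, 'b::{ring,monoid_mult}) ext_data \<Rightarrow> ('k, 'b, ('b, 'k) env, 'b) bimod" where
  "GamAop G = \<lparr>car = Gam G, scl = fscale,
     lac = (\<lambda>a u. bemul G (be G 1 a) u), rac = (\<lambda>u a. bemul G u (be G 1 a))\<rparr>"

definition Kp ::
  "('k::field, 'h::ring_1, 'b::{ring,monoid_mult}) ext_data \<Rightarrow> nat \<Rightarrow> ('b, 'k) env list \<Rightarrow> ('b, 'k) Kelt" where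
  "Kp G n us = tpow_elt (n + 1) (GamAop G) (coinv G) us"

definition Kact ::
  "('k::field, 'h::ring_1, 'b::{ring,monoid_mult}) ext_data
     \<Rightarrow> nat \<Rightarrow> ('b, 'k) env \<Rightarrow> ('b, 'k) Kelt \<Rightarrow> ('b, 'k) Kelt" where
  "Kact G n u k = k \<bind> (\<lambda>us. Kp G n (bemul G u (hd us) # tl us))"

text \<open>\<open>K\<^sub>n\<close> as an \<open>A\<close>-bimodule by restricting the \<open>\<Gamma>\<close>-action to \<open>A\<^sup>e\<close>.\<close>

definition K_cx ::
  "('k::field, 'h::ring_1, 'b::{ring,monoid_mult}) ext_data \<Rightarrow> nat \<Rightarrow> ('k, 'b, ('b, 'k) Kelt, 'b) bimod" where
  "K_cx G n = \<lparr>car = tpow_car (n + 1) (GamAop G) (coinv G), scl = fscale,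
     lac = (\<lambda>a k. Kact G n (be G a 1) k), rac = (\<lambda>k a. Kact G n (be G 1 a) k)\<rparr>"

definition dK ::
  "('k::field, 'h::ring_1, 'b::{ring,monoid_mult}) ext_data \<Rightarrow> nat \<Rightarrow> ('b, 'k) Kelt \<Rightarrow> ('b, 'k) Kelt" where
  "dK G n k = (if n = 0 then 0 else k \<bind> (\<lambda>us.
     (\<Sum>i<n. fscale ((-1) ^ i)
        (Kp G (n - 1) (take i us @ bemul G (us ! i) (us ! (i + 1)) # drop (i + 2) us))) +
     fscale ((-1) ^ n)
        (Kp G (n - 1) (take (n - 1) us @ [bemul G (us ! (n - 1)) (be G 1 (Gcounit G (us ! n)))]))))"

text \<open>\<open>Gsplit G [\<gamma>\<^sub>0, \<dots>, \<gamma>\<^sub>r]\<close> is the formal sum of the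
  \<open>([\<gamma>\<^sub>0\<^sub>(\<^sub>1\<^sub>), \<dots>, \<gamma>\<^sub>r\<^sub>(\<^sub>1\<^sub>)], \<gamma>\<^sub>0\<^sub>(\<^sub>2\<^sub>) \<cdots> \<gamma>\<^sub>r\<^sub>(\<^sub>2\<^sub>))\<close>.\<close>

fun Gsplit ::
  "('k::field, 'h::ring_1, 'b::{ring,monoid_mult}) ext_data
     \<Rightarrow> ('b, 'k) env list \<Rightarrow> (('b, 'k) env list \<times> ('b, 'k) env \<Rightarrow>\<^sub>0 'k)" where
  "Gsplit G [] = ins ([], be G 1 1)"
| "Gsplit G (u # us) =
     Gcomul G u \<bind> (\<lambda>(u1, u2). Gsplit G us \<bind> (\<lambda>(ws, w). ins (u1 # ws, bemul G u2 w)))"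

definition DeltaK ::
  "('k::field, 'h::ring_1, 'b::{ring,monoid_mult}) ext_data
     \<Rightarrow> nat \<Rightarrow> nat \<Rightarrow> ('b, 'k) Kelt \<Rightarrow> (('b, 'k) Kelt \<times> ('b, 'k) Kelt \<Rightarrow>\<^sub>0 'k)" where
  "DeltaK G r s k = k \<bind> (\<lambda>us. Gsplit G (take (r + 1) us) \<bind> (\<lambda>(ws, w).
     tns (K_cx G r) (coinv G) (K_cx G s) (Kp G r ws) (Kp G s (w # drop (r + 1) us))))"


section \<open>The complex \<open>K' = B\<^sup>e \<otimes>\<^sub>A\<^sub>e K\<close>\<close>

type_synonym ('b, 'k) KKelt = "('b, 'k) env \<times> ('b, 'k) Kelt \<Rightarrow>\<^sub>0 'k"

definition Be_reg ::
  "('k::field, 'h::ring_1, 'b::{ring,monoid_mult}) ext_data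
     \<Rightarrow> ('k, ('b, 'k) env, ('b, 'k) env, ('b, 'k) env) bimod" where
  "Be_reg G = \<lparr>car = Be_car G, scl = fscale, lac = bemul G, rac = bemul G\<rparr>"

definition K_left ::
  "('k::field, 'h::ring_1, 'b::{ring,monoid_mult}) ext_data
     \<Rightarrow> nat \<Rightarrow> ('k, ('b, 'k) env, ('b, 'k) Kelt, 'k) bimod" where
  "K_left G n = \<lparr>car = car (K_cx G n), scl = fscale, lac = Kact G n, rac = (\<lambda>k c. fscale c k)\<rparr>"

definition KKp ::
  "('k::field, 'h::ring_1, 'b::{ring,monoid_mult}) ext_data
     \<Rightarrow> nat \<Rightarrow> ('b, 'k) env \<Rightarrow> ('b, 'k) Kelt \<Rightarrow> ('b, 'k) KKelt" where
  "KKp G n x k = tns (Be_reg G) (Ae G) (K_left G n) x k"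

definition KK ::
  "('k::field, 'h::ring_1, 'b::{ring,monoid_mult}) ext_data
     \<Rightarrow> nat \<Rightarrow> ('k, 'b, ('b, 'k) KKelt, 'b) bimod" where
  "KK G n = \<lparr>car = car (tensor (Be_reg G) (Ae G) (K_left G n)), scl = fscale,
     lac = (\<lambda>c x. lac (tensor (Be_reg G) (Ae G) (K_left G n)) (be G c 1) x),
     rac = (\<lambda>x c. lac (tensor (Be_reg G) (Ae G) (K_left G n)) (be G 1 c) x)\<rparr>"

definition dKK ::
  "('k::field, 'h::ring_1, 'b::{ring,monoid_mult}) ext_data \<Rightarrow> nat \<Rightarrow> ('b, 'k) KKelt \<Rightarrow> ('b, 'k) KKelt" where
  "dKK G n x = x \<bind> (\<lambda>(u, k). KKp G (n - 1) u (dK G n k))"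

definition KKact ::
  "('k::field, 'h::ring_1, 'b::{ring,monoid_mult}) ext_data
     \<Rightarrow> nat \<Rightarrow> 'h \<Rightarrow> ('b, 'k) KKelt \<Rightarrow> ('b, 'k) KKelt" where
  "KKact G n h x = x \<bind> (\<lambda>(u, k). u \<bind> (\<lambda>(b, b'). tau G h \<bind> (\<lambda>(l, t). t \<bind> (\<lambda>(w, r).
     KKp G n (be G (b * l) (r * b')) (Kact G n w k)))))"

text \<open>\<open>DeltaKK_form G r s b b' k\<close> is the value prescribed at \<open>(b \<otimes> b'\<^sup>o\<^sup>p) \<otimes> k\<close>.\<close>

definition DeltaKK_form ::
  "('k::field, 'h::ring_1, 'b::{ring,monoid_mult}) ext_data \<Rightarrow> nat \<Rightarrow> nat
     \<Rightarrow> 'b \<Rightarrow> 'b \<Rightarrow> ('b, 'k) Kelt \<Rightarrow> (('b, 'k) KKelt \<times> ('b, 'k) KKelt \<Rightarrow>\<^sub>0 'k)" where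
  "DeltaKK_form G r s b b' k = DeltaK G r s k \<bind> (\<lambda>(kr, ks).
     tns (KK G r) UNIV (KK G s) (KKp G r (be G b 1) kr) (KKp G s (be G 1 b') ks))"

definition DeltaKK ::
  "('k::field, 'h::ring_1, 'b::{ring,monoid_mult}) ext_data \<Rightarrow> nat \<Rightarrow> nat
     \<Rightarrow> ('b, 'k) KKelt \<Rightarrow> (('b, 'k) KKelt \<times> ('b, 'k) KKelt \<Rightarrow>\<^sub>0 'k)" where
  "DeltaKK G r s x = x \<bind> (\<lambda>(u, k). u \<bind> (\<lambda>(b, b'). DeltaKK_form G r s b b' k))"


section \<open>The complex \<open>P = Tot (L \<otimes>\<^sub>H K')\<close>\<close>

type_synonym ('h, 'b, 'k) LKelt = "('h, 'k) Lelt \<times> ('b, 'k) KKelt \<Rightarrow>\<^sub>0 'k"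

definition KK_H ::
  "('k::field, 'h::ring_1, 'b::{ring,monoid_mult}) ext_data
     \<Rightarrow> nat \<Rightarrow> ('k, 'h, ('b, 'k) KKelt, 'b) bimod" where
  "KK_H G r = \<lparr>car = car (KK G r), scl = fscale, lac = KKact G r, rac = rac (KK G r)\<rparr>"

definition LKp ::
  "('k::field, 'h::ring_1, 'b::{ring,monoid_mult}) ext_data
     \<Rightarrow> nat \<Rightarrow> nat \<Rightarrow> ('h, 'k) Lelt \<Rightarrow> ('b, 'k) KKelt \<Rightarrow> ('h, 'b, 'k) LKelt" where
  "LKp G p r l x = tns (L_cx G p) UNIV (KK_H G r) l x"

definition LK ::
  "('k::field, 'h::ring_1, 'b::{ring,monoid_mult}) ext_data
     \<Rightarrow> nat \<Rightarrow> nat \<Rightarrow> ('k, 'b, ('h, 'b, 'k) LKelt, 'b) bimod" where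
  "LK G p r = \<lparr>car = car (tensor (L_cx G p) UNIV (KK_H G r)), scl = fscale,
     lac = (\<lambda>c y. y \<bind> (\<lambda>(l, x). LKp G p r l (lac (KK G r) c x))),
     rac = (\<lambda>y c. y \<bind> (\<lambda>(l, x). LKp G p r l (rac (KK G r) x c)))\<rparr>"

definition dLK_h ::
  "('k::field, 'h::ring_1, 'b::{ring,monoid_mult}) ext_data
     \<Rightarrow> nat \<Rightarrow> nat \<Rightarrow> ('h, 'b, 'k) LKelt \<Rightarrow> ('h, 'b, 'k) LKelt" where
  "dLK_h G p r y = y \<bind> (\<lambda>(l, x). LKp G (p - 1) r (dL G p l) x)"

definition dLK_v ::
  "('k::field, 'h::ring_1, 'b::{ring,monoid_mult}) ext_data
     \<Rightarrow> nat \<Rightarrow> nat \<Rightarrow> ('h, 'b, 'k) LKelt \<Rightarrow> ('h, 'b, 'k) LKelt" where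
  "dLK_v G p r y = y \<bind> (\<lambda>(l, x). LKp G p (r - 1) l (dKK G r x))"

definition DeltaLK_form ::
  "('k::field, 'h::ring_1, 'b::{ring,monoid_mult}) ext_data \<Rightarrow> nat \<Rightarrow> nat \<Rightarrow> nat \<Rightarrow> nat
     \<Rightarrow> ('h, 'k) Lelt \<Rightarrow> 'b \<Rightarrow> 'b \<Rightarrow> ('b, 'k) Kelt
     \<Rightarrow> (('h, 'b, 'k) LKelt \<times> ('h, 'b, 'k) LKelt \<Rightarrow>\<^sub>0 'k)" where
  "DeltaLK_form G p r q s l b b' k =
     DeltaL G p q l \<bind> (\<lambda>(lp, lq). DeltaK G r s k \<bind> (\<lambda>(kr, ks).
       fscale ((-1) ^ (q * r))
         (tns (LK G p r) UNIV (LK G q s)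
            (LKp G p r lp (KKp G r (be G b 1) kr)) (LKp G q s lq (KKp G s (be G 1 b') ks)))))"

definition DeltaLK ::
  "('k::field, 'h::ring_1, 'b::{ring,monoid_mult}) ext_data \<Rightarrow> nat \<Rightarrow> nat \<Rightarrow> nat \<Rightarrow> nat
     \<Rightarrow> ('h, 'b, 'k) LKelt \<Rightarrow> (('h, 'b, 'k) LKelt \<times> ('h, 'b, 'k) LKelt \<Rightarrow>\<^sub>0 'k)" where
  "DeltaLK G p r q s y =
     y \<bind> (\<lambda>(l, x). x \<bind> (\<lambda>(u, k). u \<bind> (\<lambda>(b, b'). DeltaLK_form G p r q s l b b' k)))"

text \<open>An element of \<open>P\<^sub>u\<close> is the family of its components in the \<open>L\<^sub>p \<otimes>\<^sub>H K'\<^sub>r\<close>, indexed by \<open>(p, r)\<close>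
  and vanishing unless \<open>p + r = u\<close>.\<close>

type_synonym ('h, 'b, 'k) Pelt = "nat \<times> nat \<Rightarrow>\<^sub>0 ('h, 'b, 'k) LKelt"

definition P_cx ::
  "('k::field, 'h::ring_1, 'b::{ring,monoid_mult}) ext_data
     \<Rightarrow> nat \<Rightarrow> ('k, 'b, ('h, 'b, 'k) Pelt, 'b) bimod" where
  "P_cx G u = \<lparr>car = {x. \<forall>(p, r)\<in>keys x. p + r = u \<and> lookup x (p, r) \<in> car (LK G p r)},
     scl = (\<lambda>c x. Poly_Mapping.map (fscale c) x),
     lac = (\<lambda>b x. \<Sum>(p, r)\<in>keys x. Poly_Mapping.single (p, r) (lac (LK G p r) b (lookup x (p, r)))),
     rac = (\<lambda>x b. \<Sum>(p, r)\<in>keys x. Poly_Mapping.single (p, r) (rac (LK G p r) (lookup x (p, r)) b))\<rparr>"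

text \<open>Here \<open>dL G 0 = 0\<close> and \<open>dK G 0 = 0\<close>, so the terms with a truncated index vanish.\<close>

definition dP ::
  "('k::field, 'h::ring_1, 'b::{ring,monoid_mult}) ext_data
     \<Rightarrow> nat \<Rightarrow> ('h, 'b, 'k) Pelt \<Rightarrow> ('h, 'b, 'k) Pelt" where
  "dP G u x = (\<Sum>(p, r)\<in>keys x.
     Poly_Mapping.single (p - 1, r) (dLK_h G p r (lookup x (p, r))) +
     Poly_Mapping.single (p, r - 1) (fscale ((-1) ^ p) (dLK_v G p r (lookup x (p, r)))))"

definition DeltaP ::
  "('k::field, 'h::ring_1, 'b::{ring,monoid_mult}) ext_data \<Rightarrow> nat \<Rightarrow> nat
     \<Rightarrow> ('h, 'b, 'k) Pelt \<Rightarrow> (('h, 'b, 'k) Pelt \<times> ('h, 'b, 'k) Pelt \<Rightarrow>\<^sub>0 'k)" where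
  "DeltaP G u v x = (\<Sum>(p, r)\<in>{(p, r). p + r = u}. \<Sum>(q, s)\<in>{(q, s). q + s = v}.
     tmap (P_cx G u) UNIV (P_cx G v) (Poly_Mapping.single (p, r)) (Poly_Mapping.single (q, s))
       (DeltaLK G p r q s (lookup x (p + q, r + s))))"


section \<open>Coassociative chain maps\<close>

text \<open>
  \<open>X\<close> is a complex of \<open>(B,B)\<close>-bimodules with differentials \<open>d n : X\<^sub>n \<rightarrow> X\<^sub>n\<^sub>-\<^sub>1\<close> and \<open>D u v\<close> is the component
  \<open>X\<^sub>u\<^sub>+\<^sub>v \<rightarrow> X\<^sub>u \<otimes>\<^sub>B X\<^sub>v\<close> of a map \<open>X \<rightarrow> Tot (X \<otimes>\<^sub>B X)\<close>. The equation below is the \<open>(u, v)\<close>-component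
  of the compatibility with the differentials in degree \<open>u + v + 1\<close>; in degree \<open>0\<close> there is
  nothing to require.
\<close>

definition diagonal_chain_map ::
  "(nat \<Rightarrow> ('k::field, 'b, 'x::ab_group_add, 'b) bimod) \<Rightarrow> (nat \<Rightarrow> 'x \<Rightarrow> 'x)
     \<Rightarrow> (nat \<Rightarrow> nat \<Rightarrow> 'x \<Rightarrow> ('x \<times> 'x \<Rightarrow>\<^sub>0 'k)) \<Rightarrow> bool" where
  "diagonal_chain_map X d D \<longleftrightarrow>
     (\<forall>u v. bimod_hom UNIV UNIV (X (u + v)) (tensor (X u) UNIV (X v)) (D u v)) \<and>
     (\<forall>u v. \<forall>x\<in>car (X (u + v + 1)).
        D u v (d (u + v + 1) x) =
          tmap (X u) UNIV (X v) (d (u + 1)) id (D (u + 1) v x) +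
          fscale ((-1) ^ u) (tmap (X u) UNIV (X v) id (d (v + 1)) (D u (v + 1) x)))"

definition coassociative ::
  "(nat \<Rightarrow> ('k::field, 'b, 'x::ab_group_add, 'b) bimod)
     \<Rightarrow> (nat \<Rightarrow> nat \<Rightarrow> 'x \<Rightarrow> ('x \<times> 'x \<Rightarrow>\<^sub>0 'k)) \<Rightarrow> bool" where
  "coassociative X D \<longleftrightarrow>
     (\<forall>u v w. \<forall>x\<in>car (X (u + v + w)).
        tassoc (X u) UNIV (X v) UNIV (X w)
          (tmap (tensor (X u) UNIV (X v)) UNIV (X w) (D u v) id (D (u + v) w x)) =
        tmap (X u) UNIV (tensor (X v) UNIV (X w)) id (D v w) (D u (v + w) x))"


section \<open>Exterior products\<close>

definition bimodule ::
  "('k::field, 'h::ring_1, 'b::{ring,monoid_mult}) ext_data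
     \<Rightarrow> ('k, 'b, 'm::ab_group_add, 'b) bimod \<Rightarrow> bool" where
  "bimodule G M \<longleftrightarrow>
     0 \<in> car M \<and> (\<forall>m\<in>car M. \<forall>m'\<in>car M. m - m' \<in> car M) \<and>
     (\<forall>b. \<forall>m\<in>car M. lac M b m \<in> car M \<and> rac M m b \<in> car M) \<and>
     (\<forall>b. \<forall>m\<in>car M. \<forall>m'\<in>car M.
        lac M b (m + m') = lac M b m + lac M b m' \<and> rac M (m + m') b = rac M m b + rac M m' b) \<and>
     (\<forall>b b'. \<forall>m\<in>car M.
        lac M (b + b') m = lac M b m + lac M b' m \<and> rac M m (b + b') = rac M m b + rac M m b') \<and>
     (\<forall>b b'. \<forall>m\<in>car M.
        lac M (b * b') m = lac M b (lac M b' m) \<and> rac M m (b * b') = rac M (rac M m b) b') \<and>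
     (\<forall>m\<in>car M. lac M 1 m = m \<and> rac M m 1 = m) \<and>
     (\<forall>b b'. \<forall>m\<in>car M. rac M (lac M b m) b' = lac M b (rac M m b')) \<and>
     (\<forall>c. \<forall>m\<in>car M. scl M c m = lac M (bscale G c 1) m \<and> scl M c m = rac M m (bscale G c 1))"

text \<open>
  \<open>Hom\<^sub>H(L\<^sub>p, Hom\<^sub>A\<^sub>e(K\<^sub>r, M))\<close>, where a left \<open>A\<^sup>e\<close>-module is a \<open>k\<close>-symmetric \<open>A\<close>-bimodule. The right
  \<open>H\<close>-action \<open>(f \<leftharpoonup> h)(k) = \<Sum> l f(w k) r\<close> is written with \<open>tau G h = \<Sum> l \<otimes> w \<otimes> r\<close>.
\<close>

definition hom_act ::
  "('k::field, 'h::ring_1, 'b::{ring,monoid_mult}) ext_data \<Rightarrow> nat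
     \<Rightarrow> ('k, 'b, 'm::ab_group_add, 'b) bimod
     \<Rightarrow> (('b, 'k) Kelt \<Rightarrow> 'm) \<Rightarrow> 'h \<Rightarrow> ('b, 'k) Kelt \<Rightarrow> 'm" where
  "hom_act G r M f h k = linext (scl M) (tau G h) (\<lambda>(b, t). linext (scl M) t (\<lambda>(w, b').
     lac M b (rac M (f (Kact G r w k)) b')))"

definition HomL ::
  "('k::field, 'h::ring_1, 'b::{ring,monoid_mult}) ext_data \<Rightarrow> nat \<Rightarrow> nat
     \<Rightarrow> ('k, 'b, 'm::ab_group_add, 'b) bimod
     \<Rightarrow> (('h, 'k) Lelt \<Rightarrow> ('b, 'k) Kelt \<Rightarrow> 'm) set" where
  "HomL G p r M = {f.
     (\<forall>l\<in>car (L_cx G p). bimod_hom (coinv G) (coinv G) (K_cx G r) M (f l)) \<and>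
     (\<forall>l\<in>car (L_cx G p). \<forall>l'\<in>car (L_cx G p). \<forall>k\<in>car (K_cx G r). f (l + l') k = f l k + f l' k) \<and>
     (\<forall>c. \<forall>l\<in>car (L_cx G p). \<forall>k\<in>car (K_cx G r). f (fscale c l) k = scl M c (f l k)) \<and>
     (\<forall>h. \<forall>l\<in>car (L_cx G p). \<forall>k\<in>car (K_cx G r). f (Lact G p l h) k = hom_act G r M (f l) h k)}"

definition crossL ::
  "('k::field, 'h::ring_1, 'b::{ring,monoid_mult}) ext_data \<Rightarrow> nat \<Rightarrow> nat \<Rightarrow> nat \<Rightarrow> nat
     \<Rightarrow> ('k, 'b, 'm::ab_group_add, 'b) bimod \<Rightarrow> ('k, 'b, 'n::ab_group_add, 'b) bimod
     \<Rightarrow> (('h, 'k) Lelt \<Rightarrow> ('b, 'k) Kelt \<Rightarrow> 'm) \<Rightarrow> (('h, 'k) Lelt \<Rightarrow> ('b, 'k) Kelt \<Rightarrow> 'n)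
     \<Rightarrow> ('h, 'k) Lelt \<Rightarrow> ('b, 'k) Kelt \<Rightarrow> ('m \<times> 'n \<Rightarrow>\<^sub>0 'k)" where
  "crossL G p r q s M N f g l k =
     DeltaL G p q l \<bind> (\<lambda>(lp, lq). DeltaK G r s k \<bind> (\<lambda>(kr, ks).
       fscale ((-1) ^ (p * q + p * s + r * s)) (tns M UNIV N (f lp kr) (g lq ks))))"

definition dL_h ::
  "('k::field, 'h::ring_1, 'b::{ring,monoid_mult}) ext_data \<Rightarrow> nat \<Rightarrow> nat
     \<Rightarrow> ('k, 'b, 'm::ab_group_add, 'b) bimod
     \<Rightarrow> (('h, 'k) Lelt \<Rightarrow> ('b, 'k) Kelt \<Rightarrow> 'm) \<Rightarrow> ('h, 'k) Lelt \<Rightarrow> ('b, 'k) Kelt \<Rightarrow> 'm" where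
  "dL_h G p r M f l k = scl M ((-1) ^ (p + r)) (f (dL G (p + 1) l) k)"

definition dL_v ::
  "('k::field, 'h::ring_1, 'b::{ring,monoid_mult}) ext_data \<Rightarrow> nat \<Rightarrow> nat
     \<Rightarrow> ('k, 'b, 'm::ab_group_add, 'b) bimod
     \<Rightarrow> (('h, 'k) Lelt \<Rightarrow> ('b, 'k) Kelt \<Rightarrow> 'm) \<Rightarrow> ('h, 'k) Lelt \<Rightarrow> ('b, 'k) Kelt \<Rightarrow> 'm" where
  "dL_v G p r M f l k = scl M ((-1) ^ r) (f l (dK G (r + 1) k))"

definition HomR ::
  "('k::field, 'h::ring_1, 'b::{ring,monoid_mult}) ext_data \<Rightarrow> nat \<Rightarrow> nat
     \<Rightarrow> ('k, 'b, 'm::ab_group_add, 'b) bimod \<Rightarrow> (('h, 'b, 'k) LKelt \<Rightarrow> 'm) set" where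
  "HomR G p r M = {F. bimod_hom UNIV UNIV (LK G p r) M F}"

definition crossR ::
  "('k::field, 'h::ring_1, 'b::{ring,monoid_mult}) ext_data \<Rightarrow> nat \<Rightarrow> nat \<Rightarrow> nat \<Rightarrow> nat
     \<Rightarrow> ('k, 'b, 'm::ab_group_add, 'b) bimod \<Rightarrow> ('k, 'b, 'n::ab_group_add, 'b) bimod
     \<Rightarrow> (('h, 'b, 'k) LKelt \<Rightarrow> 'm) \<Rightarrow> (('h, 'b, 'k) LKelt \<Rightarrow> 'n)
     \<Rightarrow> ('h, 'b, 'k) LKelt \<Rightarrow> ('m \<times> 'n \<Rightarrow>\<^sub>0 'k)" where
  "crossR G p r q s M N F F' y =
     fscale ((-1) ^ ((p + r) * (q + s))) (tmap M UNIV N F F' (DeltaLK G p r q s y))"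

definition dR_h ::
  "('k::field, 'h::ring_1, 'b::{ring,monoid_mult}) ext_data \<Rightarrow> nat \<Rightarrow> nat
     \<Rightarrow> ('k, 'b, 'm::ab_group_add, 'b) bimod
     \<Rightarrow> (('h, 'b, 'k) LKelt \<Rightarrow> 'm) \<Rightarrow> ('h, 'b, 'k) LKelt \<Rightarrow> 'm" where
  "dR_h G p r M F y = scl M ((-1) ^ (p + r)) (F (dLK_h G (p + 1) r y))"

definition dR_v ::
  "('k::field, 'h::ring_1, 'b::{ring,monoid_mult}) ext_data \<Rightarrow> nat \<Rightarrow> nat
     \<Rightarrow> ('k, 'b, 'm::ab_group_add, 'b) bimod
     \<Rightarrow> (('h, 'b, 'k) LKelt \<Rightarrow> 'm) \<Rightarrow> ('h, 'b, 'k) LKelt \<Rightarrow> 'm" where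
  "dR_v G p r M F y = scl M ((-1) ^ r) (F (dLK_v G p (r + 1) y))"

end

theory Submission
imports Defs
begin

text \<open>
All assertions are identities between multilinear maps, so it is enough to check them on words in
\<open>H\<close> and in \<open>\<Gamma>\<close>. Three things make that possible.

The structure maps of \<open>\<Gamma>\<close> exist by descent along \<open>B/A\<close>. Their values, \<open>\<Delta>\<^sub>\<Gamma>(\<gamma>)\<close> and the element
\<open>\<tau>(h) = l\<^sub>i(h\<^sub>1) \<otimes>\<^sub>A (r\<^sub>i(h\<^sub>1) \<otimes> l\<^sub>j(h\<^sub>2)) \<otimes>\<^sub>A r\<^sub>j(h\<^sub>2)\<close>, are given by formulas in which \<open>B\<^sup>e\<close> stands
in place of \<open>\<Gamma>\<close>. Since \<open>\<Gamma>\<close> is the kernel of a map of right \<open>A\<close>-modules on \<open>B\<^sup>e\<close>, flatness gives an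
inverse \<open>theta\<close> of the map \<open>\<Gamma> \<otimes>\<^sub>A B \<rightarrow> B \<otimes> B\<close> that multiplies in the second factor, and faithfulness then
puts \<open>\<Delta>\<^sub>\<Gamma>(\<gamma>)\<close> into \<open>\<Gamma> \<otimes>\<^sub>A \<Gamma>\<close> (\<open>comul_form_in_image\<close>). Moreover \<open>\<Gamma> \<otimes>\<^sub>A \<Gamma>\<close> embeds into
\<open>B \<otimes> B \<otimes> B\<close> (\<open>GG_zero\<close>), where \<open>\<Delta>\<^sub>\<Gamma>(x \<otimes> y)\<close> becomes \<open>x \<otimes> 1 \<otimes> y\<close>. That formula makes
multiplicativity, coassociativity and the Takeuchi condition evident. For \<open>\<tau>\<close> one needs that
\<open>\<Delta>\<^sub>H\<close> and \<open>\<Delta>\<^sub>\<Gamma>\<close> agree on it (\<open>tau_comul\<close>).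

The diagonals of \<open>L\<close> and of \<open>K\<close> cut a word in two, comultiply the letters of one part and move
the product of the new factors across the cut. Read letter by letter (\<open>Hsplit\<close>, \<open>Gsplit\<close>), this
commutes with multiplying neighbours and with comultiplying again; hence the chain rules and the
coassociativity of \<open>DeltaL\<close> and \<open>DeltaK\<close>.

The rest is formal. Let \<open>crossLK\<close> be the product \<open>\<times>\<^sub>\<ell>\<close> without its sign. It inherits the Leibniz
rules and associativity from the two diagonals, it is natural in the coefficients, and it preserves
\<open>H\<close>-linearity by \<open>tau_comul\<close>. The bimodules \<open>K'\<^sub>n\<close> and \<open>L\<^sub>p \<otimes>\<^sub>H K'\<^sub>r\<close> carry universal elements
\<open>uK\<close> and \<open>uL\<close>, and the diagonals of \<open>K'\<close> and of \<open>L \<otimes>\<^sub>H K'\<close> are the bimodule maps that send a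
universal element to the product of two universal elements. So the assertions on these diagonals
are those on products, for one particular choice of factors. For \<open>\<times>\<^sub>r\<close> one composes with
\<open>F \<otimes>\<^sub>B G\<close>. Finally \<open>P\<^sub>u\<close> is a finite direct sum of the bimodules \<open>L\<^sub>p \<otimes>\<^sub>H K'\<^sub>r\<close>, and its diagonal
is checked on components, where only the parities of the signs are left to compare.
\<close>

text \<open>Sweedler notation: \<open>t >> (x,y). f x y\<close> sums \<open>f\<close> over the terms of the formal sum that represents
\<open>t\<close>. For balanced \<open>f\<close> this is the value at \<open>t\<close> of the linear map that \<open>f\<close> induces.\<close>

notation bind (infix ">>" 60)

syntax "_Bind" :: "'a => pttrn => 'b => 'c" ("_ >> _. _" [61, 0, 60] 60)
translations "t >> p. b" == "t >> (%p. b)"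

abbreviation (input) iff (infixr "<->" 25) where "P <-> Q == P = (Q::bool)"
notation fscale (infixr "*." 75)
type_notation poly_mapping ("(_ =>0 /_)" [1,0] 0)
abbreviation tensorU (infixr "**" 70) where "M ** N == tensor M UNIV N"
abbreviation "tnsU M N == tns M UNIV N"
abbreviation "tmapU M N == tmap M UNIV N"
abbreviation "tassocU M N Q == tassoc M UNIV N UNIV Q"
abbreviation "bihom == bimod_hom UNIV UNIV"

section \<open>Formal linear combinations\<close>

lemmas fscale_plus = fv.scale_right_distrib

lemma linear_bind: "Vector_Spaces.linear fscale fscale (%v. v >> f)"
unfolding bind_def by(rule linear_linext) (fact fv.vector_space_axioms)

lemma
shows bind_add_left: "(v + w) >> f = (v >> f) + (w >> f)"
 and bind_diff_left: "(v - w) >> f = (v >> f) - (w >> f)"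
 and bind_minus_left: "(- v) >> f = - (v >> f)"
 and bind_scale_left: "c*.v >> f = c *. (v >> f)"
 and bind_zero_left: "0 >> f = 0"
 and bind_sum_left: "(\<Sum>i\<in>S. u i) >> f = (\<Sum>i\<in>S. u i >> f)"
proof -
interpret l: Vector_Spaces.linear fscale fscale "%v. v >> f" by(rule linear_bind)
show "(v + w) >> f = (v >> f) + (w >> f)" "(v - w) >> f = (v >> f) - (w >> f)"
 "(- v) >> f = - (v >> f)" "c*.v >> f = c *. (v >> f)" "0 >> f = 0"
 "(\<Sum>i\<in>S. u i) >> f = (\<Sum>i\<in>S. u i >> f)"
 by(rule l.add l.diff l.neg l.scale l.zero l.sum)+
qed

lemma bind_sum: "v >> f = (\<Sum>x\<in>keys v. lookup v x *. f x)"
by(simp add: bind_def linext_def)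

lemma bind_cong: "(!!x. x : keys v ==> f x = g x) ==> (v >> f) = (v >> g)"
by(simp add: bind_sum)

lemma bind_cong2: "(!!x y. (x, y) : keys v ==> f x y = g x y)
 ==> (v >> (x,y). f x y) = v >> (x,y). g x y"
by(rule bind_cong) auto

lemma bind_add_right: "v >> x. f x + g x = (v >> f) + (v >> g)"
by(simp add: bind_sum fscale_plus sum.distrib)

lemma bind_add_right2:
"v >> (x,y). f x y + g x y = (v >> (x,y). f x y) + (v >> (x,y). g x y)"
by(simp add: bind_add_right[symmetric] split_def)

lemma bind_diff_right2:
"v >> (x,y). f x y - g x y = (v >> (x,y). f x y) - (v >> (x,y). g x y)"
by(simp add: bind_sum fv.scale_right_diff_distrib sum_subtractf split_def)

lemma bind_zero_right: "v >> x. 0 = 0"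
by(simp add: bind_sum)

lemma bind_zero_right2: "v >> (x,y). 0 = 0"
by(simp add: bind_sum split_def)

lemma bind_scale_right: "v >> x. c *. f x = c *. (v >> f)"
by(simp add: bind_sum fv.scale_sum_right mult.commute)

lemma bind_scale_right2: "v >> (x,y). c *. f x y = c *. (v >> (x,y). f x y)"
by(simp add: bind_scale_right[symmetric] split_def)

lemma bind_sum_right: "v >> x. (\<Sum>i\<in>S. f i x) = (\<Sum>i\<in>S. v >> f i)"
by(simp add: bind_sum fv.scale_sum_right sum.swap[of _ S])

lemma bind_sum_right2: "v >> (x,y). (\<Sum>i\<in>S. f i x y) = (\<Sum>i\<in>S. v >> (x,y). f i x y)"
by(simp add: bind_sum_right[symmetric] split_def)

lemma ins_bind [simp]: "ins x >> f = f x"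
by(simp add: bind_sum ins_def)

lemma bind_ins: "v >> ins = v"
proof -
have "lookup (v >> ins) y = lookup v y" for y
 by(simp add: bind_sum lookup_sum ins_def lookup_single when_def if_distrib[of "(*) _"] in_keys_iff
   cong: if_cong)
thus ?thesis by(rule poly_mapping_eqI)
qed

lemma bind_assoc: "(v >> f) >> g = v >> (%x. f x >> g)"
by(simp add: bind_sum[of v] bind_sum_left bind_scale_left)

lemma bind_assoc2: "(v >> (x,y). f x y) >> g = v >> (%(x,y). f x y >> g)"
by(simp add: bind_assoc split_def)

lemma bind_commute: "v >> x. w >> y. f x y = w >> y. v >> x. f x y"
by(simp add: bind_sum fv.scale_sum_right sum.swap[of _ "keys w"] mult.commute)

lemma bind_commute2:
"v >> (x,x'). w >> (y,y'). f x x' y y' = w >> (y,y'). v >> (x,x'). f x x' y y'"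
unfolding split_def by(rule bind_commute)

lemma bind_pull:
assumes "!!c d. v >> (a,b). F a b c d = H c d"
shows "v >> (a,b). w >> (c,d). F a b c d = w >> (c,d). H c d"
by(subst bind_commute2)(simp add: assms)

lemma keys_bind: "keys (v >> f) <= (\<Union>x\<in>keys v. keys (f x))"
proof -
have "keys (\<Sum>x\<in>S. lookup v x *. f x) <= (\<Union>x\<in>S. keys (f x))" if "finite S" for S
 using that
proof induction
 case (insert x S)
 have "keys (lookup v x *. f x) <= keys (f x)" by(auto simp: in_keys_iff)
 with insert show ?case using keys_add by fastforce
qed simp
thus ?thesis by(simp add: bind_sum)
qed

lemma keys_fscale: "keys (c*.v) <= keys v"
by(auto simp: in_keys_iff)

lemma keys_fscale_sub: "keys v <= S ==> keys (c*.v) <= S"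
using keys_fscale[of c v] by blast

lemma keys_diff_sub: "keys v <= S ==> keys w <= S ==> keys (v - w) <= S"
using keys_diff[of v w] by blast

lemma keys_ins [simp]: "keys (ins x :: 'x =>0 'k::field) = {x}"
by(simp add: ins_def)

lemma keys_ins_sub: "m : S ==> n : T ==> keys (ins (m, n) :: _ =>0 'k::field) <= S \<times> T"
by simp

lemma bind_in_subspace:
assumes "fv.subspace S" "!!x. x : keys v ==> f x : S"
shows "(v >> f) : S"
unfolding bind_sum using assms by(intro fv.subspace_sum fv.subspace_scale) auto

lemma bind_in_subspace2:
assumes "fv.subspace S" "!!x y. (x, y) : keys v ==> f x y : S"
shows "(v >> (x,y). f x y) : S"
using assms by(auto intro!: bind_in_subspace)

lemmas bind_linear = bind_add_left bind_scale_left bind_add_right bind_add_right2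
bind_scale_right bind_scale_right2 bind_zero_left bind_zero_right bind_zero_right2

lemma fscale_mult [simp]: "a *. b*.v = (a * b) *. v"
by simp

section \<open>Linear and balanced maps\<close>

definition klin :: "('k, 'l, 'm::ab_group_add, 'r) bimod => ('k, 'l2, 'n::ab_group_add, 'r2) bimod
 => ('m => 'n) => bool" where
"klin M N f == (ALL x:car M. f x : car N) & (ALL x:car M. ALL y:car M. f (x + y) = f x + f y) &
  (ALL c. ALL x:car M. f (scl M c x) = scl N c (f x))"

definition lin_on :: "('k::field, 'l, 'm::ab_group_add, 'r) bimod => ('m => ('y =>0 'k)) => bool" where
"lin_on M f == (ALL x:car M. ALL y:car M. f (x + y) = f x + f y) &
  (ALL c. ALL x:car M. f (scl M c x) = c *. f x)"

definition bal :: "('k::field, 'l, 'm::ab_group_add, 'r) bimod => 'r set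
 => ('k, 'r, 'n::ab_group_add, 's) bimod => ('m => 'n => ('y =>0 'k)) => bool" where
"bal M R N F == (ALL n:car N. lin_on M (%m. F m n)) & (ALL m:car M. lin_on N (F m)) &
  (ALL m:car M. ALL r:R. ALL n:car N. F (rac M m r) n = F m (lac N r n))"

abbreviation "balU M N == bal M UNIV N"

lemma balI:
assumes "!!n. n : car N ==> lin_on M (%m. F m n)" "!!m. m : car M ==> lin_on N (%n. F m n)"
 "!!m r n. m : car M ==> r : R ==> n : car N ==> F (rac M m r) n = F m (lac N r n)"
shows "bal M R N F"
using assms by(simp add: bal_def)

lemma
assumes "bal M R N F"
shows bal_lin_left: "n : car N ==> lin_on M (%m. F m n)"
 and bal_lin_right: "m : car M ==> lin_on N (%n. F m n)"
 and bal_eq: "m : car M ==> r : R ==> n : car N ==> F (rac M m r) n = F m (lac N r n)"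
using assms by(auto simp: bal_def)

lemma
assumes "lin_on M f"
shows lin_on_add: "x : car M ==> y : car M ==> f (x + y) = f x + f y"
 and lin_on_scale: "x : car M ==> f (scl M c x) = c *. f x"
using assms by(auto simp: lin_on_def)

lemma
assumes "klin M N f"
shows klin_in: "x : car M ==> f x : car N"
 and klin_add: "x : car M ==> y : car M ==> f (x + y) = f x + f y"
 and klin_scale: "x : car M ==> f (scl M c x) = scl N c (f x)"
using assms by(auto simp: klin_def)

lemma lin_on_bind: "(!!x. x : keys t ==> lin_on M (%m. f m x)) ==> lin_on M (%m. t >> f m)"
unfolding lin_on_def
by(auto simp: bind_add_right[symmetric] bind_scale_right[symmetric] intro!: bind_cong)

lemma lin_on_bind2: "(!!x y. (x, y) : keys t ==> lin_on M (%m. f m x y))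
 ==> lin_on M (%m. t >> (x,y). f m x y)"
by(rule lin_on_bind) auto

lemma lin_on_bind_left: "lin_on M g ==> lin_on M (%m. g m >> f)"
by(auto simp: lin_on_def bind_add_left bind_scale_left)

lemma lin_on_fscale: "lin_on M f ==> lin_on M (%m. c *. f m)"
by(auto simp: lin_on_def fscale_plus mult.commute)

lemma lin_on_plus: "lin_on M f ==> lin_on M g ==> lin_on M (%m. f m + g m)"
by(auto simp: lin_on_def fscale_plus)

lemma lin_on_comp: "lin_on N f ==> klin M N g ==> lin_on M (%m. f (g m))"
by(auto simp: lin_on_def klin_def)

lemma klin_comp: "klin N Q f ==> klin M N g ==> klin M Q (%m. f (g m))"
by(auto simp: klin_def)

text \<open>\<open>kclosed\<close>: the carrier is a subspace. The axioms for the scalar action follow, wherever they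
matter, from linearity of the maps under consideration.\<close>

definition kclosed :: "('k, 'l, 'm::ab_group_add, 'r) bimod => bool" where
"kclosed M == 0 : car M & (ALL x:car M. ALL y:car M. x - y : car M) & (ALL c. ALL x:car M. scl M c x : car M)"

lemma
assumes "kclosed M"
shows kclosed_zero: "0 : car M"
 and kclosed_diff: "x : car M ==> y : car M ==> x - y : car M"
 and kclosed_add: "x : car M ==> y : car M ==> x + y : car M"
 and kclosed_scl: "x : car M ==> scl M c x : car M"
 and kclosed_minus: "x : car M ==> - x : car M"
proof -
have 1: "0 : car M" "!!x y. x : car M ==> y : car M ==> x - y : car M" "!!x c. x : car M ==> scl M c x : car M"
 using assms by(auto simp: kclosed_def)
have 2: "- x : car M" if "x : car M" for x using 1(2)[OF 1(1) that] by simp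
show "x + y : car M" if "x : car M" "y : car M" for x y
 using 1(2)[OF that(1) 2[OF that(2)]] by simp
show "0 : car M" "x : car M ==> y : car M ==> x - y : car M" "x : car M ==> scl M c x : car M"
 "x : car M ==> - x : car M" by(fact 1 2)+
qed

lemma kclosed_sum: "kclosed M ==> (!!i. i : S ==> f i : car M) ==> sum f S : car M"
by(induction S rule: infinite_finite_induct)(auto simp: kclosed_add kclosed_zero)

lemma linext_in: "kclosed M ==> (!!x. x : keys v ==> f x : car M) ==> linext (scl M) v f : car M"
unfolding linext_def by(auto intro!: kclosed_sum kclosed_scl)

lemma subspace_car: "kclosed M ==> scl M = fscale ==> fv.subspace (car M)"
by(auto simp: fv.subspace_def kclosed_zero kclosed_add kclosed_scl dest: kclosed_scl)

lemma lin_on_zero: "kclosed M ==> lin_on M f ==> f 0 = 0"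
using lin_on_add[of M f 0 0] by(simp add: kclosed_zero)

lemma lin_on_sum:
assumes "kclosed M" "lin_on M f" "!!i. i : S ==> g i : car M"
shows "f (\<Sum>i\<in>S. g i) = (\<Sum>i\<in>S. f (g i))"
using assms(3)
by(induction S rule: infinite_finite_induct)
 (auto simp: lin_on_zero[OF assms(1,2)] lin_on_add[OF assms(2)] kclosed_sum[OF assms(1)])

lemma lin_on_diff:
assumes "kclosed M" "lin_on M f" "x : car M" "y : car M"
shows "f (x - y) = f x - f y"
using lin_on_add[OF assms(2) kclosed_diff[OF assms(1,3,4)] assms(4)] by simp

lemma lin_on_linext:
assumes "kclosed M" "lin_on M f" "!!x. x : keys v ==> g x : car M"
shows "f (linext (scl M) v g) = v >> x. f (g x)"
unfolding linext_def bind_sum using assms(3)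
by(subst lin_on_sum[OF assms(1,2)])(auto simp: kclosed_scl[OF assms(1)] lin_on_scale[OF assms(2)])

lemma klin_zero: "kclosed M ==> klin M N f ==> f 0 = 0"
using klin_add[of M N f 0 0] by(simp add: kclosed_zero)

lemma klin_sum:
assumes "kclosed M" "klin M N f" "!!i. i : S ==> g i : car M"
shows "f (\<Sum>i\<in>S. g i) = (\<Sum>i\<in>S. f (g i))"
using assms(3)
by(induction S rule: infinite_finite_induct)
 (auto simp: klin_zero[OF assms(1,2)] klin_add[OF assms(2)] kclosed_sum[OF assms(1)])

lemma klin_linext:
assumes "kclosed M" "klin M N f" "!!x. x : keys v ==> g x : car M"
shows "f (linext (scl M) v g) = linext (scl N) v (%x. f (g x))"
unfolding linext_def using assms(3)
by(subst klin_sum[OF assms(1,2)])(auto simp: kclosed_scl[OF assms(1)] klin_scale[OF assms(2)])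

lemma klin_bind:
assumes "kclosed M" "scl M = fscale" "klin M N f" "!!x. x : keys v ==> g x : car M"
shows "f (v >> g) = linext (scl N) v (%x. f (g x))"
using klin_linext[OF assms(1,3,4)] assms(2) by(simp add: bind_def)

lemma lin_on_bind_out:
assumes "kclosed M" "scl M = fscale" "lin_on M f" "!!x. x : keys v ==> g x : car M"
shows "f (v >> g) = v >> x. f (g x)"
using lin_on_linext[OF assms(1,3,4)] assms(2) by(simp add: bind_def)

lemma lin_on_bind_out2:
assumes "kclosed M" "scl M = fscale" "lin_on M f" "!!x y. (x, y) : keys v ==> g x y : car M"
shows "f (v >> (x,y). g x y) = v >> (x,y). f (g x y)"
by(subst lin_on_bind_out[OF assms(1-3)])(auto simp: assms(4) intro!: bind_cong)

section \<open>Tensor products\<close>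

definition tensor_gens where
"tensor_gens M R N =
  {ins (m + m', n) - ins (m, n) - ins (m', n) | m m' n. m : car M & m' : car M & n : car N} \<union>
  {ins (m, n + n') - ins (m, n) - ins (m, n') | m n n'. m : car M & n : car N & n' : car N} \<union>
  {ins (scl M c m, n) - c *. ins (m, n) | c m n. m : car M & n : car N} \<union>
  {ins (m, scl N c n) - c *. ins (m, n) | c m n. m : car M & n : car N} \<union>
  {ins (rac M m r, n) - ins (m, lac N r n) | m r n. m : car M & r : R & n : car N}"

lemma tensor_rel_span: "tensor_rel M R N = fv.span (tensor_gens M R N)"
by(simp add: tensor_rel_def tensor_gens_def)

lemma subspace_tensor_rel [simp]: "fv.subspace (tensor_rel M R N)"
by(simp add: tensor_rel_def fv.subspace_span)

context
fixes R :: "('x =>0 'k::field) set"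
assumes R: "fv.subspace R"
begin

interpretation q: Vector_Spaces.linear fscale fscale "nf R"
using is_nf_nf[OF R] by(simp add: is_nf_def)

lemma nf_eqI: "v - w : R ==> nf R v = nf R w"
using nf_eq_iff[OF R] by blast

lemma nf_idem: "nf R (nf R v) = nf R v"
using is_nf_nf[OF R] by(intro nf_eqI)(auto simp: is_nf_def)

lemma nf_diff_in: "nf R v - v : R"
using is_nf_nf[OF R] by(auto simp: is_nf_def)

lemma nf_zero_iff: "nf R v = 0 <-> v : R"
using nf_eq_iff[OF R, of v 0] by simp

lemmas nf_add = q.add and nf_scale = q.scale and nf_zero = q.zero and nf_diff = q.diff and nf_sum = q.sum

lemma nf_bind: "nf R (v >> f) = v >> x. nf R (f x)"
by(simp add: bind_sum nf_sum nf_scale)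

lemma nf_ins: "nf R v = v >> x. nf R (ins x)"
by(subst nf_bind[symmetric])(simp add: bind_ins)

lemma nf_keys_subspace:
assumes "keys v <= S" "!!w. w : R ==> keys w <= S"
shows "keys (nf R v) <= S"
proof -
have "keys (v + (nf R v - v)) <= S"
 using keys_add[of v "nf R v - v"] assms(1) assms(2)[OF nf_diff_in] by blast
thus ?thesis by simp
qed

end

lemma nf_span_bind:
assumes "!!v. v : G ==> (v >> f) = 0"
shows "nf (fv.span G) v >> f = v >> f"
using linext_nf[OF fv.vector_space_axioms, of G f v] assms by(simp add: bind_def)

lemma span_keys:
assumes "v : fv.span G" "!!g. g : G ==> keys g <= S"
shows "keys v <= S"
using assms(1)
proof(induction rule: fv.span_induct_alt)
case base show ?case by simp
next
case (step c x y)
thus ?case using assms(2)[of x] keys_add[of "c*.x" y] keys_fscale[of c x] by blast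
qed

lemma nf_tensor_bind:
assumes "bal M R N F"
shows "nf (tensor_rel M R N) v >> (%(m,n). F m n) = v >> (%(m,n). F m n)"
unfolding tensor_rel_span
by(rule nf_span_bind)
 (use assms in "auto simp: tensor_gens_def bind_diff_left bind_scale_left bal_def lin_on_def")

lemma tns_bind:
assumes "bal M R N F"
shows "tns M R N m n >> (%(m,n). F m n) = F m n"
unfolding tns_def nf_tensor_bind[OF assms] by simp

lemma bal_tns: "bal M R N (tns M R N)"
proof -
have eq: "nf (tensor_rel M R N) v = nf (tensor_rel M R N) w" if "v - w : tensor_gens M R N" for v w
 using that by(intro nf_eqI)(simp_all add: tensor_rel_span fv.span_base fv.subspace_span)
have 1: "nf (tensor_rel M R N) (ins (m + m', n)) = nf (tensor_rel M R N) (ins (m, n)) + nf (tensor_rel M R N) (ins (m', n))"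
 if "m : car M" "m' : car M" "n : car N" for m m' n
 unfolding nf_add[OF subspace_tensor_rel, symmetric]
 by(rule eq) (unfold tensor_gens_def diff_diff_eq[symmetric], use that in blast)
have 2: "nf (tensor_rel M R N) (ins (m, n + n')) = nf (tensor_rel M R N) (ins (m, n)) + nf (tensor_rel M R N) (ins (m, n'))"
 if "m : car M" "n : car N" "n' : car N" for m n n'
 unfolding nf_add[OF subspace_tensor_rel, symmetric]
 by(rule eq) (unfold tensor_gens_def diff_diff_eq[symmetric], use that in blast)
have 3: "nf (tensor_rel M R N) (ins (scl M c m, n)) = c *. nf (tensor_rel M R N) (ins (m, n))"
 if "m : car M" "n : car N" for c m n
 unfolding nf_scale[OF subspace_tensor_rel, symmetric]
 by(rule eq) (unfold tensor_gens_def, use that in blast)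
have 4: "nf (tensor_rel M R N) (ins (m, scl N c n)) = c *. nf (tensor_rel M R N) (ins (m, n))"
 if "m : car M" "n : car N" for c m n
 unfolding nf_scale[OF subspace_tensor_rel, symmetric]
 by(rule eq) (unfold tensor_gens_def, use that in blast)
have 5: "nf (tensor_rel M R N) (ins (rac M m r, n)) = nf (tensor_rel M R N) (ins (m, lac N r n))"
 if "m : car M" "r : R" "n : car N" for m r n
 by(rule eq) (unfold tensor_gens_def, use that in blast)
show ?thesis
 unfolding bal_def lin_on_def tns_def by(simp add: 1 2 3 4 5)
qed

lemma
shows tns_add_left: "m : car M ==> m' : car M ==> n : car N ==> tns M R N (m + m') n = tns M R N m n + tns M R N m' n"
 and tns_add_right: "m : car M ==> n : car N ==> n' : car N ==> tns M R N m (n + n') = tns M R N m n + tns M R N m n'"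
 and tns_scl_left: "m : car M ==> n : car N ==> tns M R N (scl M c m) n = c *. tns M R N m n"
 and tns_scl_right: "m : car M ==> n : car N ==> tns M R N m (scl N c n) = c *. tns M R N m n"
 and tns_bal: "m : car M ==> r : R ==> n : car N ==> tns M R N (rac M m r) n = tns M R N m (lac N r n)"
using bal_tns[of M R N] by(auto simp: bal_def lin_on_def)

lemma lin_tns_left: "n : car N ==> lin_on M (%m. tns M R N m n)"
and lin_tns_right: "m : car M ==> lin_on N (tns M R N m)"
using bal_tns[of M R N] by(auto simp: bal_def)

lemma scl_tensor [simp]: "scl (tensor M R N) = fscale"
by(simp add: tensor_def)

lemma tensor_car: "t : car (tensor M R N) <-> (EX v. keys v <= car M \<times> car N & t = (v >> (m,n). tns M R N m n))"
proof -
have "nf (tensor_rel M R N) v = v >> (m,n). tns M R N m n" for v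
 unfolding tns_def by(subst nf_ins)(auto intro!: bind_cong)
thus ?thesis by(auto simp: tensor_def)
qed

lemma tensor_repE:
assumes "t : car (tensor M R N)"
obtains v where "keys v <= car M \<times> car N" "t = v >> (m,n). tns M R N m n"
using assms tensor_car by blast

lemma subspace_tensor: "fv.subspace (car (tensor M R N))"
proof -
have 1: "0 : car (tensor M R N)"
 unfolding tensor_car by(rule exI[of _ 0])(simp add: bind_zero_left)
have 2: "x + y : car (tensor M R N)" if x: "x : car (tensor M R N)" and y: "y : car (tensor M R N)" for x y
proof -
 obtain v where v: "keys v <= car M \<times> car N" "x = v >> (m,n). tns M R N m n" by(rule tensor_repE[OF x])
 obtain w where w: "keys w <= car M \<times> car N" "y = w >> (m,n). tns M R N m n" by(rule tensor_repE[OF y])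
 show ?thesis unfolding tensor_car
  by(rule exI[of _ "v + w"])(use v w keys_add[of v w] in "auto simp: bind_add_left")
qed
have 3: "c*.x : car (tensor M R N)" if x: "x : car (tensor M R N)" for x c
proof -
 obtain v where v: "keys v <= car M \<times> car N" "x = v >> (m,n). tns M R N m n" by(rule tensor_repE[OF x])
 show ?thesis unfolding tensor_car
  by(rule exI[of _ "c*.v"])(use v keys_fscale[of c v] in "auto simp: bind_scale_left")
qed
show ?thesis using 1 2 3 by(auto simp: fv.subspace_def)
qed

lemma kclosed_tensor [simp]: "kclosed (tensor M R N)"
using subspace_tensor[of M R N] fv.subspace_diff by(auto simp: kclosed_def fv.subspace_def)

lemma tns_in [simp]: "m : car M ==> n : car N ==> tns M R N m n : car (tensor M R N)"
unfolding tensor_car by(rule exI[of _ "ins (m, n)"]) simp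

lemmas tensor_bind_in = bind_in_subspace2[OF subspace_tensor]

text \<open>For an element of a tensor product, its expression as a linear combination of pure tensors is
itself: this is what makes an element its own representative.\<close>

lemma tensor_self: "t : car (tensor M R N) ==> (t >> (m,n). tns M R N m n) = t"
by(erule tensor_repE)(simp add: bind_assoc2 tns_bind[OF bal_tns])

lemma tensor_lin_eqI:
assumes t: "t : car (tensor M R N)" and f: "lin_on (tensor M R N) f" and g: "lin_on (tensor M R N) g"
 and eq: "!!m n. m : car M ==> n : car N ==> f (tns M R N m n) = g (tns M R N m n)"
shows "f t = g t"
proof -
obtain v where v: "keys v <= car M \<times> car N" "t = v >> (m,n). tns M R N m n" by(rule tensor_repE[OF t])
show ?thesis unfolding v(2) using v(1)
 by(subst lin_on_bind_out2[OF _ _ f], simp, simp, force)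
  (subst lin_on_bind_out2[OF _ _ g], simp, simp, force, auto intro!: bind_cong2 eq)
qed

lemma tensor_klin_eqI:
assumes t: "t : car (tensor M R N)" and f: "klin (tensor M R N) Q f" and g: "klin (tensor M R N) Q g"
 and eq: "!!m n. m : car M ==> n : car N ==> f (tns M R N m n) = g (tns M R N m n)"
shows "f t = g t"
proof -
obtain v where v: "keys v <= car M \<times> car N" "t = v >> (m,n). tns M R N m n" by(rule tensor_repE[OF t])
have "f t = linext (scl Q) v (%x. f (case x of (m, n) => tns M R N m n))"
 unfolding v(2) using v(1) by(intro klin_bind[OF _ _ f]) auto
also have "... = linext (scl Q) v (%x. g (case x of (m, n) => tns M R N m n))"
 unfolding linext_def using v(1) by(intro sum.cong)(auto simp: eq subset_iff)
also have "... = g t"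
 unfolding v(2) using v(1) by(intro klin_bind[OF _ _ g, symmetric]) auto
finally show ?thesis .
qed

text \<open>When the carriers are closed under the operations that occur in the relations, the terms of a
tensor have their components in the carriers.\<close>

definition rclosed where
"rclosed M R == kclosed M & (ALL m:car M. ALL r:R. rac M m r : car M)"

definition lclosed where
"lclosed R N == kclosed N & (ALL n:car N. ALL r:R. lac N r n : car N)"

lemma tensor_keys:
assumes M: "rclosed M R" and N: "lclosed R N" and t: "t : car (tensor M R N)"
shows "keys t <= car M \<times> car N"
proof -
obtain v where v: "keys v <= car M \<times> car N" "t = nf (tensor_rel M R N) v"
 using t unfolding tensor_def by force
have M': "kclosed M" and N': "kclosed N"
 and r: "!!m r. m : car M ==> r : R ==> rac M m r : car M"
 and l: "!!n r. n : car N ==> r : R ==> lac N r n : car N"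
 using M N by(auto simp: rclosed_def lclosed_def)
note cl = kclosed_add[OF M'] kclosed_add[OF N'] kclosed_scl[OF M'] kclosed_scl[OF N'] r l
have "keys w <= car M \<times> car N" if "w : tensor_rel M R N" for w
 using that unfolding tensor_rel_span
proof(rule span_keys)
 fix g assume "g : tensor_gens M R N"
 thus "keys g <= car M \<times> car N"
  unfolding tensor_gens_def Un_iff
  apply (elim disjE CollectE exE conjE)
  apply (simp_all only: )
  apply (intro keys_diff_sub keys_fscale_sub keys_ins_sub cl; assumption)+
  done
qed
hence "keys (nf (tensor_rel M R N) v) <= car M \<times> car N"
 by(intro nf_keys_subspace[OF subspace_tensor_rel v(1)])
with v(2) show ?thesis by simp
qed

lemma tensor_keysD:
assumes "(m, n) : keys t" "t : car (tensor M R N)" "rclosed M R" "lclosed R N"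
shows "m : car M" "n : car N"
using tensor_keys[OF assms(3,4,2)] assms(1) by auto

lemma tmap_tns:
assumes "bal M' R' N' (%x y. tns M R N (f x) (g y))"
shows "tmap M R N f g (tns M' R' N' x y) = tns M R N (f x) (g y)"
unfolding tmap_def using tns_bind[OF assms] .

definition rhom where
"rhom R M' M f == klin M' M f & (ALL x:car M'. ALL r:R. f (rac M' x r) = rac M (f x) r)"

definition lhom where
"lhom R M' M f == klin M' M f & (ALL x:car M'. ALL r:R. f (lac M' r x) = lac M r (f x))"

lemma bal_tns_comp:
assumes "rhom R M' M f" "lhom R N' N g"
shows "bal M' R N' (%x y. tns M R N (f x) (g y))"
proof(rule balI)
fix n assume "n : car N'"
thus "lin_on M' (%m. tns M R N (f m) (g n))"
 using assms by(intro lin_on_comp[OF lin_tns_left])(auto simp: rhom_def lhom_def klin_def)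
next
fix m assume "m : car M'"
thus "lin_on N' (%n. tns M R N (f m) (g n))"
 using assms by(intro lin_on_comp[OF lin_tns_right])(auto simp: rhom_def lhom_def klin_def)
next
fix m r n assume "m : car M'" "r : R" "n : car N'"
thus "tns M R N (f (rac M' m r)) (g n) = tns M R N (f m) (g (lac N' r n))"
 using assms by(auto simp: rhom_def lhom_def klin_def intro!: tns_bal)
qed

lemma tmap_tns_hom:
assumes "rhom R M' M f" "lhom R N' N g"
shows "tmap M R N f g (tns M' R N' x y) = tns M R N (f x) (g y)"
by(rule tmap_tns[OF bal_tns_comp[OF assms]])

lemma tmap_in:
assumes "rhom R M' M f" "lhom R N' N g" "t : car (tensor M' R N')"
shows "tmap M R N f g t : car (tensor M R N)"
proof -
obtain v where v: "keys v <= car M' \<times> car N'" "t = v >> (m,n). tns M' R N' m n"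
 by(rule tensor_repE[OF assms(3)])
have "tmap M R N f g t = v >> (m,n). tns M R N (f m) (g n)"
 unfolding v(2) tmap_def bind_assoc2 using tns_bind[OF bal_tns_comp[OF assms(1,2)]] by simp
also have "... : car (tensor M R N)"
 using v(1) assms(1,2) by(intro tensor_bind_in)(auto simp: rhom_def lhom_def klin_def)
finally show ?thesis .
qed

lemma rhom_id: "rhom R M M (%x. x)" "rhom R M M id"
by(auto simp: rhom_def klin_def)

lemma lhom_id: "lhom R M M (%x. x)" "lhom R M M id"
by(auto simp: lhom_def klin_def)

lemma rhom_comp: "rhom R N Q f ==> rhom R M N g ==> rhom R M Q (%x. f (g x))"
by(auto simp: rhom_def klin_def)

lemma lhom_comp: "lhom R N Q f ==> lhom R M N g ==> lhom R M Q (%x. f (g x))"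
by(auto simp: lhom_def klin_def)

lemma lac_tensor: "lac (tensor M R N) l t = t >> (m,n). tns M R N (lac M l m) n"
by(simp add: tensor_def)

lemma rac_tensor: "rac (tensor M R N) t s = t >> (m,n). tns M R N m (rac N n s)"
by(simp add: tensor_def)

lemma lac_tns:
assumes "rhom R M M (lac M l)"
shows "lac (tensor M R N) l (tns M R N m n) = tns M R N (lac M l m) n"
unfolding lac_tensor by(rule tns_bind[OF bal_tns_comp[OF assms lhom_id(1)]])

lemma rac_tns:
assumes "lhom R N N (%n. rac N n s)"
shows "rac (tensor M R N) (tns M R N m n) s = tns M R N m (rac N n s)"
unfolding rac_tensor by(rule tns_bind[OF bal_tns_comp[OF rhom_id(1) assms]])

lemma lac_in:
assumes "rhom R M M (lac M l)" "t : car (tensor M R N)"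
shows "lac (tensor M R N) l t : car (tensor M R N)"
using tmap_in[OF assms(1) lhom_id(1) assms(2)] by(simp add: lac_tensor tmap_def)

lemma rac_in:
assumes "lhom R N N (%n. rac N n s)" "t : car (tensor M R N)"
shows "rac (tensor M R N) t s : car (tensor M R N)"
using tmap_in[OF rhom_id(1) assms] by(simp add: rac_tensor tmap_def)

lemma tns_linext_left:
assumes "kclosed M" "n : car N" "!!x. x : keys v ==> f x : car M"
shows "tns M R N (linext (scl M) v f) n = v >> x. tns M R N (f x) n"
using lin_on_linext[OF assms(1) lin_tns_left[OF assms(2)] assms(3)] .

lemma tns_linext_right:
assumes "kclosed N" "m : car M" "!!x. x : keys v ==> f x : car N"
shows "tns M R N m (linext (scl N) v f) = v >> x. tns M R N m (f x)"
using lin_on_linext[OF assms(1) lin_tns_right[OF assms(2)] assms(3)] .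

subsection \<open>Iterated tensor products\<close>

text \<open>These are the maps that factor through the triple tensor product, in either bracketing.\<close>

definition tribal :: "('k::field, 'l, 'm::ab_group_add, 'r) bimod => 'r set
 => ('k, 'r, 'n::ab_group_add, 's) bimod => 's set => ('k, 's, 'q::ab_group_add, 't) bimod
 => ('m => 'n => 'q => ('y =>0 'k)) => bool" where
"tribal M R N S Q F == (ALL q:car Q. bal M R N (%m n. F m n q)) & (ALL m:car M. bal N S Q (F m))"

lemma tribalI:
assumes "!!q. q : car Q ==> bal M R N (%m n. F m n q)" "!!m. m : car M ==> bal N S Q (%n q. F m n q)"
shows "tribal M R N S Q F"
using assms by(simp add: tribal_def)

lemma rclosed_tensor:
assumes "!!s. s : S ==> lhom R N N (%n. rac N n s)"
shows "rclosed (tensor M R N) S"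
using assms by(auto simp: rclosed_def intro!: rac_in)

lemma lclosed_tensor:
assumes "!!s. s : S ==> rhom R M M (lac M s)"
shows "lclosed S (tensor M R N)"
using assms by(auto simp: lclosed_def intro!: lac_in)

lemma bal_tensor_left:
assumes F: "tribal M R N S Q F" and c: "rclosed M R" "lclosed R N"
shows "bal (tensor M R N) S Q (%u q. u >> (m,n). F m n q)"
proof(rule balI)
show "lin_on (tensor M R N) (%u. u >> (m,n). F m n q)" for q
 by(rule lin_on_bind_left)(simp add: lin_on_def)
next
fix u assume u: "u : car (tensor M R N)"
show "lin_on Q (%q. u >> (m,n). F m n q)"
 using F tensor_keysD[OF _ u c] by(intro lin_on_bind2)(auto simp: tribal_def bal_def)
next
fix u s q assume u: "u : car (tensor M R N)" and s: "s : S" and q: "q : car Q"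
have "bal M R N (%m n. F m n q)" using F q by(simp add: tribal_def)
from tns_bind[OF this]
have "rac (tensor M R N) u s >> (m,n). F m n q = u >> (m,n). F m (rac N n s) q"
 by(simp add: rac_tensor bind_assoc2)
also have "... = u >> (m,n). F m n (lac Q s q)"
 using F s q tensor_keysD[OF _ u c] by(intro bind_cong2)(auto simp: tribal_def bal_def)
finally show "rac (tensor M R N) u s >> (m,n). F m n q = u >> (m,n). F m n (lac Q s q)" .
qed

lemma bal_tensor_right:
assumes F: "tribal M R N S Q F" and c: "rclosed N S" "lclosed S Q"
shows "bal M R (tensor N S Q) (%m t. t >> (n,q). F m n q)"
proof(rule balI)
fix u assume u: "u : car (tensor N S Q)"
show "lin_on M (%m. u >> (n,q). F m n q)"
 using F tensor_keysD[OF _ u c] by(intro lin_on_bind2)(auto simp: tribal_def bal_def)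
next
show "lin_on (tensor N S Q) (%u. u >> (n,q). F m n q)" for m
 by(rule lin_on_bind_left)(simp add: lin_on_def)
next
fix m r u assume u: "u : car (tensor N S Q)" and r: "r : R" and m: "m : car M"
have "bal N S Q (F m)" using F m by(simp add: tribal_def)
from tns_bind[OF this]
have "lac (tensor N S Q) r u >> (n,q). F m n q = u >> (n,q). F m (lac N r n) q"
 by(simp add: lac_tensor bind_assoc2)
also have "... = u >> (n,q). F (rac M m r) n q"
 using F r m tensor_keysD[OF _ u c] by(intro bind_cong2)(auto simp: tribal_def bal_def)
finally show "u >> (n,q). F (rac M m r) n q = lac (tensor N S Q) r u >> (n,q). F m n q"
 by simp
qed

lemma tribal_tns:
assumes "!!r. r : R ==> rhom S N N (lac N r)"
shows "tribal M R N S Q (%m n q. tns M R (tensor N S Q) m (tns N S Q n q))"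
proof(rule tribalI)
fix q assume q: "q : car Q"
show "bal M R N (%m n. tns M R (tensor N S Q) m (tns N S Q n q))"
proof(rule balI)
 fix m r n assume h: "m : car M" "r : R" "n : car N"
 show "tns M R (tensor N S Q) (rac M m r) (tns N S Q n q) = tns M R (tensor N S Q) m (tns N S Q (lac N r n) q)"
  using h q by(subst tns_bal)(simp_all add: lac_tns assms)
qed (use q in "auto intro!: lin_tns_left lin_on_comp[OF lin_tns_right] simp: klin_def tns_add_left tns_scl_left")
next
fix m assume m: "m : car M"
show "bal N S Q (%n q. tns M R (tensor N S Q) m (tns N S Q n q))"
 using m by(intro balI lin_on_comp[OF lin_tns_right])
  (auto simp: klin_def tns_add_left tns_scl_left tns_add_right tns_scl_right tns_bal)
qed

lemma tribal_tns':
assumes "!!s. s : S ==> lhom R N N (%n. rac N n s)"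
shows "tribal M R N S Q (%m n q. tns (tensor M R N) S Q (tns M R N m n) q)"
proof(rule tribalI)
fix m assume m: "m : car M"
show "bal N S Q (%n q. tns (tensor M R N) S Q (tns M R N m n) q)"
proof(rule balI)
 fix n s q assume h: "n : car N" "s : S" "q : car Q"
 show "tns (tensor M R N) S Q (tns M R N m (rac N n s)) q = tns (tensor M R N) S Q (tns M R N m n) (lac Q s q)"
  using h m by(subst tns_bal[symmetric])(simp_all add: rac_tns assms)
qed (use m in "auto intro!: lin_tns_right lin_on_comp[OF lin_tns_left] simp: klin_def tns_add_right tns_scl_right")
next
fix q assume m: "q : car Q"
show "bal M R N (%m n. tns (tensor M R N) S Q (tns M R N m n) q)"
 using m by(intro balI lin_on_comp[OF lin_tns_left])
  (auto simp: klin_def tns_add_left tns_scl_left tns_add_right tns_scl_right tns_bal)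
qed

lemma tassoc_bind:
assumes F: "tribal M R N S Q F" and c: "rclosed M R" "lclosed R N" "rclosed N S" "lclosed S Q"
 and c': "rclosed (tensor M R N) S" and t: "t : car (tensor (tensor M R N) S Q)"
shows "tassoc M R N S Q t >> (m,u). u >> (n,q). F m n q = t >> (u,q). u >> (m,n). F m n q"
unfolding tassoc_def bind_assoc2
proof(intro bind_cong2, goal_cases)
case (1 u q m n)
note u = tensor_keysD[OF 1(1) t c' c(4)]
note m = tensor_keysD[OF 1(2) u(1) c(1,2)]
show ?case
 using tns_bind[OF bal_tensor_right[OF F c(3,4)], of m "tns N S Q n q"] F m(1)
 by(simp add: tns_bind tribal_def)
qed

lemma tassoc_tns:
assumes "!!r. r : R ==> rhom S N N (lac N r)" and c: "rclosed M R" "lclosed R N"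
shows "tassoc M R N S Q (tns (tensor M R N) S Q u q) = u >> (m,n). tns M R (tensor N S Q) m (tns N S Q n q)"
unfolding tassoc_def by(rule tns_bind[OF bal_tensor_left[OF tribal_tns[OF assms(1)] c]])

section \<open>Hopf algebras, comodule algebras and the Galois condition\<close>

lemma vsp_simps [simp]: "car (vsp C s) = C" "scl (vsp C s) = s" "lac (vsp C s) = s" "rac (vsp C s) m c = s c m"
by(simp_all add: vsp_def)

lemma Hk_simps [simp]: "car (Hk G) = UNIV" "scl (Hk G) = hscale G" "lac (Hk G) = hscale G" "rac (Hk G) m c = hscale G c m"
by(simp_all add: Hk_def)

lemma Bk_simps [simp]: "car (Bk G) = UNIV" "scl (Bk G) = bscale G" "lac (Bk G) = bscale G" "rac (Bk G) m c = bscale G c m"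
by(simp_all add: Bk_def)

lemma Breg_simps [simp]: "car (Breg G) = UNIV" "scl (Breg G) = bscale G" "lac (Breg G) = (*)" "rac (Breg G) = (*)"
by(simp_all add: Breg_def)

lemma lin_on_Bk: "lin_on (Bk G) f <-> (ALL x y. f (x + y) = f x + f y) & (ALL c x. f (bscale G c x) = c *. f x)"
and lin_on_Hk: "lin_on (Hk G') f' <-> (ALL x y. f' (x + y) = f' x + f' y) & (ALL c x. f' (hscale G' c x) = c *. f' x)"
and lin_on_Breg: "lin_on (Breg G) f <-> (ALL x y. f (x + y) = f x + f y) & (ALL c x. f (bscale G c x) = c *. f x)"
by(simp_all add: lin_on_def)

lemma bal_scalars:
assumes "!!n. n : car N ==> lin_on M (%m. F m n)" "!!m. m : car M ==> lin_on N (%n. F m n)"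
 "!!m c. m : car M ==> rac M m c = scl M c m" "!!n c. n : car N ==> lac N c n = scl N c n"
shows "bal M (UNIV :: 'k::field set) N F"
using assms by(intro balI)(auto simp: lin_on_def)

locale hopf_galois_ext =
fixes G :: "('k::field, 'h::ring_1, 'b::{ring,monoid_mult}) ext_data"
assumes hopf: "hopf_algebra G" and galois: "faithfully_flat_galois G"
begin

abbreviation "A == coinv G"
abbreviation "bs == bscale G"
abbreviation "hs == hscale G"
abbreviation "tBH == tnsU (Bk G) (Hk G)"
abbreviation "tHH == tnsU (Hk G) (Hk G)"
abbreviation "tAB == tns (Breg G) A (Breg G)"

lemma comodule_algebra: "comodule_algebra G" and hopf_galois: "hopf_galois G"
using galois by(auto simp: faithfully_flat_galois_def)

sublocale vs_h: vector_space "hscale G"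
using hopf by(simp add: hopf_algebra_def k_algebra_def)

sublocale vs_b: vector_space "bscale G"
using comodule_algebra by(simp add: comodule_algebra_def k_algebra_def)

lemma hs_mult [simp]: "hs c x * y = hs c (x * y)" "x * hs c y = hs c (x * y)"
and bs_mult [simp]: "bs c u * v = bs c (u * v)" "u * bs c v = bs c (u * v)"
using hopf comodule_algebra unfolding hopf_algebra_def comodule_algebra_def k_algebra_def by metis+

lemma comul_lin [simp]: "comul G (x + y) = comul G x + comul G y" "comul G (hs c x) = c *. comul G x"
and coact_lin [simp]: "coact G (u + v) = coact G u + coact G v" "coact G (bs c u) = c *. coact G u"
and counit_lin [simp]: "counit G (x + y) = counit G x + counit G y" "counit G (hs c x) = c * counit G x"
and antip_lin [simp]: "antip G (x + y) = antip G x + antip G y" "antip G (hs c x) = hs c (antip G x)"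
using hopf comodule_algebra
by(auto simp: hopf_algebra_def comodule_algebra_def Vector_Spaces.linear_iff)

lemma comul_in [simp]: "comul G h : car (HH G)" and coact_in [simp]: "coact G b : car (BH G)"
using hopf comodule_algebra by(auto simp: hopf_algebra_def comodule_algebra_def)

lemma comul_one: "comul G 1 = tHH 1 1" and coact_one: "coact G 1 = tBH 1 1"
and counit_one [simp]: "counit G 1 = 1" and counit_mult [simp]: "counit G (x * y) = counit G x * counit G y"
and comul_mult: "comul G (x * y) = algmul (Hk G) (Hk G) (comul G x) (comul G y)"
and coact_mult: "coact G (u * v) = algmul (Bk G) (Hk G) (coact G u) (coact G v)"
using hopf comodule_algebra by(auto simp: hopf_algebra_def comodule_algebra_def)

lemma bal_Bk_Hk: "balU (Bk G) (Hk G) F <-> (ALL h. lin_on (Bk G) (%b. F b h)) & (ALL b. lin_on (Hk G) (F b))"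
and bal_Hk_Hk: "balU (Hk G) (Hk G) F2 <-> (ALL h. lin_on (Hk G) (%b. F2 b h)) & (ALL b. lin_on (Hk G) (F2 b))"
and bal_Bk_Bk: "balU (Bk G) (Bk G) F3 <-> (ALL h. lin_on (Bk G) (%b. F3 b h)) & (ALL b. lin_on (Bk G) (F3 b))"
by(auto simp: bal_def lin_on_def)

lemma bal_Breg: "bal (Breg G) A (Breg G) F <-> (ALL h. lin_on (Bk G) (%b. F b h)) & (ALL b. lin_on (Bk G) (F b))
 & (ALL x y. ALL a:A. F (x * a) y = F x (a * y))"
by(auto simp: bal_def lin_on_def)

lemma closed_k [simp]: "rclosed (Hk G) UNIV" "lclosed UNIV (Hk G)" "rclosed (Bk G) UNIV" "lclosed UNIV (Bk G)"
"rclosed (Breg G) A" "lclosed A (Breg G)"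
by(auto simp: rclosed_def lclosed_def kclosed_def)

lemma closed_kt [simp]: "rclosed (HH G) UNIV" "lclosed UNIV (HH G)" "rclosed (BH G) UNIV"
by(auto intro!: rclosed_tensor lclosed_tensor simp: lhom_def rhom_def klin_def vs_h.scale_right_distrib mult.commute)

subsection \<open>Sweedler calculus\<close>

lemma comul_coassoc:
assumes F: "tribal (Hk G) UNIV (Hk G) UNIV (Hk G) F"
shows "comul G h >> (h1,h2). comul G h1 >> (a,b). F a b h2
   = comul G h >> (h1,h2). comul G h2 >> (b,c). F h1 b c"
proof -
let ?T = "tmapU (HH G) (Hk G) (comul G) id (comul G h)"
have T: "?T = comul G h >> (x,y). tnsU (HH G) (Hk G) (comul G x) y" by(simp add: tmap_def)
have "tassocU (Hk G) (Hk G) (Hk G) ?T >> (m,u). u >> (n,q). F m n q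
  = tmapU (Hk G) (HH G) id (comul G) (comul G h) >> (m,u). u >> (n,q). F m n q"
 using hopf by(simp add: hopf_algebra_def)
moreover have "?T : car ((HH G) ** (Hk G))"
 unfolding T by(rule tensor_bind_in) simp
ultimately have "?T >> (u,q). u >> (m,n). F m n q
  = tmapU (Hk G) (HH G) id (comul G) (comul G h) >> (m,u). u >> (n,q). F m n q"
 by(simp add: tassoc_bind[OF F])
thus ?thesis
 unfolding T tmap_def bind_assoc2 tns_bind[OF bal_tensor_left[OF F closed_k(1,2)]]
  tns_bind[OF bal_tensor_right[OF F closed_k(1,2)]] by simp
qed

lemma coact_coassoc:
assumes F: "tribal (Bk G) UNIV (Hk G) UNIV (Hk G) F"
shows "coact G b >> (b0,h2). coact G b0 >> (a,h1). F a h1 h2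
   = coact G b >> (b0,h). comul G h >> (h1,h2). F b0 h1 h2"
proof -
let ?T = "tmapU (BH G) (Hk G) (coact G) id (coact G b)"
have T: "?T = coact G b >> (x,y). tnsU (BH G) (Hk G) (coact G x) y" by(simp add: tmap_def)
have "tassocU (Bk G) (Hk G) (Hk G) ?T >> (m,u). u >> (n,q). F m n q
  = tmapU (Bk G) (HH G) id (comul G) (coact G b) >> (m,u). u >> (n,q). F m n q"
 using comodule_algebra by(simp add: comodule_algebra_def)
moreover have "?T : car ((BH G) ** (Hk G))"
 unfolding T by(rule tensor_bind_in) simp
ultimately have "?T >> (u,q). u >> (m,n). F m n q
  = tmapU (Bk G) (HH G) id (comul G) (coact G b) >> (m,u). u >> (n,q). F m n q"
 by(simp add: tassoc_bind[OF F])
thus ?thesis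
 unfolding T tmap_def bind_assoc2 tns_bind[OF bal_tensor_left[OF F closed_k(3,2)]]
  tns_bind[OF bal_tensor_right[OF F closed_k(1,2)]] by simp
qed

lemma kclosed_k [simp]: "kclosed (Hk G)" "kclosed (Bk G)" "kclosed (Breg G)"
by(auto simp: kclosed_def)

lemma lin_Hk_linext: "lin_on (Hk G) f ==> f (linext hs v g) = v >> x. f (g x)"
and lin_Bk_linext: "lin_on (Bk G) f' ==> f' (linext bs v' g') = v' >> x. f' (g' x)"
using lin_on_linext[of "Hk G"] lin_on_linext[of "Bk G"] by simp_all

lemma comul_counit_left:
assumes "lin_on (Hk G) f" shows "comul G h >> (h1,h2). counit G h1 *. f h2 = f h"
proof -
have "f (linext hs (comul G h) (%(h1,h2). hs (counit G h1) h2)) = f h"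
 using hopf by(simp add: hopf_algebra_def)
thus ?thesis using assms by(simp add: lin_Hk_linext split_def lin_on_Hk)
qed

lemma comul_counit_right:
assumes "lin_on (Hk G) f" shows "comul G h >> (h1,h2). counit G h2 *. f h1 = f h"
proof -
have "f (linext hs (comul G h) (%(h1,h2). hs (counit G h2) h1)) = f h"
 using hopf by(simp add: hopf_algebra_def)
thus ?thesis using assms by(simp add: lin_Hk_linext split_def lin_on_Hk)
qed

lemma comul_antip_right:
assumes "lin_on (Hk G) f" shows "comul G h >> (h1,h2). f (h1 * antip G h2) = counit G h *. f 1"
proof -
have "f (linext hs (comul G h) (%(h1,h2). h1 * antip G h2)) = f (hs (counit G h) 1)"
 using hopf by(simp add: hopf_algebra_def)
thus ?thesis using assms by(simp add: lin_Hk_linext split_def lin_on_Hk)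
qed

lemma coact_counit:
assumes "lin_on (Bk G) f" shows "coact G b >> (b0,h). counit G h *. f b0 = f b"
proof -
have "f (linext bs (coact G b) (%(b0,h). bs (counit G h) b0)) = f b"
 using comodule_algebra by(simp add: comodule_algebra_def)
thus ?thesis using assms by(simp add: lin_Bk_linext split_def lin_on_Bk)
qed

lemma coact_mult_bind:
assumes "balU (Bk G) (Hk G) F"
shows "coact G (x * y) >> (b,h). F b h
  = coact G x >> (x0,x1). coact G y >> (y0,y1). F (x0 * y0) (x1 * y1)"
unfolding coact_mult algmul_def bind_assoc2 tns_bind[OF assms] by simp

lemma comul_mult_bind:
assumes "balU (Hk G) (Hk G) F"
shows "comul G (x * y) >> (b,h). F b h
  = comul G x >> (x0,x1). comul G y >> (y0,y1). F (x0 * y0) (x1 * y1)"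
unfolding comul_mult algmul_def bind_assoc2 tns_bind[OF assms] by simp

lemma coact_A:
assumes "balU (Bk G) (Hk G) F" "a : A"
shows "coact G a >> (b,h). F b h = F a 1"
using assms(2) by(simp add: coinv_def tns_bind[OF assms(1)])

lemma coact_one_bind:
assumes "balU (Bk G) (Hk G) F"
shows "coact G 1 >> (b,h). F b h = F 1 1"
by(simp add: coact_one tns_bind[OF assms(1)])

lemma coact_A_mult:
assumes "balU (Bk G) (Hk G) F" "a : A"
shows "coact G (a * b) >> (b,h). F b h = coact G b >> (b,h). F (a * b) h"
 "coact G (b * a) >> (b,h). F b h = coact G b >> (b,h). F (b * a) h"
proof -
have 1: "balU (Bk G) (Hk G) (%x h. coact G b >> (y0,y1). F (x * y0) (h * y1))"
 "!!x h. balU (Bk G) (Hk G) (%y k. F (x * y) (h * k))"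
 using assms(1) by(auto simp: bal_Bk_Hk lin_on_Bk lin_on_Hk bind_linear distrib_left distrib_right)
show "coact G (a * b) >> (b,h). F b h = coact G b >> (b,h). F (a * b) h"
 by(simp add: coact_mult_bind[OF assms(1)] coact_A[OF 1(1) assms(2)])
show "coact G (b * a) >> (b,h). F b h = coact G b >> (b,h). F (b * a) h"
 by(simp add: coact_mult_bind[OF assms(1)] coact_A[OF 1(2) assms(2)])
qed

lemma tBH_lin [simp]: "tBH (x + y) h = tBH x h + tBH y h" "tBH x (h + k) = tBH x h + tBH x k"
 "tBH (bs c x) h = c *. tBH x h" "tBH x (hs c h) = c *. tBH x h"
by(simp_all add: tns_add_left[where M="Bk G"] tns_add_right[where M="Bk G"]
 tns_scl_left[where M="Bk G", simplified] tns_scl_right[where N="Hk G", simplified])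

lemma bal_tBH: "balU (Bk G) (Hk G) (%b h. tBH b h)"
by(rule bal_tns)

lemma coact_self: "coact G b >> (b0,h). tBH b0 h = coact G b"
by(rule tensor_self) simp

lemma A_mult: "a : A ==> a' : A ==> a * a' : A"
using coact_A_mult(1)[OF bal_tBH, of a a'] coact_A[of "%x h. tBH (a * x) h" a']
by(simp add: coact_self bal_Bk_Hk lin_on_Bk lin_on_Hk distrib_left)(simp add: coinv_def)

lemma A_add: "a : A ==> a' : A ==> a + a' : A"
by(simp add: coinv_def)

lemma A_scale: "a : A ==> bs c a : A"
by(simp add: coinv_def)

lemma A_one: "1 : A" by(simp add: coinv_def coact_one)

lemma A_diff: "a : A ==> a' : A ==> a - a' : A"
using A_add[of a "bs (-1) a'"] A_scale[of a' "-1"] by simp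

abbreviation Hsplit where "Hsplit == Defs.Hsplit G"
abbreviation Gsplit where "Gsplit == Defs.Gsplit G"
abbreviation Bk where "Bk == Defs.Bk G"
abbreviation Hk where "Hk == Defs.Hk G"
abbreviation Breg where "Breg == Defs.Breg G"
abbreviation coact where "coact == ext_data.coact G"
abbreviation galois_map where "galois_map == Defs.galois_map G"
abbreviation BAB where "BAB == Defs.BAB G"
abbreviation transl where "transl == Defs.transl G"
abbreviation BH where "BH == Defs.BH G"
abbreviation counit where "counit == hopf.counit G"
abbreviation comul where "comul == hopf.comul G"
abbreviation antip where "antip == hopf.antip G"
abbreviation right_A_module where "right_A_module == Defs.right_A_module G"
abbreviation be where "be == Defs.be G"
abbreviation Be_car where "Be_car == Defs.Be_car G"
abbreviation bemul (infixl "*~" 85) where "bemul == Defs.bemul G"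
abbreviation Gam where "Gam == Defs.Gam G"
abbreviation BeA where "BeA == Defs.BeA G"
abbreviation GamA where "GamA == Defs.GamA G"
abbreviation Gcomul where "Gcomul == Defs.Gcomul G"
abbreviation Gcounit where "Gcounit == Defs.Gcounit G"
abbreviation tau where "tau == Defs.tau G"
abbreviation L_cx where "L_cx == Defs.L_cx G"
abbreviation Lact where "Lact == Defs.Lact G"
abbreviation Lk where "Lk == Defs.Lk G"
abbreviation Lp where "Lp == Defs.Lp G"
abbreviation DeltaL where "DeltaL == Defs.DeltaL G"
abbreviation dL where "dL == Defs.dL G"
abbreviation GamAop where "GamAop == Defs.GamAop G"
abbreviation K_cx where "K_cx == Defs.K_cx G"
abbreviation Kact where "Kact == Defs.Kact G"
abbreviation Kp where "Kp == Defs.Kp G"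
abbreviation dK where "dK == Defs.dK G"
abbreviation DeltaK where "DeltaK == Defs.DeltaK G"
abbreviation bimodule where "bimodule == Defs.bimodule G"
abbreviation hom_act where "hom_act == Defs.hom_act G"
abbreviation HomL where "HomL == Defs.HomL G"
abbreviation crossL where "crossL == Defs.crossL G"
abbreviation dL_h where "dL_h == Defs.dL_h G"
abbreviation dL_v where "dL_v == Defs.dL_v G"
abbreviation Be_reg where "Be_reg == Defs.Be_reg G"
abbreviation Ae where "Ae == Defs.Ae G"
abbreviation K_left where "K_left == Defs.K_left G"
abbreviation KK where "KK == Defs.KK G"
abbreviation KKp where "KKp == Defs.KKp G"
abbreviation DeltaKK_form where "DeltaKK_form == Defs.DeltaKK_form G"
abbreviation DeltaKK where "DeltaKK == Defs.DeltaKK G"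
abbreviation dKK where "dKK == Defs.dKK G"
abbreviation KKact where "KKact == Defs.KKact G"
abbreviation KK_H where "KK_H == Defs.KK_H G"
abbreviation LK where "LK == Defs.LK G"
abbreviation LKp where "LKp == Defs.LKp G"
abbreviation dLK_h where "dLK_h == Defs.dLK_h G"
abbreviation dLK_v where "dLK_v == Defs.dLK_v G"
abbreviation DeltaLK_form where "DeltaLK_form == Defs.DeltaLK_form G"
abbreviation DeltaLK where "DeltaLK == Defs.DeltaLK G"
abbreviation crossR where "crossR == Defs.crossR G"
abbreviation dR_h where "dR_h == Defs.dR_h G"
abbreviation dR_v where "dR_v == Defs.dR_v G"
abbreviation P_cx where "P_cx == Defs.P_cx G"
abbreviation DeltaP where "DeltaP == Defs.DeltaP G"
abbreviation dP where "dP == Defs.dP G"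
abbreviation "extB M == tensor M A Breg"
abbreviation "extmap N f == tmap N A Breg f id"
abbreviation "tnsB M == tns M A Breg"
abbreviation "balG == bal GamA A GamA"
abbreviation "balK r s == bal (K_cx r) A (K_cx s)"
abbreviation "balL p q == balU (Lk p) (Lk q)"

subsection \<open>The translation map\<close>

lemma tribal_BHH: "tribal Bk UNIV Hk UNIV Hk F <-> (ALL y z. lin_on Bk (%x. F x y z)) &
 (ALL x z. lin_on Hk (%y. F x y z)) & (ALL x y. lin_on Hk (F x y))"
and tribal_HHH: "tribal Hk UNIV Hk UNIV Hk F' <-> (ALL y z. lin_on Hk (%x. F' x y z)) &
 (ALL x z. lin_on Hk (%y. F' x y z)) & (ALL x y. lin_on Hk (F' x y))"
by(auto simp: tribal_def bal_Bk_Hk bal_Hk_Hk)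

lemmas lin_simps = bal_Bk_Hk bal_Hk_Hk bal_Bk_Bk tribal_BHH tribal_HHH lin_on_Bk lin_on_Hk
bind_linear distrib_left distrib_right split_def

lemma bal_galois: "bal Breg A Breg (%b b'. coact b' >> (b0,h). tBH (b * b0) h)"
proof -
have "coact y >> (b0,h). tBH (x * (a * b0)) h = coact (a * y) >> (b0,h). tBH (x * b0) h"
 if "a : A" for x y a
 using that by(subst coact_A_mult(1)[where F = "%b h. tBH (x * b) h"])(simp_all add: lin_simps)
thus ?thesis
 by(simp add: bal_Breg mult.assoc)(simp add: lin_simps)
qed

lemma galois_map_tns: "galois_map (tAB b b') = coact b' >> (b0,h). tBH (b * b0) h"
unfolding galois_map_def by(rule tns_bind[OF bal_galois])

lemma galois_map_lin: "galois_map (t + u) = galois_map t + galois_map u"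
"galois_map (c*.t) = c *. galois_map t"
by(simp_all add: galois_map_def bind_linear)

lemma galois_map_bind2:
"galois_map (t >> (x,y). f x y) = t >> (x,y). galois_map (f x y)"
by(simp add: galois_map_def bind_assoc2)

lemma galois_map_eqI:
"t : car BAB ==> u : car BAB ==> galois_map t = galois_map u ==> t = u"
using hopf_galois unfolding hopf_galois_def bij_betw_def inj_on_def by blast

lemma transl_in [simp]: "transl h : car BAB"
and galois_map_transl: "galois_map (transl h) = tBH 1 h"
proof -
have "galois_map ` car BAB = car BH"
 using hopf_galois by(auto simp: hopf_galois_def bij_betw_def)
hence "tBH 1 h : galois_map ` car BAB" by simp
thus "transl h : car BAB" "galois_map (transl h) = tBH 1 h"
 unfolding transl_def by(rule inv_into_into, rule f_inv_into_f)
qed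

lemma transl_lin [simp]: "transl (x + y) = transl x + transl y" "transl (hs c x) = c *. transl x"
by(rule galois_map_eqI; simp add: subspace_tensor fv.subspace_add fv.subspace_scale galois_map_transl galois_map_lin)+

text \<open>This and the next identity say \<open>\<beta> \<beta>\<^sup>-\<^sup>1 = id\<close> and \<open>\<beta>\<^sup>-\<^sup>1 \<beta> = id\<close>. Further rules for the translation map
follow by inserting the second identity into a term and then removing another factor by the first.\<close>

lemma transl_inverse_left:
assumes "balU Bk Hk F"
shows "transl h >> (l,r). coact r >> (r0,r1). F (l * r0) r1 = F 1 h"
proof -
have "galois_map (transl h) >> (b,h). F b h = F 1 h"
 by(simp add: galois_map_transl tns_bind[OF assms])
thus ?thesis by(simp add: galois_map_def bind_assoc2 tns_bind[OF assms])
qed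

lemma transl_inverse_right:
assumes F: "bal Breg A Breg F"
shows "coact b' >> (b0,b1). transl b1 >> (l,r). F (b * b0 * l) r = F b b'"
proof -
let ?t = "coact b' >> (b0,b1). transl b1 >> (l,r). tAB (b * b0 * l) r"
have "?t = tAB b b'"
proof(rule galois_map_eqI)
 show "?t : car BAB" by(intro tensor_bind_in) simp
 have "galois_map ?t = coact b' >> (b0,b1). transl b1 >> (l,r). coact r >> (r0,r1).
   tBH (b * b0 * (l * r0)) r1"
  by(simp add: galois_map_bind2 galois_map_tns mult.assoc)
 also have "... = coact b' >> (b0,b1). tBH (b * b0) b1"
  by(subst transl_inverse_left[of "%x h. tBH (_ * x) h"])(simp_all add: lin_simps)
 finally show "galois_map ?t = galois_map (tAB b b')" by(simp add: galois_map_tns)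
qed simp
hence "?t >> (x,y). F x y = F b b'" by(simp add: tns_bind[OF F])
thus ?thesis by(simp add: bind_assoc2 tns_bind[OF F])
qed

lemma transl_central:
assumes F: "bal Breg A Breg F" and a: "a : A"
shows "transl h >> (l,r). F l (r * a) = transl h >> (l,r). F (a * l) r"
proof -
note F' = F[unfolded bal_Breg lin_on_Bk]
have "transl h >> (l,r). F l (r * a)
  = transl h >> (l,r). coact (r * a) >> (b0,b1). transl b1 >> (l',r'). F (l * b0 * l') r'"
 by(simp add: transl_inverse_right[OF F])
also have "... = transl h >> (l,r). coact r >> (b0,b1). transl b1 >> (l',r'). F ((l * b0) * (a * l')) r'"
 by(subst coact_A_mult(2)[OF _ a])(simp_all add: lin_simps F' mult.assoc)
also have "... = transl h >> (l',r'). F (1 * (a * l')) r'"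
 by(rule transl_inverse_left)(simp add: lin_simps F')
finally show ?thesis by simp
qed

lemma transl_mult:
assumes f: "lin_on Bk f"
shows "transl h >> (l,r). f (l * r) = counit h *. f 1"
proof -
note f' = f[unfolded lin_on_Bk]
have "transl h >> (l,r). f (l * r)
  = transl h >> (l,r). coact r >> (r0,r1). counit r1 *. f (l * r0)"
 by(subst coact_counit)(simp_all add: lin_simps f')
also have "... = counit h *. f 1"
 by(rule transl_inverse_left)(simp add: lin_simps f' fv.scale_left_distrib fscale_plus mult.commute)
finally show ?thesis .
qed

lemma transl_coact_right:
assumes K: "!!h. bal Breg A Breg (%l r. K l r h)" "!!l r. lin_on Hk (K l r)"
shows "transl h >> (l,r). coact r >> (r0,r1). K l r0 r1
  = comul h >> (h1,h2). transl h1 >> (l,r). K l r h2"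
proof -
note K' = K(1)[unfolded bal_Breg lin_on_Bk] K(2)[unfolded lin_on_Hk]
have "transl h >> (l,r). coact r >> (r0,r1). K l r0 r1
  = transl h >> (l,r). coact r >> (r0,r1). coact r0 >> (s0,s1). transl s1 >> (l',r').
   K (l * s0 * l') r' r1"
 by(simp add: transl_inverse_right[OF K(1)])
also have "... = transl h >> (l,r). coact r >> (r0,r1). comul r1 >> (a,c). transl a >> (l',r').
   K (l * r0 * l') r' c"
 by(subst coact_coassoc)(simp_all add: lin_simps K')
also have "... = comul h >> (a,c). transl a >> (l',r'). K (1 * l') r' c"
 by(rule transl_inverse_left)(simp add: lin_simps K')
finally show ?thesis by simp
qed

lemma transl_coact_left:
assumes K: "!!h. bal Breg A Breg (%l r. K l h r)" "!!l r. lin_on Hk (%h. K l h r)"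
shows "transl h >> (l,r). coact l >> (l0,l1). K l0 l1 r
  = comul h >> (h1,h2). transl h2 >> (l,r). K l (antip h1) r"
proof -
note K' = K(1)[unfolded bal_Breg lin_on_Bk] K(2)[unfolded lin_on_Hk]
let ?Q = "%b g h. transl h >> (l,r). K (b * l) g r"
have "transl h >> (l,r). coact l >> (l0,l1). K l0 l1 r
 = transl h >> (l,r). coact l >> (l0,l1). coact r >> (r0,r1). ?Q (l0 * r0) l1 r1"
 by(simp add: transl_inverse_right[OF K(1)])
also have "... = transl h >> (l,r). coact l >> (l0,l1). coact r >> (r0,r1).
   comul r1 >> (d,c). counit d *. ?Q (l0 * r0) (l1 * 1) c"
 by(subst comul_counit_left)(simp_all add: lin_simps K')
also have "... = transl h >> (l,r). coact l >> (l0,l1). coact r >> (r0,r1).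
   comul r1 >> (d,c). comul d >> (a,e). ?Q (l0 * r0) (l1 * (a * antip e)) c"
 by(subst comul_antip_right[of "%x. ?Q _ (_ * x) _"])(simp_all add: lin_simps K')
also have "... = transl h >> (l,r). coact l >> (l0,l1). coact r >> (r0,r1).
   comul r1 >> (a,c). comul c >> (h1,h2). ?Q (l0 * r0) (l1 * (a * antip h1)) h2"
 by(subst comul_coassoc)(simp_all add: lin_simps K')
also have "... = transl h >> (l,r). coact l >> (l0,l1). coact r >> (r0,r1).
   coact r0 >> (s0,s1). comul r1 >> (h1,h2). ?Q (l0 * s0) (l1 * s1 * antip h1) h2"
 by(subst coact_coassoc)(simp_all add: lin_simps K' mult.assoc)
also have "... = transl h >> (l,r). coact r >> (r0,r1).
   coact l >> (l0,l1). coact r0 >> (s0,s1). comul r1 >> (h1,h2). ?Q (l0 * s0) (l1 * s1 * antip h1) h2"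
 by(subst bind_commute2) simp
also have "... = transl h >> (l,r). coact r >> (r0,r1).
   coact (l * r0) >> (b0,b1). comul r1 >> (h1,h2). ?Q b0 (b1 * antip h1) h2"
 by(subst coact_mult_bind)(simp_all add: lin_simps K')
also have "... = coact 1 >> (b0,b1). comul h >> (h1,h2). ?Q b0 (b1 * antip h1) h2"
 by(rule transl_inverse_left)(simp add: lin_simps K')
also have "... = comul h >> (h1,h2). ?Q 1 (1 * antip h1) h2"
 by(rule coact_one_bind)(simp add: lin_simps K')
finally show ?thesis by simp
qed

end

section \<open>Faithful flatness\<close>

text \<open>Words code pairs of words, so that the tensor product of two modules generated by words is
generated by words. The number of leading letters \<open>Inl 0\<close>, closed off by one more letter, is the length of
the first word.\<close>

fun pair_dec :: "('b::zero + 'h::zero) list => ('b + 'h) list \<times> ('b + 'h) list" where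
"pair_dec z = (let n = length (takeWhile (%c. c = Inl 0) z); z' = drop (Suc n) z in (take n z', drop n z'))"

lemma pair_dec_surj: "EX z. pair_dec z = (x, y)"
proof
show "pair_dec (replicate (length x) (Inl 0) @ Inr 0 # x @ y) = (x, y)"
 by(simp add: takeWhile_append Let_def)
qed

lemma exact_at_transport:
assumes "bij_betw a (car M) (car M')" "bij_betw b (car N) (car N')"
 and "!!x. x : car M ==> f x : car N" "!!x. x : car M ==> f' (a x) = b (f x)"
 and "!!x. x : car N ==> g' (b x) = 0 <-> g x = 0"
shows "exact_at M N f g <-> exact_at M' N' f' g'"
proof -
have 1: "f' ` car M' = b ` f ` car M"
 using assms(1) assms(4) by(force simp: bij_betw_def image_iff)
have 2: "{n : car N'. g' n = 0} = b ` {n : car N. g n = 0}"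
 using assms(2,5) by(force simp: bij_betw_def image_iff)
have 3: "b ` X = b ` Y <-> X = Y" if "X <= car N" "Y <= car N" for X Y
 using that assms(2) by(auto simp: bij_betw_def inj_on_image_eq_iff)
show ?thesis
 unfolding exact_at_def 1 2 using assms(3) by(subst 3) auto
qed

context hopf_galois_ext
begin

lemmas rmod_def = right_A_module_def

text \<open>Modules that are generated, as vector spaces, by a family indexed by the words in \<open>B\<close> and \<open>H\<close>
can be moved into the ambient type over which \<open>faithfully_flat\<close> quantifies.\<close>

definition wgen :: "('k, 'l, 'm::ab_group_add, 'r) bimod => bool" where
"wgen M == kclosed M & (\<exists>phi :: ('b + 'h) list => 'm. (ALL x. phi x : car M) &
  (ALL m:car M. EX v. m = linext (scl M) v phi))"

lemma wgenE:
assumes "wgen M"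
obtains phi :: "('b + 'h) list => _" where "!!x. phi x : car M" "!!m. m : car M ==> EX v. m = linext (scl M) v phi"
using assms unfolding wgen_def by blast

lemma wgenI:
fixes phi :: "('b + 'h) list => _"
assumes "kclosed M" "!!x. phi x : car M" "!!m. m : car M ==> EX v. m = linext (scl M) v phi"
shows "wgen M"
unfolding wgen_def using assms(2,3) by(intro conjI[OF assms(1)] exI[of _ phi]) blast

lemma wgen_Bk: "wgen Bk"
proof -
have "x = linext bs (ins [Inl x]) (%z. case z of [Inl b] => b | _ => 0)" for x
 by(simp add: linext_def ins_def)
thus ?thesis unfolding wgen_def by(intro conjI exI[of _ "%z. case z of [Inl b] => b | _ => 0"]) auto
qed

lemma wgen_Hk: "wgen Hk"
proof -
have "x = linext hs (ins [Inr x]) (%z. case z of [Inr b] => b | _ => 0)" for x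
 by(simp add: linext_def ins_def)
thus ?thesis unfolding wgen_def by(intro conjI exI[of _ "%z. case z of [Inr b] => b | _ => 0"]) auto
qed

lemma wgen_tensor:
assumes "wgen M" "wgen N"
shows "wgen (tensor M R N)"
proof -
obtain phi :: "('b + 'h) list => _" where p: "!!x. phi x : car M" "!!m. m : car M ==> EX v. m = linext (scl M) v phi"
 using wgenE[OF assms(1)] by blast
obtain psi :: "('b + 'h) list => _" where q: "!!x. psi x : car N" "!!m. m : car N ==> EX v. m = linext (scl N) v psi"
 using wgenE[OF assms(2)] by blast
define chi where "chi z = (case pair_dec z of (x, y) => tns M R N (phi x) (psi y))" for z
let ?S = "range (%v. v >> chi)"
have S: "fv.subspace ?S"
proof -
 have "fv.subspace (UNIV :: (('b + 'h) list =>0 'k) set)" by(rule fv.subspace_UNIV)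
 thus ?thesis
  by(auto simp: fv.subspace_def bind_add_left[symmetric] bind_scale_left[symmetric] intro!: range_eqI[of _ _ 0])
   (simp add: bind_zero_left)
qed
have 1: "tns M R N (phi x) (psi y) : ?S" for x y
proof -
 obtain z where "pair_dec z = (x, y)" using pair_dec_surj by blast
 hence "tns M R N (phi x) (psi y) = (ins z >> chi)" by(simp add: chi_def)
 thus ?thesis by blast
qed
have 2: "tns M R N m n : ?S" if mn: "m : car M" "n : car N" for m n
proof -
 obtain v w where v: "m = linext (scl M) v phi" "n = linext (scl N) w psi" using p(2) q(2) mn by blast
 have k: "kclosed M" "kclosed N" using assms by(auto simp: wgen_def)
 have "tns M R N m n = v >> x. tns M R N (phi x) n"
  unfolding v(1) by(rule tns_linext_left)(auto simp: k p mn)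
 also have "... = v >> x. w >> y. tns M R N (phi x) (psi y)"
  unfolding v(2) by(subst tns_linext_right)(auto simp: k p q)
 finally show ?thesis by(auto intro!: bind_in_subspace[OF S] 1)
qed
have 3: "t : ?S" if "t : car (tensor M R N)" for t
 using that by(rule tensor_repE)(auto intro!: bind_in_subspace2[OF S] 2)
have "chi x : car (tensor M R N)" for x by(auto simp: chi_def p q split: prod.split)
thus ?thesis using 3 by(auto simp: wgen_def bind_def intro!: exI[of _ chi])
qed

lemma wgen_subspace:
assumes "wgen M" "scl M = fscale" "car N <= car M" "kclosed N" "scl N = fscale"
shows "wgen N"
proof -
obtain phi :: "('b + 'h) list => _" where p: "!!x. phi x : car M" "!!m. m : car M ==> EX v. m = linext (scl M) v phi"
 using wgenE[OF assms(1)] by blast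
note S = subspace_car[OF assms(4,5)]
let ?psi = "%x. phi x - nf (car N) (phi x)"
have "?psi x : car N" for x
 using fv.subspace_neg[OF S nf_diff_in[OF S, of "phi x"]] by simp
moreover have "EX v. n = linext (scl N) v ?psi" if n: "n : car N" for n
proof -
 obtain v where v: "n = (v >> phi)" using p(2)[of n] assms n by(auto simp: bind_def)
 have "nf (car N) n = 0" using nf_zero_iff[OF S] n by blast
 hence "n = (v >> ?psi)"
  by(simp add: v nf_bind[OF S])(simp add: bind_sum fv.scale_right_diff_distrib sum_subtractf)
 thus ?thesis using assms by(auto simp: bind_def)
qed
ultimately show ?thesis by(rule wgenI[OF assms(4)])
qed

lemma wgen_quotient:
assumes "wgen N" "scl N = fscale" and S: "fv.subspace S" and "car Q = nf S ` car N" "scl Q = fscale"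
shows "wgen Q"
proof -
obtain phi :: "('b + 'h) list => _" where p: "!!x. phi x : car N" "!!m. m : car N ==> EX v. m = linext (scl N) v phi"
 using wgenE[OF assms(1)] by blast
have N: "kclosed N" using assms by(auto simp: wgen_def)
have "kclosed Q"
 unfolding kclosed_def assms using kclosed_diff[OF N] kclosed_scl[OF N] kclosed_zero[OF N] assms(2)
 by(auto simp: nf_diff[OF S, symmetric] nf_scale[OF S, symmetric] intro!: image_eqI[of 0 _ 0] simp: nf_zero[OF S])
moreover have "nf S (phi x) : car Q" for x using p(1) assms(4) by auto
moreover have "EX v. q = linext (scl Q) v (%x. nf S (phi x))" if q: "q : car Q" for q
proof -
 obtain n where n: "n : car N" "q = nf S n" using q unfolding assms(4) by blast
 obtain v where v: "n = (v >> phi)" using p(2)[of n] assms n by(auto simp: bind_def)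
 have "q = v >> x. nf S (phi x)" by(simp add: n v nf_bind[OF S])
 thus ?thesis using assms by(auto simp: bind_def)
qed
ultimately show ?thesis by(rule wgenI)
qed

definition amod :: "('k, 'l, 'x =>0 'k, 'b) bimod => bool" where
"amod M == right_A_module M & scl M = fscale & wgen M"

lemma
assumes "amod M"
shows amod_kclosed: "kclosed M" and amod_scl: "scl M = fscale" and amod_rclosed: "rclosed M A"
using assms by(auto simp: amod_def rclosed_def rmod_def wgen_def)

lemma amod_add: "amod M ==> m : car M ==> m' : car M ==> a : A ==> rac M (m + m') a = rac M m a + rac M m' a"
by(simp add: amod_def rmod_def)

text \<open>A module generated by words is a quotient of the free space on words. Normal forms modulo the
relations realise this quotient on a subset of that space.\<close>

lemma transport:
assumes M: "amod M"
obtains M' :: "('k, unit, ('b + 'h) list =>0 'k, 'b) bimod" and i j where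
 "right_A_module M'" "rhom A M M' i" "rhom A M' M j"
 "!!m. m : car M ==> j (i m) = m" "!!m. m : car M' ==> i (j m) = m"
proof -
have cl: "kclosed M" and s: "scl M = fscale" using M by(auto simp: amod_def wgen_def)
obtain phi :: "('b + 'h) list => _" where p: "!!x. phi x : car M" "!!m. m : car M ==> EX v. m = (v >> phi)"
 using M wgenE[of M] unfolding amod_def bind_def by metis
let ?K = "{v. (v >> phi) = 0}"
have K: "fv.subspace ?K"
 by(auto simp: fv.subspace_def bind_linear)
define i where "i m = nf ?K (SOME v. m = (v >> phi))" for m
define j where "j v = (v >> phi)" for v
have ieq: "i (v >> phi) = nf ?K v" for v
proof -
 have "(v >> phi) = ((SOME w. (v >> phi) = (w >> phi)) >> phi)"
  by(rule someI[of "%w. (v >> phi) = (w >> phi)"]) (rule refl)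
 thus ?thesis unfolding i_def by(intro nf_eqI[OF K])(simp add: bind_diff_left)
qed
have jnf: "j (nf ?K v) = j v" for v
 using nf_diff_in[OF K, of v] by(simp add: j_def bind_diff_left)
have ji: "j (i m) = m" if "m : car M" for m
 using p(2)[OF that] ieq jnf by(auto simp: j_def)
have iadd: "i (m + m') = i m + i m'" if "m : car M" "m' : car M" for m m'
 using p(2)[OF that(1)] p(2)[OF that(2)] by(auto simp: bind_add_left[symmetric] ieq nf_add[OF K])
have iscl: "i (c*.m) = c *. i m" if "m : car M" for m c
 using p(2)[OF that(1)] by(auto simp: bind_scale_left[symmetric] ieq nf_scale[OF K])
define M' :: "('k, unit, ('b + 'h) list =>0 'k, 'b) bimod" where "M' = \<lparr>car = i ` car M, scl = fscale, lac = (%_ x. x), rac = (%w a. i (rac M (j w) a))\<rparr>"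
have rM: "right_A_module M" using M by(simp add: amod_def)
have idiff: "i m - i m' = i (m - m')" if "m : car M" "m' : car M" for m m'
 using iadd[of "m - m'" m'] that kclosed_diff[OF cl] by simp
have rac: "rac M m a : car M" if "m : car M" "a : A" for m a
 using rM that by(simp add: rmod_def)
have ji0: "i 0 = 0" using iadd[of 0 0] kclosed_zero[OF cl] by simp
have "right_A_module M'"
 unfolding rmod_def
proof(intro conjI ballI allI)
 show "0 : car M'" using ji0 kclosed_zero[OF cl] unfolding M'_def by force
next
 fix x y assume "x : car M'" "y : car M'"
 then obtain m m' where m: "m : car M" "m' : car M" "x = i m" "y = i m'" by(auto simp: M'_def)
 show "x - y : car M'" using m idiff kclosed_diff[OF cl m(1,2)] by(simp add: M'_def)
 fix a assume a: "a : A"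
 show "rac M' (x + y) a = rac M' x a + rac M' y a"
  using m a by(simp add: M'_def ji iadd[symmetric] kclosed_add[OF cl] rac amod_add[OF M])
next
 fix x a assume "x : car M'" and a: "a : A"
 then obtain m where m: "m : car M" "x = i m" by(auto simp: M'_def)
 show "rac M' x a : car M'" using m a by(simp add: M'_def ji rac)
 fix a' assume a': "a' : A"
 show "rac M' x (a + a') = rac M' x a + rac M' x a'" "rac M' x (a * a') = rac M' (rac M' x a) a'"
  using m a a' rM by(simp_all add: M'_def ji iadd[symmetric] rac rmod_def)
next
 fix x assume "x : car M'"
 then obtain m where m: "m : car M" "x = i m" by(auto simp: M'_def)
 show "rac M' x 1 = x" using m rM by(simp add: M'_def ji rmod_def)
 fix c
 have "rac M m (bs c 1) = c*.m" using m rM s unfolding rmod_def by metis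
 thus "scl M' c x = rac M' x (bs c 1)" using m by(simp add: M'_def ji iscl)
qed
moreover have "rhom A M M' i"
 by(auto simp: rhom_def klin_def M'_def iadd iscl s ji)
moreover have "rhom A M' M j"
 by(auto simp: rhom_def klin_def M'_def iadd[symmetric] iscl[symmetric] ji s rac
   kclosed_add[OF cl] kclosed_scl[OF cl, unfolded s])
moreover have "i (j m) = m" if "m : car M'" for m
 using that by(auto simp: M'_def ji)
ultimately show thesis using ji by(intro that[of M' i j])
qed

lemma tmap_comp:
assumes f: "rhom A M N f" and f': "rhom A N Q f'" and t: "t : car (extB M)"
shows "extmap Q f' (extmap N f t) = extmap Q (%x. f' (f x)) t"
proof(rule tensor_lin_eqI[OF t])
show "lin_on (extB M) (%t. extmap Q f' (extmap N f t))"
 by(auto simp: lin_on_def tmap_def bind_linear)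
show "lin_on (extB M) (extmap Q (%x. f' (f x)))"
 by(auto simp: lin_on_def tmap_def bind_linear)
show "extmap Q f' (extmap N f (tnsB M m n)) =
  extmap Q (%x. f' (f x)) (tnsB M m n)" for m n
 unfolding tmap_tns_hom[OF f lhom_id(2)] tmap_tns_hom[OF f' lhom_id(2)]
  tmap_tns_hom[OF rhom_comp[OF f' f] lhom_id(2)] by simp
qed

lemma tmap_ident:
assumes t: "t : car (extB M)" and f: "!!x. x : car M ==> f x = x" and M: "rclosed M A"
shows "extmap M f t = t"
proof(rule tensor_lin_eqI[OF t, of _ "%t. t"])
have "rhom A M M f"
 using M f by(auto simp: rhom_def klin_def rclosed_def kclosed_add kclosed_scl)
thus "extmap M f (tnsB M m n) = tnsB M m n" if "m : car M" for m n
 by(simp add: tmap_tns_hom[OF _ lhom_id(2)] f that)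
show "lin_on (extB M) (extmap M f)"
 by(auto simp: lin_on_def tmap_def bind_linear)
qed (auto simp: lin_on_def)

lemma bij_tmap:
assumes "rhom A M M' i" "rhom A M' M j" "rclosed M A" "rclosed M' A"
 and "!!m. m : car M ==> j (i m) = m" "!!m. m : car M' ==> i (j m) = m"
shows "bij_betw (extmap M' i) (car (extB M)) (car (extB M'))"
proof(rule bij_betw_byWitness[where f' = "extmap M j"])
show "ALL t:car (extB M). extmap M j (extmap M' i t) = t"
 using assms by(auto simp: tmap_comp tmap_ident)
show "ALL t:car (extB M'). extmap M' i (extmap M j t) = t"
 using assms by(auto simp: tmap_comp tmap_ident)
qed (use assms in "auto intro!: tmap_in lhom_id")

lemma tmap_zero: "tmap M R N f g 0 = 0"
by(simp add: tmap_def bind_zero_left)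

lemma flat_words:
fixes M N Q :: "('k, unit, ('b + 'h) list =>0 'k, 'b) bimod"
assumes "right_A_module M" "right_A_module N" "right_A_module Q" "rhom A M N f" "rhom A N Q g"
shows "exact_at M N f g <-> exact_at (extB M) (extB N)
  (extmap N f) (extmap Q g)"
proof -
have h: "bimod_hom {} A M N f" "bimod_hom {} A N Q g"
 using assms by(auto simp: bimod_hom_def rhom_def klin_def)
have "faithfully_flat TYPE(('b + 'h) list =>0 'k) G" using galois by(simp add: faithfully_flat_galois_def)
from this[unfolded faithfully_flat_def, rule_format, OF conjI[OF assms(1) conjI[OF assms(2) conjI[OF assms(3) conjI[OF h]]]]]
show ?thesis .
qed

lemma flat_exact_iff:
assumes M: "amod M" and N: "amod N" and Q: "amod Q" and f: "rhom A M N f" and g: "rhom A N Q g"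
shows "exact_at M N f g <-> exact_at (extB M) (extB N)
  (extmap N f) (extmap Q g)"
proof -
obtain M' :: "('k, unit, ('b + 'h) list =>0 'k, 'b) bimod" and iM jM where
 tM: "right_A_module M'" "rhom A M M' iM" "rhom A M' M jM"
 "!!m. m : car M ==> jM (iM m) = m" "!!m. m : car M' ==> iM (jM m) = m"
 by(rule transport[OF M]) blast
obtain N' :: "('k, unit, ('b + 'h) list =>0 'k, 'b) bimod" and iN jN where
 tN: "right_A_module N'" "rhom A N N' iN" "rhom A N' N jN"
 "!!m. m : car N ==> jN (iN m) = m" "!!m. m : car N' ==> iN (jN m) = m"
 by(rule transport[OF N]) blast
obtain Q' :: "('k, unit, ('b + 'h) list =>0 'k, 'b) bimod" and iQ jQ where
 tQ: "right_A_module Q'" "rhom A Q Q' iQ" "rhom A Q' Q jQ"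
 "!!m. m : car Q ==> jQ (iQ m) = m" "!!m. m : car Q' ==> iQ (jQ m) = m"
 by(rule transport[OF Q]) blast
have rc: "rclosed X A" if "right_A_module X" for X :: "('k, unit, ('b + 'h) list =>0 'k, 'b) bimod"
 using that by(auto simp: rmod_def rclosed_def kclosed_def A_one A_scale)
note cM = amod_rclosed[OF M] rc[OF tM(1)] and cN = amod_rclosed[OF N] rc[OF tN(1)]
 and cQ = amod_rclosed[OF Q] rc[OF tQ(1)]
let ?f = "%x. iN (f (jM x))" and ?g = "%x. iQ (g (jN x))"
have f': "rhom A M' N' ?f" by(intro rhom_comp[OF tN(2)] rhom_comp[OF f] tM)
have g': "rhom A N' Q' ?g" by(intro rhom_comp[OF tQ(2)] rhom_comp[OF g] tN)
have fin: "f x : car N" if "x : car M" for x using f that by(auto simp: rhom_def klin_def)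
have gin: "g x : car Q" if "x : car N" for x using g that by(auto simp: rhom_def klin_def)
have i0: "iQ x = 0 <-> x = 0" if "x : car Q" for x
 using that tQ(4)[of x] tQ(4)[of 0] klin_zero[of Q Q' iQ] klin_zero[of Q' Q jQ] tQ(2,3) cQ
 by(auto simp: rhom_def rclosed_def)
have bb: "bij_betw i (car X) (car Y)" if "rhom A X Y i" "rhom A Y X j" "!!m. m : car X ==> j (i m) = m"
 "!!m. m : car Y ==> i (j m) = m" for i j and X :: "('k, 'x, 'y =>0 'k, 'b) bimod" and Y :: "('k, unit, ('b + 'h) list =>0 'k, 'b) bimod"
 using that by(intro bij_betw_byWitness[where f' = j])(auto simp: rhom_def klin_def)
have "exact_at M N f g <-> exact_at M' N' ?f ?g"
 by(rule exact_at_transport[where a = iM and b = iN])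
  (auto simp: fin gin tM(4) tN(4) i0 intro: bb tM tN)
also have "... <-> exact_at (extB M') (extB N')
  (extmap N' ?f) (extmap Q' ?g)"
 by(rule flat_words[OF tM(1) tN(1) tQ(1) f' g'])
also have "... <-> exact_at (extB M) (extB N)
  (extmap N f) (extmap Q g)"
proof(rule exact_at_transport[where a = "extmap M' iM" and b = "extmap N' iN", symmetric])
 show "bij_betw (extmap M' iM) (car (extB M)) (car (extB M'))"
  by(rule bij_tmap[OF tM(2,3) cM tM(4,5)])
 show "bij_betw (extmap N' iN) (car (extB N)) (car (extB N'))"
  by(rule bij_tmap[OF tN(2,3) cN tN(4,5)])
 fix x assume x: "x : car (extB M)"
 show "extmap N f x : car (extB N)" by(rule tmap_in[OF f lhom_id(2) x])
 have "extmap N' ?f (extmap M' iM x) = extmap N' (%x. ?f (iM x)) x"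
  by(rule tmap_comp[OF tM(2) f' x])
 also have "... = extmap N' (%x. iN (f x)) x"
  unfolding tmap_def using tensor_keys[OF cM(1) closed_k(6) x] by(intro bind_cong2)(auto simp: tM(4))
 also have "... = extmap N' iN (extmap N f x)"
  by(rule tmap_comp[OF f tN(2) x, symmetric])
 finally show "extmap N' ?f (extmap M' iM x) = extmap N' iN (extmap N f x)" .
next
 fix x assume x: "x : car (extB N)"
 have gx: "extmap Q g x : car (extB Q)" by(rule tmap_in[OF g lhom_id(2) x])
 have "extmap Q' ?g (extmap N' iN x) = extmap Q' (%x. ?g (iN x)) x"
  by(rule tmap_comp[OF tN(2) g' x])
 also have "... = extmap Q' (%x. iQ (g x)) x"
  unfolding tmap_def using tensor_keys[OF cN(1) closed_k(6) x] by(intro bind_cong2)(auto simp: tN(4))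
 also have "... = extmap Q' iQ (extmap Q g x)"
  by(rule tmap_comp[OF g tQ(2) x, symmetric])
 also have "... = 0 <-> extmap Q g x = 0"
 proof
  assume "extmap Q' iQ (extmap Q g x) = 0"
  hence "extmap Q jQ (extmap Q' iQ (extmap Q g x)) = 0"
   by(simp add: tmap_zero)
  thus "extmap Q g x = 0"
   by(simp add: tmap_comp[OF tQ(2,3) gx] tmap_ident[OF gx _ cQ(1)] tQ(4))
 qed (simp add: tmap_zero)
 finally show "extmap Q' ?g (extmap N' iN x) = 0 <-> extmap Q g x = 0" .
qed
finally show ?thesis .
qed

definition zmod :: "('k, 'l, 'x =>0 'k, 'b) bimod" where
"zmod = \<lparr>car = {0}, scl = fscale, lac = (%_ x. x), rac = (%_ _. 0)\<rparr>"

lemma amod_zmod: "amod zmod"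
by(auto simp: amod_def zmod_def rmod_def wgen_def kclosed_def linext_def intro!: exI[of _ "%_. 0"])

lemma tns_zero: "kclosed M ==> n : car N ==> tns M R N 0 n = 0"
using lin_on_zero[OF _ lin_tns_left] .

lemma flat_inj:
fixes M :: "('k, 'l, 'c =>0 'k, 'b) bimod"
assumes M: "amod M" and N: "amod N" and f: "rhom A M N f" and inj: "inj_on f (car M)"
 and t: "t : car (extB M)" and 0: "extmap N f t = 0"
shows "t = 0"
proof -
let ?Z = "zmod :: ('k, 'l, 'c =>0 'k, 'b) bimod"
note kM = amod_kclosed[OF M]
have z: "rhom A ?Z M (%_. 0)"
 using amod_add[OF M kclosed_zero[OF kM] kclosed_zero[OF kM]] kM amod_scl[OF M]
 by(auto simp: rhom_def klin_def zmod_def kclosed_zero)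
have f0: "f 0 = 0" using f klin_zero[OF kM] by(auto simp: rhom_def)
have "exact_at ?Z M (%_. 0) f"
 using inj f0 kclosed_zero[OF kM] by(auto simp: exact_at_def zmod_def inj_on_def)
hence "exact_at (extB ?Z) (extB M) (extmap M (%_. 0)) (extmap N f)"
 using flat_exact_iff[OF amod_zmod M N z f] by simp
hence "t : extmap M (%_. 0) ` car (extB ?Z)"
 using t 0 by(simp add: exact_at_def)
thus ?thesis by(auto simp: tmap_def tns_zero[OF kM] bind_zero_right2)
qed

lemma flat_kernel:
fixes M N :: "('k, 'l, 'c =>0 'k, 'b) bimod" and Q :: "('k, 'l, 'd =>0 'k, 'b) bimod"
assumes M: "amod M" and N: "amod N" and Q: "amod Q" and f: "rhom A N Q f"
 and incl: "rhom A M N id" and car: "car M = {n : car N. f n = 0}"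
 and t: "t : car (extB N)" and 0: "extmap Q f t = 0"
shows "EX s:car (extB M). extmap N id s = t"
proof -
have "exact_at M N id f" using car by(simp add: exact_at_def)
hence "exact_at (extB M) (extB N) (extmap N id) (extmap Q f)"
 using flat_exact_iff[OF M N Q incl f] by simp
hence "t : extmap N id ` car (extB M)"
 using t 0 by(simp add: exact_at_def)
thus ?thesis by auto
qed

text \<open>By flatness \<open>m A \<otimes>\<^sub>A B\<close> is a submodule of \<open>M \<otimes>\<^sub>A B\<close>. It is generated by \<open>m \<otimes> 1\<close>, so it vanishes
together with \<open>m \<otimes> 1\<close>, and then so does the cyclic module \<open>m A\<close>.\<close>

lemma faithful:
fixes M :: "('k, 'l, 'c =>0 'k, 'b) bimod"
assumes M: "amod M" and m: "m : car M" and 0: "tnsB M m 1 = 0"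
shows "m = 0"
proof -
let ?C = "\<lparr>car = {rac M m a | a. a : A}, scl = fscale, lac = lac M, rac = rac M\<rparr>"
let ?Z = "zmod :: ('k, 'l, 'c =>0 'k, 'b) bimod"
note kM = amod_kclosed[OF M] and sM = amod_scl[OF M]
have rM: "right_A_module M" using M by(simp add: amod_def)
have in_M: "rac M m a : car M" if "a : A" for a using rM m that by(simp add: rmod_def)
have add2: "rac M m (a + a') = rac M m a + rac M m a'" if "a : A" "a' : A" for a a'
 using rM m that by(simp add: rmod_def)
have mult: "rac M (rac M m a) a' = rac M m (a * a')" if "a : A" "a' : A" for a a'
 using rM m that by(simp add: rmod_def)
have scl: "c *. rac M m a = rac M m (a * bs c 1)" if "a : A" for a c
 using rM in_M[OF that] mult[OF that A_scale[OF A_one]] sM unfolding rmod_def by metis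
have diff: "rac M m a - rac M m a' = rac M m (a - a')" if "a : A" "a' : A" for a a'
 using add2[OF A_diff[OF that] that(2)] by simp
have zero: "0 = rac M m 0" using diff[of 1 1] by(simp add: A_one)
have A0: "0 : A" using A_diff[OF A_one A_one] by simp
have one: "rac M m 1 = m" using rM m by(simp add: rmod_def)
have C_sub: "car ?C <= car M" using in_M by auto
have "right_A_module ?C"
 unfolding rmod_def
proof(intro conjI ballI allI)
 show "0 : car ?C" using zero A0 by auto
next
 fix x y assume "x : car ?C" "y : car ?C"
 thus "x - y : car ?C" using diff A_diff by auto
next
 fix x a assume "x : car ?C" "a : A"
 thus "rac ?C x a : car ?C" using mult A_mult by auto
qed (use rM C_sub sM in "auto simp: rmod_def subset_iff")
moreover have "kclosed ?C"
 using zero A0 diff A_diff scl A_mult[OF _ A_scale[OF A_one]] by(auto simp: kclosed_def)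
moreover have "wgen ?C"
 by(rule wgen_subspace[of M])(use M sM C_sub calculation in "auto simp: amod_def")
ultimately have C: "amod ?C" by(simp add: amod_def)
have incl: "rhom A ?C M id" using C_sub sM by(auto simp: rhom_def klin_def)
have vanish: "t = 0" if t: "t : car (extB ?C)" for t
proof(rule tensor_lin_eqI[OF t, of "%t. t" "%_. 0"])
 fix x b assume x: "x : car ?C"
 then obtain a where a: "a : A" "x = rac M m a" by auto
 have "bal M A Breg (%x y. tnsB M x (y * (a * b)))"
  by(intro balI lin_on_comp[OF lin_tns_right])
   (auto simp: lin_tns_left klin_def distrib_right tns_bal mult.assoc)
 from tns_bind[OF this, of m 1] have "tnsB M m (a * b) = 0"
  using 0 by(simp add: bind_zero_left)
 hence "tnsB M x b = 0"
  using tns_bal[of m M a A b "Breg"] a m by simp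
 hence "extmap M id (tnsB ?C x b) = 0"
  unfolding tmap_tns_hom[OF incl lhom_id(2)] by simp
 moreover have "tnsB ?C x b : car (extB ?C)" using x by(rule tns_in) simp
 ultimately show "tnsB ?C x b = 0"
  using flat_inj[OF C M incl inj_on_id] by blast
qed (auto simp: lin_on_def)
have "exact_at (extB ?Z) (extB ?C) (extmap ?C (%_. 0)) (extmap ?Z (%_. 0))"
proof -
 have z: "!!t. t : car (extB ?Z) ==> extmap ?C (%_. 0) t = 0"
  by(auto simp: tmap_def tns_zero[OF `kclosed ?C`] bind_zero_right2)
 have 0: "0 : car (extB ?Z)" "0 : car (extB ?C)"
  by(rule kclosed_zero, simp)+
 have "extmap ?C (%_. 0) ` car (extB ?Z) = (%_. 0) ` car (extB ?Z)"
  by(intro image_cong refl z)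
 also have "... = {0}" using 0(1) by blast
 also have "... = {n : car (extB ?C). extmap ?Z (%_. 0) n = 0}"
 proof -
  have "{n : car (extB ?C). extmap ?Z (%_. 0) n = 0} <= {0}" using vanish by blast
  moreover have "extmap ?Z (%_. 0) 0 = 0" by(rule tmap_zero)
  ultimately show ?thesis using 0(2) by blast
 qed
 finally show ?thesis unfolding exact_at_def .
qed
moreover have "rac M 0 a = 0" if "a : A" for a
 using mult[OF A0 that] zero by simp
hence "rhom A ?Z ?C (%_. 0)" "rhom A ?C ?Z (%_. 0)"
 using zero A0 by(auto simp: rhom_def klin_def zmod_def)
ultimately have "exact_at ?Z ?C (%_. 0) (%_. 0 :: 'c =>0 'k)"
 using flat_exact_iff[OF amod_zmod C amod_zmod] by blast
hence "{0} = car ?C" by(simp add: exact_at_def zmod_def)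
moreover have "m : car ?C" using one[symmetric] A_one by simp blast
ultimately show ?thesis by blast
qed

text \<open>Faithfulness for the class of \<open>n\<close> in the quotient by \<open>S\<close>.\<close>

lemma faithful_submodule:
assumes N: "amod N" and S: "fv.subspace S" "S <= car N" "!!x a. x : S ==> a : A ==> rac N x a : S"
 and n: "n : car N" and v: "keys v <= S \<times> UNIV" "tnsB N n 1 = v >> (x,b). tnsB N x b"
shows "n : S"
proof -
let ?Q = "\<lparr>car = nf S ` car N, scl = fscale, lac = lac N, rac = (%q a. nf S (rac N q a))\<rparr>"
note kN = amod_kclosed[OF N] and sN = amod_scl[OF N]
have rN: "right_A_module N" using N by(simp add: amod_def)
have nfN: "nf S x : car N" if "x : car N" for x
 using kclosed_add[OF kN that subsetD[OF S(2) nf_diff_in[OF S(1), of x]]] by simp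
have rdiff: "rac N (x - y) a = rac N x a - rac N y a" if "x : car N" "y : car N" "a : A" for x y a
 using amod_add[OF N kclosed_diff[OF kN that(1,2)] that(2,3)] by simp
have rac: "nf S (rac N (nf S x) a) = nf S (rac N x a)" if "x : car N" "a : A" for x a
 by(rule nf_eqI[OF S(1)])
  (use S(3)[OF nf_diff_in[OF S(1), of x] that(2)] rdiff[OF nfN[OF that(1)] that] in simp)
have wQ: "wgen ?Q" by(rule wgen_quotient[OF _ sN S(1)])(use N in "auto simp: amod_def")
have kQ: "kclosed ?Q" using wQ unfolding wgen_def by blast
have "right_A_module ?Q"
 unfolding rmod_def
proof(intro conjI ballI allI)
 show "0 : car ?Q" by(rule kclosed_zero[OF kQ])
next
 fix x y assume "x : car ?Q" "y : car ?Q"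
 thus "x - y : car ?Q" by(rule kclosed_diff[OF kQ])
next
 fix x a assume x: "x : car ?Q" "a : A"
 thus "rac ?Q x a : car ?Q" using nfN rN by(auto simp: rmod_def)
 fix y assume y: "y : car ?Q"
 show "rac ?Q (x + y) a = rac ?Q x a + rac ?Q y a"
  using x y nfN amod_add[OF N] by(auto simp: nf_add[OF S(1)])
next
 fix x a a' assume x: "x : car ?Q" "a : A" "a' : A"
 show "rac ?Q x (a + a') = rac ?Q x a + rac ?Q x a'"
  using x nfN rN by(auto simp: nf_add[OF S(1), symmetric] rmod_def)
 obtain y where y: "y : car N" "x = nf S y" using x by auto
 have "rac N y a : car N" "rac N y (a * a') = rac N (rac N y a) a'"
  using rN y x by(auto simp: rmod_def)
 thus "rac ?Q x (a * a') = rac ?Q (rac ?Q x a) a'"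
  using x y by(simp add: rac A_mult)
next
 fix x assume x: "x : car ?Q"
 thus "rac ?Q x 1 = x" using nfN rN by(auto simp: rmod_def nf_idem[OF S(1)])
 fix c show "scl ?Q c x = rac ?Q x (bs c 1)"
 proof -
  obtain y where y: "y : car N" "x = nf S y" using x by auto
  have "rac N (nf S y) (bs c 1) = c *. nf S y"
   using rN nfN[OF y(1)] sN unfolding rmod_def by metis
  thus ?thesis using y by(simp add: nf_scale[OF S(1)] nf_idem[OF S(1)])
 qed
qed
hence Q: "amod ?Q" using wQ by(simp add: amod_def)
have h: "rhom A N ?Q (nf S)"
 using sN by(auto simp: rhom_def klin_def nf_add[OF S(1)] nf_scale[OF S(1)] rac)
have "tnsB ?Q (nf S n) 1 = extmap ?Q (nf S) (tnsB N n 1)"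
 by(simp add: tmap_tns_hom[OF h lhom_id(2)])
also have "... = v >> (x,b). tnsB ?Q (nf S x) b"
 unfolding v(2) tmap_def bind_assoc2 tns_bind[OF bal_tns_comp[OF h lhom_id(2)]] by simp
also have "... = v >> (x,b). 0"
proof(rule bind_cong2)
 fix x b assume "(x, b) : keys v"
 hence "nf S x = 0" using v(1) nf_zero_iff[OF S(1)] by blast
 thus "tnsB ?Q (nf S x) b = 0" by(simp add: tns_zero[OF amod_kclosed[OF Q]])
qed
finally have "tnsB ?Q (nf S n) 1 = 0" by(simp add: bind_zero_right2)
hence "nf S n = 0" using faithful[OF Q] n by simp
thus ?thesis using nf_zero_iff[OF S(1)] by blast
qed

lemma amod_tensor:
assumes M: "wgen M" and N: "wgen N" "right_A_module N" and h: "!!a. a : A ==> lhom R N N (%n. rac N n a)"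
shows "amod (tensor M R N)"
proof -
let ?T = "tensor M R N"
have lin: "lin_on ?T (%t. rac ?T t a)" for a
 by(auto simp: lin_on_def rac_tensor bind_linear)
have inT: "rac ?T t a : car ?T" if "t : car ?T" "a : A" for t a
 using that h by(auto intro: rac_in)
have "right_A_module ?T"
 unfolding rmod_def
proof(intro conjI ballI allI)
 show "0 : car ?T" by(rule kclosed_zero) simp
 show "x - y : car ?T" if "x : car ?T" "y : car ?T" for x y using that by(intro kclosed_diff) simp_all
 show "rac ?T x a : car ?T" if "x : car ?T" "a : A" for x a using that by(rule inT)
 show "rac ?T (x + y) a = rac ?T x a + rac ?T y a" for x y a
  by(simp add: rac_tensor bind_linear)
next
 fix t a a' assume t: "t : car ?T" and a: "a : A" "a' : A"
 show "rac ?T t (a + a') = rac ?T t a + rac ?T t a'"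
  by(rule tensor_lin_eqI[OF t lin lin_on_plus[OF lin lin]])
   (use N(2) a A_add[OF a] in "auto simp: rac_tns h rmod_def tns_add_right")
 show "rac ?T t (a * a') = rac ?T (rac ?T t a) a'"
 proof(rule tensor_lin_eqI[OF t lin])
  show "lin_on ?T (%t. rac ?T (rac ?T t a) a')"
   using inT[OF _ a(1)] by(intro lin_on_comp[OF lin])(auto simp: klin_def rac_tensor bind_linear)
 qed (use N(2) a A_mult[OF a] in "auto simp: rac_tns h rmod_def")
next
 fix t assume t: "t : car ?T"
 show "rac ?T t 1 = t"
  by(rule tensor_lin_eqI[OF t lin, of "%t. t"])
   (use N(2) A_one in "auto simp: rac_tns h rmod_def lin_on_def")
 fix c show "scl ?T c t = rac ?T t (bs c 1)"
 proof(rule tensor_lin_eqI[OF t _ lin])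
  show "lin_on ?T (scl ?T c)" by(simp add: lin_on_def fscale_plus mult.commute)
  fix m n assume mn: "m : car M" "n : car N"
  hence "rac N n (bs c 1) = scl N c n" using N(2) by(simp add: rmod_def)
  thus "scl ?T c (tns M R N m n) = rac ?T (tns M R N m n) (bs c 1)"
   using mn A_scale[OF A_one] by(simp add: rac_tns h tns_scl_right)
 qed
qed
thus ?thesis using wgen_tensor[OF M N(1)] by(simp add: amod_def)
qed

section \<open>The algebra \<open>\<Gamma>\<close>\<close>

abbreviation "BB == tensor Bk UNIV Bk"

lemma be_lin [simp]: "be (x + y) z = be x z + be y z" "be x (y + z) = be x y + be x z"
 "be (bs c x) z = c *. be x z" "be x (bs c z) = c *. be x z"
unfolding be_def
by(simp_all add: tns_add_left[where M="Bk"] tns_add_right[where M="Bk"]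
 tns_scl_left[where M="Bk", simplified] tns_scl_right[where N="Bk", simplified])

lemma be_in [simp]: "be x y : Be_car"
by(simp add: be_def Be_car_def)

lemma be_bind: "balU Bk Bk F ==> (be x y >> (x,y). F x y) = F x y"
unfolding be_def by(rule tns_bind)

lemma be_self: "u : Be_car ==> (u >> (x,y). be x y) = u"
unfolding be_def Be_car_def by(rule tensor_self)

lemma subspace_Be [simp]: "fv.subspace Be_car"
unfolding Be_car_def by(rule subspace_tensor)

lemma Be_closed [simp]: "0 : Be_car" "u : Be_car ==> v : Be_car ==> u + v : Be_car"
"u : Be_car ==> v : Be_car ==> u - v : Be_car"
"u : Be_car ==> c*.u : Be_car"
using subspace_Be fv.subspace_diff unfolding fv.subspace_def by blast+

lemma bemul_lin [simp]: "(u + v) *~ w = u*~w + v*~w" "u *~ (v + w) = u*~v + u*~w"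
"(c*.u)*~w = c *. u*~w" "u*~(c*.w) = c *. u*~w"
by(simp_all add: bemul_def bind_linear split_def)

lemma bemul_in [simp]: "u*~v : Be_car"
unfolding bemul_def by(intro bind_in_subspace2[OF subspace_Be]) simp

lemma bemul_bind:
assumes "balU Bk Bk F"
shows "u*~v >> (x,y). F x y = u >> (x,y). v >> (x',y'). F (x * x') (y' * y)"
unfolding bemul_def bind_assoc2 be_bind[OF assms] by simp

lemma bemul_be [simp]: "be x y *~ be x' y' = be (x * x') (y' * y)"
proof -
have "balU Bk Bk (%a b. be (x * a) (b * y))" "balU Bk Bk (%a b. be x' y' >> (x',y'). be (a * x') (y' * b))"
 by(simp_all add: lin_simps)
thus ?thesis by(simp add: bemul_def be_bind)
qed

lemma bemul_be_left: "be a b *~ v = v >> (x,y). be (a * x) (y * b)"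
proof -
have "balU Bk Bk (%a b. v >> (x',y'). be (a * x') (y' * b))"
 by(simp add: lin_simps)
thus ?thesis by(simp add: bemul_def be_bind)
qed

lemma bemul_be_right: "v *~ be a b = v >> (x,y). be (x * a) (b * y)"
unfolding bemul_def by(subst be_bind)(simp_all add: lin_simps)

lemma bemul_assoc: "u*~v *~ w = u *~ (v*~w)"
proof -
have "balU Bk Bk (%x y. w >> (x',y'). be (x * x') (y' * y))"
 "!!x y. balU Bk Bk (%x' y'. be (x * x') (y' * y))"
 by(simp_all add: lin_simps)
note h = this[THEN bemul_bind]
show ?thesis
 unfolding bemul_def[of G "u*~v" w] bemul_def[of G u "v*~w"] h by(simp add: mult.assoc)
qed

lemma bemul_one: "u : Be_car ==> be 1 1 *~ u = u" "u : Be_car ==> u *~ be 1 1 = u"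
by(simp_all add: bemul_be_left bemul_be_right be_self)

abbreviation "V == vsp Be_car fscale"

lemma lin_V: "u : Be_car ==> lin_on Hk (tnsU V Hk u)" "lin_on V (%u. tnsU V Hk u h)"
by(rule lin_tns_right, simp) (rule lin_tns_left, simp)

lemma tV_lin [simp]:
"u : Be_car ==> v : Be_car ==> tnsU V Hk (u + v) h = tnsU V Hk u h + tnsU V Hk v h"
"u : Be_car ==> tnsU V Hk (c*.u) h = c *. tnsU V Hk u h"
"u : Be_car ==> tnsU V Hk u (h + k) = tnsU V Hk u h + tnsU V Hk u k"
"u : Be_car ==> tnsU V Hk u (hs c h) = c *. tnsU V Hk u h"
by(simp_all add: tns_add_left tns_add_right tns_scl_left[where M=V, simplified] tns_scl_right[where N="Hk", simplified])

definition BBH_lin where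
"BBH_lin F == (ALL y h. lin_on Bk (%x. F x y h)) & (ALL x h. lin_on Bk (%y. F x y h)) & (ALL x y. lin_on Hk (F x y))"

lemma bal_V_Hk:
assumes "BBH_lin F"
shows "balU V Hk (%w h. w >> (x,y). F x y h)"
using assms by(intro bal_scalars)(auto simp: BBH_lin_def lin_simps lin_on_def[of V])

lemma BBH_lin_V: "BBH_lin (%x y h. tnsU V Hk (be x y) h)"
by(simp add: BBH_lin_def lin_simps)

lemma Gam_bind:
assumes u: "u : Gam" and F: "BBH_lin F"
shows "u >> (x,y). coact x >> (x0,x1). coact y >> (y0,y1). F x0 y0 (x1 * y1)
   = u >> (x,y). F x y 1"
proof -
have "balU Bk Bk (%x y. F x y h)" for h using F by(auto simp: BBH_lin_def bal_Bk_Bk)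
note b = be_bind[OF this]
have "(u >> (x,y). coact x >> (x0,x1). coact y >> (y0,y1).
   tnsU V Hk (be x0 y0) (x1 * y1)) >> (w,h). w >> (x,y). F x y h
  = tnsU V Hk u 1 >> (w,h). w >> (x,y). F x y h"
 using u by(simp add: Gam_def)
thus ?thesis by(simp add: bind_assoc2 tns_bind[OF bal_V_Hk[OF F]] b)
qed

lemma Gam_Be: "u : Gam ==> u : Be_car"
by(simp add: Gam_def)

lemma GamI:
assumes u: "u : Be_car"
 and F: "!!F :: 'b => 'b => 'h => ((('b, 'k) env) \<times> 'h =>0 'k). BBH_lin F ==>
  (u >> (x,y). coact x >> (x0,x1). coact y >> (y0,y1). F x0 y0 (x1 * y1))
   = u >> (x,y). F x y 1"
shows "u : Gam"
proof -
have "tnsU V Hk u 1 = tnsU V Hk (u >> (x,y). be x y) 1" by(simp add: be_self[OF u])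
also have "... = u >> (x,y). tnsU V Hk (be x y) 1"
 by(rule lin_on_bind_out2[OF _ _ lin_V(2)])(auto simp: kclosed_def)
finally show ?thesis using u F[OF BBH_lin_V] by(simp add: Gam_def)
qed

lemma subspace_Gam [simp]: "fv.subspace Gam"
proof -
have z: "tnsU V Hk 0 1 = 0" by(rule lin_on_zero[OF _ lin_V(2)])(simp add: kclosed_def)
show ?thesis by(auto simp: fv.subspace_def Gam_def bind_linear z)
qed

lemma Gam_closed [simp]: "0 : Gam" "u : Gam ==> v : Gam ==> u + v : Gam"
"u : Gam ==> v : Gam ==> u - v : Gam"
"u : Gam ==> c*.u : Gam"
using subspace_Gam fv.subspace_diff unfolding fv.subspace_def by blast+

lemma be_Gam [simp]: "a : A ==> a' : A ==> be a a' : Gam"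
proof(rule GamI)
fix F :: "'b => 'b => 'h => ((('b, 'k) env) \<times> 'h =>0 'k)"
assume a: "a : A" "a' : A" and F: "BBH_lin F"
note F' = F[unfolded BBH_lin_def lin_on_Bk lin_on_Hk]
have 1: "balU Bk Bk (%x y. coact x >> (x0,x1). coact y >> (y0,y1). F x0 y0 (x1 * y1))"
 "balU Bk Bk (%x y. F x y 1)" "!!x h. balU Bk Hk (%y k. F x y (h * k))"
 "balU Bk Hk (%x k. F x a' k)"
 by(simp_all add: lin_simps F')
show "be a a' >> (x,y). coact x >> (x0,x1). coact y >> (y0,y1). F x0 y0 (x1 * y1)
   = be a a' >> (x,y). F x y 1"
 by(simp add: be_bind[OF 1(1)] be_bind[OF 1(2)] coact_A[OF 1(3) a(2)] coact_A[OF 1(4) a(1)])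
qed simp

lemma bemul_Gam [simp]: "u : Gam ==> v : Gam ==> u*~v : Gam"
proof(rule GamI)
fix F :: "'b => 'b => 'h => ((('b, 'k) env) \<times> 'h =>0 'k)"
assume u: "u : Gam" and v: "v : Gam" and F: "BBH_lin F"
note F' = F[unfolded BBH_lin_def lin_on_Bk lin_on_Hk]
have "u*~v >> (x,y). coact x >> (x0,x1). coact y >> (y0,y1). F x0 y0 (x1 * y1)
 = u >> (x,y). v >> (x',y'). coact (x * x') >> (x0,x1). coact (y' * y) >> (y0,y1). F x0 y0 (x1 * y1)"
 by(rule bemul_bind)(simp add: lin_simps F')
also have "... = u >> (x,y). v >> (x',y'). coact x >> (x0,x1). coact x' >> (x0',x1').
   coact y' >> (y0',y1'). coact y >> (y0,y1). F (x0 * x0') (y0' * y0) (x1 * (x1' * y1') * y1)"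
 by(subst coact_mult_bind, simp add: lin_simps F', subst coact_mult_bind)
  (simp_all add: lin_simps F' mult.assoc)
also have "... = u >> (x,y). coact x >> (x0,x1). coact y >> (y0,y1). v >> (x',y'). coact x' >> (x0',x1').
   coact y' >> (y0',y1'). F (x0 * x0') (y0' * y0) (x1 * (x1' * y1') * y1)"
 by(rule bind_cong2, rule bind_pull, rule sym, rule trans[OF bind_commute2],
  rule bind_cong2, rule bind_pull, rule bind_commute2)
also have "... = u >> (x,y). coact x >> (x0,x1). coact y >> (y0,y1). v >> (x',y').
   F (x0 * x') (y' * y0) (x1 * 1 * y1)"
 by(subst Gam_bind[OF v])(simp_all add: BBH_lin_def lin_simps F')
also have "... = u >> (x,y). v >> (x',y'). F (x * x') (y' * y) 1"
 by(simp, rule Gam_bind[OF u])(simp add: BBH_lin_def lin_simps F')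
also have "... = u*~v >> (x,y). F x y 1"
 by(rule bemul_bind[symmetric])(simp add: lin_simps F')
finally show "u*~v >> (x,y). coact x >> (x0,x1). coact y >> (y0,y1). F x0 y0 (x1 * y1)
   = u*~v >> (x,y). F x y 1" .
qed simp

lemma BeA_simps [simp]: "car BeA = Be_car" "scl BeA = fscale" "lac BeA a u = be a 1 *~ u"
"rac BeA u a = be 1 a *~ u"
by(simp_all add: BeA_def)

lemma GamA_simps [simp]: "car GamA = Gam" "scl GamA = fscale" "lac GamA a u = be a 1 *~ u"
"rac GamA u a = be 1 a *~ u"
by(simp_all add: GamA_def)

lemma kclosed_BeA [simp]: "kclosed BeA" and kclosed_GamA [simp]: "kclosed GamA" and kclosed_V [simp]: "kclosed V"
by(simp_all add: kclosed_def)

lemma closed_A [simp]: "rclosed BeA A" "lclosed A BeA" "rclosed GamA A" "lclosed A GamA"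
by(auto simp: rclosed_def lclosed_def A_one)

lemma right_A_BeA: "right_A_module BeA" and right_A_GamA: "right_A_module GamA"
proof -
have 1: "be 1 (a * a') *~ u = be 1 a' *~ (be 1 a *~ u)" for a a' u
 by(simp add: bemul_assoc[symmetric])
show "right_A_module BeA" "right_A_module GamA"
 by(auto simp: rmod_def 1 A_one bemul_one Gam_Be)
qed

lemma amod_BeA: "amod BeA"
proof -
have "wgen BB" by(rule wgen_tensor[OF wgen_Bk wgen_Bk])
hence "wgen BeA"
 by(rule wgen_subspace)(auto simp: Be_car_def)
thus ?thesis using right_A_BeA by(simp add: amod_def)
qed

lemma amod_GamA: "amod GamA"
using wgen_subspace[of "BeA" "GamA"] amod_BeA right_A_GamA by(auto simp: amod_def Gam_Be subset_iff)

lemma bemul_lr: "be a 1 *~ (be 1 a' *~ u) = be 1 a' *~ (be a 1 *~ u)"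
by(simp add: bemul_assoc[symmetric])

lemma hom_A [simp]:
"rhom A BeA BeA (bemul (be a 1))" "lhom A BeA BeA (bemul (be 1 a))"
"a : A ==> rhom A GamA GamA (bemul (be a 1))" "a : A ==> lhom A GamA GamA (bemul (be 1 a))"
by(auto simp: rhom_def lhom_def klin_def bemul_lr A_one)

subsection \<open>The isomorphism \<open>\<Gamma> \<otimes>\<^sub>A B \<cong> B \<otimes> B\<close>\<close>

lemma transl_one: "transl 1 = tAB 1 1"
proof(rule galois_map_eqI)
show "galois_map (transl 1) = galois_map (tAB 1 1)"
 using coact_self[of 1] by(simp add: galois_map_transl galois_map_tns coact_one)
qed simp_all

lemma transl_absorb:
assumes F: "bal Breg A Breg F"
shows "transl h >> (l,r). F l (r * y)
   = coact y >> (y0,y1). transl (h * y1) >> (l,r). F (y0 * l) r"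
proof -
note F' = F[unfolded bal_Breg lin_on_Bk]
have "transl h >> (l,r). F l (r * y)
  = transl h >> (l,r). coact (r * y) >> (b0,b1). transl b1 >> (l',r'). F (l * b0 * l') r'"
 by(simp add: transl_inverse_right[OF F])
also have "... = transl h >> (l,r). coact r >> (r0,r1). coact y >> (y0,y1).
   transl (r1 * y1) >> (l',r'). F ((l * r0) * y0 * l') r'"
 by(subst coact_mult_bind)(simp_all add: lin_simps F' mult.assoc)
also have "... = coact y >> (y0,y1). transl (h * y1) >> (l',r'). F (1 * y0 * l') r'"
 by(rule transl_inverse_left)(simp add: lin_simps F')
finally show ?thesis by simp
qed

abbreviation "GB == extB GamA"
abbreviation "BeB == extB BeA"
abbreviation "teb x y b == tnsB BeA (be x y) b"
abbreviation "emb s == extmap BeA id s"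
abbreviation "tV == tnsU V Hk"

definition BBB_bal where
"BBB_bal K == (ALL y b. lin_on Bk (%x. K x y b)) & (ALL x. bal Breg A Breg (K x))"

lemma BBB_bal_simps: "BBB_bal K <-> (ALL y b. lin_on Bk (%x. K x y b)) & (ALL x b. lin_on Bk (%y. K x y b)) &
 (ALL x y. lin_on Bk (K x y)) & (ALL x y b. ALL a:A. K x (y * a) b = K x y (a * b))"
by(auto simp: BBB_bal_def bal_Breg)

lemma bemul_bind_left:
assumes "balU Bk Bk F"
shows "be a b *~ u >> (x,y). F x y = u >> (x,y). F (a * x) (y * b)"
by(simp add: bemul_be_left bind_assoc2 be_bind[OF assms])

lemma bal_BeA_Breg:
assumes "BBB_bal K"
shows "bal BeA A Breg (%u b. u >> (x,y). K x y b)"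
proof(rule balI)
note K = assms[unfolded BBB_bal_simps lin_on_Bk]
show "lin_on BeA (%u. u >> (x,y). K x y b)" for b
 by(rule lin_on_bind_left)(simp add: lin_on_def)
show "lin_on Breg (%b. u >> (x,y). K x y b)" for u
 by(rule lin_on_bind2)(simp add: lin_on_Breg K)
fix u a b assume a: "a : A"
show "rac BeA u a >> (x,y). K x y b = u >> (x,y). K x y (lac Breg a b)"
 using K a by(simp, subst bemul_bind_left)(simp_all add: lin_simps)
qed

lemma bal_GamA_left: "bal BeA A N F ==> bal GamA A N F"
by(auto simp: bal_def lin_on_def Gam_Be)

lemma bal_GamA_right: "bal M A BeA F ==> bal M A GamA F"
by(auto simp: bal_def lin_on_def Gam_Be)

lemma incl_hom [simp]: "rhom A GamA BeA id" "lhom A GamA BeA id"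
by(auto simp: rhom_def lhom_def klin_def Gam_Be)

lemma incl_bind: "bal BeA A Breg F ==> (emb s >> (u,b). F u b) = s >> (u,b). F u b"
by(simp add: tmap_def bind_assoc2 tns_bind)

lemma incl_inj:
assumes "s : car GB" "s' : car GB" "emb s = emb s'"
shows "s = s'"
proof -
have "emb (s - s') = 0" using assms(3) by(simp add: tmap_def bind_diff_left)
hence "s - s' = 0"
 using flat_inj[OF amod_GamA amod_BeA incl_hom(1) inj_on_id] kclosed_diff[OF kclosed_tensor assms(1,2)] by blast
thus ?thesis by simp
qed

lemma tns_BeA_lin [simp]:
"u : Be_car ==> v : Be_car ==> n : car N ==> tns BeA R N (u + v) n = tns BeA R N u n + tns BeA R N v n"
"u : Be_car ==> n : car N ==> tns BeA R N (c*.u) n = c *. tns BeA R N u n"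
by(simp_all add: tns_add_left tns_scl_left[where M="BeA", simplified])

lemma teb_lin [simp]:
"teb (x + x') y b = teb x y b + teb x' y b" "teb x (y + y') b = teb x y b + teb x y' b" "teb x y (b + b') = teb x y b + teb x y b'"
"teb (bs c x) y b = c *. teb x y b" "teb x (bs c y) b = c *. teb x y b" "teb x y (bs c b) = c *. teb x y b"
by(simp_all add: tns_add_left tns_add_right tns_scl_left[where M="BeA", simplified] tns_scl_right[where N="Breg", simplified])

lemma teb_A: "a : A ==> teb x (y * a) b = teb x y (a * b)"
using tns_bal[of "be x y" "BeA" a A b "Breg"] by simp

text \<open>The inverse of \<open>(x \<otimes> y) \<otimes> b \<mapsto> x \<otimes> y b\<close>, at first with values in \<open>B\<^sup>e \<otimes>\<^sub>A B\<close> only.\<close>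

definition theta' where
"theta' x y = coact x >> (x0,x1). transl x1 >> (l,r). teb x0 l (r * y)"

lemma theta'_in: "theta' x y : car BeB"
unfolding theta'_def by(intro tensor_bind_in tns_in) simp_all

lemma theta'_lin [simp]: "theta' (x + x') y = theta' x y + theta' x' y" "theta' x (y + y') = theta' x y + theta' x y'"
"theta' (bs c x) y = c *. theta' x y" "theta' x (bs c y) = c *. theta' x y"
by(simp_all add: theta'_def lin_simps)

lemma theta'_bind:
assumes "BBB_bal K"
shows "theta' x y >> (u,b). u >> (x',y'). K x' y' b
   = coact x >> (x0,x1). transl x1 >> (l,r). K x0 l (r * y)"
proof -
have "balU Bk Bk (%x y. K x y b)" for b
 using assms by(auto simp: BBB_bal_simps bal_Bk_Bk)
from be_bind[OF this] show ?thesis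
 by(simp add: theta'_def bind_assoc2 tns_bind[OF bal_BeA_Breg[OF assms]])
qed

text \<open>\<open>\<Gamma>\<close> is the kernel of \<open>coaction_defect\<close>, the codiagonal coaction minus the trivial one. With the following
right \<open>A\<close>-module structure on \<open>B\<^sup>e \<otimes> H\<close> the defect is a map of \<open>A\<close>-modules, and flatness applies to it.\<close>

definition QA :: "('k, 'b, ('b, 'k) env \<times> 'h =>0 'k, 'b) bimod" where
"QA = \<lparr>car = car (V ** Hk), scl = fscale, lac = (%_ t. t),
  rac = (%t a. tmapU V Hk (bemul (be 1 a)) id t)\<rparr>"

definition coaction_defect where
"coaction_defect u = (u >> (x,y). coact x >> (x0,x1). coact y >> (y0,y1). tV (be x0 y0) (x1 * y1))
  - tV u 1"

lemma QA_simps [simp]: "car QA = car (V ** Hk)" "scl QA = fscale"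
by(simp_all add: QA_def)

lemma kclosed_QA [simp]: "kclosed QA"
using kclosed_tensor[of V UNIV "Hk"] by(simp add: kclosed_def)

lemma bemul_hom_V: "rhom UNIV V V (bemul (be 1 a))"
by(auto simp: rhom_def klin_def)

lemma rac_QA_tns: "rac QA (tV u h) a = tV (be 1 a *~ u) h"
unfolding QA_def by(simp add: tmap_tns_hom[OF bemul_hom_V lhom_id(2), simplified])

lemma rac_QA_bind: "rac QA (t >> (x,y). f x y) a = t >> (x,y). rac QA (f x y) a"
by(simp add: QA_def tmap_def bind_assoc2)

lemma rac_QA_lin: "rac QA (t + u) a = rac QA t a + rac QA u a" "rac QA (t - u) a = rac QA t a - rac QA u a"
 "rac QA (c*.t) a = c *. rac QA t a"
by(simp_all add: QA_def tmap_def bind_linear bind_diff_left)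

lemma lin_rac_QA: "lin_on (V ** Hk) (%t. rac QA t a)"
by(simp add: lin_on_def rac_QA_lin)

lemma rac_QA_in: "t : car QA ==> rac QA t a : car QA"
using tmap_in[OF bemul_hom_V lhom_id(2), of t "Hk"] by(simp add: QA_def)

lemma amod_QA: "amod QA"
proof -
have V: "wgen V"
 by(rule wgen_subspace[OF wgen_tensor[OF wgen_Bk wgen_Bk], of UNIV])(simp_all add: Be_car_def[symmetric])
have "wgen QA"
 by(rule wgen_subspace[OF wgen_tensor[OF V wgen_Hk], of UNIV]) auto
moreover have "right_A_module QA"
 unfolding rmod_def
proof(intro conjI ballI allI)
 show "0 : car QA" by(rule kclosed_zero) simp
 show "x - y : car QA" if "x : car QA" "y : car QA" for x y using that by(rule kclosed_diff[OF kclosed_QA])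
 show "rac QA x a : car QA" if "x : car QA" for x a using that by(rule rac_QA_in)
 show "rac QA (x + y) a = rac QA x a + rac QA y a" for x y a by(simp add: rac_QA_lin)
next
 fix t a a' assume "t : car QA"
 hence t: "t : car (V ** Hk)" by simp
 show "rac QA t (a + a') = rac QA t a + rac QA t a'"
  by(rule tensor_lin_eqI[OF t lin_rac_QA lin_on_plus[OF lin_rac_QA lin_rac_QA]])(simp add: rac_QA_tns)
 show "rac QA t (a * a') = rac QA (rac QA t a) a'"
 proof(rule tensor_lin_eqI[OF t lin_rac_QA])
  show "lin_on (V ** Hk) (%t. rac QA (rac QA t a) a')" by(simp add: lin_on_def rac_QA_lin)
 qed (simp add: rac_QA_tns bemul_assoc[symmetric])
next
 fix t assume "t : car QA"
 hence t: "t : car (V ** Hk)" by simp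
 show "rac QA t 1 = t"
  by(rule tensor_lin_eqI[OF t lin_rac_QA, of "%t. t"])(simp_all add: rac_QA_tns lin_on_def bemul_one)
 show "scl QA c t = rac QA t (bs c 1)" for c
  by(rule tensor_lin_eqI[OF t _ lin_rac_QA])
   (simp_all add: rac_QA_tns lin_on_def bemul_one fscale_plus mult.commute)
qed
ultimately show ?thesis by(simp add: amod_def)
qed

lemma coaction_defect_hom: "rhom A BeA QA coaction_defect"
proof -
have "coaction_defect u : car QA" if "u : Be_car" for u
 unfolding coaction_defect_def using that
 by(intro kclosed_diff[OF kclosed_QA])(auto intro!: tensor_bind_in)
moreover have "coaction_defect (u + v) = coaction_defect u + coaction_defect v" if "u : Be_car" "v : Be_car" for u v
 using that by(simp add: coaction_defect_def bind_linear)
moreover have "coaction_defect (c*.u) = c *. coaction_defect u" if "u : Be_car" for c u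
 using that by(simp add: coaction_defect_def bind_linear fv.scale_right_diff_distrib)
moreover have "coaction_defect (be 1 a *~ u) = rac QA (coaction_defect u) a" if u: "u : Be_car" and a: "a : A" for u a
proof -
 have "be 1 a *~ u >> (x,y). coact x >> (x0,x1). coact y >> (y0,y1). tV (be x0 y0) (x1 * y1)
  = u >> (x,y). coact (1 * x) >> (x0,x1). coact (y * a) >> (y0,y1). tV (be x0 y0) (x1 * y1)"
  by(rule bemul_bind_left)(simp add: lin_simps)
 also have "... = u >> (x,y). coact x >> (x0,x1). coact y >> (y0,y1). tV (be x0 (y0 * a)) (x1 * y1)"
  by(subst coact_A_mult(2)[OF _ a])(simp_all add: lin_simps)
 also have "... = rac QA (u >> (x,y). coact x >> (x0,x1). coact y >> (y0,y1). tV (be x0 y0) (x1 * y1)) a"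
  by(simp add: rac_QA_bind rac_QA_tns)
 finally show ?thesis by(simp add: coaction_defect_def rac_QA_lin rac_QA_tns)
qed
ultimately show ?thesis by(auto simp: rhom_def klin_def)
qed

lemma Gam_kernel: "Gam = {u : Be_car. coaction_defect u = 0}"
by(auto simp: Gam_def coaction_defect_def)

text \<open>The coaction of \<open>H\<close> on \<open>l\<^sub>i(h)\<close> is given by the antipode (\<open>transl_coact_left\<close>), and this cancels
the coaction on \<open>x\<close>.\<close>

lemma theta'_kernel: "extmap QA coaction_defect (theta' x y) = 0"
proof -
define T where "T x y h b = tnsB QA (tV (be x y) h) b" for x y h b
have T_in: "tV (be x y) h : car QA" for x y h by simp
have T_lin: "T (x + x') y h b = T x y h b + T x' y h b" "T x (y + y') h b = T x y h b + T x y' h b"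
 "T x y (h + h') b = T x y h b + T x y h' b" "T x y h (b + b') = T x y h b + T x y h b'"
 "T (bs c x) y h b = c *. T x y h b" "T x (bs c y) h b = c *. T x y h b"
 "T x y (hs c h) b = c *. T x y h b" "T x y h (bs c b) = c *. T x y h b" for x x' y y' h h' b b' c
 using T_in by(simp_all add: T_def tns_add_left tns_add_right tns_scl_left[where M=QA, simplified]
   tns_scl_right[where N="Breg", simplified])
have T_A: "T x (y * a) h b = T x y h (a * b)" if "a : A" for x y a h b
 using tns_bal[of "tV (be x y) h" QA a A b "Breg"] that by(simp add: T_def rac_QA_tns)
have 1: "tnsB QA (coaction_defect (be p l)) b
  = (coact p >> (p0,p1). coact l >> (l0,l1). T p0 l0 (p1 * l1) b) - T p l 1 b" for p l b
proof -
 have lin: "lin_on QA (%t. tnsB QA t b)" by(rule lin_tns_left) simp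
 have "balU Bk Bk (%x y. coact x >> (x0,x1). coact y >> (y0,y1). tV (be x0 y0) (x1 * y1))"
  by(simp add: lin_simps)
 from be_bind[OF this]
 have "coaction_defect (be p l) = (coact p >> (p0,p1). coact l >> (l0,l1). tV (be p0 l0) (p1 * l1)) - tV (be p l) 1"
  by(simp add: coaction_defect_def)
 also have "tnsB QA ... b = tnsB QA (coact p >> (p0,p1). coact l >> (l0,l1). tV (be p0 l0) (p1 * l1)) b
   - T p l 1 b"
  unfolding T_def by(rule lin_on_diff[OF kclosed_QA lin])(auto intro!: tensor_bind_in)
 also have "tnsB QA (coact p >> (p0,p1). coact l >> (l0,l1). tV (be p0 l0) (p1 * l1)) b
   = coact p >> (p0,p1). coact l >> (l0,l1). T p0 l0 (p1 * l1) b"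
  unfolding T_def
  by(subst lin_on_bind_out2[OF kclosed_QA _ lin], simp, force intro!: tensor_bind_in,
    subst lin_on_bind_out2[OF kclosed_QA _ lin]) auto
 finally show ?thesis .
qed
have "extmap QA coaction_defect (theta' x y)
 = coact x >> (x0,x1). transl x1 >> (l,r). tnsB QA (coaction_defect (be x0 l)) (r * y)"
 unfolding theta'_def tmap_def bind_assoc2 tns_bind[OF bal_tns_comp[OF coaction_defect_hom lhom_id(2)]] by simp
also have "... = (coact x >> (x0,x1). transl x1 >> (l,r). coact x0 >> (p,q). coact l >> (l0,l1).
   T p l0 (q * l1) (r * y)) - (coact x >> (x0,x1). transl x1 >> (l,r). T x0 l 1 (r * y))"
 by(simp add: 1 bind_diff_right2)
also have "coact x >> (x0,x1). transl x1 >> (l,r). coact x0 >> (p,q). coact l >> (l0,l1).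
   T p l0 (q * l1) (r * y)
 = coact x >> (x0,x1). coact x0 >> (p,q). transl x1 >> (l,r). coact l >> (l0,l1).
   T p l0 (q * l1) (r * y)"
 by(rule bind_cong2, rule bind_commute2)
also have "... = coact x >> (x0,x1). coact x0 >> (p,q). comul x1 >> (h1,h2). transl h2 >> (l,r).
   T p l (q * antip h1) (r * y)"
 by(subst transl_coact_left)(simp_all add: lin_simps bal_Breg T_lin T_A mult.assoc)
also have "... = coact x >> (p,g). comul g >> (q,x1). comul x1 >> (h1,h2). transl h2 >> (l,r).
   T p l (q * antip h1) (r * y)"
 by(rule coact_coassoc)(simp add: lin_simps T_lin)
also have "... = coact x >> (p,g). comul g >> (d,h2). comul d >> (q,h1). transl h2 >> (l,r).
   T p l (q * antip h1) (r * y)"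
 by(subst comul_coassoc)(simp_all add: lin_simps T_lin)
also have "... = coact x >> (p,g). comul g >> (d,h2). counit d *. (transl h2 >> (l,r).
   T p l 1 (r * y))"
 by(subst comul_antip_right[where f = "%z. transl _ >> (l,r). T _ l z (r * y)"])(simp_all add: lin_simps T_lin)
also have "... = coact x >> (p,g). transl g >> (l,r). T p l 1 (r * y)"
 by(subst comul_counit_left)(simp_all add: lin_simps T_lin)
finally show ?thesis unfolding diff_self .
qed

text \<open>By flatness \<open>\<Gamma> \<otimes>\<^sub>A B\<close> is a submodule of \<open>B\<^sup>e \<otimes>\<^sub>A B\<close>, so there is only one choice.\<close>

definition theta where
"theta x y = (SOME s. s : car GB & emb s = theta' x y)"

lemma theta_in [simp]: "theta x y : car GB" and incl_theta: "emb (theta x y) = theta' x y"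
proof -
have "EX s:car GB. emb s = theta' x y"
 by(rule flat_kernel[OF amod_GamA amod_BeA amod_QA coaction_defect_hom incl_hom(1) _ theta'_in theta'_kernel])
  (simp add: Gam_kernel)
hence "EX s. s : car GB & emb s = theta' x y" by blast
from someI_ex[OF this] show "theta x y : car GB" "emb (theta x y) = theta' x y"
 unfolding theta_def by blast+
qed

lemma theta_keys: "(u, c) : keys (theta x y) ==> u : Gam"
using tensor_keysD(1)[OF _ theta_in closed_A(3) closed_k(6)] by simp

lemma incl_bind2: "emb (t >> (x,y). f x y) = t >> (x,y). emb (f x y)"
and incl_lin: "emb (s + s') = emb s + emb s'" "emb (c*.s) = c *. (emb s)"
by(simp_all add: tmap_def bind_assoc2 bind_linear)

lemma theta_lin [simp]: "theta (x + x') y = theta x y + theta x' y" "theta x (y + y') = theta x y + theta x y'"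
"theta (bs c x) y = c *. theta x y" "theta x (bs c y) = c *. theta x y"
by(rule incl_inj; simp add: incl_lin incl_theta subspace_tensor fv.subspace_add fv.subspace_scale)+

lemma theta_bind:
assumes "BBB_bal K"
shows "theta x y >> (u,b). u >> (x',y'). K x' y' b
   = coact x >> (x0,x1). transl x1 >> (l,r). K x0 l (r * y)"
using incl_bind[OF bal_BeA_Breg[OF assms], of "theta x y"] by(simp add: incl_theta theta'_bind[OF assms])

lemma theta_bind_mult:
assumes "balU Bk Bk K"
shows "theta x y >> (u,b). u >> (x',y'). K x' (y' * b) = K x y"
proof -
note K = assms[unfolded lin_simps, unfolded lin_simps]
have "theta x y >> (u,b). u >> (x',y'). K x' (y' * b)
  = coact x >> (x0,x1). transl x1 >> (l,r). K x0 (l * (r * y))"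
 by(rule theta_bind)(simp add: BBB_bal_simps lin_simps K mult.assoc)
also have "... = coact x >> (x0,x1). transl x1 >> (l,r). K x0 (l * r * y)"
 by(simp add: mult.assoc)
also have "... = coact x >> (x0,x1). counit x1 *. K x0 (1 * y)"
 by(subst transl_mult[where f = "%z. K _ (z * y)"])(simp_all add: lin_simps K)
also have "... = K x y"
 by(subst coact_counit)(simp_all add: lin_simps K)
finally show ?thesis .
qed

lemma tns_be_left: "u : Be_car ==> n : car N ==> (u >> (x,y). tns BeA R N (be x y) n) = tns BeA R N u n"
using lin_on_bind_out2[OF kclosed_BeA _ lin_tns_left, of n N u "be" R] by(simp add: be_self)

lemma theta_inverse:
assumes u: "u : Gam"
shows "u >> (x,y). theta x (y * b) = tnsB GamA u b"
proof(rule incl_inj)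
show "(u >> (x,y). theta x (y * b)) : car GB" by(rule tensor_bind_in) simp
show "tnsB GamA u b : car GB" using u by simp
have "emb (u >> (x,y). theta x (y * b)) = u >> (x,y). coact x >> (x0,x1). transl x1 >> (l,r).
   teb x0 l (r * y * b)"
 by(simp add: incl_bind2 incl_theta theta'_def mult.assoc)
also have "... = u >> (x,y). coact x >> (x0,x1). coact y >> (y0,y1). transl (x1 * y1) >> (l,r).
   teb x0 (y0 * l) (r * b)"
 by(subst transl_absorb[where F = "%l r. teb _ l (r * b)"])
  (simp_all add: bal_Breg lin_simps teb_A mult.assoc)
also have "... = u >> (x,y). transl 1 >> (l,r). teb x (y * l) (r * b)"
 by(rule Gam_bind[OF u])(simp add: BBH_lin_def lin_simps)
also have "... = u >> (x,y). teb x (y * 1) (1 * b)"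
 unfolding transl_one by(subst tns_bind)(simp_all add: bal_Breg lin_simps teb_A mult.assoc[symmetric])
also have "... = tnsB BeA u b"
 using tns_be_left[OF Gam_Be[OF u], of b "Breg"] by simp
also have "... = emb (tnsB GamA u b)"
 unfolding tmap_tns_hom[OF incl_hom(1) lhom_id(2)] by simp
finally show "emb (u >> (x,y). theta x (y * b)) = emb (tnsB GamA u b)" .
qed

lemma theta_inverse_bind:
assumes u: "u : Gam" and F: "bal GamA A Breg F"
shows "u >> (x,y). theta x (y * b) >> (w,c). F w c = F u b"
using arg_cong[OF theta_inverse[OF u, of b], of "%t. t >> (w,c). F w c"]
by(simp add: bind_assoc2 tns_bind[OF F])

lemma lac_bind2: "lac (tensor M R N) a (t >> (x,y). f x y) = t >> (x,y). lac (tensor M R N) a (f x y)"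
by(simp add: lac_tensor bind_assoc2)

lemma theta_A: "a : A ==> theta (a * x) y = lac GB a (theta x y)"
proof(rule incl_inj)
assume a: "a : A"
have lG: "rhom A GamA GamA (lac GamA a)" and lB: "rhom A BeA BeA (lac BeA a)"
 using a by(auto simp: rhom_def klin_def bemul_lr A_one)
show "lac GB a (theta x y) : car GB" by(rule lac_in[OF lG]) simp
have c: "emb (lac GB a s) = lac BeB a (emb s)" if s: "s : car GB" for s
proof(rule tensor_lin_eqI[OF s])
 show "lin_on GB (%s. emb (lac GB a s))" "lin_on GB (%s. lac BeB a (emb s))"
  by(simp_all add: lin_on_def tmap_def lac_tensor bind_linear)
 show "emb (lac GB a (tnsB GamA m n)) = lac BeB a (emb (tnsB GamA m n))" for m n
  unfolding lac_tns[OF lG] tmap_tns_hom[OF incl_hom(1) lhom_id(2)] lac_tns[OF lB] id_apply by simp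
qed
have "emb (theta (a * x) y) = coact x >> (x0,x1). transl x1 >> (l,r). teb (a * x0) l (r * y)"
 unfolding incl_theta theta'_def by(rule coact_A_mult(1)[OF _ a])(simp add: lin_simps)
also have "... = lac BeB a (theta' x y)"
 unfolding theta'_def lac_bind2 lac_tns[OF lB] by simp
finally show "emb (theta (a * x) y) = emb (lac GB a (theta x y))" by(simp add: c incl_theta)
qed simp

lemma theta_A_bind:
assumes "a : A" "bal GamA A Breg F"
shows "theta (a * x) y >> (w,c). F w c = theta x y >> (w,c). F (be a 1 *~ w) c"
by(simp add: theta_A[OF assms(1)] lac_tensor bind_assoc2 tns_bind[OF assms(2)])

subsection \<open>The comultiplication of \<open>\<Gamma>\<close>\<close>

abbreviation "GG == tensor GamA A GamA"
abbreviation "EE == tensor BeA A BeA"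
abbreviation "tGG == tns GamA A GamA"
abbreviation "tEE == tns BeA A BeA"

definition BBB_lin where
"BBB_lin F == (ALL y b. lin_on Bk (%x. F x y b)) & (ALL x b. lin_on Bk (%y. F x y b)) & (ALL x y. lin_on Bk (F x y))"

text \<open>For \<open>F x z y = x \<otimes> z \<otimes> y\<close> this is the map \<open>\<Gamma> \<otimes>\<^sub>A \<Gamma> \<rightarrow> B \<otimes> B \<otimes> B\<close> that multiplies the inner factors.\<close>

definition mid where
"mid F u v = u >> (x,y). v >> (x',y'). F x (y * x') y'"

definition BBBB_bal where
"BBBB_bal K == (ALL y x' y'. lin_on Bk (%x. K x y x' y')) & (ALL x y'. bal Breg A Breg (%y x'. K x y x' y')) &
  (ALL x y x'. lin_on Bk (K x y x'))"

lemma bal_BeA_BeA: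
assumes "BBBB_bal K"
shows "bal BeA A BeA (%u v. u >> (x,y). v >> (x',y'). K x y x' y')"
proof(rule balI)
note K = assms[unfolded BBBB_bal_def bal_Breg lin_on_Bk]
show "lin_on BeA (%u. u >> (x,y). v >> (x',y'). K x y x' y')" for v
 by(rule lin_on_bind_left)(simp add: lin_on_def)
show "lin_on BeA (%v. u >> (x,y). v >> (x',y'). K x y x' y')" for u
 by(intro lin_on_bind2 lin_on_bind_left)(simp add: lin_on_def)
fix u a v assume a: "a : A"
have "be 1 a *~ u >> (x,y). v >> (x',y'). K x y x' y'
  = u >> (x,y). v >> (x',y'). K (1 * x) (y * a) x' y'"
 by(rule bemul_bind_left)(simp add: lin_simps K)
also have "... = u >> (x,y). v >> (x',y'). K x y (a * x') (y' * 1)"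
 using K a by simp
also have "... = u >> (x,y). be a 1 *~ v >> (x',y'). K x y x' y'"
 by(subst bemul_bind_left)(simp_all add: lin_simps K)
finally show "rac BeA u a >> (x,y). v >> (x',y'). K x y x' y'
  = u >> (x,y). lac BeA a v >> (x',y'). K x y x' y'" by simp
qed

lemma BBBB_mid: "BBB_lin F ==> BBBB_bal (%x y x' y'. F x (y * x') y')"
by(simp add: BBB_lin_def BBBB_bal_def lin_simps bal_Breg mult.assoc)

lemma bal_mid: "BBB_lin F ==> bal BeA A BeA (mid F)"
using bal_BeA_BeA[OF BBBB_mid, of F] by(simp add: mid_def[abs_def])

lemma bal_mid': "BBB_lin F ==> balG (mid F)"
by(intro bal_GamA_left bal_GamA_right bal_mid)

abbreviation "tri x y z == tnsU Bk BB x (be y z)"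

lemma tns_Bk_Be_lin [simp]:
"u : Be_car ==> v : Be_car ==> tnsU Bk BB x (u + v) = tnsU Bk BB x u + tnsU Bk BB x v"
"u : Be_car ==> tnsU Bk BB x (c*.u) = c *. tnsU Bk BB x u"
"u : Be_car ==> tnsU Bk BB (x + y) u = tnsU Bk BB x u + tnsU Bk BB y u"
"u : Be_car ==> tnsU Bk BB (bs c x) u = c *. tnsU Bk BB x u"
unfolding Be_car_def
by(simp_all add: tns_add_left tns_add_right tns_scl_left[where M="Bk", simplified] tns_scl_right[where N=BB, simplified])

lemma BBB_lin_tri: "BBB_lin (%x y z. tri x y z)"
by(simp add: BBB_lin_def lin_simps)

lemma tri_bind:
assumes "BBB_lin F"
shows "tri x y z >> (a,t). t >> (b,c). F a b c = F x y z"
proof -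
have F: "tribal Bk UNIV Bk UNIV Bk F"
 using assms by(auto simp: tribal_def BBB_lin_def bal_Bk_Bk)
have 1: "balU Bk Bk (F x)" using assms by(auto simp: BBB_lin_def bal_Bk_Bk)
show ?thesis using be_bind[OF 1] by(simp add: tns_bind[OF bal_tensor_right[OF F closed_k(3,4)]])
qed

lemma wgen_GamA: "wgen GamA" and wgen_BeA: "wgen BeA"
using amod_GamA amod_BeA by(auto simp: amod_def)

lemma amod_GG: "amod GG"
by(rule amod_tensor[OF wgen_GamA wgen_GamA right_A_GamA])(auto simp: rhom_def lhom_def klin_def bemul_lr A_one)

lemma amod_EE: "amod EE"
by(rule amod_tensor[OF wgen_BeA wgen_BeA right_A_BeA])(auto simp: rhom_def lhom_def klin_def bemul_lr A_one)

lemma GamA_rac_hom: "a : A ==> lhom A GamA GamA (%n. rac GamA n a)"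
and GamA_lac_hom: "a : A ==> rhom A GamA GamA (lac GamA a)"
by(auto simp: rhom_def lhom_def klin_def bemul_lr A_one)

lemma BeA_rac_hom: "lhom A BeA BeA (%n. rac BeA n a)"
and BeA_lac_hom: "rhom A BeA BeA (lac BeA a)"
by(auto simp: rhom_def lhom_def klin_def bemul_lr A_one)

lemma tribal_GGB: "tribal GamA A GamA A Breg (%m n q. tnsB GG (tGG m n) q)"
by(rule tribal_tns') (rule GamA_rac_hom)

lemma bal_theta_step:
assumes F: "tribal GamA A GamA A Breg F"
shows "bal GamA A Breg (%u c. theta c y >> (u',c'). F u u' c')"
proof(rule balI)
fix c
show "lin_on GamA (%u. theta c y >> (u',c'). F u u' c')"
 using F by(intro lin_on_bind2)(auto simp: tribal_def bal_def dest: theta_keys)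
next
fix u
show "lin_on Breg (%c. theta c y >> (u',c'). F u u' c')"
 by(intro lin_on_bind_left)(simp add: lin_on_Breg)
next
fix u a c assume u: "u : car GamA" and a: "a : A"
have "bal GamA A Breg (F u)" using F u by(simp add: tribal_def)
hence "theta (a * c) y >> (u',c'). F u u' c' = theta c y >> (u',c'). F u (be a 1 *~ u') c'"
 by(rule theta_A_bind[OF a])
also have "... = theta c y >> (u',c'). F (rac GamA u a) u' c'"
 using F u a by(intro bind_cong2)(auto simp: tribal_def bal_def dest: theta_keys)
finally show "theta c y >> (u',c'). F (rac GamA u a) u' c' = theta (lac Breg a c) y >> (u',c'). F u u' c'"
 by simp
qed

lemma theta_twice:
assumes F: "tribal GamA A GamA A Breg F" and u: "u : Gam" "v : Gam"
shows "u >> (x,y). v >> (x',y'). theta x (y * x') >> (w,c). theta c (y' * b) >> (w',c'). F w w' c' = F u v b"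
proof -
have "u >> (x,y). v >> (x',y'). theta x (y * x') >> (w,c). theta c (y' * b) >> (w',c'). F w w' c'
 = v >> (x',y'). u >> (x,y). theta x (y * x') >> (w,c). theta c (y' * b) >> (w',c'). F w w' c'"
 by(rule bind_commute2)
also have "... = v >> (x',y'). theta x' (y' * b) >> (w',c'). F u w' c'"
 by(simp add: theta_inverse_bind[OF u(1) bal_theta_step[OF F]])
also have "... = F u v b"
 using F u by(intro theta_inverse_bind)(auto simp: tribal_def)
finally show ?thesis .
qed

lemma GG_keys: "(u, v) : keys t ==> t : car GG ==> u : Gam & v : Gam"
using tensor_keysD[of u v t "GamA" A "GamA"] by simp

text \<open>After tensoring with \<open>B\<close> over \<open>A\<close> the map to \<open>B \<otimes> B \<otimes> B\<close> has a left inverse: apply \<open>theta\<close> twice.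
By faithfulness it was injective before.\<close>

lemma GG_zero:
assumes t: "t : car GG" and 0: "t >> (u,v). mid (%x y z. tri x y z) u v = 0"
shows "t = 0"
proof(rule faithful[OF amod_GG t])
let ?T = "%m n q. tnsB GG (tGG m n) q"
define psi where "psi x y z = theta x y >> (w,c). theta c z >> (w',c'). ?T w w' c'" for x y z
have psi: "BBB_lin psi"
 by(simp add: BBB_lin_def psi_def lin_simps)
have "tnsB GG t 1 = tnsB GG (t >> (u,v). tGG u v) 1"
 by(simp add: tensor_self[OF t])
also have "... = t >> (u,v). ?T u v 1"
 by(rule lin_on_bind_out2[OF _ _ lin_tns_left])(auto dest: GG_keys[OF _ t])
also have "... = t >> (u,v). u >> (x,y). v >> (x',y'). psi x (y * x') (y' * 1)"
 unfolding psi_def by(intro bind_cong2 theta_twice[OF tribal_GGB, symmetric])(auto dest: GG_keys[OF _ t])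
also have "... = (t >> (u,v). mid (%x y z. tri x y z) u v) >> (a,t). t >> (b,c). psi a b c"
 by(simp add: mid_def bind_assoc2 tri_bind[OF psi])
finally show "tnsB GG t 1 = 0" by(simp add: 0 bind_zero_left)
qed

lemma GG_eqI:
assumes t: "t : car GG" "t' : car GG"
 and eq: "t >> (u,v). mid (%x y z. tri x y z) u v = t' >> (u,v). mid (%x y z. tri x y z) u v"
shows "t = t'"
using GG_zero[OF kclosed_diff[OF kclosed_tensor t]] eq by(simp add: bind_diff_left)

abbreviation "emb2 t == tmap BeA A BeA id id t"

lemma incl2_bind: "bal BeA A BeA F ==> (emb2 s >> (u,b). F u b) = s >> (u,b). F u b"
by(simp add: tmap_def bind_assoc2 tns_bind)

lemma incl2_inj: "t : car GG ==> t' : car GG ==> emb2 t = emb2 t' ==> t = t'"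
using incl2_bind[OF bal_mid[OF BBB_lin_tri], of t] incl2_bind[OF bal_mid[OF BBB_lin_tri], of t'] by(auto intro: GG_eqI)

definition comul_form where
"comul_form u = u >> (x,y). coact x >> (x0,x1). transl x1 >> (l,r). tEE (be x0 l) (be r y)"

lemma tns_BeA_right_lin [simp]:
"m : car M ==> u : Be_car ==> v : Be_car ==> tns M R BeA m (u + v) = tns M R BeA m u + tns M R BeA m v"
"m : car M ==> u : Be_car ==> tns M R BeA m (c*.u) = c *. tns M R BeA m u"
by(simp_all add: tns_add_right tns_scl_right[where N="BeA", simplified])

lemma incl2_tns: "emb2 (tGG u v) = tEE u v"
unfolding tmap_tns_hom[OF incl_hom(1,2)] by simp

lemma tns_EE_lin [simp]:
"u : car EE ==> v : car EE ==> tnsB EE (u + v) b = tnsB EE u b + tnsB EE v b"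
"u : car EE ==> tnsB EE (c*.u) b = c *. tnsB EE u b"
"u : car EE ==> tnsB EE u (b + b') = tnsB EE u b + tnsB EE u b'"
"u : car EE ==> tnsB EE u (bs c b) = c *. tnsB EE u b"
by(simp_all add: tns_add_left tns_add_right tns_scl_left[where M=EE, simplified] tns_scl_right[where N="Breg", simplified])

lemma tribal_EEB: "tribal BeA A BeA A Breg (%m n q. tnsB EE (tEE m n) q)"
by(rule tribal_tns') (rule BeA_rac_hom)

text \<open>By faithfulness it suffices that \<open>comul_form u \<otimes> 1\<close> lies in the image of \<open>\<Gamma> \<otimes>\<^sub>A \<Gamma> \<otimes>\<^sub>A B\<close>. It is the
image of the element that arises from \<open>u\<close> by applying \<open>theta\<close> twice.\<close>

lemma comul_form_in_image:
assumes u: "u : Gam"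
shows "comul_form u : emb2 ` car GG"
proof -
let ?S = "emb2 ` car GG"
define v where "v = u >> (x,y). theta x 1 >> (w,c). theta c y >> (w',c'). ins (tEE w w', c')"
define T where "T x y x' y' b = tnsB EE (tEE (be x y) (be x' y')) b" for x y x' y' b
have T_lin: "T (x + x2) y x' y' b = T x y x' y' b + T x2 y x' y' b"
 "T x (y + y2) x' y' b = T x y x' y' b + T x y2 x' y' b"
 "T x y (x' + x2) y' b = T x y x' y' b + T x y x2 y' b"
 "T x y x' (y' + y2) b = T x y x' y' b + T x y x' y2 b"
 "T x y x' y' (b + b2) = T x y x' y' b + T x y x' y' b2"
 "T (bs c x) y x' y' b = c *. T x y x' y' b"
 "T x (bs c y) x' y' b = c *. T x y x' y' b"
 "T x y (bs c x') y' b = c *. T x y x' y' b"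
 "T x y x' (bs c y') b = c *. T x y x' y' b"
 "T x y x' y' (bs c b) = c *. T x y x' y' b" for x y x' y' b x2 y2 b2 c
 by(simp_all add: T_def)
have T_A: "T x (y * a) x' y' b = T x y (a * x') y' b" "T x y x' (y' * a) b = T x y x' y' (a * b)" if "a : A" for x y x' y' b a
proof -
 show "T x (y * a) x' y' b = T x y (a * x') y' b"
  using tns_bal[of "be x y" "BeA" a A "be x' y'" "BeA"] that by(simp add: T_def)
 have "bal BeA A Breg (%n q. tnsB EE (tEE (be x y) n) q)"
  using tribal_EEB by(simp add: tribal_def)
 from bal_eq[OF this, of "be x' y'" a b] that
 show "T x y x' (y' * a) b = T x y x' y' (a * b)" by(simp add: T_def)
qed
have T1: "tnsB EE (tEE w w') b = w >> (x,y). w' >> (x',y'). T x y x' y' b" if "w : Be_car" "w' : Be_car" for w w' b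
proof -
 have l1: "lin_on BeA (%m. tnsB EE (tEE m w') b)" "!!m. m : Be_car ==> lin_on BeA (%n. tnsB EE (tEE m n) b)"
  using tribal_EEB that by(auto simp: tribal_def bal_def)
 have "tnsB EE (tEE w w') b = tnsB EE (tEE (w >> (x,y). be x y) w') b"
  by(simp add: be_self that)
 also have "... = w >> (x,y). tnsB EE (tEE (be x y) w') b"
  by(rule lin_on_bind_out2[OF _ _ l1(1)]) auto
 also have "... = w >> (x,y). tnsB EE (tEE (be x y) (w' >> (x',y'). be x' y')) b"
  by(simp add: be_self that)
 also have "... = w >> (x,y). w' >> (x',y'). T x y x' y' b"
  unfolding T_def by(intro bind_cong2 lin_on_bind_out2[OF _ _ l1(2)]) auto
 finally show ?thesis .
qed
have step1: "theta c y >> (w',c'). w' >> (x',y'). T p q x' y' c'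
  = coact c >> (c0,c1). transl c1 >> (l,r). T p q c0 l (r * y)" for c y p q
 by(rule theta_bind)(simp add: BBB_bal_simps lin_simps T_lin T_A)
have step2: "theta x 1 >> (w,c). w >> (p,q). coact c >> (c0,c1). transl c1 >> (l,r). T p q c0 l (r * y)
  = coact x >> (x0,x1). transl x1 >> (l,r). coact r >> (c0,c1). transl c1 >> (l',r'). T x0 l c0 l' (r' * y)" for x y
proof -
 have "coact (a * c) >> (c0,c1). transl c1 >> (l,r). T p q c0 l (r * y)
   = coact c >> (c0,c1). transl c1 >> (l,r). T p q (a * c0) l (r * y)" if "a : A" for a c p q
  by(rule coact_A_mult(1)[OF _ that])(simp add: lin_simps T_lin)
 hence "BBB_bal (%p q c. coact c >> (c0,c1). transl c1 >> (l,r). T p q c0 l (r * y))"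
  by(simp add: BBB_bal_simps T_A(1))(simp add: lin_simps T_lin)
 from theta_bind[OF this, of x 1] show ?thesis by simp
qed
have "tnsB EE (comul_form u) 1
  = u >> (x,y). coact x >> (x0,x1). transl x1 >> (l,r). T x0 l r y 1"
proof -
 have l: "lin_on EE (%t. tnsB EE t 1)" by(rule lin_tns_left) simp
 show ?thesis unfolding comul_form_def T_def
  by(subst lin_on_bind_out2[OF _ _ l], simp, simp, force intro!: tensor_bind_in,
    subst lin_on_bind_out2[OF _ _ l], simp, simp, force intro!: tensor_bind_in,
    subst lin_on_bind_out2[OF _ _ l]) auto
qed
also have "... = u >> (x,y). coact x >> (x0,x1). transl x1 >> (l,r).
   transl 1 >> (l',r'). T x0 l r (y * l') r'"
 unfolding transl_one by(subst tns_bind)(simp_all add: bal_Breg lin_simps T_lin T_A mult.assoc[symmetric])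
also have "... = u >> (x,y). coact x >> (x0,x1). coact y >> (y0,y1).
   coact x0 >> (p,q). transl q >> (l,r). transl (x1 * y1) >> (l',r'). T p l r (y0 * l') r'"
 by(rule Gam_bind[OF u, symmetric])(simp add: BBH_lin_def lin_simps T_lin)
also have "... = u >> (x,y). coact x >> (x0,x1).
   coact x0 >> (p,q). transl q >> (l,r). coact y >> (y0,y1). transl (x1 * y1) >> (l',r'). T p l r (y0 * l') r'"
 by(rule bind_cong2, rule bind_cong2, rule bind_pull, rule bind_commute2)
also have "... = u >> (x,y). coact x >> (x0,x1).
   coact x0 >> (p,q). transl q >> (l,r). transl x1 >> (l',r'). T p l r l' (r' * y)"
 by(subst transl_absorb)(simp_all add: bal_Breg lin_simps T_lin T_A)
also have "... = u >> (x,y). coact x >> (x0,x1).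
   comul x1 >> (h1,h2). transl h1 >> (l,r). transl h2 >> (l',r'). T x0 l r l' (r' * y)"
 by(subst coact_coassoc)(simp_all add: lin_simps T_lin)
also have "... = u >> (x,y). coact x >> (x0,x1). transl x1 >> (l,r).
   coact r >> (c0,c1). transl c1 >> (l',r'). T x0 l c0 l' (r' * y)"
 by(subst transl_coact_right)(simp_all add: bal_Breg lin_simps T_lin T_A)
also have "... = u >> (x,y). theta x 1 >> (w,c). w >> (p,q). theta c y >> (w',c'). w' >> (x',y'). T p q x' y' c'"
 by(simp add: step1 step2)
also have "... = u >> (x,y). theta x 1 >> (w,c). theta c y >> (w',c'). w >> (p,q). w' >> (x',y'). T p q x' y' c'"
 by(rule bind_cong2, rule bind_cong2, rule bind_commute2)
also have "... = u >> (x,y). theta x 1 >> (w,c). theta c y >> (w',c'). tnsB EE (tEE w w') c'"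
 by(intro bind_cong2 T1[symmetric])(auto dest!: theta_keys Gam_Be)
also have "... = v >> (x,b). tnsB EE x b"
 by(simp add: v_def bind_assoc2)
finally have eq: "tnsB EE (comul_form u) 1 = v >> (x,b). tnsB EE x b" .
have TS: "tEE w w' : ?S" if "w : Gam" "w' : Gam" for w w'
 using that by(intro image_eqI[of _ _ "tGG w w'"])(simp_all add: incl2_tns)
hence keys: "keys v <= ?S \<times> UNIV"
 unfolding v_def by(auto dest!: subsetD[OF keys_bind] intro!: TS simp del: image_iff dest: theta_keys)
have S: "fv.subspace ?S"
 using subspace_tensor[of "GamA" A "GamA"]
 by(auto simp: fv.subspace_def tmap_def bind_add_left[symmetric] bind_scale_left[symmetric])
  (auto simp: bind_zero_left intro!: image_eqI[of _ _ 0])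
have SE: "?S <= car EE" by(auto intro!: tmap_in)
have Sr: "rac EE x a : ?S" if x: "x : ?S" and a: "a : A" for x a
proof -
 obtain t where t: "t : car GG" "x = emb2 t" using x by auto
 have "rac EE (emb2 t) a = emb2 (rac GG t a)"
 proof(rule tensor_lin_eqI[OF t(1)])
  show "lin_on GG (%t. rac EE (emb2 t) a)" "lin_on GG (%t. emb2 (rac GG t a))"
   by(simp_all add: lin_on_def tmap_def rac_tensor bind_linear)
  show "rac EE (emb2 (tGG m n)) a = emb2 (rac GG (tGG m n) a)" for m n
   unfolding incl2_tns rac_tns[OF BeA_rac_hom] rac_tns[OF GamA_rac_hom[OF a]] by simp
 qed
 thus ?thesis using t rac_in[OF GamA_rac_hom[OF a] t(1)] by auto
qed
have "comul_form u : car EE"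
 unfolding comul_form_def by(intro tensor_bind_in) simp
from faithful_submodule[OF amod_EE S SE Sr this keys eq] show ?thesis .
qed

lemma Gcomul: assumes u: "u : Gam" shows Gcomul_in [simp]: "Gcomul u : car GG" and incl2_Gcomul: "emb2 (Gcomul u) = comul_form u"
proof -
obtain t where t: "t : car GG" "comul_form u = emb2 t" using comul_form_in_image[OF u] by auto
have "EX! t. t : car GG & emb2 t = comul_form u"
 by(rule ex1I[of _ t])(use t in "auto intro: incl2_inj")
from theI'[OF this] show "Gcomul u : car GG" "emb2 (Gcomul u) = comul_form u"
 unfolding Gcomul_def comul_form_def by blast+
qed

lemma Gcomul_keys: "(v, w) : keys (Gcomul u) ==> u : Gam ==> v : Gam"
"(v, w) : keys (Gcomul u) ==> u : Gam ==> w : Gam"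
using GG_keys[OF _ Gcomul_in] by auto

lemma Gcomul_bind:
assumes u: "u : Gam" and K: "BBBB_bal K"
shows "Gcomul u >> (v,w). v >> (x,y). w >> (x',y'). K x y x' y'
   = u >> (x,y). coact x >> (x0,x1). transl x1 >> (l,r). K x0 l r y"
proof -
note K' = K[unfolded BBBB_bal_def bal_Breg]
have b: "balU Bk Bk (%x y. w >> (x',y'). K x y x' y')" "!!x y. balU Bk Bk (%x' y'. K x y x' y')"
 "!!x' y'. balU Bk Bk (%x y. K x y x' y')" for w
 using K' by(simp_all add: bal_Bk_Bk lin_on_bind2)
have "Gcomul u >> (v,w). v >> (x,y). w >> (x',y'). K x y x' y'
  = comul_form u >> (v,w). v >> (x,y). w >> (x',y'). K x y x' y'"
 unfolding incl2_Gcomul[OF u, symmetric] by(rule incl2_bind[OF bal_BeA_BeA[OF K], symmetric])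
thus ?thesis
 by(simp add: comul_form_def bind_assoc2 tns_bind[OF bal_BeA_BeA[OF K]] be_bind[OF b(2)] be_bind[OF b(3)])
qed

text \<open>The inner factors multiply to \<open>l\<^sub>i(h) r\<^sub>i(h) = \<epsilon>(h)\<close>.\<close>

lemma Gcomul_mid:
assumes u: "u : Gam" and F: "BBB_lin F"
shows "Gcomul u >> (v,w). mid F v w = u >> (x,y). F x 1 y"
proof -
note F' = F[unfolded BBB_lin_def lin_on_Bk]
have "Gcomul u >> (v,w). mid F v w = u >> (x,y). coact x >> (x0,x1). transl x1 >> (l,r). F x0 (l * r) y"
 unfolding mid_def by(rule Gcomul_bind[OF u BBBB_mid[OF F]])
also have "... = u >> (x,y). coact x >> (x0,x1). counit x1 *. F x0 1 y"
 by(subst transl_mult)(simp_all add: lin_simps F')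
also have "... = u >> (x,y). F x 1 y"
 by(subst coact_counit)(simp_all add: lin_simps F')
finally show ?thesis .
qed

lemma Gcomul_eqI:
assumes u: "u : Gam" and t: "t : car GG"
 and eq: "t >> (u,v). mid (%x y z. tri x y z) u v = u >> (x,y). tri x 1 y"
shows "Gcomul u = t"
using eq by(intro GG_eqI[OF Gcomul_in[OF u] t])(simp add: Gcomul_mid[OF u BBB_lin_tri])

lemma Gcomul_add: "u : Gam ==> v : Gam ==> Gcomul (u + v) = Gcomul u + Gcomul v"
and Gcomul_scale: "u : Gam ==> Gcomul (c*.u) = c *. Gcomul u"
by(rule Gcomul_eqI; simp add: bind_linear Gcomul_mid BBB_lin_tri subspace_tensor fv.subspace_add fv.subspace_scale)+

lemma lin_Gcomul: "lin_on GamA Gcomul"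
by(simp add: lin_on_def Gcomul_add Gcomul_scale)

lemma mid_be: "BBB_lin F ==> mid F (be a b) (be c d) = F a (b * c) d"
proof -
assume F: "BBB_lin F"
note F' = F[unfolded BBB_lin_def lin_on_Bk]
show ?thesis unfolding mid_def
 by(subst be_bind, simp add: lin_simps F', subst be_bind)(simp_all add: lin_simps F')
qed

lemma Gcomul_be:
assumes "a : A" "a' : A"
shows "Gcomul (be a a') = tGG (be a 1) (be 1 a')"
proof(rule Gcomul_eqI)
have "balU Bk Bk (%x y. tri x 1 y)" by(simp add: lin_simps)
thus "tGG (be a 1) (be 1 a') >> (u,v). mid (%x y z. tri x y z) u v = be a a' >> (x,y). tri x 1 y"
 by(simp add: tns_bind[OF bal_mid'[OF BBB_lin_tri]] be_bind mid_be[OF BBB_lin_tri])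
qed (use assms A_one in auto)

lemma Gcomul_one: "Gcomul (be 1 1) = tGG (be 1 1) (be 1 1)"
by(rule Gcomul_be[OF A_one A_one])

text \<open>The Takeuchi condition: in \<open>B \<otimes> B \<otimes> B\<close> both sides are \<open>x \<otimes> a \<otimes> y\<close>.\<close>

lemma Gcomul_takeuchi:
assumes u: "u : Gam" and a: "a : A" and F: "balG F"
shows "Gcomul u >> (v,w). F (v *~ be 1 a) w = Gcomul u >> (v,w). F v (w *~ be a 1)"
proof -
let ?t = "Gcomul u >> (v,w). tGG (v *~ be 1 a) w"
let ?t' = "Gcomul u >> (v,w). tGG v (w *~ be a 1)"
have "?t = ?t'"
proof(rule GG_eqI)
 show "?t : car GG" "?t' : car GG"
  by(auto intro!: tensor_bind_in tns_in bemul_Gam be_Gam A_one a intro: Gcomul_keys[OF _ u])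
 have "?t >> (u,v). mid (%x y z. tri x y z) u v = Gcomul u >> (v,w). mid (%x y z. tri x (a * y) z) v w"
  unfolding bind_assoc2 tns_bind[OF bal_mid'[OF BBB_lin_tri]] unfolding mid_def bemul_be_right bind_assoc2
  by(subst be_bind)(simp_all add: lin_simps mult.assoc)
 also have "... = Gcomul u >> (v,w). mid (%x y z. tri x (y * a) z) v w"
  by(subst Gcomul_mid[OF u], simp add: BBB_lin_def lin_simps, subst Gcomul_mid[OF u])
   (simp_all add: BBB_lin_def lin_simps)
 also have "... = ?t' >> (u,v). mid (%x y z. tri x y z) u v"
  unfolding bind_assoc2 tns_bind[OF bal_mid'[OF BBB_lin_tri]] unfolding mid_def bemul_be_right bind_assoc2
  by(subst be_bind)(simp_all add: lin_simps mult.assoc)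
 finally show "?t >> (u,v). mid (%x y z. tri x y z) u v = ?t' >> (u,v). mid (%x y z. tri x y z) u v" .
qed
from arg_cong[OF this, of "%t. t >> (u,v). F u v"] show ?thesis
 by(simp add: bind_assoc2 tns_bind[OF F])
qed

text \<open>Componentwise multiplication is not defined on all of \<open>\<Gamma> \<otimes>\<^sub>A \<Gamma>\<close>, hence the form of the statement. In
\<open>B \<otimes> B \<otimes> B\<close> both sides are \<open>x p \<otimes> 1 \<otimes> q y\<close>.\<close>

lemma Gcomul_mult:
assumes u: "u : Gam" "v : Gam" and F: "balG F"
shows "Gcomul (u*~v) >> (a,b). F a b
  = Gcomul u >> (u1,u2). Gcomul v >> (v1,v2). F (u1*~v1) (u2*~v2)"
proof -
let ?t = "Gcomul u >> (u1,u2). Gcomul v >> (v1,v2). tGG (u1*~v1) (u2*~v2)"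
have "Gcomul (u*~v) = ?t"
proof(rule Gcomul_eqI)
 show "?t : car GG" "u*~v : Gam"
  using u(1,2) by(auto intro!: tensor_bind_in tns_in bemul_Gam intro: Gcomul_keys[OF _ u(1)] Gcomul_keys[OF _ u(2)])
 have "?t >> (u,v). mid (%x y z. tri x y z) u v
   = Gcomul u >> (u1,u2). Gcomul v >> (v1,v2). mid (%x y z. tri x y z) (u1*~v1) (u2*~v2)"
  unfolding bind_assoc2 tns_bind[OF bal_mid'[OF BBB_lin_tri]] ..
 also have "... = Gcomul u >> (u1,u2). Gcomul v >> (v1,v2).
   u1 >> (x,y). v1 >> (p,q). u2 >> (x',y'). v2 >> (p',q'). tri (x * p) (q * y * (x' * p')) (q' * y')"
  unfolding mid_def
  by(subst bemul_bind, simp add: lin_simps, subst bemul_bind)(simp_all add: lin_simps)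
 also have "... = Gcomul u >> (u1,u2). Gcomul v >> (v1,v2).
   v1 >> (p,q). v2 >> (p',q'). u1 >> (x,y). u2 >> (x',y'). tri (x * p) (q * y * (x' * p')) (q' * y')"
  by(rule bind_cong2, rule bind_cong2, rule bind_pull, rule sym, rule trans[OF bind_commute2],
    rule bind_cong2, rule bind_commute2)
 also have "... = Gcomul v >> (v1,v2). v1 >> (p,q). v2 >> (p',q').
   Gcomul u >> (u1,u2). mid (%x z y. tri (x * p) (q * z * p') (q' * y)) u1 u2"
  unfolding mid_def mult.assoc
  by(rule bind_pull, rule bind_pull, rule bind_commute2)
 also have "... = Gcomul v >> (v1,v2). v1 >> (p,q). v2 >> (p',q').
   u >> (x,y). tri (x * p) (q * 1 * p') (q' * y)"
  by(subst Gcomul_mid[OF u(1)])(simp_all add: BBB_lin_def lin_simps)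
 also have "... = u >> (x,y). Gcomul v >> (v1,v2). mid (%p z q'. tri (x * p) z (q' * y)) v1 v2"
  unfolding mid_def mult_1_right
  by(rule sym, rule bind_pull, rule bind_pull, rule bind_commute2)
 also have "... = u >> (x,y). v >> (p,q). tri (x * p) 1 (q * y)"
  by(subst Gcomul_mid[OF u(2)])(simp_all add: BBB_lin_def lin_simps)
 also have "... = u*~v >> (x,y). tri x 1 y"
  by(subst bemul_bind)(simp_all add: lin_simps)
 finally show "?t >> (u,v). mid (%x y z. tri x y z) u v = u*~v >> (x,y). tri x 1 y" .
qed
from arg_cong[OF this, of "%t. t >> (u,v). F u v"] show ?thesis
 by(simp add: bind_assoc2 tns_bind[OF F])
qed

lemma Gcounit_lin [simp]: "Gcounit (u + v) = Gcounit u + Gcounit v" "Gcounit (c*.u) = bs c (Gcounit u)"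
proof -
interpret l: Vector_Spaces.linear fscale bs "%v. linext bs v (%(x,y). x * y)"
 by(rule linear_linext) unfold_locales
show "Gcounit (u + v) = Gcounit u + Gcounit v" "Gcounit (c*.u) = bs c (Gcounit u)"
 by(simp_all add: Gcounit_def l.add l.scale)
qed

lemma Gcounit_bind: "lin_on Bk f ==> f (Gcounit u) = u >> (x,y). f (x * y)"
by(simp add: Gcounit_def lin_Bk_linext split_def)

lemma Gcounit_in_A:
assumes u: "u : Gam" shows "Gcounit u : A"
proof -
have "coact (Gcounit u) = u >> (x,y). coact (x * y)"
 by(rule Gcounit_bind)(simp add: lin_simps)
also have "... = u >> (x,y). coact (x * y) >> (b,h). tBH b h"
 by(simp add: coact_self)
also have "... = u >> (x,y). coact x >> (x0,x1). coact y >> (y0,y1). tBH (x0 * y0) (x1 * y1)"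
 by(subst coact_mult_bind)(simp_all add: lin_simps)
also have "... = u >> (x,y). tBH (x * y) 1"
 by(rule Gam_bind[OF u])(simp add: BBH_lin_def lin_simps)
also have "... = tBH (Gcounit u) 1"
 by(rule Gcounit_bind[symmetric])(simp add: lin_simps)
finally show ?thesis by(simp add: coinv_def)
qed

lemma coact_inj: "coact x = coact y ==> x = y"
using comodule_algebra unfolding comodule_algebra_def by metis

lemma Gcounit_right: "Gcounit (be 1 a *~ u) = Gcounit u * a"
proof(rule coact_inj)
have "coact (Gcounit (be 1 a *~ u)) = be 1 a *~ u >> (x,y). coact (x * y)"
 by(rule Gcounit_bind)(simp add: lin_simps)
also have "... = u >> (x,y). coact (x * y * a)"
 by(subst bemul_bind_left)(simp_all add: lin_simps mult.assoc)
also have "... = coact (Gcounit u * a)"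
 by(rule Gcounit_bind[symmetric])(simp add: lin_simps)
finally show "coact (Gcounit (be 1 a *~ u)) = coact (Gcounit u * a)" .
qed

lemma Gcomul_counit:
assumes u: "u : Gam"
shows "Gcomul u >> (v,w). be (Gcounit v) 1 *~ w = u"
proof -
have "be (Gcounit v) 1 *~ w = mid (%x z y. be (x * z) y) v w" for v w
proof -
 have "be (Gcounit v) 1 *~ w = v >> (x,y). be (x * y) 1 *~ w"
  by(rule Gcounit_bind)(simp add: lin_simps)
 thus ?thesis by(simp add: mid_def bemul_be_left mult.assoc)
qed
hence "Gcomul u >> (v,w). be (Gcounit v) 1 *~ w = Gcomul u >> (v,w). mid (%x z y. be (x * z) y) v w"
 by simp
also have "... = u >> (x,y). be (x * 1) y"
 by(rule Gcomul_mid[OF u])(simp add: BBB_lin_def lin_simps)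
also have "... = u" by(simp add: be_self[OF Gam_Be[OF u]])
finally show ?thesis .
qed

abbreviation "GGG == tensor GamA A GG"

lemma closed_GG [simp]: "rclosed GG A" "lclosed A GG"
by(intro rclosed_tensor GamA_rac_hom, assumption) (intro lclosed_tensor GamA_lac_hom, assumption)

lemma GG_rac_hom: "a : A ==> lhom A GG GG (%n. rac GG n a)"
proof -
assume a: "a : A"
have "rac GG (lac GG r x) a = lac GG r (rac GG x a)" if x: "x : car GG" and r: "r : A" for x r
 by(rule tensor_lin_eqI[OF x])
  (simp_all add: lin_on_def rac_tensor[of "GamA" A "GamA"] lac_tensor[of "GamA" A "GamA"] bind_linear
   rac_tensor[symmetric] lac_tensor[symmetric] rac_tns[OF GamA_rac_hom[OF a]] lac_tns[OF GamA_lac_hom[OF r]])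
thus ?thesis
 using rac_in[OF GamA_rac_hom[OF a]] by(auto simp: lhom_def klin_def rac_tensor bind_linear)
qed

definition BBBB_lin where
"BBBB_lin F == (ALL y z p. lin_on Bk (%x. F x y z p)) & (ALL x z p. lin_on Bk (%y. F x y z p)) &
  (ALL x y p. lin_on Bk (%z. F x y z p)) & (ALL x y z. lin_on Bk (F x y z))"

definition mid3 where
"mid3 F u v w = u >> (x,y). v >> (x',y'). w >> (x'',y''). F x (y * x') (y' * x'') y''"

abbreviation "W == vsp UNIV fscale"
abbreviation "qd x y z p == tnsU Bk W x (tri y z p)"

lemma qd_lin [simp]: "tnsU Bk W x (s + t) = tnsU Bk W x s + tnsU Bk W x t"
"tnsU Bk W x (c*.s) = c *. tnsU Bk W x s"
"tnsU Bk W (x + y) s = tnsU Bk W x s + tnsU Bk W y s"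
"tnsU Bk W (bs c x) s = c *. tnsU Bk W x s"
by(simp_all add: tns_add_left tns_add_right tns_scl_left[where M="Bk", simplified] tns_scl_right[where N=W, simplified])

lemma BBBB_lin_qd: "BBBB_lin (%x y z p. qd x y z p)"
by(simp add: BBBB_lin_def lin_simps)

lemma qd_bind:
assumes F: "BBBB_lin F"
shows "qd x y z p >> (a,t). t >> (b,t'). t' >> (c,d). F a b c d = F x y z p"
proof -
note F' = F[unfolded BBBB_lin_def]
have 1: "balU Bk W (%a t. t >> (b,t'). t' >> (c,d). F a b c d)"
 using F' by(intro bal_scalars lin_on_bind2 lin_on_bind_left)(auto simp: lin_on_def)
have "BBB_lin (F x)" using F' by(simp add: BBB_lin_def)
thus ?thesis by(simp add: tns_bind[OF 1] tri_bind)
qed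

lemma bal_bind2: "(!!x y. (x, y) : keys t ==> bal M R N (%m n. f m n x y)) ==> bal M R N (%m n. t >> (x,y). f m n x y)"
by(rule balI)(auto intro!: lin_on_bind2 bind_cong2 simp: bal_def)

lemma mid3_left: "mid3 F u v w = mid (%x z y'. w >> (x'',y''). F x z (y' * x'') y'') u v"
by(simp add: mid3_def mid_def)

lemma mid3_right: "mid3 F u v w = u >> (x,y). mid (%x' z p. F x (y * x') z p) v w"
by(simp add: mid3_def mid_def mult.assoc)

lemma tribal_mid3:
assumes F: "BBBB_lin F"
shows "tribal GamA A GamA A GamA (mid3 F)"
proof(rule tribalI)
note F' = F[unfolded BBBB_lin_def lin_on_Bk]
show "balG (%m n. mid3 F m n q)" for q
 unfolding mid3_left by(rule bal_mid')(simp add: BBB_lin_def lin_simps F')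
show "balG (%n q. mid3 F m n q)" for m
 unfolding mid3_right by(intro bal_bind2 bal_mid')(simp add: BBB_lin_def lin_simps F')
qed

lemma right_A_GG: "right_A_module GG" using amod_GG by(simp add: amod_def)

lemma amod_GGG: "amod GGG"
by(rule amod_tensor[OF wgen_GamA _ right_A_GG GG_rac_hom])(use amod_GG in "simp add: amod_def")

lemma GGG_keys: "(u, s) : keys t ==> t : car GGG ==> u : Gam & s : car GG"
using tensor_keysD[of u s t "GamA" A GG] by simp

text \<open>As for two factors, with \<open>theta\<close> applied three times.\<close>

lemma GGG_zero:
assumes t: "t : car GGG" and 0: "t >> (u,s). s >> (v,w). mid3 (%x y z p. qd x y z p) u v w = 0"
shows "t = 0"
proof(rule faithful[OF amod_GGG t])
define T where "T u v w b = tnsB GGG (tns GamA A GG u (tGG v w)) b" for u v w b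
have X: "tribal GamA A GG A Breg (%m n q. tnsB GGG (tns GamA A GG m n) q)"
 by(rule tribal_tns') (rule GG_rac_hom)
have T1: "tribal GamA A GamA A Breg (T u)" if u: "u : Gam" for u
proof -
 have X1: "bal GG A Breg (%n q. tnsB GGG (tns GamA A GG u n) q)"
  using X u by(simp add: tribal_def)
 show ?thesis
 proof(rule tribalI)
  fix b
  have l: "lin_on GG (%n. tnsB GGG (tns GamA A GG u n) b)"
   by(rule bal_lin_left[OF X1]) simp
  show "balG (%v w. T u v w b)"
   unfolding T_def using bal_tns[of "GamA" A "GamA"]
   by(intro balI lin_on_comp[OF l])(auto simp: bal_def klin_def lin_on_def)
 next
  fix v assume v: "v : car GamA"
  show "bal GamA A Breg (%w b. T u v w b)"
  proof(rule balI)
   fix b show "lin_on GamA (%w. T u v w b)"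
    unfolding T_def using bal_tns[of "GamA" A "GamA"] v
    by(intro lin_on_comp[OF bal_lin_left[OF X1]])(auto simp: bal_def klin_def lin_on_def)
  next
   fix w assume w: "w : car GamA"
   show "lin_on Breg (%b. T u v w b)"
    unfolding T_def using v w by(intro bal_lin_right[OF X1]) simp
   fix a b assume a: "a : A"
   have "T u v (rac GamA w a) b = tnsB GGG (tns GamA A GG u (rac GG (tGG v w) a)) b"
    by(simp only: T_def rac_tns[OF GamA_rac_hom[OF a]])
   also have "... = T u v w (lac Breg a b)"
    unfolding T_def using v w a by(intro bal_eq[OF X1]) simp_all
   finally show "T u v (rac GamA w a) b = T u v w (lac Breg a b)" .
  qed
 qed
qed
have T2: "balG (%u v. T u v w b)" if w: "w : Gam" for w b
proof -
 have X1: "bal GamA A GG (%m n. tnsB GGG (tns GamA A GG m n) b)"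
  using X by(simp add: tribal_def)
 show ?thesis
 proof(rule balI)
  show "lin_on GamA (%u. T u v w b)" if "v : car GamA" for v
   unfolding T_def using that w by(intro bal_lin_left[OF X1]) simp
  show "lin_on GamA (%v. T u v w b)" if "u : car GamA" for u
   unfolding T_def using bal_tns[of "GamA" A "GamA"] w that
    by(intro lin_on_comp[OF bal_lin_right[OF X1]])(auto simp: bal_def klin_def lin_on_def)
  fix u a v assume uv: "u : car GamA" "v : car GamA" and a: "a : A"
  have "T (rac GamA u a) v w b = tnsB GGG (tns GamA A GG u (lac GG a (tGG v w))) b"
   unfolding T_def using uv w a by(intro bal_eq[OF X1]) simp_all
  also have "... = T u (lac GamA a v) w b"
   by(simp only: T_def lac_tns[OF GamA_lac_hom[OF a]])
  finally show "T (rac GamA u a) v w b = T u (lac GamA a v) w b" .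
 qed
qed
define psi where "psi x y z p = theta x y >> (u,c). theta c z >> (v,c'). theta c' p >> (w,c''). T u v w c''" for x y z p
have psi: "BBBB_lin psi"
 by(simp add: BBBB_lin_def psi_def lin_simps)
have F: "tribal GamA A GamA A Breg (%u v c. theta c p >> (w,c''). T u v w c'')" for p
 by(intro tribalI bal_bind2 bal_theta_step T1 T2)(auto dest: theta_keys)
have step: "u >> (x,y). v >> (x',y'). w >> (x'',y''). psi x (y * x') (y' * x'') y'' = T u v w 1"
 if uvw: "u : Gam" "v : Gam" "w : Gam" for u v w
proof -
 have "u >> (x,y). v >> (x',y'). w >> (x'',y''). psi x (y * x') (y' * x'') y''
  = w >> (x'',y''). u >> (x,y). v >> (x',y'). psi x (y * x') (y' * x'') y''"
  by(rule sym, rule bind_pull, rule bind_commute2)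
 also have "... = w >> (x'',y''). theta x'' (y'' * 1) >> (w,c''). T u v w c''"
  unfolding psi_def by(simp add: theta_twice[OF F uvw(1,2)])
 also have "... = T u v w 1"
  using T1[OF uvw(1)] uvw by(intro theta_inverse_bind)(auto simp: tribal_def)
 finally show ?thesis .
qed
have "tnsB GGG t 1 = tnsB GGG (t >> (u,s). tns GamA A GG u s) 1"
 by(simp add: tensor_self[OF t])
also have "... = t >> (u,s). tnsB GGG (tns GamA A GG u s) 1"
 by(rule lin_on_bind_out2[OF _ _ lin_tns_left])(auto dest: GGG_keys[OF _ t])
also have "... = t >> (u,s). s >> (v,w). T u v w 1"
proof(rule bind_cong2)
 fix u s assume "(u, s) : keys t"
 hence us: "u : Gam" "s : car GG" using GGG_keys[OF _ t] by auto
 have l: "lin_on GG (%s. tnsB GGG (tns GamA A GG u s) 1)"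
  using X us by(auto simp: tribal_def bal_def)
 have "tnsB GGG (tns GamA A GG u s) 1 = tnsB GGG (tns GamA A GG u (s >> (v,w). tGG v w)) 1"
  by(simp add: tensor_self[OF us(2)])
 also have "... = s >> (v,w). T u v w 1"
  unfolding T_def by(rule lin_on_bind_out2[OF _ _ l])(auto dest: GG_keys[OF _ us(2)])
 finally show "tnsB GGG (tns GamA A GG u s) 1 = s >> (v,w). T u v w 1" .
qed
also have "... = t >> (u,s). s >> (v,w). u >> (x,y). v >> (x',y'). w >> (x'',y''). psi x (y * x') (y' * x'') y''"
 by(intro bind_cong2 step[symmetric])(auto dest!: GGG_keys[OF _ t] dest: GG_keys)
also have "... = ((t >> (u,s). s >> (v,w). mid3 (%x y z p. qd x y z p) u v w) >>
   (%(a,t). t >> (b,t'). t' >> (c,d). psi a b c d))"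
 by(simp add: mid3_def bind_assoc2 qd_bind[OF psi])
finally show "tnsB GGG t 1 = 0" by(simp add: 0 bind_zero_left)
qed

lemma mid3_Gcomul_left:
assumes u: "u : Gam" and F: "BBBB_lin F"
shows "Gcomul u >> (v,w). Gcomul v >> (a,b). mid3 F a b w = u >> (x,y). F x 1 1 y"
proof -
note F' = F[unfolded BBBB_lin_def lin_on_Bk]
have "Gcomul u >> (v,w). Gcomul v >> (a,b). mid3 F a b w
  = Gcomul u >> (v,w). v >> (x,y). w >> (x'',y''). F x 1 (y * x'') y''"
 unfolding mid3_left
 by(intro bind_cong2 Gcomul_mid)(auto intro: Gcomul_keys[OF _ u] simp: BBB_lin_def lin_simps F')
also have "... = u >> (x,y). F x 1 1 y"
 using Gcomul_mid[OF u, of "%x z y. F x 1 z y"] F' by(simp add: mid_def BBB_lin_def lin_on_Bk)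
finally show ?thesis .
qed

lemma mid3_Gcomul_right:
assumes u: "u : Gam" and F: "BBBB_lin F"
shows "Gcomul u >> (v,w). Gcomul w >> (a,b). mid3 F v a b = u >> (x,y). F x 1 1 y"
proof -
note F' = F[unfolded BBBB_lin_def lin_on_Bk]
have "Gcomul u >> (v,w). Gcomul w >> (a,b). mid3 F v a b
  = Gcomul u >> (v,w). v >> (x,y). Gcomul w >> (a,b). mid (%x' z p. F x (y * x') z p) a b"
 unfolding mid3_right by(rule bind_cong2, rule bind_commute2)
also have "... = Gcomul u >> (v,w). v >> (x,y). w >> (x',y'). F x (y * x') 1 y'"
 by(intro bind_cong2 Gcomul_mid)(auto intro: Gcomul_keys[OF _ u] simp: BBB_lin_def lin_simps F')
also have "... = u >> (x,y). F x 1 1 y"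
 using Gcomul_mid[OF u, of "%x z y. F x z 1 y"] F' by(simp add: mid_def BBB_lin_def lin_on_Bk)
finally show ?thesis .
qed

text \<open>In \<open>B \<otimes> B \<otimes> B \<otimes> B\<close> both sides are \<open>x \<otimes> 1 \<otimes> 1 \<otimes> y\<close>.\<close>

lemma Gcomul_coassoc:
assumes u: "u : Gam" and F: "tribal GamA A GamA A GamA F"
shows "Gcomul u >> (v,w). Gcomul v >> (a,b). F a b w
   = Gcomul u >> (v,w). Gcomul w >> (a,b). F v a b"
proof -
let ?q = "mid3 (%x y z p. qd x y z p)"
let ?t = "Gcomul u >> (v,w). Gcomul v >> (a,b). tns GamA A GG a (tGG b w)"
let ?t' = "Gcomul u >> (v,w). Gcomul w >> (a,b). tns GamA A GG v (tGG a b)"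
have ev: "tns GamA A GG a (tGG b c) >> (u,s). s >> (v,w). F u v w = F a b c"
 if "tribal GamA A GamA A GamA F" "a : Gam" for a b c and F :: "_ => _ => _ => ('x =>0 'k)"
 using that tns_bind[of "GamA" A "GamA" "F a" b c]
 by(simp add: tns_bind[OF bal_tensor_right[OF that(1) closed_A(3,4)]] tribal_def)
have in_t: "?t : car GGG" "?t' : car GGG"
 by(auto intro!: tensor_bind_in tns_in intro: Gcomul_keys[OF _ u] Gcomul_keys[OF _ Gcomul_keys(1)[OF _ u]]
   Gcomul_keys[OF _ Gcomul_keys(2)[OF _ u]])
have evt: "?t >> (u,s). s >> (v,w). F u v w = Gcomul u >> (v,w). Gcomul v >> (a,b). F a b w"
 "?t' >> (u,s). s >> (v,w). F u v w = Gcomul u >> (v,w). Gcomul w >> (a,b). F v a b"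
 if "tribal GamA A GamA A GamA F" for F :: "_ => _ => _ => ('x =>0 'k)"
 unfolding bind_assoc2
 by(intro bind_cong2 ev[OF that]; blast intro: Gcomul_keys[OF _ u] Gcomul_keys[OF _ Gcomul_keys(1)[OF _ u]])+
have "?t - ?t' = 0"
 by(rule GGG_zero[OF kclosed_diff[OF kclosed_tensor in_t]])
  (simp add: bind_diff_left evt[OF tribal_mid3[OF BBBB_lin_qd]] mid3_Gcomul_left[OF u BBBB_lin_qd] mid3_Gcomul_right[OF u BBBB_lin_qd])
hence "?t = ?t'" by simp
from arg_cong[OF this, of "%t. t >> (u,s). s >> (v,w). F u v w"] show ?thesis
 unfolding evt[OF F] .
qed

subsection \<open>The element \<open>tau\<close>\<close>

abbreviation "BGB == tensor Breg A GB"

text \<open>\<open>theta\<close> gives a retraction of \<open>B\<^sup>e \<otimes>\<^sub>A B\<close> onto \<open>\<Gamma> \<otimes>\<^sub>A B\<close>. It is left \<open>A\<close>-linear, so the inclusion stays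
injective under \<open>B \<otimes>\<^sub>A -\<close>, and the formula for \<open>\<tau>(h)\<close> determines it.\<close>

lemma retract_hom:
shows "klin BeB GB (%z. z >> (u,b). u >> (x,y). theta x (y * b))" (is "klin _ _ ?r")
 and "lhom A BeB GB (%z. z >> (u,b). u >> (x,y). theta x (y * b))"
proof -
show 1: "klin BeB GB ?r"
 by(auto simp: klin_def bind_linear intro!: tensor_bind_in)
have K: "BBB_bal (%x y b. theta x (y * b))"
 by(simp add: BBB_bal_simps lin_simps mult.assoc)
have "?r (lac BeB a z) = lac GB a (?r z)" if a: "a : A" and z: "z : car BeB" for a z
proof -
 have "?r (lac BeB a z) = z >> (u,b). be a 1 *~ u >> (x,y). theta x (y * b)"
  by(simp add: lac_tensor bind_assoc2 tns_bind[OF bal_BeA_Breg[OF K]])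
 also have "... = z >> (u,b). u >> (x,y). theta (a * x) (y * 1 * b)"
  by(subst bemul_bind_left)(simp_all add: lin_simps)
 also have "... = lac GB a (?r z)" by(simp add: theta_A[OF a] lac_bind2)
 finally show ?thesis .
qed
thus "lhom A BeB GB ?r" using 1 by(auto simp: lhom_def)
qed

lemma incl_lhom: "lhom A GB BeB (%s. emb s)"
proof -
have "emb (lac GB a s) = lac BeB a (emb s)" if a: "a : A" and s: "s : car GB" for s a
proof(rule tensor_lin_eqI[OF s])
 show "lin_on GB (%s. emb (lac GB a s))" "lin_on GB (%s. lac BeB a (emb s))"
  by(simp_all add: lin_on_def tmap_def lac_tensor bind_linear)
 show "emb (lac GB a (tnsB GamA m n)) = lac BeB a (emb (tnsB GamA m n))" for m n
  unfolding lac_tns[OF GamA_lac_hom[OF a]] tmap_tns_hom[OF incl_hom(1) lhom_id(2)] lac_tns[OF BeA_lac_hom] id_apply by simp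
qed
thus ?thesis by(auto simp: lhom_def klin_def incl_lin intro!: tmap_in lhom_id)
qed

lemma retract_incl:
assumes s: "s : car GB" shows "(emb s >> (u,b). u >> (x,y). theta x (y * b)) = s"
proof -
have K: "BBB_bal (%x y b. theta x (y * b))"
 by(simp add: BBB_bal_simps lin_simps mult.assoc)
have "(emb s >> (u,b). u >> (x,y). theta x (y * b)) = s >> (u,b). u >> (x,y). theta x (y * b)"
 by(rule incl_bind[OF bal_BeA_Breg[OF K]])
also have "... = s >> (u,b). tnsB GamA u b"
 using tensor_keysD(1)[OF _ s closed_A(3) closed_k(6)] by(intro bind_cong2 theta_inverse) simp
finally show ?thesis by(simp add: tensor_self[OF s])
qed

abbreviation "tau_img t == tmap Breg A BeB id (extmap BeA id) t"

lemma tau_img_inj: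
assumes t: "t : car BGB" "t' : car BGB" and eq: "tau_img t = tau_img t'"
shows "t = t'"
proof -
let ?r = "%z. z >> (u,b). u >> (x,y). theta x (y * b)"
have r: "tmap Breg A GB id ?r (tau_img s) = s" if s: "s : car BGB" for s
proof(rule tensor_lin_eqI[OF s])
 show "lin_on BGB (%s. tmap Breg A GB id ?r (tau_img s))" "lin_on BGB (%s. s)"
  by(simp_all add: lin_on_def tmap_def bind_linear)
 fix m n assume "n : car GB"
 thus "tmap Breg A GB id ?r (tau_img (tns Breg A GB m n)) = tns Breg A GB m n"
  unfolding tmap_tns_hom[OF rhom_id(2) incl_lhom] tmap_tns_hom[OF rhom_id(2) retract_hom(2)]
  by(simp add: retract_incl)
qed
show ?thesis using r[OF t(1)] r[OF t(2)] unfolding eq by(rule trans[OF sym])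
qed

lemma tau_eq: "tau h = transl h >> (l,r). tns Breg A GB l (theta r 1)"
proof -
let ?t = "transl h >> (l,r). tns Breg A GB l (theta r 1)"
define T where "T l r l' r' = tns Breg A BeB l (tnsB BeA (be r l') r')" for l r l' r'
have T_lin: "T l (x + y) l' r' = T l x l' r' + T l y l' r'" "T l (bs c x) l' r' = c *. T l x l' r'"
 "T l x (l' + l2) r' = T l x l' r' + T l x l2 r'" "T l x (bs c l') r' = c *. T l x l' r'"
 "T l x l' (r' + r2) = T l x l' r' + T l x l' r2" "T l x l' (bs c r') = c *. T l x l' r'"
 "T (l + l2) x l' r' = T l x l' r' + T l2 x l' r'" "T (bs c l) x l' r' = c *. T l x l' r'" for l x y l' r' l2 r2 c
 by(simp_all add: T_def tns_add_left tns_add_right tns_scl_left[where M="Breg", simplified] tns_scl_right[where N=BeB, simplified])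
have T_A: "T (l * a) x l' r' = T l (a * x) l' r'" if "a : A" for l x l' r' a
 using tns_bal[of l "Breg" a A "tnsB BeA (be x l') r'" BeB] that
 by(simp add: T_def lac_tns[OF BeA_lac_hom])
have in_t: "?t : car BGB" by(intro tensor_bind_in) simp
have l: "lin_on BeB (%s. tns Breg A BeB l s)" for l
 by(rule lin_tns_right) simp
have "tau_img ?t = transl h >> (l,r). tns Breg A BeB l (theta' r 1)"
 unfolding tmap_def[of "Breg" A BeB] bind_assoc2 tns_bind[OF bal_tns_comp[OF rhom_id(2) incl_lhom]] by(simp add: incl_theta)
also have "... = transl h >> (l,r). coact r >> (r0,r1). transl r1 >> (l',r'). T l r0 l' r'"
 unfolding theta'_def T_def
 by(intro bind_cong2, subst lin_on_bind_out2[OF _ _ l], simp, simp, force intro!: tensor_bind_in,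
    subst lin_on_bind_out2[OF _ _ l]) auto
also have "... = comul h >> (h1,h2). transl h1 >> (l,r). transl h2 >> (l',r'). T l r l' r'"
 by(rule transl_coact_right)(simp_all add: bal_Breg lin_simps T_lin T_A)
finally have img: "tau_img ?t = comul h >> (h1,h2). transl h1 >> (l,r). transl h2 >> (l',r'). T l r l' r'" .
show ?thesis unfolding tau_def
 by(rule the_equality, unfold T_def[symmetric])(use img in_t in "auto intro: tau_img_inj")
qed

lemma tau_in [simp]: "tau h : car BGB"
unfolding tau_eq by(intro tensor_bind_in) simp

lemma tau_lin [simp]: "tau (h + h') = tau h + tau h'" "tau (hs c h) = c *. tau h"
by(simp_all add: tau_eq bind_linear)

lemma closed_GB [simp]: "lclosed A GB"
by(intro lclosed_tensor GamA_lac_hom)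

lemma tau_keys: "(b, t) : keys (tau h) ==> t : car GB"
"(w, c) : keys t ==> t : car GB ==> w : Gam"
using tensor_keysD(2)[OF _ tau_in closed_k(5) closed_GB] tensor_keysD(1)[OF _ _ closed_A(3) closed_k(6)] by simp_all

lemma tau_bind:
assumes "tribal Breg A GamA A Breg F"
shows "tau h >> (b,t). t >> (w,c). F b w c = transl h >> (l,r). theta r 1 >> (w,c). F l w c"
unfolding tau_eq bind_assoc2 tns_bind[OF bal_tensor_right[OF assms closed_A(3) closed_k(6)]] ..

lemma theta_right_bind:
assumes F: "bal GamA A Breg F"
shows "theta x (d * a) >> (w,e). F w e = theta x d >> (w,e). F w (e * a)"
proof -
have "theta x d >> (w,e). F w (e * a)
  = theta x d >> (w,e). w >> (x',y'). theta x' (y' * (e * a)) >> (w,e). F w e"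
 by(intro bind_cong2 theta_inverse_bind[OF _ F, symmetric]) (rule theta_keys)
also have "... = theta x d >> (w,e). w >> (x',y'). theta x' ((y' * e) * a) >> (w,e). F w e"
 by(simp add: mult.assoc)
also have "... = theta x (d * a) >> (w,e). F w e"
 by(rule theta_bind_mult)(simp add: lin_simps)
finally show ?thesis by simp
qed

definition BB_bal_left where
"BB_bal_left K == (ALL y b. lin_on Bk (%x. K x y b)) & (ALL x b. lin_on Bk (%y. K x y b)) &
 (ALL x y. lin_on Bk (K x y)) & (ALL x y b. ALL a:A. K (x * a) y b = K x (a * y) b)"

lemma tau_eval:
assumes K: "BB_bal_left K"
shows "tau h >> (b,t). t >> (w,c). w >> (x,y). K b x (y * c) = transl h >> (l,r). K l r 1"
proof -
note K' = K[unfolded BB_bal_left_def lin_on_Bk]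
have F: "tribal Breg A GamA A Breg (%b w c. w >> (x,y). K b x (y * c))"
proof(rule tribalI)
 show "bal GamA A Breg (%w c. w >> (x,y). K b x (y * c))" for b
  by(rule bal_GamA_left, rule bal_BeA_Breg)(simp add: BBB_bal_simps lin_simps K' mult.assoc)
 show "bal Breg A GamA (%b w. w >> (x,y). K b x (y * c))" for c
 proof(rule balI)
  show "lin_on Breg (%b. w >> (x,y). K b x (y * c))" for w
   by(rule lin_on_bind2)(simp add: lin_on_Breg K')
  show "lin_on GamA (%w. w >> (x,y). K b x (y * c))" for b
   by(rule lin_on_bind_left)(simp add: lin_on_def)
  show "w >> (x,y). K (rac Breg b a) x (y * c) = lac GamA a w >> (x,y). K b x (y * c)" if "a : A" for b a w
   using K' that by(simp, subst bemul_bind_left)(simp_all add: lin_simps)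
 qed
qed
have "tau h >> (b,t). t >> (w,c). w >> (x,y). K b x (y * c)
  = transl h >> (l,r). theta r 1 >> (w,c). w >> (x,y). K l x (y * c)"
 by(rule tau_bind[OF F])
also have "... = transl h >> (l,r). K l r 1"
 by(subst theta_bind_mult)(simp_all add: lin_simps K')
finally show ?thesis .
qed

lemma tau_central:
assumes F: "tribal Breg A GamA A Breg F" and a: "a : A"
shows "tau h >> (b,t). t >> (w,c). F b (w *~ be a 1) c
   = tau h >> (b,t). t >> (w,c). F (a * b) w c"
 and "tau h >> (b,t). t >> (w,c). F b (w *~ be 1 a) c
   = tau h >> (b,t). t >> (w,c). F b w (c * a)"
proof -
define K where "K b x z = theta x z >> (w,c). F b w c" for b x z
have Fb: "bal GamA A Breg (F b)" for b using F by(simp add: tribal_def)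
have Kl: "lin_on Bk (%b. K b x z)" for x z
 unfolding K_def using F
 by(intro lin_on_bind2)(auto simp: tribal_def bal_def lin_on_Breg lin_on_Bk dest: theta_keys)
have Kb: "K (b * a) x z = K b (a * x) z" if "a : A" for b a x z
 unfolding K_def theta_A_bind[OF that Fb] using F that
 by(intro bind_cong2)(auto simp: tribal_def bal_def dest: theta_keys)
have K2: "K b (x + x') z = K b x z + K b x' z" "K b (bs c x) z = c *. K b x z"
 "K b x (z + z') = K b x z + K b x z'" "K b x (bs c z) = c *. K b x z" for b x x' z z' c
 by(simp_all add: K_def lin_simps)
note K' = Kl[unfolded lin_on_Bk] K2
have FK: "F b w c = w >> (x,y). K b x (y * c)" if "w : Gam" for b w c
 unfolding K_def by(rule theta_inverse_bind[OF that Fb, symmetric])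
have kk: "w : Gam" if "(b, t) : keys (tau h)" "(w, c) : keys t" for b t w c
 using tau_keys that by blast
have "tau h >> (b,t). t >> (w,c). F b (w *~ be a 1) c
  = tau h >> (b,t). t >> (w,c). w *~ be a 1 >> (x,y). K b x (y * c)"
 by(intro bind_cong2 FK bemul_Gam be_Gam a A_one) (rule kk)
also have "... = tau h >> (b,t). t >> (w,c). w >> (x,y). K b (x * a) (y * c)"
 by(simp add: bemul_be_right bind_assoc2, subst be_bind)(simp_all add: lin_simps K')
also have "... = transl h >> (l,r). theta r 1 >> (w,c). w >> (x,y). K l (x * a) (y * c)"
proof -
 have "tau h >> (b,t). t >> (w,c). w >> (x,y). K b (x * a) (y * c) = transl h >> (l,r). K l (r * a) 1"
  by(rule tau_eval)(simp add: BB_bal_left_def lin_simps K' Kb mult.assoc)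
 moreover have "theta r 1 >> (w,c). w >> (x,y). K l (x * a) (y * c) = K l (r * a) 1" for l r
  by(rule theta_bind_mult)(simp add: lin_simps K')
 ultimately show ?thesis by simp
qed
also have "... = transl h >> (l,r). K l (r * a) 1"
 by(subst theta_bind_mult)(simp_all add: lin_simps K')
also have "... = transl h >> (l,r). K (a * l) r 1"
 by(rule transl_central[OF _ a])(simp add: bal_Breg lin_simps K' Kb)
also have "... = tau h >> (b,t). t >> (w,c). w >> (x,y). K (a * b) x (y * c)"
 by(rule tau_eval[symmetric])(simp add: BB_bal_left_def lin_simps K' Kb mult.assoc[symmetric])
also have "... = tau h >> (b,t). t >> (w,c). F (a * b) w c"
 by(intro bind_cong2 FK[symmetric]) (rule kk)
finally show "tau h >> (b,t). t >> (w,c). F b (w *~ be a 1) c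
   = tau h >> (b,t). t >> (w,c). F (a * b) w c" .
have "tau h >> (b,t). t >> (w,c). F b (w *~ be 1 a) c
  = tau h >> (b,t). t >> (w,c). w *~ be 1 a >> (x,y). K b x (y * c)"
 by(intro bind_cong2 FK bemul_Gam be_Gam a A_one) (rule kk)
also have "... = tau h >> (b,t). t >> (w,c). w >> (x,y). K b x (a * (y * c))"
 by(simp add: bemul_be_right bind_assoc2, subst be_bind)(simp_all add: lin_simps K' mult.assoc)
also have "... = transl h >> (l,r). K l r (a * 1)"
 by(rule tau_eval)(simp add: BB_bal_left_def lin_simps K' Kb)
also have "... = transl h >> (l,r). K l r (1 * a)" by simp
also have "... = tau h >> (b,t). t >> (w,c). w >> (x,y). K b x ((y * c) * a)"
 by(rule tau_eval[symmetric])(simp add: BB_bal_left_def lin_simps K' Kb)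
also have "... = tau h >> (b,t). t >> (w,c). w >> (x,y). K b x (y * (c * a))"
 by(simp add: mult.assoc)
also have "... = tau h >> (b,t). t >> (w,c). F b w (c * a)"
 by(intro bind_cong2 FK[symmetric]) (rule kk)
finally show "tau h >> (b,t). t >> (w,c). F b (w *~ be 1 a) c
   = tau h >> (b,t). t >> (w,c). F b w (c * a)" .
qed

text \<open>This is why \<open>H\<close> acts compatibly on products (\<open>crossK_act\<close>): acting by \<open>h\<^sub>1\<close> and \<open>h\<^sub>2\<close> on two factors
amounts to acting by \<open>h\<close> with the middle component of \<open>\<tau>(h)\<close> comultiplied.\<close>

lemma tau_comul:
assumes P1: "!!w' c. w' : Gam ==> tribal Breg A GamA A Breg (%b w e. P b w e w' c)"
 and P2: "!!b w. w : Gam ==> tribal Breg A GamA A Breg (%e w' c. P b w e w' c)"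
shows "comul h >> (h1,h2). tau h1 >> (b,t). t >> (w,b'). tau h2 >> (c,t'). t' >> (%(w',c').
     P b w (b' * c) w' c')
  = tau h >> (b,t). t >> (w,c). Gcomul w >> (w1,w2). P b w1 1 w2 c"
proof -
define K where "K b x d x' z = theta x d >> (w,e). theta x' z >> (w',c'). P b w e w' c'" for b x d x' z
have Pb: "bal GamA A Breg (%w e. theta x' z >> (w',c'). P b w e w' c')" for b x' z
 using P1 by(intro bal_bind2)(auto simp: tribal_def dest!: theta_keys)
have Pb': "bal GamA A Breg (P b w e)" if "w : Gam" for b w e
 using P2[OF that] by(simp add: tribal_def)
have Kb: "lin_on Bk (%b. K b x d x' z)" for x d x' z
 unfolding K_def
 by(intro lin_on_bind2)(use P1 in "force simp: tribal_def bal_def lin_on_Breg lin_on_Bk dest!: theta_keys")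
have K2: "K b (x + y) d x' z = K b x d x' z + K b y d x' z" "K b (bs c x) d x' z = c *. K b x d x' z"
 "K b x (d + d') x' z = K b x d x' z + K b x d' x' z" "K b x (bs c d) x' z = c *. K b x d x' z"
 "K b x d (x' + x2) z = K b x d x' z + K b x d x2 z" "K b x d (bs c x') z = c *. K b x d x' z"
 "K b x d x' (z + z') = K b x d x' z + K b x d x' z'" "K b x d x' (bs c z) = c *. K b x d x' z"
 for b x y d d' x' x2 z z' c
 by(simp_all add: K_def lin_simps)
note K' = Kb[unfolded lin_on_Bk] K2
have KA1: "K (b * a) x d x' z = K b (a * x) d x' z" if a: "a : A" for a b x d x' z
 unfolding K_def theta_A_bind[OF a Pb]
 by(intro bind_cong2)(use P1 a in "force simp: tribal_def bal_def dest!: theta_keys")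
have KA2: "K b x (d * a) x' z = K b x d (a * x') z" if a: "a : A" for a b x d x' z
proof -
 have "theta x' z >> (w',c'). P b w (e * a) w' c' = theta (a * x') z >> (w',c'). P b w e w' c'" if w: "w : Gam" for w e
  unfolding theta_A_bind[OF a Pb'[OF w]]
  by(intro bind_cong2)(use P2[OF w] a in "force simp: tribal_def bal_def dest!: theta_keys")
 thus ?thesis
  unfolding K_def theta_right_bind[OF Pb] by(intro bind_cong2)(auto dest: theta_keys)
qed
have PK: "P b w d w' c = w >> (x,y). w' >> (x',y'). K b x (y * d) x' (y' * c)"
 if w: "w : Gam" "w' : Gam" for b w d w' c
proof -
 have "w >> (x,y). w' >> (x',y'). K b x (y * d) x' (y' * c)
   = w >> (x,y). theta x (y * d) >> (w1,e). w' >> (x',y'). theta x' (y' * c) >> (w2,c'). P b w1 e w2 c'"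
  unfolding K_def by(rule bind_cong2, rule bind_commute2)
 also have "... = w >> (x,y). theta x (y * d) >> (w1,e). P b w1 e w' c"
  by(intro bind_cong2 theta_inverse_bind[OF w(2) Pb']) (rule theta_keys)
 also have "... = P b w d w' c"
  by(rule theta_inverse_bind[OF w(1)])(use P1[OF w(2)] in "simp add: tribal_def")
 finally show ?thesis by simp
qed
have kk: "w : Gam" if "(b, t) : keys (tau h)" "(w, c) : keys t" for b t w c h
 using tau_keys that by blast
have "comul h >> (h1,h2). tau h1 >> (b,t). t >> (w,b'). tau h2 >> (c,t'). t' >> (%(w',c').
     P b w (b' * c) w' c')
 = comul h >> (h1,h2). tau h1 >> (b,t). t >> (w,b'). tau h2 >> (c,t'). t' >> (w',c').
   w >> (x,y). w' >> (x',y'). K b x (y * (b' * c)) x' (y' * c')"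
 by(intro bind_cong2 PK kk)
also have "... = comul h >> (h1,h2). tau h1 >> (b,t). t >> (w,b'). w >> (x,y). tau h2 >> (c,t'). t' >> (w',c').
   w' >> (x',y'). K b x (y * b' * c) x' (y' * c')"
 unfolding mult.assoc
 by(rule bind_cong2, rule bind_cong2, rule bind_cong2, rule sym, rule bind_pull, rule bind_commute2)
also have "... = comul h >> (h1,h2). tau h1 >> (b,t). t >> (w,b'). w >> (x,y). transl h2 >> (l',r').
   K b x (y * b' * l') r' 1"
 by(subst tau_eval)(simp_all add: BB_bal_left_def lin_simps K' KA2 mult.assoc[symmetric])
also have "... = comul h >> (h1,h2). transl h1 >> (l,r). transl h2 >> (l',r'). K l r (1 * l') r' 1"
 by(subst tau_eval)(simp_all add: BB_bal_left_def lin_simps K' KA1)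
also have "... = transl h >> (l,r). coact r >> (r0,r1). transl r1 >> (l',r'). K l r0 l' r' 1"
 by(subst transl_coact_right)(simp_all add: bal_Breg lin_simps K' KA1)
also have "... = tau h >> (b,t). t >> (w,c). w >> (x,y). coact x >> (x0,x1). transl x1 >> (l',r').
   K b x0 l' r' (y * c)"
proof(rule tau_eval[symmetric])
 have "coact (a * x) >> (x0,x1). transl x1 >> (l',r'). K b x0 l' r' z
   = coact x >> (x0,x1). transl x1 >> (l',r'). K b (a * x0) l' r' z" if "a : A" for a b x z
  by(rule coact_A_mult(1)[OF _ that])(simp add: lin_simps K')
 thus "BB_bal_left (%b x z. coact x >> (x0,x1). transl x1 >> (l',r'). K b x0 l' r' z)"
  by(simp add: BB_bal_left_def KA1)(simp add: lin_simps K')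
qed
also have "... = tau h >> (b,t). t >> (w,c). Gcomul w >> (w1,w2). w1 >> (x,y). w2 >> (x',y').
   K b x (y * 1) x' (y' * c)"
proof(intro bind_cong2)
 fix b t w c assume "(b, t) : keys (tau h)" "(w, c) : keys t"
 hence w: "w : Gam" by(rule kk)
 have "BBBB_bal (%x y x' y'. K b x y x' (y' * c))"
  by(simp add: BBBB_bal_def bal_Breg lin_simps K' KA2)
 from Gcomul_bind[OF w this]
 show "w >> (x,y). coact x >> (x0,x1). transl x1 >> (l',r'). K b x0 l' r' (y * c)
  = Gcomul w >> (w1,w2). w1 >> (x,y). w2 >> (x',y'). K b x (y * 1) x' (y' * c)"
  by simp
qed
also have "... = tau h >> (b,t). t >> (w,c). Gcomul w >> (w1,w2). P b w1 1 w2 c"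
 by(intro bind_cong2 PK[symmetric])(auto dest: kk intro: Gcomul_keys)
finally show ?thesis .
qed

end

section \<open>Tensor powers\<close>

definition nlists :: "nat => ('k, 'l, 'm, 'r) bimod => 'm list set" where
"nlists n M = {xs. length xs = n & set xs <= car M}"

lemma nlists_simps [simp]: "[] : nlists n M <-> n = 0" "x # xs : nlists n M <-> n > 0 & x : car M & xs : nlists (n - 1) M"
by(cases n; auto simp: nlists_def)+

lemma nlists_Suc: "xs : nlists (Suc n) M <-> (EX y ys. xs = y # ys & y : car M & ys : nlists n M)"
by(cases xs) auto

lemma nlists_0 [simp]: "xs : nlists 0 M <-> xs = []"
by(auto simp: nlists_def)

lemma nlists_append: "xs : nlists m M ==> ys : nlists n M ==> xs @ ys : nlists (m + n) M"
by(auto simp: nlists_def)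

primrec tlin :: "nat => ('k::field, 'r, 'm::ab_group_add, 'r) bimod => 'r set => ('m list => ('y =>0 'k)) => bool" where
"tlin 0 M R F = True"
| "tlin (Suc n) M R F <-> (ALL ys:nlists n M. lin_on M (%m. F (m # ys))) & (ALL m:car M. tlin n M R (%ys. F (m # ys))) &
  (ALL m:car M. ALL r:R. ALL m' ys. m' # ys : nlists n M --> F (rac M m r # m' # ys) = F (m # lac M r m' # ys))"

lemma tlin_lin:
assumes "tlin n M R F" "length xs + 1 + length ys = n" "set xs <= car M" "set ys <= car M"
shows "lin_on M (%m. F (xs @ m # ys))"
using assms
proof(induction xs arbitrary: n F)
case Nil
thus ?case by(cases n)(auto simp: nlists_def)
next
case (Cons x xs)
then obtain n' where "n = Suc n'" by(cases n) auto
with Cons.prems Cons.IH[of n' "%zs. F (x # zs)"] show ?case by simp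
qed

lemma tlin_bal:
assumes "tlin n M R F" "length xs + 2 + length ys = n" "set xs <= car M" "set ys <= car M"
 "m : car M" "m' : car M" "r : R"
shows "F (xs @ rac M m r # m' # ys) = F (xs @ m # lac M r m' # ys)"
using assms
proof(induction xs arbitrary: n F)
case Nil
then obtain n' where n: "n = Suc (Suc n')" by(cases n)(auto simp: gr0_conv_Suc)
with Nil have "m' # ys : nlists (Suc n') M" by(auto simp: nlists_def)
with Nil n show ?case by simp
next
case (Cons x xs)
then obtain n' where "n = Suc n'" by(cases n) auto
with Cons.prems Cons.IH[of n' "%zs. F (x # zs)"] show ?case by simp
qed

lemma tlinI:
assumes "!!xs ys. length xs + 1 + length ys = n ==> set xs <= car M ==> set ys <= car M ==> lin_on M (%m. F (xs @ m # ys))"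
 and "!!xs m r m' ys. length xs + 2 + length ys = n ==> set xs <= car M ==> set ys <= car M ==>
  m : car M ==> m' : car M ==> r : R ==> F (xs @ rac M m r # m' # ys) = F (xs @ m # lac M r m' # ys)"
shows "tlin n M R F"
using assms
proof(induction n arbitrary: F)
case (Suc n)
have "tlin n M R (%ys. F (x # ys))" if x: "x : car M" for x
proof(rule Suc.IH)
 show "lin_on M (%m. F (x # xs @ m # ys))" if "length xs + 1 + length ys = n" "set xs <= car M" "set ys <= car M" for xs ys
  using Suc.prems(1)[of "x # xs" ys] that x by simp
 show "F (x # xs @ rac M m r # m' # ys) = F (x # xs @ m # lac M r m' # ys)"
  if "length xs + 2 + length ys = n" "set xs <= car M" "set ys <= car M" "m : car M" "m' : car M" "r : R" for xs m r m' ys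
  using Suc.prems(2)[of "x # xs" ys m m' r] that x by simp
qed
moreover have "lin_on M (%m. F (m # ys))" if "ys : nlists n M" for ys
 using Suc.prems(1)[of "[]" ys] that by(simp add: nlists_def)
moreover have "F (rac M m r # m' # ys) = F (m # lac M r m' # ys)" if "m : car M" "r : R" "m' # ys : nlists n M" for m r m' ys
 using Suc.prems(2)[of "[]" ys m m' r] that by(auto simp: nlists_def)
ultimately show ?case by simp
qed simp

lemma tlin_bind2:
"(!!x y. (x, y) : keys t ==> tlin n M R (%us. f us x y)) ==> tlin n M R (%us. t >> (x,y). f us x y)"
proof(induction n arbitrary: f)
case (Suc n)
thus ?case
 by(auto intro!: lin_on_bind2 bind_cong2)
qed simp

lemma tlin_comp_lin:
assumes "!!us. us : nlists n M ==> F us : car N" "lin_on N f" "scl N = fscale" "tlin n M R F"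
 and cl: "kclosed M" "!!x r. x : car M ==> r : R ==> rac M x r : car M" "!!x r. x : car M ==> r : R ==> lac M r x : car M"
shows "tlin n M R (%us. f (F us))"
using assms(1,4)
proof(induction n arbitrary: F)
case (Suc n)
have "lin_on M (%m. f (F (m # ys)))" if "ys : nlists n M" for ys
proof(rule lin_on_comp[OF assms(2)])
 show "klin M N (%m. F (m # ys))"
  using Suc.prems that assms(3) by(auto simp: klin_def lin_on_def)
qed
moreover have "tlin n M R (%ys. f (F (m # ys)))" if "m : car M" for m
 using Suc.prems that by(intro Suc.IH) auto
ultimately show ?case using Suc.prems(2) by simp
qed simp

lemma tlin_plus: "tlin n M R F ==> tlin n M R F' ==> tlin n M R (%us. F us + F' us)"
by(induction n arbitrary: F F')(auto intro: lin_on_plus)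

lemma tlin_fscale: "tlin n M R F ==> tlin n M R (%us. c *. F us)"
by(induction n arbitrary: F)(auto intro: lin_on_fscale)

lemma tlin_zero: "tlin n M R (%us. 0)"
by(induction n)(auto simp: lin_on_def)

lemma tlin_sum: "(!!i. i : S ==> tlin n M R (F i)) ==> tlin n M R (%us. \<Sum>i\<in>S. F i us)"
by(induction S rule: infinite_finite_induct)(auto intro: tlin_plus tlin_zero)

text \<open>The diagonals cut words in two; balancedness at the cut is then a separate condition.\<close>

lemma tlin_append:
assumes "!!vs. vs : nlists m M ==> tlin n M R (%us. F us vs)" "!!us. us : nlists n M ==> tlin m M R (F us)"
 and "!!us u r v vs. us @ [u] : nlists n M ==> v # vs : nlists m M ==> r : R ==>
  F (us @ [rac M u r]) (v # vs) = F (us @ [u]) (lac M r v # vs)"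
shows "tlin (n + m) M R (%zs. F (take n zs) (drop n zs))"
using assms
proof(induction n arbitrary: F)
case 0
thus ?case by simp
next
case (Suc n)
have nl: "take n zs : nlists n M & drop n zs : nlists m M" if "zs : nlists (n + m) M" for zs
 using that set_take_subset[of n zs] set_drop_subset[of n zs] by(auto simp: nlists_def)
have 1: "lin_on M (%u. F (u # take n zs) (drop n zs))" if "zs : nlists (n + m) M" for zs
 using Suc.prems(1)[of "drop n zs"] nl[OF that] by simp
have 2: "tlin (n + m) M R (%zs. F (u # take n zs) (drop n zs))" if u: "u : car M" for u
proof(rule Suc.IH)
 show "tlin n M R (%us. F (u # us) vs)" if "vs : nlists m M" for vs
  using Suc.prems(1)[OF that] u by simp
 show "tlin m M R (F (u # us))" if "us : nlists n M" for us
  using Suc.prems(2)[of "u # us"] u that by simp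
 show "F (u # us @ [rac M w r]) (v # vs) = F (u # us @ [w]) (lac M r v # vs)"
  if "us @ [w] : nlists n M" "v # vs : nlists m M" "r : R" for us w r v vs
  using Suc.prems(3)[of "u # us" w v vs r] u that by simp
qed
have 3: "F (take (Suc n) (rac M u r # v # vs)) (drop (Suc n) (rac M u r # v # vs))
  = F (take (Suc n) (u # lac M r v # vs)) (drop (Suc n) (u # lac M r v # vs))"
 if u: "u : car M" "r : R" "v # vs : nlists (n + m) M" for u r v vs
proof(cases n)
 case 0
 thus ?thesis using Suc.prems(3)[of "[]" u v vs r] u by simp
next
 case (Suc n')
 have "v # take n' vs : nlists n M" "drop n' vs : nlists m M" using nl[OF u(3)] Suc by simp_all
 thus ?thesis using Suc.prems(1)[of "drop n' vs"] u Suc by simp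
qed
show ?case using 1 2 3 by simp
qed

subsection \<open>The universal property\<close>

definition tpow_gens where
"tpow_gens n M R =
  {ins (xs @ (m + m') # ys) - ins (xs @ m # ys) - ins (xs @ m' # ys) | xs m m' ys.
   length xs + 1 + length ys = n & set xs \<union> {m, m'} \<union> set ys <= car M} \<union>
  {ins (xs @ scl M c m # ys) - c *. ins (xs @ m # ys) | xs c m ys.
   length xs + 1 + length ys = n & set xs \<union> {m} \<union> set ys <= car M} \<union>
  {ins (xs @ rac M m r # m' # ys) - ins (xs @ m # lac M r m' # ys) | xs m r m' ys.
   r : R & length xs + 2 + length ys = n & set xs \<union> {m, m'} \<union> set ys <= car M}"

lemma tpow_rel_span: "tpow_rel n M R = fv.span (tpow_gens n M R)"
by(simp add: tpow_rel_def tpow_gens_def)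

lemma subspace_tpow_rel [simp]: "fv.subspace (tpow_rel n M R)"
by(simp add: tpow_rel_span fv.subspace_span)

lemma nf_tpow_bind:
assumes "tlin n M R F"
shows "nf (tpow_rel n M R) v >> F = v >> F"
unfolding tpow_rel_span
proof(rule nf_span_bind)
fix g assume "g : tpow_gens n M R"
thus "(g >> F) = 0"
 unfolding tpow_gens_def
 using lin_on_add[OF tlin_lin[OF assms]] lin_on_scale[OF tlin_lin[OF assms]] tlin_bal[OF assms]
 by(auto simp: bind_diff_left bind_scale_left)
qed

lemma tpow_bind: "tlin n M R F ==> tpow_elt n M R xs >> F = F xs"
by(simp add: tpow_elt_def nf_tpow_bind)

lemma tlin_tpow_elt: "tlin n M R (tpow_elt n M R)"
proof(rule tlinI)
have eq: "nf (tpow_rel n M R) v = nf (tpow_rel n M R) w" if "v - w : tpow_gens n M R" for v w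
 using that by(intro nf_eqI)(simp_all add: tpow_rel_span fv.span_base fv.subspace_span)
show "lin_on M (%m. tpow_elt n M R (xs @ m # ys))"
 if "length xs + 1 + length ys = n" "set xs <= car M" "set ys <= car M" for xs ys
 unfolding lin_on_def tpow_elt_def nf_add[OF subspace_tpow_rel, symmetric] nf_scale[OF subspace_tpow_rel, symmetric]
proof(intro conjI ballI allI; rule eq)
 fix x y assume "x : car M" "y : car M"
 thus "ins (xs @ (x + y) # ys) - (ins (xs @ x # ys) + ins (xs @ y # ys)) : tpow_gens n M R"
  unfolding tpow_gens_def diff_diff_eq[symmetric] using that by blast
next
 fix c x assume "x : car M"
 thus "ins (xs @ scl M c x # ys) - c *. ins (xs @ x # ys) : tpow_gens n M R"
  unfolding tpow_gens_def using that by blast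
qed
show "tpow_elt n M R (xs @ rac M m r # m' # ys) = tpow_elt n M R (xs @ m # lac M r m' # ys)"
 if "length xs + 2 + length ys = n" "set xs <= car M" "set ys <= car M" "m : car M" "m' : car M" "r : R" for xs m r m' ys
 unfolding tpow_elt_def by(rule eq) (unfold tpow_gens_def, use that in blast)
qed

lemma tpow_car_iff: "t : tpow_car n M R <-> (EX v. keys v <= nlists n M & t = (v >> tpow_elt n M R))"
proof -
have "nf (tpow_rel n M R) v = (v >> tpow_elt n M R)" for v
 by(subst nf_ins)(simp_all add: tpow_elt_def[abs_def])
thus ?thesis by(auto simp: tpow_car_def nlists_def)
qed

lemma subspace_tpow: "fv.subspace (tpow_car n M R)"
proof -
have 1: "0 : tpow_car n M R"
 unfolding tpow_car_iff by(rule exI[of _ 0])(simp add: bind_zero_left)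
have 2: "x + y : tpow_car n M R" if x: "x : tpow_car n M R" and y: "y : tpow_car n M R" for x y
proof -
 obtain v w where "keys v <= nlists n M" "x = (v >> tpow_elt n M R)" "keys w <= nlists n M" "y = (w >> tpow_elt n M R)"
  using x y unfolding tpow_car_iff by blast
 thus ?thesis unfolding tpow_car_iff
  by(intro exI[of _ "v + w"])(use keys_add[of v w] in "auto simp: bind_add_left")
qed
have 3: "c*.x : tpow_car n M R" if x: "x : tpow_car n M R" for x c
proof -
 obtain v where "keys v <= nlists n M" "x = (v >> tpow_elt n M R)" using x unfolding tpow_car_iff by blast
 thus ?thesis unfolding tpow_car_iff
  by(intro exI[of _ "c*.v"])(use keys_fscale[of c v] in "auto simp: bind_scale_left")
qed
show ?thesis using 1 2 3 by(auto simp: fv.subspace_def)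
qed

lemma tpow_elt_in: "xs : nlists n M ==> tpow_elt n M R xs : tpow_car n M R"
unfolding tpow_car_iff by(rule exI[of _ "ins xs"]) simp

lemma tpow_lin_eqI:
assumes t: "t : car N" and N: "car N = tpow_car n M R" "scl N = fscale" and "lin_on N f" "lin_on N g"
 and eq: "!!us. us : nlists n M ==> f (tpow_elt n M R us) = g (tpow_elt n M R us)"
shows "f t = g t"
proof -
have k: "kclosed N" using subspace_tpow[of n M R] fv.subspace_diff N by(auto simp: kclosed_def fv.subspace_def)
obtain v where v: "keys v <= nlists n M" "t = (v >> tpow_elt n M R)" using t unfolding N tpow_car_iff by blast
have "f t = v >> x. f (tpow_elt n M R x)" unfolding v(2)
 by(rule lin_on_bind_out[OF k N(2) assms(4)])(use v(1) N tpow_elt_in in blast)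
also have "... = v >> x. g (tpow_elt n M R x)" using v(1) eq by(auto intro!: bind_cong)
also have "... = g t" unfolding v(2)
 by(rule lin_on_bind_out[OF k N(2) assms(5), symmetric])(use v(1) N tpow_elt_in in blast)
finally show ?thesis .
qed

lemma tpow_keys:
assumes cl: "kclosed M" "!!x r. x : car M ==> r : R ==> rac M x r : car M" "!!x r. x : car M ==> r : R ==> lac M r x : car M"
 and t: "t : tpow_car n M R"
shows "keys t <= nlists n M"
proof -
obtain v where v: "keys v <= nlists n M" "t = nf (tpow_rel n M R) v"
 using t unfolding tpow_car_def nlists_def by blast
have k: "keys (ins xs :: _ =>0 'a) <= nlists n M" if "xs : nlists n M" for xs using that by simp
have "keys w <= nlists n M" if "w : tpow_rel n M R" for w
 using that unfolding tpow_rel_span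
proof(rule span_keys)
 fix g assume "g : tpow_gens n M R"
 thus "keys g <= nlists n M"
  unfolding tpow_gens_def Un_iff
  apply (elim disjE CollectE exE conjE)
  apply (simp_all only: )
  apply (intro keys_diff_sub keys_fscale_sub k; simp add: nlists_def kclosed_add[OF cl(1)] kclosed_scl[OF cl(1)] cl(2,3))+
  done
qed
hence "keys (nf (tpow_rel n M R) v) <= nlists n M"
 by(intro nf_keys_subspace[OF subspace_tpow_rel v(1)])
with v(2) show ?thesis by simp
qed

subsection \<open>Faces\<close>

definition mrg :: "('m => 'm => 'm) => nat => 'm list => 'm list" where
"mrg mul i xs = take i xs @ mul (xs ! i) (xs ! (i + 1)) # drop (i + 2) xs"

lemma mrg_0 [simp]: "mrg mul 0 (x # y # ys) = mul x y # ys"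
and mrg_Suc [simp]: "mrg mul (Suc i) (x # xs) = x # mrg mul i xs"
by(simp_all add: mrg_def)

lemma mrg_append: "i + 1 < length xs ==> mrg mul i (xs @ ys) = mrg mul i xs @ ys"
by(simp add: mrg_def nth_append)

lemma mrg_append': "mrg mul (length xs + i) (xs @ ys) = xs @ mrg mul i ys"
by(induction xs) auto

lemma mrg_nlists:
assumes "!!x y. x : car M ==> y : car M ==> mul x y : car M"
shows "i < n ==> xs : nlists (Suc n) M ==> mrg mul i xs : nlists n M"
proof(induction i arbitrary: n xs)
case 0
thus ?case using assms by(cases n)(auto simp: nlists_Suc)
next
case (Suc i)
then obtain n' where n: "n = Suc n'" "i < n'" by(cases n) auto
then obtain x ys where "xs = x # ys" "x : car M" "ys : nlists (Suc n') M"
 using Suc.prems(2) unfolding nlists_Suc[of xs] by blast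
thus ?case using Suc.IH n by simp
qed

lemma tlin_mrg:
assumes mul: "!!x y. x : car M ==> y : car M ==> mul x y : car M"
 "!!y. y : car M ==> klin M M (%x. mul x y)" "!!x. x : car M ==> klin M M (mul x)"
 "!!x y r. x : car M ==> y : car M ==> r : R ==> mul (rac M x r) y = mul x (lac M r y)"
 "!!x y r. x : car M ==> y : car M ==> r : R ==> mul x (rac M y r) = rac M (mul x y) r"
 "!!x y r. x : car M ==> y : car M ==> r : R ==> mul (lac M r x) y = lac M r (mul x y)"
shows "i < n ==> tlin n M R F ==> tlin (Suc n) M R (%xs. F (mrg mul i xs))"
proof(induction i arbitrary: n F)
case 0
then obtain n' where n: "n = Suc n'" by(cases n) auto
have 1: "lin_on M (%m. F (mrg mul 0 (m # ys)))" if ys: "ys : nlists n M" for ys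
proof -
 obtain y zs where "ys = y # zs" "y : car M" "zs : nlists n' M" using ys unfolding n nlists_Suc by blast
 thus ?thesis using 0 n lin_on_comp[of M "%m. F (m # zs)" M "%x. mul x y"] mul(2) by simp
qed
have 2: "tlin n M R (%ys. F (mrg mul 0 (m # ys)))" if m: "m : car M" for m
proof -
 have "lin_on M (%y. F (mul m y # zs))" if "zs : nlists n' M" for zs
  using 0 n that m lin_on_comp[of M "%m. F (m # zs)" M "mul m"] mul(3) by simp
 moreover have "tlin n' M R (%zs. F (mul m y # zs))" if "y : car M" for y
  using 0 n that m mul(1) by simp
 moreover have "F (mul m (rac M y r) # y' # zs) = F (mul m y # lac M r y' # zs)"
  if "y : car M" "r : R" "y' # zs : nlists n' M" for y r y' zs
  using 0 n that m mul(1,5) by simp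
 ultimately show ?thesis unfolding n by simp
qed
have 3: "F (mrg mul 0 (rac M m r # m' # ys)) = F (mrg mul 0 (m # lac M r m' # ys))" if "m : car M" "r : R" "m' # ys : nlists n M" for m r m' ys
 using that mul(4) by simp
show ?case using 1 2 3 by simp
next
case (Suc i)
then obtain n' where n: "n = Suc n'" "i < n'" by(cases n) auto
have 1: "lin_on M (%m. F (m # mrg mul i ys))" if "ys : nlists n M" for ys
 using Suc.prems n that mrg_nlists[of M mul i n' ys] mul(1) by simp
have 2: "tlin n M R (%ys. F (m # mrg mul i ys))" if m: "m : car M" for m
 using Suc.IH[of n' "%ys. F (m # ys)"] Suc.prems n m by simp
have 3: "F (rac M m r # mrg mul i (y # ys)) = F (m # mrg mul i (lac M r y # ys))" if m: "m : car M" "r : R" "y # ys : nlists n M" for m r y ys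
proof(cases i)
 case 0
 then obtain z zs where z: "ys = z # zs" "z : car M" using m n by(cases ys; cases n')(auto simp: nlists_def)
 have "mul y z # zs : nlists n' M" using mrg_nlists[of M mul i n' "y # ys"] mul(1) n m z 0 by simp
 thus ?thesis using Suc.prems(2) n m z 0 mul(6) by simp
next
 case (Suc i')
 have "mrg mul i (y # ys) : nlists n' M" using mrg_nlists[of M mul i n' "y # ys"] mul(1) n m by simp
 thus ?thesis using Suc.prems(2) n m Suc by simp
qed
show ?case using 1 2 3 by simp
qed

declare tlin.simps(2) [simp del]

section \<open>The diagonal on the bar resolution of \<open>H\<close>\<close>

lemma sum_lessThan_split: "(\<Sum>i<a + b. f i) = (\<Sum>i<a. f i) + (\<Sum>j<b. f (a + j :: nat))"
by(induction b)(auto simp: add.assoc)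

context hopf_galois_ext
begin

lemma nlists_Hk: "xs : nlists n Hk <-> length xs = n"
by(simp add: nlists_def)

abbreviation "hlin n F == tlin n Hk UNIV F"

lemma hlin_Suc: "hlin (Suc n) F <-> (ALL ys. length ys = n --> lin_on Hk (%m. F (m # ys))) & (ALL m. hlin n (%ys. F (m # ys)))"
proof -
have "F (hs c m # m' # ys) = F (m # hs c m' # ys)"
 if "ALL ys. length ys = n --> lin_on Hk (%m. F (m # ys))" "ALL m. hlin n (%ys. F (m # ys))" "length (m' # ys) = n" for c m m' ys
proof -
 have "F (hs c m # m' # ys) = c *. F (m # m' # ys)"
  using that(1,3) by(auto simp: lin_on_Hk)
 also have "... = F (m # hs c m' # ys)"
  using tlin_lin[OF that(2)[rule_format, of m], where xs = "[]" and ys = ys] that(3) by(simp add: lin_on_Hk)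
 finally show ?thesis .
qed
thus ?thesis by(auto simp: tlin.simps nlists_Hk)
qed

lemma Hsplit_keys: "(g, gs) : keys (Hsplit ks) ==> length gs = length ks"
proof(induction ks arbitrary: g gs)
case (Cons h ks)
thus ?case
 by(auto dest!: subsetD[OF keys_bind] split: prod.splits)
qed simp

text \<open>\<open>hshift h\<close> absorbs the first letter \<open>h\<close> of a word into the functional. Statements about \<open>Hsplit\<close>
are thus proved by induction on the word for all functionals that are multilinear in the sense of
\<open>hgood\<close>, a class which is stable under \<open>hshift\<close>.\<close>

definition hgood where
"hgood n P == (ALL gs. length gs = n --> lin_on Hk (%g. P g gs)) & (ALL g. hlin n (P g))"

definition hshift where
"hshift h P g gs = comul h >> (h1,h2). P (h1 * g) (h2 # gs)"

lemma lin_on_mult_left: "lin_on Hk f ==> lin_on Hk (%g. f (h * g))"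
and lin_on_mult_right: "lin_on Hk f ==> lin_on Hk (%g. f (g * h))"
by(auto simp: lin_on_Hk distrib_left distrib_right)

lemma hgood_hshift: "hgood (Suc n) P ==> hgood n (hshift h P)"
unfolding hgood_def hshift_def hlin_Suc
by(auto intro!: lin_on_bind2 tlin_bind2 lin_on_mult_left)

lemma Hsplit_Cons: "Hsplit (h # ks) >> (g,gs). P g gs = comul h >> (h1,h2). Hsplit ks >> (g,gs). P (h1 * g) (h2 # gs)"
by(simp add: bind_assoc2)

lemma Hsplit_hshift: "Hsplit (h # ks) >> (g,gs). P g gs = Hsplit ks >> (g,gs). hshift h P g gs"
unfolding Hsplit_Cons hshift_def by(rule bind_commute2)

lemma lin_comul: "lin_on Hk comul"
by(simp add: lin_on_Hk)

lemma hlin_Hsplit: "hgood n P ==> hlin n (%ks. Hsplit ks >> (g,gs). P g gs)"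
proof(induction n arbitrary: P)
case (Suc n)
have "lin_on Hk (%h. Hsplit (h # ks) >> (g,gs). P g gs)" for ks
 unfolding Hsplit_Cons by(intro lin_on_bind_left lin_comul)
moreover have "hlin n (%ks. Hsplit (h # ks) >> (g,gs). P g gs)" for h
 unfolding Hsplit_hshift by(rule Suc.IH[OF hgood_hshift[OF Suc.prems]])
ultimately show ?case unfolding hlin_Suc by blast
qed simp

lemma Hsplit_append:
"Hsplit (xs @ ys) >> (g,gs). P g gs = Hsplit xs >> (g,gs). Hsplit ys >> (g',gs'). P (g * g') (gs @ gs')"
proof(induction xs arbitrary: P)
case Nil
thus ?case by simp
next
case (Cons x xs)
thus ?case by(simp only: append_Cons Hsplit_Cons Cons.IH mult.assoc)
qed

lemma Hsplit_single: "Hsplit [h] >> (g,gs). P g gs = comul h >> (h1,h2). P h1 [h2]"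
by(simp add: bind_assoc2)

lemma Hsplit_mrg:
assumes "hgood n P" "i < n" "length ks = Suc n"
shows "Hsplit (mrg (*) i ks) >> (g,gs). P g gs = Hsplit ks >> (g,gs). P g (mrg (*) i gs)"
using assms
proof(induction i arbitrary: n P ks)
case 0
then obtain n' x y zs where n: "n = Suc n'" "ks = x # y # zs" "length zs = n'"
 by(cases n; cases ks; cases "tl ks") auto
have "balU Hk Hk (%a b. Hsplit zs >> (g,gs). P (a * g) (b # gs))"
 unfolding bal_Hk_Hk
 using 0 n by(auto simp: hgood_def hlin_Suc intro!: lin_on_bind2 lin_on_mult_right dest: Hsplit_keys)
from comul_mult_bind[OF this] show ?case
 by(simp add: n Hsplit_Cons mult.assoc del: Hsplit.simps)
next
case (Suc i)
then obtain n' x ys where n: "n = Suc n'" "ks = x # ys" "length ys = Suc n'" "i < n'"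
 by(cases n; cases ks) auto
have "Hsplit (mrg (*) i ys) >> (g,gs). hshift x P g gs = Hsplit ys >> (g,gs). hshift x P g (mrg (*) i gs)"
 using Suc.IH[OF hgood_hshift] Suc.prems n by blast
moreover have "hshift x (%g gs. P g (mrg (*) (Suc i) gs)) = (%g gs. hshift x P g (mrg (*) i gs))"
 by(simp add: hshift_def fun_eq_iff)
ultimately show ?case unfolding n mrg_Suc Hsplit_hshift by simp
qed

lemma Hsplit_coassoc:
assumes "!!gs. length gs = length ks ==> balU Hk Hk (%a b. P a b gs)" "!!a b. hlin (length ks) (P a b)"
shows "Hsplit ks >> (g,gs). comul g >> (a,b). P a b gs
   = Hsplit ks >> (g,gs). Hsplit gs >> (g',gs'). P g g' gs'"
using assms
proof(induction ks arbitrary: P)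
case Nil
thus ?case by(simp add: comul_one tns_bind)
next
case (Cons h ks)
define P' where "P' a b gs = comul h >> (h1,h2). comul h1 >> (c,d). P (c * a) (d * b) (h2 # gs)" for a b gs
have l: "lin_on Hk (%a. P a b gs)" "lin_on Hk (%b. P a b gs)" if "length gs = Suc (length ks)" for a b gs
 using Cons.prems(1)[of gs] that by(auto simp: bal_Hk_Hk)
have l3: "lin_on Hk (%h. P a b (h # gs))" if "length gs = length ks" for a b gs
 using Cons.prems(2)[of a b] that by(simp add: hlin_Suc)
have P'2: "P' a b gs = comul h >> (h1,h2). comul h2 >> (c,d). P (h1 * a) (c * b) (d # gs)" if "length gs = length ks" for a b gs
 unfolding P'_def
 by(rule comul_coassoc)(use that in "auto simp: tribal_HHH intro!: l3 lin_on_mult_right l")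
have "Hsplit (h # ks) >> (g,gs). comul g >> (a,b). P a b gs
  = comul h >> (h1,h2). Hsplit ks >> (g,gs). comul (h1 * g) >> (a,b). P a b (h2 # gs)"
 by(rule Hsplit_Cons)
also have "... = comul h >> (h1,h2). Hsplit ks >> (g,gs). comul h1 >> (c,d). comul g >> (a,b).
   P (c * a) (d * b) (h2 # gs)"
 by(intro bind_cong2 comul_mult_bind Cons.prems(1))(auto dest: Hsplit_keys)
also have "... = Hsplit ks >> (g,gs). comul g >> (a,b). P' a b gs"
 unfolding P'_def
 by(rule bind_pull, rule sym, rule bind_pull, rule bind_commute2)
also have "... = Hsplit ks >> (g,gs). Hsplit gs >> (g',gs'). P' g g' gs'"
proof(rule Cons.IH)
 show "balU Hk Hk (%a b. P' a b gs)" if "length gs = length ks" for gs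
  unfolding P'_def bal_Hk_Hk using that by(auto intro!: lin_on_bind2 lin_on_mult_left l)
 show "hlin (length ks) (P' a b)" for a b
  unfolding P'_def using Cons.prems(2) by(auto intro!: tlin_bind2 simp: hlin_Suc)
qed
also have "... = Hsplit ks >> (g,gs). Hsplit gs >> (g',gs'). comul h >> (h1,h2). comul h2 >> (c,d). P (h1 * g) (c * g') (d # gs')"
 by(intro bind_cong2 P'2)(auto dest!: Hsplit_keys)
also have "... = comul h >> (h1,h2). Hsplit ks >> (g,gs). comul h2 >> (c,d). Hsplit gs >> (g',gs'). P (h1 * g) (c * g') (d # gs')"
 by(rule sym, rule bind_pull, rule sym, rule bind_pull, rule bind_commute2)
also have "... = Hsplit (h # ks) >> (g,gs). Hsplit gs >> (g',gs'). P g g' gs'"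
 unfolding Hsplit_Cons ..
finally show ?case .
qed

subsection \<open>The complex \<open>L\<close>\<close>

lemma L_cx_simps [simp]: "scl (L_cx n) = fscale" "lac (L_cx n) = fscale" "rac (L_cx n) = Lact n"
by(simp_all add: L_cx_def)

abbreviation "Lcar n == car (L_cx n)"

lemma Lcar: "Lcar n = tpow_car (Suc n) Hk UNIV"
by(simp add: L_cx_def)

lemma subspace_L [simp]: "fv.subspace (Lcar n)"
unfolding Lcar by(rule subspace_tpow)

lemma L_closed [simp]: "0 : Lcar n" "x : Lcar n ==> y : Lcar n ==> x + y : Lcar n" "x : Lcar n ==> y : Lcar n ==> x - y : Lcar n"
"x : Lcar n ==> c*.x : Lcar n"
using subspace_L[of n] fv.subspace_diff unfolding fv.subspace_def by blast+

lemma kclosed_L [simp]: "kclosed (Lk n)" "kclosed (L_cx n)"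
by(simp_all add: kclosed_def)

lemma Lp_in [simp]: "length xs = Suc n ==> Lp n xs : Lcar n"
by(simp add: Lcar Lp_def tpow_elt_in nlists_Hk)

lemma hlin_Lp: "hlin (Suc n) (Lp n)"
using tlin_tpow_elt[of "Suc n" "Hk" UNIV] by(simp add: Lp_def[abs_def])

lemma Lp_bind: "hlin (Suc n) F ==> (Lp n xs >> F) = F xs"
by(simp add: Lp_def tpow_bind)

lemma L_keys: "xs : keys l ==> l : Lcar n ==> length xs = Suc n"
using tpow_keys[of "Hk" UNIV l "Suc n"] by(auto simp: Lcar nlists_Hk)

lemma L_eqI:
assumes "l : Lcar n" "lin_on (Lk n) f" "lin_on (Lk n) g" "!!xs. length xs = Suc n ==> f (Lp n xs) = g (Lp n xs)"
shows "f l = g l"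
by(rule tpow_lin_eqI[of l "Lk n" "Suc n" "Hk" UNIV])(use assms in "auto simp: Lcar nlists_Hk Lp_def")

lemma hlin_comp: "hlin (Suc n) F ==> (!!xs. length xs = Suc n ==> F xs : Lcar m) ==> lin_on (Lk m) f ==> hlin (Suc n) (%xs. f (F xs))"
by(rule tlin_comp_lin[where N = "Lk m"])(auto simp: nlists_Hk)

lemma hlin_snoc: "hlin n F ==> n = Suc (length xs) ==> lin_on Hk (%g. F (xs @ [g]))"
using tlin_lin[of n "Hk" UNIV F xs "[]"] by simp

lemma hlin_append_right: "hlin n F ==> n = m + length ys ==> hlin m (%xs. F (xs @ ys))"
proof(induction m arbitrary: n F)
case (Suc m)
thus ?case by(auto simp: hlin_Suc)
qed simp

lemma hlin_cong: "(!!xs. length xs = n ==> F xs = F' xs) ==> hlin n F ==> hlin n F'"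
proof(induction n arbitrary: F F')
case (Suc n)
have "lin_on Hk (%m. F' (m # ys))" if "length ys = n" for ys
 using Suc.prems that by(simp add: hlin_Suc lin_on_Hk)
moreover have "hlin n (%ys. F' (m # ys))" for m
 by(rule Suc.IH[of "%ys. F (m # ys)"])(use Suc.prems in "auto simp: hlin_Suc")
ultimately show ?case by(simp add: hlin_Suc)
qed simp

lemma hlin_last: "hlin (Suc n) F ==> hlin (Suc n) (%xs. F (butlast xs @ [last xs * h]))"
proof(induction n arbitrary: F)
case 0
thus ?case using lin_on_mult_right[of "%m. F [m]" h] by(simp add: hlin_Suc)
next
case (Suc n)
have 1: "hlin (Suc n) (%ys. F (butlast (m # ys) @ [last (m # ys) * h]))" for m
proof(rule hlin_cong)
 show "hlin (Suc n) (%ys. F (m # butlast ys @ [last ys * h]))"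
  using Suc.IH[of "%ys. F (m # ys)"] Suc.prems by(simp add: hlin_Suc[of "Suc n"])
qed auto
have 2: "lin_on Hk (%m. F (butlast (m # ys) @ [last (m # ys) * h]))" if "length ys = Suc n" for ys
proof -
 have "length (butlast ys @ [last ys * h]) = Suc n" "ys ~= []" using that by auto
 thus ?thesis using Suc.prems by(simp add: hlin_Suc[of "Suc n"])
qed
show ?case using 1 2 unfolding hlin_Suc[of "Suc n"] by blast
qed

lemma Lact_Lp: "Lact n (Lp n ks) h = Lp n (butlast ks @ [last ks * h])"
unfolding Lact_def by(rule Lp_bind) (rule hlin_last[OF hlin_Lp])

lemma Lact_in [simp]: "l : Lcar n ==> Lact n l h : Lcar n"
unfolding Lact_def by(intro bind_in_subspace[OF subspace_L] Lp_in)(auto dest: L_keys)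

lemma Lact_lin [simp]: "Lact n (l + l') h = Lact n l h + Lact n l' h" "Lact n (c*.l) h = c *. Lact n l h"
by(simp_all add: Lact_def bind_linear)

lemma lin_hlin_Lp: "lin_on (Lk n) f ==> hlin (Suc n) (%xs. f (Lp n xs))"
by(rule hlin_comp[OF hlin_Lp]) auto

lemma hgood_DeltaL:
assumes F: "balL p q F" and xs: "length xs = p"
shows "hgood (Suc q) (%g gs. F (Lp p (xs @ [g])) (Lp q gs))"
proof -
have A: "hlin (Suc p) (%ks. F (Lp p ks) (Lp q gs))" if "length gs = Suc q" for gs
 by(rule lin_hlin_Lp)(use F that in "auto simp: bal_def")
have "lin_on Hk (%g. F (Lp p (xs @ [g])) (Lp q gs))" if "length gs = Suc q" for gs
 by(rule hlin_snoc[OF A[OF that]])(simp add: xs)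
moreover have "hlin (Suc q) (%gs. F (Lp p (xs @ [g])) (Lp q gs))" for g
 by(rule lin_hlin_Lp)(use F xs in "auto simp: bal_def")
ultimately show ?thesis by(simp add: hgood_def)
qed

lemma tlin_DeltaL:
assumes F: "balL p q F"
shows "hlin (p + Suc q) (%ks. Hsplit (drop p ks) >> (g,gs). F (Lp p (take p ks @ [g])) (Lp q gs))"
proof -
define D where "D xs ys = Hsplit ys >> (g,gs). F (Lp p (xs @ [g])) (Lp q gs)" for xs ys
have 1: "hlin p (%xs. D xs ys)" if "length ys = Suc q" for ys
 unfolding D_def
proof(rule tlin_bind2)
 fix g gs assume "(g, gs) : keys (Hsplit ys)"
 hence "length gs = Suc q" using Hsplit_keys that by auto
 hence "hlin (Suc p) (%ks. F (Lp p ks) (Lp q gs))"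
  by(intro lin_hlin_Lp)(use F in "auto simp: bal_def")
 thus "hlin p (%xs. F (Lp p (xs @ [g])) (Lp q gs))"
  by(rule hlin_append_right) simp
qed
have 2: "hlin (Suc q) (D xs)" if "length xs = p" for xs
 unfolding D_def by(rule hlin_Hsplit[OF hgood_DeltaL[OF F that]])
have 3: "D (us @ [hs c u]) (v # vs) = D (us @ [u]) (hs c v # vs)" if "length (us @ [u]) = p" "length (v # vs) = Suc q" for us u v vs c
proof -
 have "D (us @ [hs c u]) (v # vs) = c *. D (us @ [u]) (v # vs)"
  using hlin_snoc[OF 1[OF that(2)], of us] that by(simp add: lin_on_Hk)
 also have "... = D (us @ [u]) (hs c v # vs)"
  using 2[OF that(1)] that by(simp add: hlin_Suc lin_on_Hk)
 finally show ?thesis .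
qed
have "hlin (p + Suc q) (%zs. D (take p zs) (drop p zs))"
 using 1 2 3 by(intro tlin_append)(auto simp: nlists_Hk)
thus ?thesis by(simp add: D_def)
qed

lemma DeltaL_bind_gen:
assumes F: "balL p q F"
shows "DeltaL p q l >> (a,b). F a b = l >> ks. Hsplit (drop p ks) >> (g,gs). F (Lp p (take p ks @ [g])) (Lp q gs)"
unfolding DeltaL_def bind_assoc[of l] bind_assoc2 tns_bind[OF F] ..

lemma DeltaL_Lp:
assumes F: "balL p q F" and xs: "length xs = p"
shows "DeltaL p q (Lp (p + q) (xs @ ys)) >> (a,b). F a b = Hsplit ys >> (g,gs). F (Lp p (xs @ [g])) (Lp q gs)"
proof -
have "hlin (Suc (p + q)) (%ks. Hsplit (drop p ks) >> (g,gs). F (Lp p (take p ks @ [g])) (Lp q gs))"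
 using tlin_DeltaL[OF F] by simp
from Lp_bind[OF this, of "xs @ ys"] xs show ?thesis by(simp add: DeltaL_bind_gen[OF F])
qed

lemma DeltaL_in [simp]: "l : Lcar (p + q) ==> DeltaL p q l : car ((Lk p) ** (Lk q))"
unfolding DeltaL_def
by(intro bind_in_subspace[OF subspace_tensor] tensor_bind_in tns_in)(auto dest!: L_keys Hsplit_keys)

lemma closed_L [simp]: "rclosed (Lk n) UNIV" "lclosed UNIV (Lk n)"
by(simp_all add: rclosed_def lclosed_def)

lemma DeltaL_keys:
assumes "(a, b) : keys (DeltaL p q l)" "l : Lcar (p + q)"
shows "a : Lcar p" "b : Lcar q"
using tensor_keysD[OF assms(1) DeltaL_in[OF assms(2)]] by simp_all

lemma DeltaL_lin [simp]: "DeltaL p q (l + l') = DeltaL p q l + DeltaL p q l'" "DeltaL p q (c*.l) = c *. DeltaL p q l"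
by(simp_all add: DeltaL_def bind_linear)

lemma lin_DeltaL_bind: "lin_on (Lk n) (%l. DeltaL p q l >> f)"
by(simp add: lin_on_def bind_linear)

lemma bal_L: "balL p q F <-> (ALL b:Lcar q. lin_on (Lk p) (%a. F a b)) & (ALL a:Lcar p. lin_on (Lk q) (F a))"
by(auto simp: bal_def lin_on_def)

lemma klin_Lact: "klin (Lk n) (Lk n) (%l. Lact n l h)"
by(simp add: klin_def)

lemma DeltaL_Lact:
assumes F: "balL p q F" and l: "l : Lcar (p + q)"
shows "DeltaL p q (Lact (p + q) l h) >> (a,b). F a b
  = comul h >> (h1,h2). DeltaL p q l >> (a,b). F (Lact p a h1) (Lact q b h2)"
proof(rule L_eqI[OF l])
show "lin_on (Lk (p + q)) (%l. DeltaL p q (Lact (p + q) l h) >> (a,b). F a b)"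
 by(simp add: lin_on_def bind_linear)
show "lin_on (Lk (p + q)) (%l. comul h >> (h1,h2). DeltaL p q l >> (a,b). F (Lact p a h1) (Lact q b h2))"
 by(intro lin_on_bind2 lin_DeltaL_bind)
fix ks :: "'h list" assume len: "length ks = Suc (p + q)"
obtain xs ys y where ks: "ks = xs @ ys @ [y]" "length xs = p" "length ys = q"
proof
 have "drop p ks ~= []" using len by simp
 thus "ks = take p ks @ butlast (drop p ks) @ [last (drop p ks)]"
  by(metis append_butlast_last_id append_take_drop_id)
qed (use len in auto)
have F': "balL p q (%a b. F (Lact p a h1) (Lact q b h2))" for h1 h2
 using F unfolding bal_L by(auto intro!: lin_on_comp[OF _ klin_Lact])
have "balU Hk Hk (%y1 y2. F (Lp p (xs @ [g * y1])) (Lp q (gs @ [y2])))" if "length gs = q" for g gs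
proof -
 have 1: "lin_on Hk (%y1. F (Lp p (xs @ [y1])) (Lp q (gs @ [y2])))" for y2
  using hgood_DeltaL[OF F ks(2)] that by(simp add: hgood_def)
 have 2: "lin_on Hk (%y2. F (Lp p (xs @ [y1])) (Lp q (gs @ [y2])))" for y1
 proof(rule hlin_snoc)
  show "hlin (Suc q) (%gs. F (Lp p (xs @ [y1])) (Lp q gs))"
   using hgood_DeltaL[OF F ks(2)] by(simp add: hgood_def)
 qed (simp add: that)
 show ?thesis unfolding bal_Hk_Hk using lin_on_mult_left[OF 1] 2 by auto
qed
note m = comul_mult_bind[OF this]
have "DeltaL p q (Lact (p + q) (Lp (p + q) ks) h) >> (a,b). F a b
 = Hsplit (ys @ [y * h]) >> (g,gs). F (Lp p (xs @ [g])) (Lp q gs)"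
 using DeltaL_Lp[OF F ks(2), of "ys @ [y * h]"] by(simp add: Lact_Lp ks butlast_append)
also have "... = Hsplit ys >> (g,gs). comul y >> (y1,y2). comul h >> (h1,h2). F (Lp p (xs @ [g * (y1 * h1)])) (Lp q (gs @ [y2 * h2]))"
 unfolding Hsplit_append Hsplit_single by(intro bind_cong2 m)(auto dest: Hsplit_keys simp: ks)
also have "... = comul h >> (h1,h2). Hsplit ys >> (g,gs). comul y >> (y1,y2). F (Lp p (xs @ [g * y1 * h1])) (Lp q (gs @ [y2 * h2]))"
 unfolding mult.assoc by(rule sym, rule bind_pull, rule bind_commute2)
also have "... = comul h >> (h1,h2). DeltaL p q (Lp (p + q) ks) >> (a,b). F (Lact p a h1) (Lact q b h2)"
 unfolding ks(1) DeltaL_Lp[OF F' ks(2)] Hsplit_append Hsplit_single Lact_Lp by simp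
finally show "(DeltaL p q (Lact (p + q) (Lp (p + q) ks) h) >> (a,b). F a b) =
 (comul h >> (h1,h2). DeltaL p q (Lp (p + q) ks) >> (a,b). F (Lact p a h1) (Lact q b h2))" .
qed

lemma dL_Suc: "dL (Suc n) l = l >> ks. counit (hd ks) *. Lp n (tl ks) +
 (\<Sum>i<Suc n. ((-1) ^ Suc i) *. Lp n (mrg (*) i ks))"
unfolding dL_def mrg_def One_nat_def sum.atLeast1_atMost_eq by simp

lemma hlin_dL: "hlin (Suc (Suc n)) (%ks. counit (hd ks) *. Lp n (tl ks) +
 (\<Sum>i<Suc n. ((-1) ^ Suc i) *. Lp n (mrg (*) i ks)))"
proof(intro tlin_plus tlin_sum tlin_fscale)
show "hlin (Suc (Suc n)) (%ks. counit (hd ks) *. Lp n (tl ks))"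
 unfolding hlin_Suc[of "Suc n"]
 by(auto simp: lin_on_Hk fv.scale_left_distrib intro!: tlin_fscale hlin_Lp)
show "hlin (Suc (Suc n)) (%ks. Lp n (mrg (*) i ks))" if "i : {..<Suc n}" for i
 by(rule tlin_mrg)(use that in "auto simp: klin_def distrib_left distrib_right hlin_Lp")
qed

lemma dL_Lp: "dL (Suc n) (Lp (Suc n) ks) = counit (hd ks) *. Lp n (tl ks) +
 (\<Sum>i<Suc n. ((-1) ^ Suc i) *. Lp n (mrg (*) i ks))"
unfolding dL_Suc by(rule Lp_bind[OF hlin_dL])

lemma dL_0 [simp]: "dL 0 l = 0"
by(simp add: dL_def)

lemma dL_lin [simp]: "dL n (l + l') = dL n l + dL n l'" "dL n (c*.l) = c *. dL n l"
by(simp_all only: dL_def bind_add_left bind_scale_left) simp_all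

lemma mrg_length: "i + 1 < length xs ==> length (mrg mul i xs) = length xs - 1"
by(simp add: mrg_def)

lemma subspace_sum': "fv.subspace S ==> (!!i. i : I ==> f i : S) ==> sum f I : S"
by(rule fv.subspace_sum)

lemma dL_in [simp]: "l : Lcar (Suc n) ==> dL (Suc n) l : Lcar n"
unfolding dL_Suc
by(intro bind_in_subspace[OF subspace_L] L_closed(2,4) subspace_sum'[OF subspace_L] Lp_in)
 (auto dest: L_keys simp: mrg_length)

lemma lin_dL_Lp:
assumes f: "lin_on (Lk n) f" and ks: "length ks = Suc (Suc n)"
shows "f (dL (Suc n) (Lp (Suc n) ks)) = counit (hd ks) *. f (Lp n (tl ks)) + (\<Sum>i<Suc n. ((-1) ^ Suc i) *. f (Lp n (mrg (*) i ks)))"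
proof -
have i: "Lp n (tl ks) : Lcar n" "!!i. i < Suc n ==> Lp n (mrg (*) i ks) : Lcar n" using ks by(auto simp: mrg_length)
hence S: "(\<Sum>i<Suc n. ((-1) ^ Suc i) *. Lp n (mrg (*) i ks)) : Lcar n"
 by(intro subspace_sum'[OF subspace_L] L_closed(4)) simp
have sc: "f (c*.x) = c *. f x" if "x : Lcar n" for c x using lin_on_scale[OF f] that by simp
have "f (\<Sum>i<Suc n. ((-1) ^ Suc i) *. Lp n (mrg (*) i ks)) = (\<Sum>i<Suc n. f (((-1) ^ Suc i) *. Lp n (mrg (*) i ks)))"
 by(rule lin_on_sum[OF kclosed_L(1) f])(use i in "auto simp del: power_Suc")
also have "... = (\<Sum>i<Suc n. ((-1) ^ Suc i) *. f (Lp n (mrg (*) i ks)))"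
 by(intro sum.cong refl sc i) simp
finally show ?thesis using lin_on_add[OF f] S i(1) sc unfolding dL_Lp by simp
qed

lemma klin_dL: "klin (Lk (Suc n)) (Lk n) (dL (Suc n))"
by(simp add: klin_def)

lemma dL_Lact:
assumes l: "l : Lcar (Suc n)"
shows "dL (Suc n) (Lact (Suc n) l h) = Lact n (dL (Suc n) l) h"
proof(rule L_eqI[OF l])
show "lin_on (Lk (Suc n)) (%l. dL (Suc n) (Lact (Suc n) l h))" "lin_on (Lk (Suc n)) (%l. Lact n (dL (Suc n) l) h)"
 by(simp_all add: lin_on_def)
fix ks :: "'h list" assume len: "length ks = Suc (Suc n)"
obtain x y zs where ks: "ks = x # y # zs" using len by(cases ks; cases "tl ks") auto
have Lact_sum: "Lact n (\<Sum>i\<in>S. f i) h = (\<Sum>i\<in>S. Lact n (f i) h)" for f and S :: "nat set"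
 by(simp add: Lact_def bind_sum_left)
have m: "mrg (*) i (butlast ks @ [last ks * h]) = butlast (mrg (*) i ks) @ [last (mrg (*) i ks) * h]" if "i < Suc n" for i
proof(cases "i = n")
 case True
 obtain us u v where "ks = us @ [u, v]" "length us = n"
 proof
  show "ks = take n ks @ [ks ! n, ks ! Suc n]"
   using len by(intro nth_equalityI)(auto simp: nth_append less_Suc_eq)
 qed (use len in auto)
 thus ?thesis using True by(simp add: mrg_def butlast_append nth_append mult.assoc)
next
 case False
 hence i: "i < n" using that by simp
 obtain us v where us: "ks = us @ [v]" "length us = Suc n"
  using len by(metis length_append_singleton nat.inject rev_exhaust list.size(3) nat.distinct(1))
 thus ?thesis using i by(simp add: mrg_append)
qed
have "butlast (tl ks) @ [last (tl ks) * h] = tl (butlast ks @ [last ks * h])" "hd (butlast ks @ [last ks * h]) = hd ks"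
 unfolding ks by auto
thus "dL (Suc n) (Lact (Suc n) (Lp (Suc n) ks) h) = Lact n (dL (Suc n) (Lp (Suc n) ks)) h"
 unfolding Lact_Lp dL_Lp by(simp add: Lact_sum Lact_Lp m del: sum.lessThan_Suc power_Suc)
qed

lemma DeltaL_coassoc:
assumes F: "tribal (Lk p) UNIV (Lk q) UNIV (Lk r) F" and l: "l : Lcar (p + q + r)"
shows "DeltaL (p + q) r l >> (a,c). DeltaL p q a >> (a,b). F a b c
  = DeltaL p (q + r) l >> (a,c). DeltaL q r c >> (b,c). F a b c" (is "?A l = ?B l")
proof(rule L_eqI[OF l, of ?A ?B])
show "lin_on (Lk (p + q + r)) ?A" "lin_on (Lk (p + q + r)) ?B"
 by(rule lin_DeltaL_bind)+
fix ks :: "'h list" assume len: "length ks = Suc (p + q + r)"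
define xs ys zs where "xs = take p ks" and "ys = take q (drop p ks)" and "zs = drop (p + q) ks"
have ks: "ks = xs @ ys @ zs" "length xs = p" "length ys = q" "length zs = Suc r"
proof -
 show "ks = xs @ ys @ zs"
  unfolding xs_def ys_def zs_def by(metis append_take_drop_id drop_drop add.commute)
qed (use len in "auto simp: xs_def ys_def zs_def")
have Fl: "lin_on (Lk p) (%a. F a b c)" if "b : Lcar q" "c : Lcar r" for b c
 using F that by(simp add: tribal_def bal_def)
have Fm: "lin_on (Lk q) (%b. F a b c)" if "a : Lcar p" "c : Lcar r" for a c
 using F that by(simp add: tribal_def bal_def)
have Fr: "lin_on (Lk r) (F a b)" if "a : Lcar p" "b : Lcar q" for a b
 using F that by(simp add: tribal_def bal_def)
have B1: "balL (p + q) r (%a c. DeltaL p q a >> (a,b). F a b c)"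
 unfolding bal_L by(auto intro!: lin_DeltaL_bind lin_on_bind2 Fr dest: DeltaL_keys)
have B2: "balL p (q + r) (%a c. DeltaL q r c >> (b,c). F a b c)"
 unfolding bal_L by(auto intro!: lin_DeltaL_bind lin_on_bind2 Fl dest: DeltaL_keys)
have B3: "balL p q (%a b. F a b c)" if "c : Lcar r" for c
 using F that by(simp add: tribal_def)
have B4: "balL q r (F a)" if "a : Lcar p" for a
 using F that by(simp add: tribal_def)
have F3: "lin_on Hk (%g. F (Lp p (xs @ [g])) b c)" if "b : Lcar q" "c : Lcar r" for b c
 by(rule hlin_snoc[OF lin_hlin_Lp[OF Fl[OF that]]])(simp add: ks)
have F4: "lin_on Hk (%g. F a (Lp q (gs @ [g])) c)" if "a : Lcar p" "c : Lcar r" "length gs = q" for a c gs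
 by(rule hlin_snoc[OF lin_hlin_Lp[OF Fm[OF that(1,2)]]])(simp add: that)
have "?A (Lp (p + q + r) ks)
 = Hsplit zs >> (g,gs). DeltaL p q (Lp (p + q) (xs @ ys @ [g])) >> (a,b). F a b (Lp r gs)"
 using DeltaL_Lp[OF B1, of "xs @ ys" zs] ks by simp
also have "... = Hsplit zs >> (g,gs). Hsplit (ys @ [g]) >> (g',gs'). F (Lp p (xs @ [g'])) (Lp q gs') (Lp r gs)"
 by(intro bind_cong2 DeltaL_Lp[OF B3 ks(2)])(auto dest: Hsplit_keys simp: ks)
also have "... = Hsplit zs >> (g,gs). Hsplit ys >> (g',gs'). comul g >> (g1,g2). F (Lp p (xs @ [g' * g1])) (Lp q (gs' @ [g2])) (Lp r gs)"
 unfolding Hsplit_append Hsplit_single ..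
also have "... = Hsplit ys >> (g',gs'). Hsplit zs >> (g,gs). comul g >> (g1,g2). F (Lp p (xs @ [g' * g1])) (Lp q (gs' @ [g2])) (Lp r gs)"
 by(rule bind_commute2)
also have "... = Hsplit ys >> (g',gs'). Hsplit zs >> (g,gs). Hsplit gs >> (g2,gs2). F (Lp p (xs @ [g' * g])) (Lp q (gs' @ [g2])) (Lp r gs2)"
proof(rule bind_cong2, rule Hsplit_coassoc)
 fix g' gs' assume "(g', gs') : keys (Hsplit ys)"
 hence gs': "length gs' = q" using Hsplit_keys ks by auto
 show "balU Hk Hk (%g1 g2. F (Lp p (xs @ [g' * g1])) (Lp q (gs' @ [g2])) (Lp r gs))" if "length gs = length zs" for gs
  unfolding bal_Hk_Hk using lin_on_mult_left[OF F3] F4 that gs' ks by auto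
 show "hlin (length zs) (%gs. F (Lp p (xs @ [g' * g1])) (Lp q (gs' @ [g2])) (Lp r gs))" for g1 g2
  unfolding ks by(rule lin_hlin_Lp[OF Fr])(simp_all add: ks gs')
qed
also have "... = Hsplit (ys @ zs) >> (g,gs). Hsplit (drop q gs) >> (g2,gs2). F (Lp p (xs @ [g])) (Lp q (take q gs @ [g2])) (Lp r gs2)"
 unfolding Hsplit_append by(intro bind_cong2)(auto dest!: Hsplit_keys simp: ks)
also have "... = Hsplit (ys @ zs) >> (g,gs). DeltaL q r (Lp (q + r) gs) >> (b,c). F (Lp p (xs @ [g])) b c"
proof(rule bind_cong2)
 fix g gs assume "(g, gs) : keys (Hsplit (ys @ zs))"
 hence len: "length gs = q + Suc r" using Hsplit_keys ks by fastforce
 have "Lp p (xs @ [g]) : Lcar p" using ks by simp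
 from DeltaL_Lp[OF B4[OF this], of "take q gs" "drop q gs"] len
 show "Hsplit (drop q gs) >> (g2,gs2). F (Lp p (xs @ [g])) (Lp q (take q gs @ [g2])) (Lp r gs2)
  = DeltaL q r (Lp (q + r) gs) >> (b,c). F (Lp p (xs @ [g])) b c" by simp
qed
also have "... = ?B (Lp (p + q + r) ks)"
 using DeltaL_Lp[OF B2 ks(2), of "ys @ zs"] ks(1) by(simp add: add.assoc)
finally show "?A (Lp (p + q + r) ks)
 = ?B (Lp (p + q + r) ks)" .
qed

text \<open>The faces inside \<open>xs @ [h]\<close> act on the first factor and those inside \<open>h # ys\<close> on the second. Left over are
the last face of the first factor and the first face of the second, given by the counit. Up to sign both
are \<open>Z\<close> in the proof, and their signs are opposite.\<close>

lemma DeltaL_chain: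
assumes F: "balL p q F" and l: "l : Lcar (p + q + 1)"
shows "DeltaL p q (dL (p + q + 1) l) >> (a,b). F a b
 = (DeltaL (p + 1) q l >> (a,b). F (dL (p + 1) a) b)
 + ((-1) ^ p) *. (DeltaL p (q + 1) l >> (a,b). F a (dL (q + 1) b))" (is "?A l = ?B l + ?e *. ?C l")
proof(rule L_eqI[OF l, of ?A "%l. ?B l + ?e *. ?C l"])
show "lin_on (Lk (p + q + 1)) ?A" "lin_on (Lk (p + q + 1)) (%l. ?B l + ?e *. ?C l)"
 by(simp_all add: lin_on_def bind_linear fscale_plus mult.commute)
fix ks :: "'h list" assume len: "length ks = Suc (p + q + 1)"
obtain xs h ys where ks: "ks = xs @ h # ys" "length xs = p" "length ys = Suc q"
proof
 show "ks = take p ks @ ks ! p # drop (Suc p) ks" using len by(simp add: id_take_nth_drop)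
qed (use len in auto)
have Fl: "lin_on (Lk p) (%a. F a b)" if "b : Lcar q" for b using F that by(simp add: bal_def)
have Fr: "lin_on (Lk q) (F a)" if "a : Lcar p" for a using F that by(simp add: bal_def)
have B1: "balL (Suc p) q (%a b. F (dL (Suc p) a) b)"
 unfolding bal_L by(auto intro!: lin_on_comp[OF Fl klin_dL] Fr)
have B2: "balL p (Suc q) (%a b. F a (dL (Suc q) b))"
 unfolding bal_L by(auto intro!: lin_on_comp[OF Fr klin_dL] Fl)
define D where "D xs ys = Hsplit ys >> (g,gs). F (Lp p (xs @ [g])) (Lp q gs)" for xs ys
have D: "DeltaL p q (Lp (p + q) (xs @ ys)) >> (a,b). F a b = D xs ys" if "length xs = p" "length ys = Suc q" for xs ys
 using DeltaL_Lp[OF F, of xs ys] that by(simp add: D_def)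
let ?xh = "xs @ [h]"
define T where "T = counit (hd ?xh) *. D (tl ?xh) ys"
define M1 where "M1 = (\<Sum>i<p. ((-1) ^ Suc i) *. D (mrg (*) i ?xh) ys)"
define Z where "Z = Hsplit ys >> (%(g,gs). F (Lp p (xs @ [h * g])) (Lp q gs))"
define M2 where "M2 = (\<Sum>j<Suc q. ((-1) ^ Suc j) *. D xs (mrg (*) j (h # ys)))"
have hd_tl: "hd (?xh @ zs) = hd ?xh" "tl (?xh @ zs) = tl ?xh @ zs" for zs by(cases xs; simp)+
have ks': "ks = ?xh @ ys" by(simp add: ks)
have lhs: "?A (Lp (p + q + 1) ks) = T + (M1 + ((-1) ^ p) *. M2)"
proof -
 let ?f = "%l. DeltaL p q l >> (a,b). F a b"
 have "?A (Lp (p + q + 1) ks) = counit (hd ks) *. ?f (Lp (p + q) (tl ks)) + (\<Sum>i<p + Suc q. ((-1) ^ Suc i) *. ?f (Lp (p + q) (mrg (*) i ks)))"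
  using lin_dL_Lp[OF lin_DeltaL_bind len[unfolded Suc_eq_plus1[symmetric]], of p q "%(a,b). F a b"] by(simp del: sum.lessThan_Suc power_Suc)
 also have "?f (Lp (p + q) (tl ks)) = D (tl ?xh) ys" unfolding ks' hd_tl by(rule D)(simp_all add: ks)
 also have "(\<Sum>i<p + Suc q. ((-1) ^ Suc i) *. ?f (Lp (p + q) (mrg (*) i ks))) = M1 + ((-1) ^ p) *. M2"
 proof -
  have "?f (Lp (p + q) (mrg (*) i ks)) = D (mrg (*) i ?xh) ys" if "i < p" for i
   using mrg_append[of i ?xh "(*)" ys] mrg_length[of i ?xh "(*)"] that ks D by simp
  moreover have "?f (Lp (p + q) (mrg (*) (p + j) ks)) = D xs (mrg (*) j (h # ys))" if "j < Suc q" for j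
   using mrg_append'[of "(*)" xs j "h # ys"] mrg_length[of j "h # ys" "(*)"] that ks D[of xs] by simp
  ultimately show ?thesis
   unfolding sum_lessThan_split M1_def M2_def fv.scale_sum_right by(simp add: power_add del: sum.lessThan_Suc)
 qed
 finally show ?thesis unfolding T_def ks' hd_tl .
qed
have rhs1: "?B (Lp (p + q + 1) ks) = T + (M1 + ((-1) ^ Suc p) *. Z)"
proof -
 have m: "mrg (*) i (?xh @ [g]) = mrg (*) i ?xh @ [g]" if "i < p" for i g
  using mrg_append[of i ?xh "(*)" "[g]"] that ks by simp
 have m': "mrg (*) p (?xh @ [g]) = xs @ [h * g]" for g using mrg_append'[of "(*)" xs 0 "[h, g]"] ks by simp
 have "?B (Lp (p + q + 1) ks) = Hsplit ys >> (g,gs). F (dL (Suc p) (Lp (Suc p) (?xh @ [g]))) (Lp q gs)"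
  using DeltaL_Lp[OF B1, of ?xh ys] ks by simp
 also have "... = Hsplit ys >> (g,gs). counit (hd ?xh) *. F (Lp p (tl ?xh @ [g])) (Lp q gs) +
   ((\<Sum>i<p. ((-1) ^ Suc i) *. F (Lp p (mrg (*) i ?xh @ [g])) (Lp q gs)) + ((-1) ^ Suc p) *. F (Lp p (xs @ [h * g])) (Lp q gs))"
 proof(rule bind_cong2)
  fix g gs assume "(g, gs) : keys (Hsplit ys)"
  hence gs: "Lp q gs : Lcar q" using Hsplit_keys ks by auto
  show "F (dL (Suc p) (Lp (Suc p) (?xh @ [g]))) (Lp q gs) = counit (hd ?xh) *. F (Lp p (tl ?xh @ [g])) (Lp q gs) +
   ((\<Sum>i<p. ((-1) ^ Suc i) *. F (Lp p (mrg (*) i ?xh @ [g])) (Lp q gs)) + ((-1) ^ Suc p) *. F (Lp p (xs @ [h * g])) (Lp q gs))"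
   using lin_dL_Lp[OF Fl[OF gs], of "?xh @ [g]"] by(simp add: hd_tl m m' ks del: append_assoc power_Suc)
 qed
 finally show ?thesis unfolding bind_add_right2 bind_scale_right2 bind_sum_right2 T_def M1_def Z_def D_def .
qed
have rhs2: "?C (Lp (p + q + 1) ks) = Z + M2"
proof -
 have "?C (Lp (p + q + 1) ks) = Hsplit (h # ys) >> (g,gs). F (Lp p (xs @ [g])) (dL (Suc q) (Lp (Suc q) gs))"
  using DeltaL_Lp[OF B2, of xs "h # ys"] ks by simp
 also have "... = Hsplit (h # ys) >> (g,gs). counit (hd gs) *. F (Lp p (xs @ [g])) (Lp q (tl gs)) +
   (\<Sum>j<Suc q. ((-1) ^ Suc j) *. F (Lp p (xs @ [g])) (Lp q (mrg (*) j gs)))"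
  by(intro bind_cong2 lin_dL_Lp Fr)(use Hsplit_keys ks in fastforce)+
 also have "... = (Hsplit (h # ys) >> (g,gs). counit (hd gs) *. F (Lp p (xs @ [g])) (Lp q (tl gs))) +
  (\<Sum>j<Suc q. ((-1) ^ Suc j) *. (Hsplit (h # ys) >> (g,gs). F (Lp p (xs @ [g])) (Lp q (mrg (*) j gs))))"
  unfolding bind_add_right2 bind_scale_right2 bind_sum_right2 ..
 also have "(\<Sum>j<Suc q. ((-1) ^ Suc j) *. (Hsplit (h # ys) >> (g,gs). F (Lp p (xs @ [g])) (Lp q (mrg (*) j gs)))) = M2"
  unfolding M2_def D_def
  by(intro sum.cong refl arg_cong[of _ _ "fscale _"] Hsplit_mrg[OF hgood_DeltaL[OF F ks(2)], symmetric])(auto simp: ks)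
 also have "Hsplit (h # ys) >> (g,gs). counit (hd gs) *. F (Lp p (xs @ [g])) (Lp q (tl gs))
   = Hsplit ys >> (g,gs). comul h >> (h1,h2). counit h2 *. F (Lp p (xs @ [h1 * g])) (Lp q gs)"
  unfolding Hsplit_Cons list.sel by(rule bind_commute2)
 also have "... = Z" unfolding Z_def
 proof(intro bind_cong2 comul_counit_right)
  fix g gs assume "(g, gs) : keys (Hsplit ys)"
  hence "lin_on Hk (%g. F (Lp p (xs @ [g])) (Lp q gs))"
   using Hsplit_keys ks hgood_DeltaL[OF F ks(2)] by(auto simp: hgood_def)
  from lin_on_mult_right[OF this] show "lin_on Hk (%a. F (Lp p (xs @ [a * g])) (Lp q gs))" .
 qed
 finally show ?thesis .
qed
show "?A (Lp (p + q + 1) ks) = ?B (Lp (p + q + 1) ks) + ?e *. ?C (Lp (p + q + 1) ks)"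
 unfolding lhs rhs1 rhs2 by(simp add: fscale_plus)
qed

section \<open>The diagonal on the bar resolution of \<open>\<Gamma>\<close>\<close>

lemma GamAop_simps [simp]: "car GamAop = Gam" "scl GamAop = fscale" "lac GamAop a u = be 1 a *~ u"
"rac GamAop u a = u *~ be 1 a"
by(simp_all add: GamAop_def)

abbreviation "GL n == nlists n GamAop"
abbreviation "glin n F == tlin n GamAop A F"

lemma lin_on_GamAop: "lin_on GamAop f <-> lin_on GamA f"
by(simp add: lin_on_def)

lemma glin_Suc: "glin (Suc n) F <-> (ALL ys:GL n. lin_on GamA (%m. F (m # ys))) & (ALL m:Gam. glin n (%ys. F (m # ys))) &
  (ALL m:Gam. ALL a:A. ALL m' ys. m' # ys : GL n --> F (m *~ be 1 a # m' # ys) = F (m # be 1 a *~ m' # ys))"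
by(simp add: tlin.simps(2) lin_on_GamAop)

lemma glin_SucI:
assumes "!!ys. ys : GL n ==> lin_on GamA (%m. F (m # ys))" "!!m. m : Gam ==> glin n (%ys. F (m # ys))"
 "!!m a m' ys. m : Gam ==> a : A ==> m' : Gam ==> m' # ys : GL n ==>
   F (m *~ be 1 a # m' # ys) = F (m # be 1 a *~ m' # ys)"
shows "glin (Suc n) F"
unfolding glin_Suc using assms by auto

lemma
assumes "glin (Suc n) F"
shows glin_head: "ys : GL n ==> lin_on GamA (%m. F (m # ys))"
 and glin_tail: "m : Gam ==> glin n (%ys. F (m # ys))"
 and glin_bal: "m : Gam ==> a : A ==> m' # ys : GL n ==>
   F (m *~ be 1 a # m' # ys) = F (m # be 1 a *~ m' # ys)"
using assms unfolding glin_Suc by blast+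

lemma Gsplit_keys: "(ws, w) : keys (Gsplit us) ==> us : GL n ==> ws : GL n & w : Gam"
proof(induction us arbitrary: ws w n)
case Nil
thus ?case by(auto simp: A_one)
next
case (Cons u us)
then obtain n' where n: "n = Suc n'" "u : Gam" "us : GL n'" by(cases n) auto
with Cons show ?case
 by(auto dest!: subsetD[OF keys_bind] dest: Gcomul_keys split: prod.splits)
qed

text \<open>The functionals that factor through \<open>\<Gamma> \<otimes> \<dots> \<otimes> \<Gamma>\<close> (over \<open>A\<^sup>o\<^sup>p\<close>) followed by \<open>\<otimes>\<^sub>A \<Gamma>\<close>, with the right
\<open>A\<close>-structure of the first letter. \<open>Gsplit\<close> is well defined with values there.\<close>

definition good where
"good n P == (ALL w:Gam. glin n (%ws. P ws w)) & (ALL ws:GL n. lin_on GamA (P ws)) &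
  (ALL a:A. ALL u ws. ALL w:Gam. u # ws : GL n --> P (be 1 a *~ u # ws) w = P (u # ws) (be a 1 *~ w))"

lemma goodI:
assumes "!!w. w : Gam ==> glin n (%ws. P ws w)" "!!ws. ws : GL n ==> lin_on GamA (%w. P ws w)"
 "!!a u ws w. a : A ==> u : Gam ==> w : Gam ==> u # ws : GL n ==> P (be 1 a *~ u # ws) w = P (u # ws) (be a 1 *~ w)"
shows "good n P"
unfolding good_def using assms by auto

lemma
assumes "good n P"
shows good_glin: "w : Gam ==> glin n (%ws. P ws w)"
 and good_lin: "ws : GL n ==> lin_on GamA (%w. P ws w)"
 and good_bal: "a : A ==> w : Gam ==> u # ws : GL n ==> P (be 1 a *~ u # ws) w = P (u # ws) (be a 1 *~ w)"
using assms unfolding good_def by blast+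

lemma good_bind2:
assumes "!!x y. (x, y) : keys t ==> good n (%ws w. P ws w x y)"
shows "good n (%ws w. t >> (x,y). P ws w x y)"
using assms by(intro goodI tlin_bind2 lin_on_bind2 bind_cong2)(auto simp: good_def)

definition gshift where
"gshift u P ws w = Gcomul u >> (u1,u2). P (u1 # ws) (u2*~w)"

lemma bal_cong:
assumes "bal M R N F" "!!m n. m : car M ==> n : car N ==> F' m n = F m n" "rclosed M R" "lclosed R N"
shows "bal M R N F'"
using assms unfolding bal_def lin_on_def rclosed_def lclosed_def by(simp add: kclosed_add kclosed_scl)

lemma lin_bemul_left: "lin_on GamA f ==> u : Gam ==> lin_on GamA (%w. f (u*~w))"
and lin_bemul_right: "lin_on GamA f ==> u : Gam ==> lin_on GamA (%w. f (w*~u))"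
by(auto simp: lin_on_def)

lemma bal_good_head:
assumes P: "good (Suc n) P" and ws: "ws : GL n" and w: "w : Gam"
shows "balG (%u1 u2. P (u1 # ws) (u2*~w))"
proof(rule balI)
show "lin_on GamA (%u1. P (u1 # ws) (u2*~w))" if "u2 : car GamA" for u2
 using glin_head[OF good_glin[OF P]] that ws w by simp
show "lin_on GamA (%u2. P (u1 # ws) (u2*~w))" if "u1 : car GamA" for u1
 by(rule lin_bemul_right[OF good_lin[OF P]])(use that ws w in auto)
show "P (rac GamA u1 a # ws) (u2*~w) = P (u1 # ws) (lac GamA a u2 *~ w)"
 if "u1 : car GamA" "a : A" "u2 : car GamA" for u1 a u2
 using good_bal[OF P] that ws w by(simp add: bemul_assoc)
qed

lemma good_gshift:
assumes P: "good (Suc n) P" and u: "u : Gam"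
shows "good n (gshift u P)"
proof(rule goodI)
fix w assume w: "w : Gam"
show "glin n (%ws. gshift u P ws w)"
 unfolding gshift_def
 by(intro tlin_bind2 glin_tail[OF good_glin[OF P]])(auto intro!: bemul_Gam intro: Gcomul_keys[OF _ u] simp: w)
next
fix ws assume ws: "ws : GL n"
show "lin_on GamA (%w. gshift u P ws w)"
 unfolding gshift_def
 by(intro lin_on_bind2 lin_bemul_left good_lin[OF P])(auto intro!: bemul_Gam intro: Gcomul_keys[OF _ u] simp: ws)
next
fix a v ws w assume a: "a : A" and v: "v : Gam" and w: "w : Gam" and vs: "v # ws : GL n"
have "gshift u P (be 1 a *~ v # ws) w = Gcomul u >> (u1,u2). P (u1 *~ be 1 a # v # ws) (u2*~w)"
 unfolding gshift_def
 by(intro bind_cong2 glin_bal[OF good_glin[OF P], symmetric])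
  (use vs a w in "auto intro!: bemul_Gam intro: Gcomul_keys[OF _ u]")
also have "... = Gcomul u >> (u1,u2). P (u1 # v # ws) (u2 *~ be a 1 *~ w)"
 by(rule Gcomul_takeuchi[OF u a bal_good_head[OF P vs w]])
finally show "gshift u P (be 1 a *~ v # ws) w = gshift u P (v # ws) (be a 1 *~ w)"
 by(simp add: gshift_def bemul_assoc)
qed

lemma Gsplit_Cons: "Gsplit (u # us) >> (ws,w). P ws w = Gcomul u >> (u1,u2). Gsplit us >> (ws,w). P (u1 # ws) (u2*~w)"
by(simp add: bind_assoc2)

lemma Gsplit_gshift: "Gsplit (u # us) >> (ws,w). P ws w = Gsplit us >> (ws,w). gshift u P ws w"
unfolding Gsplit_Cons gshift_def by(rule bind_commute2)

lemma Gsplit_Nil: "Gsplit [] >> (ws,w). P ws w = P [] (be 1 1)"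
by simp

declare Gsplit.simps [simp del]

lemma bal_Gsplit:
assumes P: "good (Suc n) P" and us: "us : GL n"
shows "balG (%u1 u2. Gsplit us >> (ws,w). P (u1 # ws) (u2*~w))"
by(intro bal_bind2 bal_good_head[OF P])(auto dest: Gsplit_keys[OF _ us])

lemma bal_bemul:
assumes F: "balG F" and v: "v1 : Gam" "v2 : Gam"
shows "balG (%m n. F (m*~v1) (n*~v2))"
proof(rule balI)
show "lin_on GamA (%m. F (m*~v1) (n*~v2))" if "n : car GamA" for n
 by(rule lin_bemul_right[OF bal_lin_left[OF F]])(use that v in auto)
show "lin_on GamA (%n. F (m*~v1) (n*~v2))" if "m : car GamA" for m
 by(rule lin_bemul_right[OF bal_lin_right[OF F]])(use that v in auto)
show "F (rac GamA m r *~ v1) (n*~v2) = F (m*~v1) (lac GamA r n *~ v2)"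
 if "m : car GamA" "r : A" "n : car GamA" for m r n
 using bal_eq[OF F, of "m*~v1" r "n*~v2"] that v by(simp add: bemul_assoc)
qed

lemma bal_Gcomul_mult:
assumes u: "u : Gam" and F: "balG F"
shows "balG (%v1 v2. Gcomul u >> (u1,u2). F (u1*~v1) (u2*~v2))" (is "bal _ _ _ ?R")
proof(rule balI)
show "lin_on GamA (%v1. ?R v1 v2)" if "v2 : car GamA" for v2
 by(intro lin_on_bind2 lin_bemul_left[OF bal_lin_left[OF F]])(use that in "auto intro!: bemul_Gam intro: Gcomul_keys[OF _ u]")
show "lin_on GamA (%v2. ?R v1 v2)" if "v1 : car GamA" for v1
 by(intro lin_on_bind2 lin_bemul_left[OF bal_lin_right[OF F]])(use that in "auto intro!: bemul_Gam intro: Gcomul_keys[OF _ u]")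
show "?R (rac GamA v1 b) v2 = ?R v1 (lac GamA b v2)" if "v1 : car GamA" "b : A" "v2 : car GamA" for v1 b v2
 using Gcomul_takeuchi[OF u that(2) bal_bemul[OF F, of v1 v2]] that by(simp add: bemul_assoc)
qed

text \<open>The comultiplication of \<open>1 \<otimes> a\<close> is \<open>(1 \<otimes> 1) \<otimes>\<^sub>A (1 \<otimes> a)\<close>.\<close>

lemma Gcomul_op_right:
assumes u: "u : Gam" and a: "a : A" and F: "balG F"
shows "Gcomul (u *~ be 1 a) >> (u1,u2). F u1 u2 = Gcomul u >> (u1,u2). F u1 (u2 *~ be 1 a)"
 and "Gcomul (be 1 a *~ u) >> (u1,u2). F u1 u2 = Gcomul u >> (u1,u2). F u1 (be 1 a *~ u2)"
proof -
let ?L = "%v1 v2. Gcomul u >> (u1,u2). F (v1*~u1) (v2*~u2)"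
have bem: "be 1 a : Gam" "be 1 1 : Gam" using a by(auto simp: A_one)
have "Gcomul (u *~ be 1 a) >> (u1,u2). F u1 u2 = Gcomul u >> (u1,u2). Gcomul (be 1 a) >> (v1,v2). F (u1*~v1) (u2*~v2)"
 by(rule Gcomul_mult[OF u bem(1) F])
also have "... = Gcomul (be 1 a) >> (v1,v2). Gcomul u >> (u1,u2). F (u1*~v1) (u2*~v2)" by(rule bind_commute2)
also have "... = Gcomul u >> (u1,u2). F (u1 *~ be 1 1) (u2 *~ be 1 a)"
 by(simp add: Gcomul_be[OF A_one a] tns_bind[OF bal_Gcomul_mult[OF u F]])
also have "... = Gcomul u >> (u1,u2). F u1 (u2 *~ be 1 a)"
 by(intro bind_cong2)(auto dest!: Gcomul_keys(1)[OF _ u] Gam_Be simp: bemul_one)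
finally show "Gcomul (u *~ be 1 a) >> (u1,u2). F u1 u2 = Gcomul u >> (u1,u2). F u1 (u2 *~ be 1 a)" .
have bL: "balG ?L"
 by(intro bal_bind2 bal_bemul[OF F])(auto intro: Gcomul_keys[OF _ u])
have "Gcomul (be 1 a *~ u) >> (u1,u2). F u1 u2 = Gcomul (be 1 a) >> (v1,v2). ?L v1 v2"
 by(rule Gcomul_mult[OF bem(1) u F])
also have "... = ?L (be 1 1) (be 1 a)"
 by(simp add: Gcomul_be[OF A_one a] tns_bind[OF bL])
also have "... = Gcomul u >> (u1,u2). F u1 (be 1 a *~ u2)"
 by(intro bind_cong2)(auto dest!: Gcomul_keys(1)[OF _ u] Gam_Be simp: bemul_one)
finally show "Gcomul (be 1 a *~ u) >> (u1,u2). F u1 u2 = Gcomul u >> (u1,u2). F u1 (be 1 a *~ u2)" .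
qed

lemma glin_Gsplit: "good n P ==> glin n (%us. Gsplit us >> (ws,w). P ws w)"
proof(induction n arbitrary: P)
case (Suc n)
show ?case
proof(rule glin_SucI)
 show "lin_on GamA (%u. Gsplit (u # us) >> (ws,w). P ws w)" for us
  unfolding Gsplit_Cons by(intro lin_on_bind_left lin_Gcomul)
 show "glin n (%us. Gsplit (u # us) >> (ws,w). P ws w)" if "u : Gam" for u
  unfolding Gsplit_gshift by(rule Suc.IH[OF good_gshift[OF Suc.prems that]])
 fix u a v us assume u: "u : Gam" and a: "a : A" and v: "v : Gam" and vs: "v # us : GL n"
 then obtain n' where n: "n = Suc n'" "us : GL n'" by(cases n) auto
 have "Gsplit (u *~ be 1 a # v # us) >> (ws,w). P ws w
   = Gcomul u >> (u1,u2). Gsplit (v # us) >> (ws,w). P (u1 # ws) (u2 *~ be 1 a *~ w)"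
  unfolding Gsplit_Cons[of "u *~ be 1 a"]
  by(rule Gcomul_op_right(1)[OF u a bal_Gsplit[OF Suc.prems vs]])
 also have "... = Gsplit (v # us) >> (ws,w). gshift u P ws (be 1 a *~ w)"
  unfolding gshift_def bemul_assoc by(rule bind_commute2)
 also have "... = Gcomul v >> (v1,v2). Gsplit us >> (ws,w). gshift u P (v1 # ws) (be 1 a *~ v2 *~ w)"
  unfolding Gsplit_Cons bemul_assoc ..
 also have "... = Gcomul (be 1 a *~ v) >> (v1,v2). Gsplit us >> (ws,w). gshift u P (v1 # ws) (v2*~w)"
  by(rule Gcomul_op_right(2)[OF v a, symmetric])
   (rule bal_Gsplit[OF good_gshift[OF Suc.prems u, unfolded n] n(2)])
 also have "... = Gsplit (u # be 1 a *~ v # us) >> (ws,w). P ws w"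
  by(simp only: Gsplit_gshift[of u "be 1 a *~ v # us" P] Gsplit_Cons[of "be 1 a *~ v" us "gshift u P"])
 finally show "Gsplit (u *~ be 1 a # v # us) >> (ws,w). P ws w = Gsplit (u # be 1 a *~ v # us) >> (ws,w). P ws w" .
qed
qed simp

lemma Gsplit_append:
assumes "vs : GL n"
shows "Gsplit (us @ vs) >> (ws,w). P ws w = Gsplit us >> (ws,w). Gsplit vs >> (ws',w'). P (ws @ ws') (w*~w')"
proof(induction us arbitrary: P)
case Nil
show ?case unfolding Gsplit_Nil append_Nil
 by(intro bind_cong2)(auto dest!: Gsplit_keys[OF _ assms] Gam_Be simp: bemul_one)
next
case (Cons u us)
thus ?case by(simp only: append_Cons Gsplit_Cons Cons.IH bemul_assoc)
qed

lemma Gsplit_single: "u : Gam ==> (Gsplit [u] >> (ws,w). P ws w) = Gcomul u >> (u1,u2). P [u1] u2"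
unfolding Gsplit_Cons Gsplit_Nil
by(intro bind_cong2)(simp add: bemul_one Gam_Be[OF Gcomul_keys(2)])

lemma Gsplit_act:
assumes P: "good n P" and v: "v : Gam" and us: "u # us : GL n"
shows "Gsplit (v*~u # us) >> (ws,w). P ws w
 = Gcomul v >> (v1,v2). Gsplit (u # us) >> (ws,w). P (v1 *~ hd ws # tl ws) (v2*~w)"
proof -
obtain n' where n: "n = Suc n'" "us : GL n'" "u : Gam" using us by(cases n) auto
show ?thesis
 unfolding Gsplit_Cons Gcomul_mult[OF v n(3) bal_Gsplit[OF P[unfolded n(1)] n(2)]] by(simp add: bemul_assoc)
qed

lemma Gsplit_last:
assumes "good (Suc n) P" "us : GL n" and u: "u : Gam" and a: "a : A"
shows "Gsplit (us @ [u *~ be 1 a]) >> (ws,w). P ws w = Gsplit (us @ [u]) >> (ws,w). P ws (w *~ be 1 a)"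
using assms(1,2)
proof(induction us arbitrary: n P)
case Nil
hence n: "n = 0" by simp
have "be 1 1 : Gam" by(simp add: A_one)
hence "balG (%u1 u2. P [u1] (u2 *~ be 1 1))"
 using bal_good_head[OF Nil(1), of "[]"] n by simp
from Gcomul_op_right(1)[OF u a this] show ?case
 unfolding append_Nil Gsplit_Cons Gsplit_Nil by(simp add: bemul_assoc)
next
case (Cons x us)
then obtain n' where n: "n = Suc n'" "us : GL n'" "x : Gam" by(cases n) auto
have "gshift x (%ws w. P ws (w *~ be 1 a)) = (%ws w. gshift x P ws (w *~ be 1 a))"
 by(simp add: gshift_def fun_eq_iff bemul_assoc)
thus ?case
 unfolding append_Cons Gsplit_gshift using Cons.IH[OF good_gshift[OF Cons.prems(1)[unfolded n(1)] n(3)] n(2)] by simp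
qed

lemma mrg_GL: "i < n ==> us : GL (Suc n) ==> mrg bemul i us : GL n"
by(rule mrg_nlists) auto

lemma glin_mrg: "i < n ==> glin n F ==> glin (Suc n) (%us. F (mrg bemul i us))"
by(rule tlin_mrg)(auto simp: klin_def bemul_assoc)

lemma Gsplit_mrg:
assumes "good n P" "i < n" "us : GL (Suc n)"
shows "Gsplit (mrg bemul i us) >> (ws,w). P ws w = Gsplit us >> (ws,w). P (mrg bemul i ws) w"
using assms
proof(induction i arbitrary: n P us)
case 0
then obtain n' where n': "n = Suc n'" by(cases n) auto
then obtain x y zs where n: "us = x # y # zs" "zs : GL n'" "x : Gam" "y : Gam"
 using 0(3) nlists_Suc unfolding n' by(fastforce simp: nlists_Suc)
show ?case
 unfolding n mrg_0 Gsplit_Cons Gcomul_mult[OF n(3,4) bal_Gsplit[OF 0(1)[unfolded n'] n(2)]]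
 by(simp add: bemul_assoc)
next
case (Suc i)
then obtain n' where n': "n = Suc n'" "i < n'" by(cases n) auto
then obtain x ys where n: "us = x # ys" "ys : GL (Suc n')" "x : Gam"
 using Suc(4) unfolding nlists_Suc[of us] by auto
have "Gsplit (mrg bemul i ys) >> (ws,w). gshift x P ws w = Gsplit ys >> (ws,w). gshift x P (mrg bemul i ws) w"
 using Suc.IH[OF good_gshift[OF Suc.prems(1)[unfolded n'(1)] n(3)] n'(2) n(2)] .
moreover have "gshift x (%ws w. P (mrg bemul (Suc i) ws) w) = (%ws w. gshift x P (mrg bemul i ws) w)"
 by(simp add: gshift_def fun_eq_iff)
ultimately show ?case unfolding n mrg_Suc Gsplit_gshift by simp
qed

text \<open>The last face of the bar complex: the last letter passes to \<open>A\<close> by the counit.\<close>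

definition lface where
"lface n us = take n us @ [(us ! n) *~ be 1 (Gcounit (us ! Suc n))]"

lemma lface_0 [simp]: "lface 0 (x # y # us) = [x *~ be 1 (Gcounit y)]"
and lface_Suc [simp]: "lface (Suc n) (x # us) = x # lface n us"
by(simp_all add: lface_def)

lemma lface_GL: "us : GL (Suc (Suc n)) ==> lface n us : GL (Suc n)"
proof(induction n arbitrary: us)
case 0
thus ?case by(auto simp: nlists_Suc A_one Gcounit_in_A)
next
case (Suc n)
thus ?case by(subst (asm) nlists_Suc) auto
qed

lemma lface_append: "lface (length xs + n) (xs @ ys) = xs @ lface n ys"
by(induction xs) auto

lemma glin_lface: "glin (Suc n) F ==> glin (Suc (Suc n)) (%us. F (lface n us))"
proof(induction n arbitrary: F)
case 0
have l: "lin_on GamA (%m. F [m])" using glin_head[OF 0, of "[]"] by simp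
show ?case
proof(rule glin_SucI)
 fix ys assume "ys : GL (Suc 0)"
 then obtain y where y: "ys = [y]" "y : Gam" by(auto simp: nlists_Suc)
 show "lin_on GamA (%m. F (lface 0 (m # ys)))"
  unfolding y lface_0 by(rule lin_bemul_right[OF l])(simp add: y A_one Gcounit_in_A)
next
 fix m assume m: "m : Gam"
 have "lin_on GamA (%y. F [m *~ be 1 (Gcounit y)])"
  using l m by(auto simp: lin_on_def A_one Gcounit_in_A)
 thus "glin (Suc 0) (%ys. F (lface 0 (m # ys)))"
  by(intro glin_SucI) auto
next
 fix m a m' ys assume "m' # ys : GL (Suc 0)"
 thus "F (lface 0 (m *~ be 1 a # m' # ys)) = F (lface 0 (m # be 1 a *~ m' # ys))"
  by(simp add: bemul_assoc Gcounit_right)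
qed
next
case (Suc n)
show ?case
proof(rule glin_SucI)
 fix ys assume "ys : GL (Suc (Suc n))"
 thus "lin_on GamA (%m. F (lface (Suc n) (m # ys)))"
  using glin_head[OF Suc.prems] lface_GL by simp
next
 show "glin (Suc (Suc n)) (%ys. F (lface (Suc n) (m # ys)))" if "m : Gam" for m
  using Suc.IH[OF glin_tail[OF Suc.prems that]] by simp
next
 fix m a m' ys assume m: "m : Gam" "a : A" "m' : Gam" "m' # ys : GL (Suc (Suc n))"
 obtain z zs where z: "lface n (m' # ys) = z # zs" "z # zs : GL (Suc n)" "lface n (be 1 a *~ m' # ys) = be 1 a *~ z # zs"
 proof(cases n)
  case 0
  then obtain y where "ys = [y]" "y : Gam" using m(4) by(auto simp: nlists_Suc)
  thus thesis using that[of "m' *~ be 1 (Gcounit y)" "[]"] 0 m by(simp add: bemul_assoc A_one Gcounit_in_A)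
 next
  case (Suc n')
  thus thesis using that[of m' "lface n' ys"] m lface_GL[of ys n'] by simp
 qed
 thus "F (lface (Suc n) (m *~ be 1 a # m' # ys)) = F (lface (Suc n) (m # be 1 a *~ m' # ys))"
  using glin_bal[OF Suc.prems m(1,2), of z zs] by simp
qed
qed

text \<open>The scalar \<open>\<epsilon>(u\<^sub>1) \<in> A\<close> is moved across \<open>\<otimes>\<^sub>A\<close> to \<open>u\<^sub>2\<close>, and counitality applies.\<close>

lemma Gsplit_counit:
assumes "good (Suc n) P" "us : GL (Suc n)" and u: "u : Gam"
shows "Gsplit (us @ [u]) >> (ws,w). P (lface n ws) w = Gsplit us >> (ws,w). P ws (w*~u)"
using assms(1,2)
proof(induction n arbitrary: us P)
case 0
then obtain p where p: "us = [p]" "p : Gam" by(auto simp: nlists_Suc)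
have "be 1 1 : Gam" by(simp add: A_one)
have "Gsplit (us @ [u]) >> (ws,w). P (lface 0 ws) w
  = Gcomul p >> (p1,p2). Gcomul u >> (u1,u2). P [p1 *~ be 1 (Gcounit u1)] (p2*~u2)"
 unfolding p append_Cons append_Nil Gsplit_Cons[of p] Gsplit_single[OF u] by simp
also have "... = Gcomul u >> (u1,u2). Gcomul p >> (p1,p2). P [p1 *~ be 1 (Gcounit u1)] (p2*~u2)"
 by(rule bind_commute2)
also have "... = Gcomul u >> (u1,u2). Gcomul p >> (p1,p2). P [p1] (p2 *~ be (Gcounit u1) 1 *~ u2)"
 by(intro bind_cong2 Gcomul_takeuchi[OF p(2)] Gcounit_in_A bal_good_head[OF 0(1)])(auto intro!: bemul_Gam intro: Gcomul_keys[OF _ u])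
also have "... = Gcomul p >> (p1,p2). Gcomul u >> (u1,u2). P [p1] (p2 *~ (be (Gcounit u1) 1 *~ u2))"
 unfolding bemul_assoc by(rule bind_commute2)
also have "... = Gcomul p >> (p1,p2). P [p1] (p2*~u)"
proof(rule bind_cong2)
 fix p1 p2 assume "(p1, p2) : keys (Gcomul p)"
 hence pp: "p1 : Gam" "p2 : Gam" using Gcomul_keys[OF _ p(2)] by auto
 have l: "lin_on GamA (%w. P [p1] (p2*~w))"
  by(rule lin_bemul_left[OF good_lin[OF 0(1)]])(simp_all add: pp)
 have "Gcomul u >> (u1,u2). P [p1] (p2 *~ (be (Gcounit u1) 1 *~ u2))
  = P [p1] (p2 *~ (Gcomul u >> (u1,u2). be (Gcounit u1) 1 *~ u2))"
  by(rule lin_on_bind_out2[OF kclosed_GamA _ l, symmetric])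
   (auto intro!: bemul_Gam be_Gam A_one Gcounit_in_A intro: Gcomul_keys[OF _ u])
 thus "Gcomul u >> (u1,u2). P [p1] (p2 *~ (be (Gcounit u1) 1 *~ u2)) = P [p1] (p2*~u)"
  by(simp add: Gcomul_counit[OF u])
qed
also have "... = Gsplit us >> (ws,w). P ws (w*~u)"
 unfolding p Gsplit_single[OF p(2)] ..
finally show ?case .
next
case (Suc n)
then obtain x us' where x: "us = x # us'" "x : Gam" "us' : GL (Suc n)" unfolding nlists_Suc[of us] by auto
have "gshift x (%ws w. P (lface (Suc n) ws) w) = (%ws w. gshift x P (lface n ws) w)"
 "gshift x (%ws w. P ws (w*~u)) = (%ws w. gshift x P ws (w*~u))"
 by(simp_all add: gshift_def fun_eq_iff bemul_assoc)
thus ?case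
 unfolding x append_Cons Gsplit_gshift using Suc.IH[OF good_gshift[OF Suc.prems(1) x(2)] x(3)] by simp
qed

lemma Gsplit_coassoc:
assumes "!!w. w : Gam ==> good n (%ws w'. P ws w' w)" "!!ws. ws : GL n ==> balG (P ws)" "us : GL n"
shows "Gsplit us >> (ws,w). Gsplit ws >> (ws',w'). P ws' w' w
   = Gsplit us >> (ws,w). Gcomul w >> (w1,w2). P ws w1 w2"
using assms
proof(induction us arbitrary: n P)
case Nil
hence "n = 0" by simp
with Nil have "balG (P [])" by simp
thus ?case unfolding Gsplit_Nil by(simp add: Gcomul_one tns_bind)
next
case (Cons u us)
then obtain n' where n: "n = Suc n'" "us : GL n'" "u : Gam" by(cases n) auto
note Pg = Cons.prems(1)[unfolded n(1)] and Pb = Cons.prems(2)[unfolded n(1)]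
define P' where "P' ws w1 w2 = Gcomul u >> (u1,u2). gshift u1 (%ws w'. P ws w' (u2*~w2)) ws w1" for ws w1 w2
have P'2: "P' ws w1 w2 = Gcomul u >> (v,u0). Gcomul u0 >> (b,c). P (v # ws) (b*~w1) (c*~w2)"
 if ws: "ws : GL n'" "w1 : Gam" "w2 : Gam" for ws w1 w2
 unfolding P'_def gshift_def
proof(rule Gcomul_coassoc[OF n(3)])
 show "tribal GamA A GamA A GamA (%a b c. P (a # ws) (b*~w1) (c*~w2))"
 proof(rule tribalI)
  show "balG (%a b. P (a # ws) (b*~w1) (c*~w2))" if "c : car GamA" for c
   by(rule bal_good_head[OF Pg])(use ws that in auto)
  fix a assume a: "a : car GamA"
  have B: "balG (P (a # ws))" by(rule Pb)(use a ws in auto)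
  show "balG (%b c. P (a # ws) (b*~w1) (c*~w2))" by(rule bal_bemul[OF B ws(2,3)])
 qed
qed
have "Gsplit (u # us) >> (ws,w). Gsplit ws >> (ws',w'). P ws' w' w
  = Gcomul u >> (u1,u2). Gsplit us >> (ws,w). Gsplit ws >> (ws',w'). gshift u1 (%ws w'. P ws w' (u2*~w)) ws' w'"
 unfolding Gsplit_Cons[of u us "%ws w. Gsplit ws >> (ws',w'). P ws' w' w"]
 by(intro bind_cong2 Gsplit_gshift)
also have "... = Gsplit us >> (ws,w). Gsplit ws >> (ws',w'). P' ws' w' w"
 unfolding P'_def by(rule bind_pull, rule bind_commute2)
also have "... = Gsplit us >> (ws,w). Gcomul w >> (w1,w2). P' ws w1 w2"
proof(rule Cons.IH[OF _ _ n(2)])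
 show "good n' (%ws w'. P' ws w' w)" if "w : Gam" for w
  unfolding P'_def
  by(intro good_bind2 good_gshift Pg)(use that in "auto intro!: bemul_Gam intro: Gcomul_keys[OF _ n(3)]")
 fix ws assume ws: "ws : GL n'"
 have "balG (%w1 w2. Gcomul u >> (v,u0). Gcomul u0 >> (b,c). P (v # ws) (b*~w1) (c*~w2))"
  by(intro bal_bind2 bal_Gcomul_mult Pb)(use ws in "auto intro: Gcomul_keys[OF _ n(3)]")
 thus "balG (P' ws)" by(rule bal_cong)(use P'2[OF ws] in simp_all)
qed
also have "... = Gsplit us >> (ws,w). Gcomul w >> (w1,w2). Gcomul u >> (v,u0). Gcomul u0 >> (b,c). P (v # ws) (b*~w1) (c*~w2)"
 by(intro bind_cong2 P'2)(auto dest: Gsplit_keys[OF _ n(2)] intro: Gcomul_keys)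
also have "... = Gcomul u >> (v,u0). Gsplit us >> (ws,w). Gcomul u0 >> (b,c). Gcomul w >> (w1,w2). P (v # ws) (b*~w1) (c*~w2)"
 by(rule sym, rule bind_pull, rule sym, rule bind_pull, rule bind_commute2)
also have "... = Gcomul u >> (v,u0). Gsplit us >> (ws,w). Gcomul (u0*~w) >> (w1,w2). P (v # ws) w1 w2"
 by(intro bind_cong2 Gcomul_mult[symmetric] Pb)(auto dest: Gsplit_keys[OF _ n(2)] Gcomul_keys[OF _ n(3)])
also have "... = Gsplit (u # us) >> (ws,w). Gcomul w >> (w1,w2). P ws w1 w2"
 unfolding Gsplit_Cons ..
finally show ?case .
qed

section \<open>The complex \<open>K\<close> and its diagonal\<close>

lemma K_cx_simps [simp]: "scl (K_cx n) = fscale" "lac (K_cx n) a k = Kact n (be a 1) k" "rac (K_cx n) k a = Kact n (be 1 a) k"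
by(simp_all add: K_cx_def)

abbreviation "Kcar n == car (K_cx n)"

lemma Kcar: "Kcar n = tpow_car (Suc n) GamAop A"
by(simp add: K_cx_def)

lemma subspace_K [simp]: "fv.subspace (Kcar n)"
unfolding Kcar by(rule subspace_tpow)

lemma K_closed [simp]: "0 : Kcar n" "x : Kcar n ==> y : Kcar n ==> x + y : Kcar n" "x : Kcar n ==> y : Kcar n ==> x - y : Kcar n"
"x : Kcar n ==> c*.x : Kcar n"
using subspace_K[of n] fv.subspace_diff unfolding fv.subspace_def by blast+

lemma kclosed_K [simp]: "kclosed (K_cx n)"
by(simp add: kclosed_def)

lemma Kp_in: "us : GL (Suc n) ==> Kp n us : Kcar n"
by(simp add: Kcar Kp_def tpow_elt_in)

lemma glin_Kp: "glin (Suc n) (Kp n)"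
using tlin_tpow_elt[of "Suc n" "GamAop" A] by(simp add: Kp_def[abs_def])

lemma Kp_bind: "glin (Suc n) F ==> (Kp n us >> F) = F us"
by(simp add: Kp_def tpow_bind)

lemma GamAop_closed: "kclosed GamAop"
by(simp add: kclosed_def)

lemma K_keys: "us : keys k ==> k : Kcar n ==> us : GL (Suc n)"
using tpow_keys[of "GamAop" A k "Suc n"] by(auto simp: Kcar GamAop_closed A_one)

lemma K_eqI:
assumes "k : Kcar n" "lin_on (K_cx n) f" "lin_on (K_cx n) g" "!!us. us : GL (Suc n) ==> f (Kp n us) = g (Kp n us)"
shows "f k = g k"
by(rule tpow_lin_eqI[of k "K_cx n" "Suc n" "GamAop" A])(use assms in "auto simp: Kcar Kp_def")

lemma lin_glin_Kp: "lin_on (K_cx n) f ==> glin (Suc n) (%us. f (Kp n us))"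
by(rule tlin_comp_lin[where N = "K_cx n"])(auto simp: glin_Kp Kp_in GamAop_closed A_one)

lemma glin_act: "glin (Suc n) F ==> v : Gam ==> glin (Suc n) (%us. F (v *~ hd us # tl us))"
by(rule glin_SucI)(auto simp: bemul_assoc[symmetric] intro: lin_bemul_left[OF glin_head] glin_tail glin_bal)

lemma Kact_Kp: "v : Gam ==> Kact n v (Kp n us) = Kp n (v *~ hd us # tl us)"
unfolding Kact_def by(rule Kp_bind) (rule glin_act[OF glin_Kp])

lemma act_GL: "us : GL (Suc n) ==> v : Gam ==> v *~ hd us # tl us : GL (Suc n)"
by(auto simp: nlists_Suc)

lemma Kact_in [simp]: "k : Kcar n ==> v : Gam ==> Kact n v k : Kcar n"
unfolding Kact_def by(intro bind_in_subspace[OF subspace_K] Kp_in act_GL)(auto dest: K_keys)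

lemma Kact_lin [simp]: "Kact n v (k + k') = Kact n v k + Kact n v k'" "Kact n v (c*.k) = c *. Kact n v k"
by(simp_all add: Kact_def bind_linear)

lemma klin_Kact: "v : Gam ==> klin (K_cx n) (K_cx n) (Kact n v)"
by(simp add: klin_def)

lemma lin_Kact_left:
assumes f: "lin_on (K_cx n) f" and k: "k : Kcar n"
shows "lin_on GamA (%v. f (Kact n v k))"
proof -
have 1: "f (Kact n v k) = k >> us. f (Kp n (v *~ hd us # tl us))" if v: "v : Gam" for v
 unfolding Kact_def by(rule lin_on_bind_out[OF _ _ f])(auto intro!: Kp_in act_GL v dest: K_keys[OF _ k])
have 2: "lin_on GamA (%v. k >> us. f (Kp n (v *~ hd us # tl us)))"
proof(rule lin_on_bind)
 fix us assume "us : keys k"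
 hence us: "us : GL (Suc n)" by(rule K_keys[OF _ k])
 hence "lin_on GamA (%v. f (Kp n (v # tl us)))" by(intro glin_head[OF lin_glin_Kp[OF f]])(auto simp: nlists_Suc)
 thus "lin_on GamA (%v. f (Kp n (v *~ hd us # tl us)))"
  by(rule lin_bemul_right)(use us in "auto simp: nlists_Suc")
qed
from 1 2 show ?thesis by(simp add: lin_on_def)
qed

lemma Kact_add: "k : Kcar n ==> v : Gam ==> w : Gam ==> Kact n (v + w) k = Kact n v k + Kact n w k"
and Kact_scale: "k : Kcar n ==> v : Gam ==> Kact n (c*.v) k = c *. Kact n v k"
using lin_Kact_left[of n "%x. x" k] by(auto simp: lin_on_def)

lemma Kact_Kact:
assumes k: "k : Kcar n" and v: "v : Gam" and w: "w : Gam"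
shows "Kact n v (Kact n w k) = Kact n (v*~w) k"
by(rule K_eqI[OF k])(simp_all add: lin_on_def Kact_Kp v w bemul_assoc)

lemma Kact_one:
assumes k: "k : Kcar n"
shows "Kact n (be 1 1) k = k"
proof(rule K_eqI[OF k])
fix us assume "us : GL (Suc n)"
thus "Kact n (be 1 1) (Kp n us) = Kp n us"
 by(auto simp: nlists_Suc Kact_Kp A_one bemul_one Gam_Be)
qed (simp_all add: lin_on_def)

lemma closed_K [simp]: "rclosed (K_cx n) A" "lclosed A (K_cx n)"
by(simp_all add: rclosed_def lclosed_def A_one)

lemma bal_K: "balK r s F <-> (ALL b:Kcar s. lin_on (K_cx r) (%a. F a b)) & (ALL a:Kcar r. lin_on (K_cx s) (F a)) &
 (ALL a:Kcar r. ALL c:A. ALL b:Kcar s. F (Kact r (be 1 c) a) b = F a (Kact s (be c 1) b))"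
by(simp add: bal_def)

subsection \<open>The differential\<close>

lemma dK_Suc: "dK (Suc n) k = k >> us. (\<Sum>i<Suc n. ((-1) ^ i) *. Kp n (mrg bemul i us)) +
 ((-1) ^ Suc n) *. Kp n (lface n us)"
unfolding dK_def mrg_def lface_def by simp

lemma glin_dK: "glin (Suc (Suc n)) (%us. (\<Sum>i<Suc n. ((-1) ^ i) *. Kp n (mrg bemul i us)) +
 ((-1) ^ Suc n) *. Kp n (lface n us))"
by(intro tlin_plus tlin_sum tlin_fscale glin_mrg glin_lface glin_Kp) auto

lemma dK_Kp: "dK (Suc n) (Kp (Suc n) us) = (\<Sum>i<Suc n. ((-1) ^ i) *. Kp n (mrg bemul i us)) +
 ((-1) ^ Suc n) *. Kp n (lface n us)"
unfolding dK_Suc by(rule Kp_bind[OF glin_dK])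

lemma dK_0 [simp]: "dK 0 k = 0"
by(simp add: dK_def)

lemma dK_lin [simp]: "dK n (k + k') = dK n k + dK n k'" "dK n (c*.k) = c *. dK n k"
by(simp_all only: dK_def bind_add_left bind_scale_left) simp_all

lemma dK_in [simp]: "k : Kcar (Suc n) ==> dK (Suc n) k : Kcar n"
unfolding dK_Suc
by(intro bind_in_subspace[OF subspace_K] K_closed(2,4) subspace_sum'[OF subspace_K] Kp_in mrg_GL lface_GL)
 (auto dest: K_keys)

lemma klin_dK: "klin (K_cx (Suc n)) (K_cx n) (dK (Suc n))"
by(simp add: klin_def)

lemma lin_dK_Kp:
assumes f: "lin_on (K_cx n) f" and us: "us : GL (Suc (Suc n))"
shows "f (dK (Suc n) (Kp (Suc n) us)) = (\<Sum>i<Suc n. ((-1) ^ i) *. f (Kp n (mrg bemul i us))) +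
 ((-1) ^ Suc n) *. f (Kp n (lface n us))"
proof -
have i: "Kp n (mrg bemul i us) : Kcar n" if "i < Suc n" for i
 using that us by(intro Kp_in mrg_GL) auto
have l: "Kp n (lface n us) : Kcar n" by(intro Kp_in lface_GL us)
have S: "(\<Sum>i<Suc n. ((-1) ^ i) *. Kp n (mrg bemul i us)) : Kcar n"
 by(intro subspace_sum'[OF subspace_K] K_closed(4) i) simp
have sc: "f (c*.x) = c *. f x" if "x : Kcar n" for c x using lin_on_scale[OF f that] by simp
have "f (\<Sum>i<Suc n. ((-1) ^ i) *. Kp n (mrg bemul i us)) = (\<Sum>i<Suc n. f (((-1) ^ i) *. Kp n (mrg bemul i us)))"
 by(rule lin_on_sum[OF kclosed_K f])(simp add: i)
also have "... = (\<Sum>i<Suc n. ((-1) ^ i) *. f (Kp n (mrg bemul i us)))"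
 by(intro sum.cong refl sc i) simp
finally show ?thesis
 unfolding dK_Kp lin_on_add[OF f S K_closed(4)[OF l]] sc[OF l] by simp
qed

lemma dK_Kact:
assumes k: "k : Kcar (Suc n)" and v: "v : Gam"
shows "dK (Suc n) (Kact (Suc n) v k) = Kact n v (dK (Suc n) k)"
proof(rule K_eqI[OF k])
fix us assume "us : GL (Suc (Suc n))"
then obtain x y zs where us: "us = x # y # zs" by(auto simp: nlists_Suc)
have m: "mrg bemul i (v*~x # y # zs) = v *~ hd (mrg bemul i us) # tl (mrg bemul i us)" for i
 unfolding us by(cases i)(simp_all add: bemul_assoc)
have l: "lface n (v*~x # y # zs) = v *~ hd (lface n us) # tl (lface n us)"
 unfolding us by(cases n)(simp_all add: bemul_assoc lface_def)
have Ks: "Kact n v (\<Sum>i\<in>S. f i) = (\<Sum>i\<in>S. Kact n v (f i))" for f and S :: "nat set"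
 by(simp add: Kact_def bind_sum_left)
have "v *~ hd us # tl us = v*~x # y # zs" by(simp add: us)
thus "dK (Suc n) (Kact (Suc n) v (Kp (Suc n) us)) = Kact n v (dK (Suc n) (Kp (Suc n) us))"
 unfolding Kact_Kp[OF v] dK_Kp by(simp add: m l Ks Kact_Kp[OF v] del: sum.lessThan_Suc power_Suc)
qed (simp_all add: lin_on_def)

subsection \<open>The diagonal\<close>

lemma good_DeltaK:
assumes F: "balK r s F" and vs: "vs : GL s"
shows "good (Suc r) (%ws w. F (Kp r ws) (Kp s (w # vs)))"
proof(rule goodI)
fix w assume w: "w : Gam"
have "Kp s (w # vs) : Kcar s" by(rule Kp_in)(simp add: w vs)
hence "lin_on (K_cx r) (%a. F a (Kp s (w # vs)))" using F by(simp add: bal_K)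
thus "glin (Suc r) (%ws. F (Kp r ws) (Kp s (w # vs)))" by(rule lin_glin_Kp)
next
fix ws assume "ws : GL (Suc r)"
hence "lin_on (K_cx s) (F (Kp r ws))" using F by(auto simp: bal_K intro: Kp_in)
from glin_head[OF lin_glin_Kp[OF this] vs]
show "lin_on GamA (%w. F (Kp r ws) (Kp s (w # vs)))" .
next
fix a u ws w assume a: "a : A" and h: "u : Gam" "w : Gam" "u # ws : GL (Suc r)"
have "Kp r (u # ws) : Kcar r" "Kp s (w # vs) : Kcar s" by(rule Kp_in, use h vs in simp)+
with F a have "F (Kact r (be 1 a) (Kp r (u # ws))) (Kp s (w # vs)) = F (Kp r (u # ws)) (Kact s (be a 1) (Kp s (w # vs)))"
 by(simp add: bal_K)
thus "F (Kp r (be 1 a *~ u # ws)) (Kp s (w # vs)) = F (Kp r (u # ws)) (Kp s (be a 1 *~ w # vs))"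
 using a by(simp add: Kact_Kp A_one)
qed

lemma glin_DeltaK:
assumes F: "balK r s F"
shows "glin (Suc r + s) (%us. Gsplit (take (Suc r) us) >> (ws,w). F (Kp r ws) (Kp s (w # drop (Suc r) us)))"
proof -
define D where "D us vs = Gsplit us >> (ws,w). F (Kp r ws) (Kp s (w # vs))" for us vs
have Fr: "glin (Suc s) (%vs. F (Kp r ws) (Kp s vs))" if "ws : GL (Suc r)" for ws
 by(rule lin_glin_Kp)(use F that in "auto simp: bal_K intro: Kp_in")
have 1: "glin (Suc r) (%us. D us vs)" if "vs : GL s" for vs
 unfolding D_def by(rule glin_Gsplit[OF good_DeltaK[OF F that]])
have 2: "glin s (D us)" if "us : GL (Suc r)" for us
 unfolding D_def
 by(intro tlin_bind2 glin_tail[OF Fr])(auto dest: Gsplit_keys[OF _ that])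
have 3: "D (us @ [u *~ be 1 a]) (v # vs) = D (us @ [u]) (be 1 a *~ v # vs)"
 if us: "us @ [u] : GL (Suc r)" and vs: "v # vs : GL s" and a: "a : A" for us u v vs a
proof -
 have u: "us : GL r" "u : Gam" using us by(auto simp: nlists_def)
 have "D (us @ [u *~ be 1 a]) (v # vs) = Gsplit (us @ [u]) >> (ws,w). F (Kp r ws) (Kp s (w *~ be 1 a # v # vs))"
  unfolding D_def by(rule Gsplit_last[OF good_DeltaK[OF F vs] u a])
 also have "... = D (us @ [u]) (be 1 a *~ v # vs)"
  unfolding D_def by(intro bind_cong2 glin_bal[OF Fr] a vs)(auto dest: Gsplit_keys[OF _ us])
 finally show ?thesis .
qed
have "glin (Suc r + s) (%zs. D (take (Suc r) zs) (drop (Suc r) zs))"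
 using 1 2 3 by(intro tlin_append) auto
thus ?thesis by(simp add: D_def)
qed

lemma DeltaK_bind_gen:
assumes F: "balK r s F"
shows "DeltaK r s k >> (a,b). F a b = k >> us. Gsplit (take (Suc r) us) >> (ws,w). F (Kp r ws) (Kp s (w # drop (Suc r) us))"
unfolding DeltaK_def bind_assoc[of k] bind_assoc2 tns_bind[OF F] by simp

lemma DeltaK_Kp:
assumes F: "balK r s F" and us: "length us = Suc r"
shows "DeltaK r s (Kp (r + s) (us @ vs)) >> (a,b). F a b = Gsplit us >> (ws,w). F (Kp r ws) (Kp s (w # vs))"
proof -
have "glin (Suc (r + s)) (%us. Gsplit (take (Suc r) us) >> (ws,w). F (Kp r ws) (Kp s (w # drop (Suc r) us)))"
 using glin_DeltaK[OF F] by simp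
from Kp_bind[OF this, of "us @ vs"] us show ?thesis by(simp add: DeltaK_bind_gen[OF F])
qed

lemma GL_split: "us : GL (m + n) ==> take m us : GL m & drop m us : GL n"
by(auto simp: nlists_def dest: in_set_takeD in_set_dropD)

lemma DeltaK_in [simp]: "k : Kcar (r + s) ==> DeltaK r s k : car (tensor (K_cx r) A (K_cx s))"
unfolding DeltaK_def
proof(rule bind_in_subspace[OF subspace_tensor], rule tensor_bind_in, rule tns_in; rule Kp_in)
fix us ws w assume k: "k : Kcar (r + s)" and us: "us : keys k" and ws: "(ws, w) : keys (Gsplit (take (r + 1) us))"
have "us : GL (Suc r + s)" using K_keys[OF us k] by simp
note this = GL_split[OF this]
thus "ws : GL (Suc r)" "w # drop (r + 1) us : GL (Suc s)"
 using Gsplit_keys[OF ws, of "Suc r"] by auto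
qed

lemma DeltaK_keys:
assumes "(a, b) : keys (DeltaK r s k)" "k : Kcar (r + s)"
shows "a : Kcar r" "b : Kcar s"
using tensor_keysD[OF assms(1) DeltaK_in[OF assms(2)]] by simp_all

lemma DeltaK_lin [simp]: "DeltaK r s (k + k') = DeltaK r s k + DeltaK r s k'" "DeltaK r s (c*.k) = c *. DeltaK r s k"
by(simp_all add: DeltaK_def bind_linear)

lemma lin_DeltaK_bind: "lin_on (K_cx n) (%k. DeltaK r s k >> f)"
by(simp add: lin_on_def bind_linear)

lemma GL_splitE:
assumes "us : GL (m + n)"
obtains xs ys where "us = xs @ ys" "xs : GL m" "ys : GL n"
using GL_split[OF assms] append_take_drop_id[of m us] by metis

lemma DeltaK_act:
assumes F: "balK r s F" and k: "k : Kcar (r + s)" and v: "v : Gam"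
shows "DeltaK r s (Kact (r + s) v k) >> (a,b). F a b
  = DeltaK r s k >> (a,b). Gcomul v >> (v1,v2). F (Kact r v1 a) (Kact s v2 b)"
proof(rule K_eqI[OF k])
show "lin_on (K_cx (r + s)) (%k. DeltaK r s (Kact (r + s) v k) >> (a,b). F a b)"
 by(simp add: lin_on_def bind_linear)
show "lin_on (K_cx (r + s)) (%k. DeltaK r s k >> (a,b). Gcomul v >> (v1,v2). F (Kact r v1 a) (Kact s v2 b))"
 by(rule lin_DeltaK_bind)
fix ks assume "ks : GL (Suc (r + s))"
then obtain us vs where ks: "ks = us @ vs" "us : GL (Suc r)" "vs : GL s"
 using GL_splitE[of ks "Suc r" s] by auto
have len: "length us = Suc r" using ks(2) by(simp add: nlists_def)
obtain x us' where us: "us = x # us'" "x : Gam" "us' : GL r" using ks(2) by(auto simp: nlists_Suc)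
have lv: "length (v*~x # us') = Suc r" using len us by simp
have lF: "lin_on (K_cx r) (%a. F a b)" if "b : Kcar s" for b using F that by(simp add: bal_K)
have rF: "lin_on (K_cx s) (F a)" if "a : Kcar r" for a using F that by(simp add: bal_K)
have B: "balK r s (%a b. Gcomul v >> (v1,v2). F (Kact r v1 a) (Kact s v2 b))"
 unfolding bal_K
proof(intro conjI ballI)
 show "lin_on (K_cx r) (%a. Gcomul v >> (v1,v2). F (Kact r v1 a) (Kact s v2 b))" if "b : Kcar s" for b
  by(intro lin_on_bind2 lin_on_comp[OF lF klin_Kact])(use that in "auto intro!: Kact_in intro: Gcomul_keys[OF _ v]")
 show "lin_on (K_cx s) (%b. Gcomul v >> (v1,v2). F (Kact r v1 a) (Kact s v2 b))" if "a : Kcar r" for a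
  by(intro lin_on_bind2 lin_on_comp[OF rF klin_Kact])(use that in "auto intro!: Kact_in intro: Gcomul_keys[OF _ v]")
 fix a c b assume a: "a : Kcar r" and c: "c : A" and b: "b : Kcar s"
 have B': "balG (%v1 v2. F (Kact r v1 a) (Kact s v2 b))"
 proof(rule balI)
  show "lin_on GamA (%v1. F (Kact r v1 a) (Kact s v2 b))" if "v2 : car GamA" for v2
   by(rule lin_Kact_left[OF lF a])(use that b in simp)
  show "lin_on GamA (%v2. F (Kact r v1 a) (Kact s v2 b))" if "v1 : car GamA" for v1
   by(rule lin_Kact_left[OF rF b])(use that a in simp)
  show "F (Kact r (rac GamA v1 d) a) (Kact s v2 b) = F (Kact r v1 a) (Kact s (lac GamA d v2) b)"
   if "v1 : car GamA" "d : A" "v2 : car GamA" for v1 d v2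
   using F that a b by(simp add: Kact_Kact[symmetric] A_one bal_K)
 qed
 have "Gcomul v >> (v1,v2). F (Kact r v1 (Kact r (be 1 c) a)) (Kact s v2 b)
  = Gcomul v >> (v1,v2). F (Kact r (v1 *~ be 1 c) a) (Kact s v2 b)"
  by(intro bind_cong2)(simp add: Kact_Kact[OF a] Gcomul_keys[OF _ v] c A_one)
 also have "... = Gcomul v >> (v1,v2). F (Kact r v1 a) (Kact s (v2 *~ be c 1) b)"
  by(rule Gcomul_takeuchi[OF v c B'])
 also have "... = Gcomul v >> (v1,v2). F (Kact r v1 a) (Kact s v2 (Kact s (be c 1) b))"
  by(intro bind_cong2)(simp add: Kact_Kact[OF b] Gcomul_keys[OF _ v] c A_one)
 finally show "Gcomul v >> (v1,v2). F (Kact r v1 (Kact r (be 1 c) a)) (Kact s v2 b)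
  = Gcomul v >> (v1,v2). F (Kact r v1 a) (Kact s v2 (Kact s (be c 1) b))" .
qed
have "DeltaK r s (Kact (r + s) v (Kp (r + s) ks)) >> (a,b). F a b
 = Gsplit (v*~x # us') >> (ws,w). F (Kp r ws) (Kp s (w # vs))"
 using DeltaK_Kp[OF F lv, of vs] by(simp add: Kact_Kp[OF v] ks us)
also have "... = Gcomul v >> (v1,v2). Gsplit (x # us') >> (ws,w). F (Kp r (v1 *~ hd ws # tl ws)) (Kp s (v2*~w # vs))"
 by(rule Gsplit_act[OF good_DeltaK[OF F ks(3)] v])(use us ks in simp)
also have "... = Gcomul v >> (v1,v2). Gsplit us >> (ws,w). F (Kact r v1 (Kp r ws)) (Kact s v2 (Kp s (w # vs)))"
 unfolding us(1)[symmetric] by(intro bind_cong2)(simp add: Kact_Kp Gcomul_keys[OF _ v])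
also have "... = Gsplit us >> (ws,w). Gcomul v >> (v1,v2). F (Kact r v1 (Kp r ws)) (Kact s v2 (Kp s (w # vs)))"
 by(rule bind_commute2)
also have "... = DeltaK r s (Kp (r + s) ks) >> (a,b). Gcomul v >> (v1,v2). F (Kact r v1 a) (Kact s v2 b)"
 unfolding ks(1) DeltaK_Kp[OF B len] ..
finally show "DeltaK r s (Kact (r + s) v (Kp (r + s) ks)) >> (a,b). F a b
  = DeltaK r s (Kp (r + s) ks) >> (a,b). Gcomul v >> (v1,v2). F (Kact r v1 a) (Kact s v2 b)" .
qed

lemma DeltaK_act_A:
assumes F: "balK r s F" and k: "k : Kcar (r + s)" and a: "a : A" "a' : A"
shows "DeltaK r s (Kact (r + s) (be a a') k) >> (x,y). F x y
  = DeltaK r s k >> (x,y). F (Kact r (be a 1) x) (Kact s (be 1 a') y)"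
unfolding DeltaK_act[OF F k be_Gam[OF a]] Gcomul_be[OF a]
proof(intro bind_cong2 tns_bind)
fix x y assume "(x, y) : keys (DeltaK r s k)"
hence xy: "x : Kcar r" "y : Kcar s" using DeltaK_keys[OF _ k] by auto
show "balG (%v1 v2. F (Kact r v1 x) (Kact s v2 y))"
proof(rule balI)
 show "lin_on GamA (%v1. F (Kact r v1 x) (Kact s v2 y))" if "v2 : car GamA" for v2
  by(rule lin_Kact_left[OF _ xy(1)])(use that F xy in "simp add: bal_K")
 show "lin_on GamA (%v2. F (Kact r v1 x) (Kact s v2 y))" if "v1 : car GamA" for v1
  by(rule lin_Kact_left[OF _ xy(2)])(use that F xy in "simp add: bal_K")
 show "F (Kact r (rac GamA v1 d) x) (Kact s v2 y) = F (Kact r v1 x) (Kact s (lac GamA d v2) y)"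
  if "v1 : car GamA" "d : A" "v2 : car GamA" for v1 d v2
  using F that xy by(simp add: Kact_Kact[symmetric] A_one bal_K)
qed
qed

lemma DeltaK_coassoc:
assumes F: "tribal (K_cx r) A (K_cx s) A (K_cx t) F" and k: "k : Kcar (r + s + t)"
shows "DeltaK (r + s) t k >> (a,c). DeltaK r s a >> (a,b). F a b c
  = DeltaK r (s + t) k >> (a,c). DeltaK s t c >> (b,c). F a b c" (is "?A k = ?B k")
proof(rule K_eqI[OF k, of ?A ?B])
show "lin_on (K_cx (r + s + t)) ?A" "lin_on (K_cx (r + s + t)) ?B"
 by(rule lin_DeltaK_bind)+
have B3: "balK r s (%a b. F a b c)" if "c : Kcar t" for c
 using F that by(simp add: tribal_def)
have B4: "balK s t (F a)" if "a : Kcar r" for a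
 using F that by(simp add: tribal_def)
have Fl: "lin_on (K_cx r) (%a. F a b c)" if "b : Kcar s" "c : Kcar t" for b c
 using B3 that by(simp add: bal_K)
have Fm: "lin_on (K_cx s) (%b. F a b c)" if "a : Kcar r" "c : Kcar t" for a c
 using B3 that by(simp add: bal_K)
have Fr: "lin_on (K_cx t) (F a b)" if "a : Kcar r" "b : Kcar s" for a b
 using B4 that by(simp add: bal_K)
have B1: "balK (r + s) t (%a c. DeltaK r s a >> (a,b). F a b c)"
 unfolding bal_K
proof(intro conjI ballI)
 fix a d c assume a: "a : Kcar (r + s)" and d: "d : A" and c: "c : Kcar t"
 have c': "Kact t (be d 1) c : Kcar t" by(simp add: c d A_one)
 show "DeltaK r s (Kact (r + s) (be 1 d) a) >> (a,b). F a b c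
  = DeltaK r s a >> (a,b). F a b (Kact t (be d 1) c)"
  unfolding DeltaK_act_A[OF B3[OF c] a A_one d]
 proof(rule bind_cong2)
  fix x y assume "(x, y) : keys (DeltaK r s a)"
  hence xy: "x : Kcar r" "y : Kcar s" using DeltaK_keys[OF _ a] by auto
  show "F (Kact r (be 1 1) x) (Kact s (be 1 d) y) c = F x y (Kact t (be d 1) c)"
   using B4[OF xy(1)] xy c d by(simp add: bal_K Kact_one)
 qed
qed (auto intro!: lin_DeltaK_bind lin_on_bind2 Fr dest: DeltaK_keys)
have B2: "balK r (s + t) (%a c. DeltaK s t c >> (b,c). F a b c)"
 unfolding bal_K
proof(intro conjI ballI)
 fix a d c assume a: "a : Kcar r" and d: "d : A" and c: "c : Kcar (s + t)"
 show "DeltaK s t c >> (b,c). F (Kact r (be 1 d) a) b c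
  = DeltaK s t (Kact (s + t) (be d 1) c) >> (b,c). F a b c"
  unfolding DeltaK_act_A[OF B4[OF a] c d A_one]
 proof(rule bind_cong2)
  fix x y assume "(x, y) : keys (DeltaK s t c)"
  hence xy: "x : Kcar s" "y : Kcar t" using DeltaK_keys[OF _ c] by auto
  show "F (Kact r (be 1 d) a) x y = F a (Kact s (be d 1) x) (Kact t (be 1 1) y)"
   using B3[OF xy(2)] xy a d by(simp add: bal_K Kact_one)
 qed
qed (auto intro!: lin_DeltaK_bind lin_on_bind2 Fl dest: DeltaK_keys)
fix ks assume "ks : GL (Suc (r + s + t))"
then obtain us vs' where ks1: "ks = us @ vs'" "us : GL (Suc r)" "vs' : GL (s + t)"
 using GL_splitE[of ks "Suc r" "s + t"] by(auto simp: add.assoc)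
then obtain vs xs where ks: "ks = us @ vs @ xs" "vs : GL s" "xs : GL t"
 using GL_splitE[of vs' s t] by auto
note us = ks1(2)
have len: "length us = Suc r" "length vs = s" "length (us @ vs) = Suc (r + s)" using ks us by(auto simp: nlists_def)
have us_vs: "us @ vs : GL (Suc r + s)" using nlists_append[OF us ks(2)] .
define \<Psi> where "\<Psi> ws w1 w = Gsplit vs >> (ws',w'). F (Kp r ws) (Kp s (w1 # ws')) (Kp t (w*~w' # xs))" for ws w1 w
have "?A (Kp (r + s + t) ks)
 = Gsplit (us @ vs) >> (ws,w). DeltaK r s (Kp (r + s) ws) >> (a,b). F a b (Kp t (w # xs))"
 using DeltaK_Kp[OF B1 len(3), of xs] ks by simp
also have "... = Gsplit us >> (ws,w). Gsplit vs >> (ws',w'). DeltaK r s (Kp (r + s) (ws @ ws')) >> (a,b). F a b (Kp t (w*~w' # xs))"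
 by(rule Gsplit_append[OF ks(2)])
also have "... = Gsplit us >> (ws,w). Gsplit vs >> (ws',w'). Gsplit ws >> (ws1,w1). F (Kp r ws1) (Kp s (w1 # ws')) (Kp t (w*~w' # xs))"
proof(intro bind_cong2 DeltaK_Kp B3 Kp_in)
 fix ws w ws' w' assume h: "(ws, w) : keys (Gsplit us)" "(ws', w') : keys (Gsplit vs)"
 show "length ws = Suc r" using Gsplit_keys[OF h(1) us] by(simp add: nlists_def)
 show "w*~w' # xs : GL (Suc t)" using Gsplit_keys[OF h(1) us] Gsplit_keys[OF h(2) ks(2)] ks(3) by simp
qed
also have "... = Gsplit us >> (ws,w). Gsplit ws >> (ws1,w1). \<Psi> ws1 w1 w"
 unfolding \<Psi>_def by(rule bind_cong2, rule bind_commute2)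
also have "... = Gsplit us >> (ws,w). Gcomul w >> (w1,w2). \<Psi> ws w1 w2"
proof(rule Gsplit_coassoc[OF _ _ us])
 show "good (Suc r) (%ws w1. \<Psi> ws w1 w)" if "w : Gam" for w
  unfolding \<Psi>_def
 proof(intro good_bind2 good_DeltaK B3 Kp_in)
  fix ws' w' assume h: "(ws', w') : keys (Gsplit vs)"
  show "w*~w' # xs : GL (Suc t)" "ws' : GL s" using Gsplit_keys[OF h ks(2)] ks(3) that by simp_all
 qed
 fix ws assume ws: "ws : GL (Suc r)"
 have a: "Kp r ws : Kcar r" by(rule Kp_in[OF ws])
 show "balG (\<Psi> ws)"
  unfolding \<Psi>_def by(intro bal_bind2 bal_good_head[OF good_DeltaK[OF B4[OF a] ks(3)]])(auto dest: Gsplit_keys[OF _ ks(2)])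
qed
also have "... = Gsplit us >> (ws,w). DeltaK s t (Kp (s + t) ((w # vs) @ xs)) >> (b,c). F (Kp r ws) b c"
proof(rule bind_cong2)
 fix ws w assume "(ws, w) : keys (Gsplit us)"
 hence a: "Kp r ws : Kcar r" using Gsplit_keys[OF _ us] by(intro Kp_in) auto
 have "DeltaK s t (Kp (s + t) ((w # vs) @ xs)) >> (b,c). F (Kp r ws) b c = Gsplit (w # vs) >> (ws',w'). F (Kp r ws) (Kp s ws') (Kp t (w' # xs))"
  by(rule DeltaK_Kp[OF B4[OF a]])(simp add: len)
 thus "Gcomul w >> (w1,w2). \<Psi> ws w1 w2 = DeltaK s t (Kp (s + t) ((w # vs) @ xs)) >> (b,c). F (Kp r ws) b c"
  by(simp add: \<Psi>_def Gsplit_Cons)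
qed
also have "... = ?B (Kp (r + s + t) ks)"
 using DeltaK_Kp[OF B2 len(1), of "vs @ xs"] ks(1) by(simp add: add.assoc)
finally show "?A (Kp (r + s + t) ks)
 = ?B (Kp (r + s + t) ks)" .
qed

text \<open>As for \<open>L\<close>. Here the last face of the first factor is the one by the counit, and it cancels the first
face of the second factor by \<open>Gsplit_counit\<close>.\<close>

lemma DeltaK_chain:
assumes F: "balK r s F" and k: "k : Kcar (r + s + 1)"
shows "DeltaK r s (dK (r + s + 1) k) >> (a,b). F a b
 = (DeltaK (r + 1) s k >> (a,b). F (dK (r + 1) a) b)
 + ((-1) ^ r) *. (DeltaK r (s + 1) k >> (a,b). F a (dK (s + 1) b))" (is "?A k = ?B k + ?e *. ?C k")
proof(rule K_eqI[OF k, of ?A "%l. ?B l + ?e *. ?C l"])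
show "lin_on (K_cx (r + s + 1)) ?A" "lin_on (K_cx (r + s + 1)) (%l. ?B l + ?e *. ?C l)"
 by(simp_all add: lin_on_def bind_linear fscale_plus mult.commute)
fix ks assume ks0: "ks : GL (Suc (r + s + 1))"
then obtain us vs' where ks1: "ks = us @ vs'" "us : GL (Suc r)" "vs' : GL (Suc s)"
 using GL_splitE[of ks "Suc r" "Suc s"] by auto
then obtain u vs where ks: "ks = us @ u # vs" "u : Gam" "vs : GL s" by(auto simp: nlists_Suc)
note us = ks1(2)
have len: "length us = Suc r" "length vs = s" using us ks by(auto simp: nlists_def)
have usu: "us @ [u] : GL (Suc (Suc r))" using nlists_append[OF us, of "[u]" 1] ks by simp
have Fl: "lin_on (K_cx r) (%a. F a b)" if "b : Kcar s" for b using F that by(simp add: bal_K)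
have Fr: "lin_on (K_cx s) (F a)" if "a : Kcar r" for a using F that by(simp add: bal_K)
have B1: "balK (Suc r) s (%a b. F (dK (Suc r) a) b)"
 using F unfolding bal_K by(auto intro!: lin_on_comp[OF Fl klin_dK] Fr simp: dK_Kact A_one)
have B2: "balK r (Suc s) (%a b. F a (dK (Suc s) b))"
 using F unfolding bal_K by(auto intro!: lin_on_comp[OF Fr klin_dK] Fl simp: dK_Kact A_one)
define D where "D us vs = Gsplit us >> (ws,w). F (Kp r ws) (Kp s (w # vs))" for us vs
have D: "DeltaK r s (Kp (r + s) (xs @ ys)) >> (a,b). F a b = D xs ys" if "length xs = Suc r" for xs ys
 using DeltaK_Kp[OF F that] by(simp add: D_def)
define M1 where "M1 = (\<Sum>i<Suc r. ((-1) ^ i) *. D (mrg bemul i (us @ [u])) vs)"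
define Z where "Z = Gsplit us >> (ws,w). F (Kp r ws) (Kp s (w*~u # vs))"
define M2 where "M2 = (\<Sum>j<s. ((-1) ^ j) *. D us (mrg bemul j (u # vs)))"
define E where "E = Gsplit us >> (ws,w). F (Kp r ws) (Kp s (lface s (w # u # vs)))"
have lhs: "?A (Kp (r + s + 1) ks)
  = M1 + ((-1) ^ Suc r) *. M2 + ((-1) ^ Suc (r + s)) *. E"
proof -
 let ?f = "%l. DeltaK r s l >> (a,b). F a b"
 have "?f (dK (Suc (r + s)) (Kp (Suc (r + s)) ks))
  = (\<Sum>i<Suc r + s. ((-1) ^ i) *. ?f (Kp (r + s) (mrg bemul i ks)))
  + ((-1) ^ Suc (r + s)) *. ?f (Kp (r + s) (lface (r + s) ks))"
  using lin_dK_Kp[OF lin_DeltaK_bind, of ks "r + s" r s "%(a,b). F a b"] ks0 by(simp del: sum.lessThan_Suc power_Suc)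
 also have "(\<Sum>i<Suc r + s. ((-1) ^ i) *. ?f (Kp (r + s) (mrg bemul i ks)))
  = M1 + ((-1) ^ Suc r) *. M2"
 proof -
  have "?f (Kp (r + s) (mrg bemul i ks)) = D (mrg bemul i (us @ [u])) vs" if "i < Suc r" for i
   using mrg_append[of i "us @ [u]" "bemul" vs] mrg_length[of i "us @ [u]" "bemul"] that ks len D by simp
  moreover have "?f (Kp (r + s) (mrg bemul (Suc r + j) ks)) = D us (mrg bemul j (u # vs))" for j
   using mrg_append'[of "bemul" us j "u # vs"] ks len D[of us] by simp
  ultimately show ?thesis
   unfolding sum_lessThan_split M1_def M2_def fv.scale_sum_right
   by(simp add: power_add del: sum.lessThan_Suc)
 qed
 also have "?f (Kp (r + s) (lface (r + s) ks)) = E"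
 proof(cases s)
  case 0
  hence vs: "vs = []" using ks by simp
  obtain us' x where x: "us = us' @ [x]" using len by(cases us rule: rev_cases) auto
  have us': "us' : GL r" "x : Gam" "length us' = r" using us x by(auto simp: nlists_def)
  have lf: "lface r (us @ [u]) = us' @ [x *~ be 1 (Gcounit u)]"
   using lface_append[of us' 0 "[x, u]"] us'(3) x by simp
  have "?f (Kp (r + s) (lface (r + s) ks)) = D (us' @ [x *~ be 1 (Gcounit u)]) []"
   using D[of "us' @ [x *~ be 1 (Gcounit u)]" "[]"] lf us' ks 0 vs by simp
  also have "... = Gsplit us >> (ws,w). F (Kp r ws) (Kp s [w *~ be 1 (Gcounit u)])"
   unfolding D_def x
   by(rule Gsplit_last[OF good_DeltaK[OF F]])(use us' 0 ks in "auto simp: Gcounit_in_A")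
  finally show ?thesis by(simp add: E_def 0 vs)
 next
  case (Suc s')
  hence "lface (r + s) ks = us @ lface s' (u # vs)"
   using lface_append[of us s' "u # vs"] ks len by simp
  thus ?thesis using D[OF len(1), of "lface s' (u # vs)"] by(simp add: E_def D_def Suc)
 qed
 finally show ?thesis by simp
qed
have rhs1: "?B (Kp (r + s + 1) ks) = M1 + ((-1) ^ Suc r) *. Z"
proof -
 have "?B (Kp (r + s + 1) ks)
  = Gsplit (us @ [u]) >> (ws,w). F (dK (Suc r) (Kp (Suc r) ws)) (Kp s (w # vs))"
  using DeltaK_Kp[OF B1, of "us @ [u]" vs] ks len by simp
 also have "... = Gsplit (us @ [u]) >> (ws,w). (\<Sum>i<Suc r. ((-1) ^ i) *. F (Kp r (mrg bemul i ws)) (Kp s (w # vs)))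
   + ((-1) ^ Suc r) *. F (Kp r (lface r ws)) (Kp s (w # vs))"
 proof(intro bind_cong2 lin_dK_Kp Fl Kp_in)
  fix ws w assume "(ws, w) : keys (Gsplit (us @ [u]))"
  thus "ws : GL (Suc (Suc r))" "w # vs : GL (Suc s)" using Gsplit_keys[OF _ usu] ks by auto
 qed
 also have "... = (\<Sum>i<Suc r. ((-1) ^ i) *. (Gsplit (us @ [u]) >> (ws,w). F (Kp r (mrg bemul i ws)) (Kp s (w # vs))))
  + ((-1) ^ Suc r) *. (Gsplit (us @ [u]) >> (ws,w). F (Kp r (lface r ws)) (Kp s (w # vs)))"
  unfolding bind_add_right2 bind_scale_right2 bind_sum_right2 ..
 also have "Gsplit (us @ [u]) >> (ws,w). F (Kp r (lface r ws)) (Kp s (w # vs)) = Z"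
  unfolding Z_def by(rule Gsplit_counit[OF good_DeltaK[OF F ks(3)] us ks(2)])
 also have "(\<Sum>i<Suc r. ((-1) ^ i) *. (Gsplit (us @ [u]) >> (ws,w). F (Kp r (mrg bemul i ws)) (Kp s (w # vs)))) = M1"
  unfolding M1_def D_def
  by(intro sum.cong refl arg_cong[of _ _ "fscale _"] Gsplit_mrg[OF good_DeltaK[OF F ks(3)] _ usu, symmetric]) simp
 finally show ?thesis .
qed
have rhs2: "?C (Kp (r + s + 1) ks) = Z - M2 + ((-1) ^ Suc s) *. E"
proof -
 have "?C (Kp (r + s + 1) ks)
  = Gsplit us >> (ws,w). F (Kp r ws) (dK (Suc s) (Kp (Suc s) (w # u # vs)))"
  using DeltaK_Kp[OF B2 len(1), of "u # vs"] ks by simp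
 also have "... = Gsplit us >> (ws,w). (\<Sum>j<Suc s. ((-1) ^ j) *. F (Kp r ws) (Kp s (mrg bemul j (w # u # vs))))
   + ((-1) ^ Suc s) *. F (Kp r ws) (Kp s (lface s (w # u # vs)))"
 proof(intro bind_cong2 lin_dK_Kp Fr Kp_in)
  fix ws w assume "(ws, w) : keys (Gsplit us)"
  thus "ws : GL (Suc r)" "w # u # vs : GL (Suc (Suc s))" using Gsplit_keys[OF _ us] ks by auto
 qed
 also have "... = (\<Sum>j<Suc s. ((-1) ^ j) *. (Gsplit us >> (ws,w). F (Kp r ws) (Kp s (mrg bemul j (w # u # vs)))))
  + ((-1) ^ Suc s) *. E"
  unfolding bind_add_right2 bind_scale_right2 bind_sum_right2 E_def ..
 also have "(\<Sum>j<Suc s. ((-1) ^ j) *. (Gsplit us >> (ws,w). F (Kp r ws) (Kp s (mrg bemul j (w # u # vs))))) = Z - M2"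
  unfolding sum.lessThan_Suc_shift Z_def M2_def D_def by(simp add: sum_negf)
 finally show ?thesis .
qed
show "?A (Kp (r + s + 1) ks) =
 ?B (Kp (r + s + 1) ks)
 + ?e *. ?C (Kp (r + s + 1) ks)"
 unfolding lhs rhs1 rhs2 by(simp add: fscale_plus fv.scale_right_diff_distrib power_add)
qed

end

section \<open>Exterior products on the left\<close>

lemma bal_mono: "bal M S N F ==> R <= S ==> bal M R N F"
by(auto simp: bal_def)

lemma bal_comp: "bal M R N F ==> rhom R M' M f ==> lhom R N' N g ==> bal M' R N' (%x y. F (f x) (g y))"
by(auto simp: bal_def lin_on_def rhom_def lhom_def klin_def)

lemma tribal_cong:
assumes "tribal M R N S Q F" "!!m n q. m : car M ==> n : car N ==> q : car Q ==> F m n q = F' m n q"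
 "rclosed M R" "lclosed R N" "rclosed N S" "lclosed S Q"
shows "tribal M R N S Q F'"
using assms unfolding tribal_def bal_def lin_on_def rclosed_def lclosed_def
by(simp add: kclosed_add kclosed_scl)

lemma neg1_pow_eq: "even m = even n ==> (- 1 :: 'a::ring_1) ^ m = (- 1) ^ n"
by(simp add: minus_one_power_iff)

lemma
assumes "bimod_hom R S M N f"
shows hom_klin: "klin M N f" and hom_lhom: "lhom R M N f" and hom_rhom: "rhom S M N f"
using assms by(auto simp: bimod_hom_def klin_def lhom_def rhom_def)

lemma klin_lin: "klin M N f ==> scl N = fscale ==> lin_on M f"
by(simp add: klin_def lin_on_def)

lemma
assumes "bimod_hom R S M N f"
shows hom_in: "m : car M ==> f m : car N"
 and hom_add: "m : car M ==> m' : car M ==> f (m + m') = f m + f m'"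
 and hom_scl: "m : car M ==> f (scl M c m) = scl N c (f m)"
 and hom_lac: "m : car M ==> r : R ==> f (lac M r m) = lac N r (f m)"
 and hom_rac: "m : car M ==> s : S ==> f (rac M m s) = rac N (f m) s"
using assms by(auto simp: bimod_hom_def)

lemma hom_comp: "bimod_hom R S N Q f ==> bimod_hom R S M N g ==> bimod_hom R S M Q (%x. f (g x))"
by(auto simp: bimod_hom_def)

lemma hom_id: "bimod_hom R S M M (%x. x)" "bimod_hom R S M M id"
by(simp_all add: bimod_hom_def)

context hopf_galois_ext
begin

lemma
assumes M: "bimodule M"
shows bim_kclosed: "kclosed M" and bim_rclosed: "rclosed M R" and bim_lclosed: "lclosed R M"
 and bim_lhom: "lhom R M M (%m. rac M m b)" and bim_rhom: "rhom R M M (lac M b)"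
 and bim_lac_in: "m : car M ==> lac M b m : car M" and bim_rac_in: "m : car M ==> rac M m b : car M"
proof -
note D = M[unfolded bimodule_def]
show k: "kclosed M" using D unfolding kclosed_def by metis
show 1: "m : car M ==> lac M b m : car M" "m : car M ==> rac M m b : car M" for m b using D by metis+
show "rclosed M R" "lclosed R M" using k 1 by(auto simp: rclosed_def lclosed_def)
have s: "scl M c m = lac M (bs c 1) m" "scl M c m = rac M m (bs c 1)" "rac M (lac M b m) b' = lac M b (rac M m b')"
 if "m : car M" for c m b b'
 using D that by blast+
have "rac M (scl M c m) b = scl M c (rac M m b)" if "m : car M" for c m
 by(simp only: s(1)[OF that] s(1)[OF 1(2)[OF that]] s(3)[OF that])
moreover have "lac M b (scl M c m) = scl M c (lac M b m)" if "m : car M" for c m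
 by(simp only: s(2)[OF that] s(2)[OF 1(1)[OF that]] s(3)[OF that])
ultimately show "lhom R M M (%m. rac M m b)" "rhom R M M (lac M b)"
 using D by(auto simp: lhom_def rhom_def klin_def)
qed

lemma
assumes M: "bimodule M" and m: "m : car M"
shows bim_lac_lac: "lac M b (lac M c m) = lac M (b * c) m" and bim_rac_rac: "rac M (rac M m b) c = rac M m (b * c)"
 and bim_one: "lac M 1 m = m" "rac M m 1 = m" and bim_lac_rac: "rac M (lac M b m) c = lac M b (rac M m c)"
 and bim_plus: "lac M (b + c) m = lac M b m + lac M c m" "rac M m (b + c) = rac M m b + rac M m c"
 and bim_bs: "lac M (bs x b) m = scl M x (lac M b m)" "rac M m (bs x b) = scl M x (rac M m b)"
proof -
note D = M[unfolded bimodule_def]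
show 1: "lac M b (lac M c m) = lac M (b * c) m" "rac M (rac M m b) c = rac M m (b * c)"
 "lac M 1 m = m" "rac M m 1 = m" "rac M (lac M b m) c = lac M b (rac M m c)"
 "lac M (b + c) m = lac M b m + lac M c m" "rac M m (b + c) = rac M m b + rac M m c" for b c
 using D m by(simp_all)
have s: "scl M c m = lac M (bs c 1) m" "scl M c m = rac M m (bs c 1)" if "m : car M" for c m
 using D that by blast+
have "lac M (bs x 1 * b) m = scl M x (lac M b m)" "rac M m (b * bs x 1) = scl M x (rac M m b)"
 by(simp_all only: s(1)[OF bim_lac_in[OF M m]] s(2)[OF bim_rac_in[OF M m]] 1)
thus "lac M (bs x b) m = scl M x (lac M b m)" "rac M m (bs x b) = scl M x (rac M m b)" by simp_all
qed

lemma
shows lac_tensor_bind: "lac (tensor M R N) b (v >> f) = v >> x. lac (tensor M R N) b (f x)"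
 and rac_tensor_bind: "rac (tensor M R N) (v >> f) c = v >> x. rac (tensor M R N) (f x) c"
 and lac_tensor_lin: "lac (tensor M R N) b (t + u) = lac (tensor M R N) b t + lac (tensor M R N) b u"
  "lac (tensor M R N) b (z*.t) = z *. lac (tensor M R N) b t"
 and rac_tensor_lin: "rac (tensor M R N) (t + u) c = rac (tensor M R N) t c + rac (tensor M R N) u c"
  "rac (tensor M R N) (z*.t) c = z *. rac (tensor M R N) t c"
by(simp_all add: lac_tensor rac_tensor bind_assoc bind_linear)

lemma
assumes "bimodule M" "bimodule N"
shows lac_cross: "lac (M ** N) b (tnsU M N m n) = tnsU M N (lac M b m) n"
 and rac_cross: "rac (M ** N) (tnsU M N m n) c = tnsU M N m (rac N n c)"
using assms by(simp_all add: lac_tns rac_tns bim_rhom bim_lhom)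

lemma bim_tensor:
assumes M: "bimodule M" and N: "bimodule N"
shows "bimodule (M ** N)"
proof -
have keys: "m : car M" "n : car N" if "t : car (M ** N)" "(m, n) : keys t" for t m n
 using tensor_keysD[OF that(2,1) bim_rclosed[OF M] bim_lclosed[OF N]] by auto
have self: "t >> (m,n). f m n = t" if t: "t : car (M ** N)" and "!!m n. m : car M ==> n : car N ==> f m n = tnsU M N m n" for f t
 using tensor_self[OF t] keys[OF t] that(2) bind_cong2[of t f "tnsU M N"] by auto
have sc: "t >> (m,n). f m n = c*.t" if t: "t : car (M ** N)" and "!!m n. m : car M ==> n : car N ==> f m n = c *. tnsU M N m n" for f t c
 using tensor_self[OF t] keys[OF t] that(2) bind_cong2[of t f "%m n. c *. tnsU M N m n"] by(auto simp: bind_scale_right2)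
note bl = bim_one[OF M] bim_one[OF N] bim_plus[OF M] bim_plus[OF N] bim_bs[OF M] bim_bs[OF N] bim_lac_lac[OF M] bim_rac_rac[OF N]
show ?thesis
 unfolding bimodule_def scl_tensor
proof(intro conjI allI ballI)
 fix t assume t: "t : car (M ** N)"
 show "lac (M ** N) b t : car (M ** N)" "rac (M ** N) t b : car (M ** N)" for b
  by(rule lac_in[OF bim_rhom[OF M] t], rule rac_in[OF bim_lhom[OF N] t])
 show "lac (M ** N) (b + b') t = lac (M ** N) b t + lac (M ** N) b' t"
  "rac (M ** N) t (b + b') = rac (M ** N) t b + rac (M ** N) t b'" for b b'
  unfolding lac_tensor rac_tensor bind_add_right2[symmetric]
  using keys[OF t] bim_lac_in[OF M] bim_rac_in[OF N] by(auto intro!: bind_cong2 simp: bl tns_add_left tns_add_right)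
 show "lac (M ** N) (b * b') t = lac (M ** N) b (lac (M ** N) b' t)" for b b'
  unfolding lac_tensor[of _ _ _ b'] lac_tensor_bind lac_tensor[of _ _ _ "b * b'"] using keys[OF t]
  by(auto intro!: bind_cong simp: lac_cross[OF M N] bl)
 show "rac (M ** N) t (b * b') = rac (M ** N) (rac (M ** N) t b) b'" for b b'
  unfolding rac_tensor[of _ _ _ _ b] rac_tensor_bind rac_tensor[of _ _ _ _ "b * b'"] using keys[OF t]
  by(auto intro!: bind_cong simp: rac_cross[OF M N] bl)
 show "lac (M ** N) 1 t = t" "rac (M ** N) t 1 = t"
  unfolding lac_tensor rac_tensor by(rule self[OF t], simp add: bl)+
 show "rac (M ** N) (lac (M ** N) b t) b' = lac (M ** N) b (rac (M ** N) t b')" for b b'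
  unfolding lac_tensor[of _ _ _ _ t] rac_tensor[of _ _ _ t] rac_tensor_bind lac_tensor_bind
  by(auto intro!: bind_cong simp: rac_cross[OF M N] lac_cross[OF M N])
 show "c*.t = lac (M ** N) (bs c 1) t" "c*.t = rac (M ** N) t (bs c 1)" for c
  unfolding lac_tensor rac_tensor
  by(rule sc[OF t, symmetric], simp add: bl tns_scl_left tns_scl_right)+
qed (auto simp: lac_tensor_lin rac_tensor_lin kclosed_zero kclosed_diff)
qed

lemma hom_scale: "bimodule N ==> scl N = fscale ==> bimod_hom R S M N f ==> bimod_hom R S M N (%x. c *. f x)"
using bim_rhom[of N "{}"] bim_lhom[of N "{}"] bim_kclosed[of N]
by(auto simp: bimod_hom_def rhom_def lhom_def klin_def kclosed_def mult.commute fscale_plus)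

subsection \<open>Products of \<open>A\<close>-bilinear maps on \<open>K\<close>\<close>

abbreviation "Ahom n M f == bimod_hom A A (K_cx n) M f"

lemma
assumes "Ahom n M f" and k: "k : Kcar n"
shows Ahom_lac: "a : A ==> f (Kact n (be a 1) k) = lac M a (f k)"
 and Ahom_rac: "a : A ==> f (Kact n (be 1 a) k) = rac M (f k) a"
 and Ahom_fscale: "f (c*.k) = scl M c (f k)"
using hom_lac[OF assms] hom_rac[OF assms] hom_scl[OF assms] by simp_all

definition crossK where
"crossK r s M N f g k = DeltaK r s k >> (x,y). tnsU M N (f x) (g y)"

lemma bal_cross:
assumes "rhom A (K_cx r) M f" "lhom A (K_cx s) N g"
shows "balK r s (%x y. tnsU M N (f x) (g y))"
using bal_comp[OF bal_mono[OF bal_tns] assms] by blast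

lemma crossK_hom:
assumes M: "bimodule M" and N: "bimodule N" and f: "Ahom r M f" and g: "Ahom s N g"
shows "Ahom (r + s) (M ** N) (crossK r s M N f g)"
unfolding bimod_hom_def scl_tensor K_cx_simps
proof(intro conjI ballI allI)
note B = bal_cross[OF hom_rhom[OF f] hom_lhom[OF g]]
fix k assume k: "k : Kcar (r + s)"
note keys = DeltaK_keys[OF _ k]
show "crossK r s M N f g k : car (M ** N)"
 unfolding crossK_def by(intro tensor_bind_in tns_in hom_in[OF f] hom_in[OF g] keys)
show "crossK r s M N f g (k + k') = crossK r s M N f g k + crossK r s M N f g k'" for k'
 by(simp add: crossK_def bind_linear)
show "crossK r s M N f g (c*.k) = c *. crossK r s M N f g k" for c
 by(simp add: crossK_def bind_linear)
fix a assume a: "a : A"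
show "crossK r s M N f g (Kact (r + s) (be a 1) k) = lac (M ** N) a (crossK r s M N f g k)"
 "crossK r s M N f g (Kact (r + s) (be 1 a) k) = rac (M ** N) (crossK r s M N f g k) a"
 unfolding crossK_def DeltaK_act_A[OF B k a A_one] DeltaK_act_A[OF B k A_one a] lac_tensor_bind rac_tensor_bind
 using keys a by(auto intro!: bind_cong simp: Kact_one Ahom_lac[OF f] Ahom_rac[OF g] lac_cross[OF M N] rac_cross[OF M N])
qed

lemma crossK_chain:
assumes f: "Ahom r M f" and g: "Ahom s N g" and k: "k : Kcar (r + s + 1)"
shows "crossK r s M N f g (dK (r + s + 1) k) =
 crossK (r + 1) s M N (%x. f (dK (r + 1) x)) g k + ((-1) ^ r) *. crossK r (s + 1) M N f (%y. g (dK (s + 1) y)) k"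
unfolding crossK_def by(rule DeltaK_chain[OF bal_cross[OF hom_rhom[OF f] hom_lhom[OF g]] k])

lemma tribal_cross:
assumes f: "rhom A (K_cx r) M f" and g: "Ahom s N g" and h: "lhom A (K_cx t) Q h" and N: "bimodule N"
shows "tribal (K_cx r) A (K_cx s) A (K_cx t) (%x y z. tnsU M (N ** Q) (f x) (tnsU N Q (g y) (h z)))"
proof -
have T: "tribal M UNIV N UNIV Q (%m n q. tnsU M (N ** Q) m (tnsU N Q n q))"
 by(rule tribal_tns[OF bim_rhom[OF N]])
show ?thesis
proof(rule tribalI)
 fix z assume "z : Kcar t"
 hence "h z : car Q" using h by(simp add: lhom_def klin_def)
 with T have "balU M N (%m n. tnsU M (N ** Q) m (tnsU N Q n (h z)))" by(simp add: tribal_def)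
 from bal_comp[OF bal_mono[OF this] f hom_lhom[OF g]]
 show "balK r s (%x y. tnsU M (N ** Q) (f x) (tnsU N Q (g y) (h z)))" by blast
next
 fix x assume "x : Kcar r"
 hence "f x : car M" using f by(simp add: rhom_def klin_def)
 with T have "balU N Q (%n q. tnsU M (N ** Q) (f x) (tnsU N Q n q))" by(simp add: tribal_def)
 from bal_comp[OF bal_mono[OF this] hom_rhom[OF g] h]
 show "balK s t (%y z. tnsU M (N ** Q) (f x) (tnsU N Q (g y) (h z)))" by blast
qed
qed

lemma crossK_cong: "k : Kcar (r + s) ==> (!!x. x : Kcar r ==> f x = f' x) ==> (!!y. y : Kcar s ==> g y = g' y) ==>
 crossK r s M N f g k = crossK r s M N f' g' k"
unfolding crossK_def by(intro bind_cong2)(simp add: DeltaK_keys)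

lemma crossK_assoc:
assumes M: "bimodule M" and N: "bimodule N"
 and f: "Ahom r M f" and g: "Ahom s N g" and h: "Ahom t Q h" and k: "k : Kcar (r + s + t)"
shows "tassocU M N Q (crossK (r + s) t (M ** N) Q (crossK r s M N f g) h k) =
 crossK r (s + t) M (N ** Q) f (crossK s t N Q g h) k"
proof -
define \<Phi> where "\<Phi> x y z = tnsU M (N ** Q) (f x) (tnsU N Q (g y) (h z))" for x y z
have T: "tribal M UNIV N UNIV Q (%m n q. tnsU M (N ** Q) m (tnsU N Q n q))"
 by(rule tribal_tns[OF bim_rhom[OF N]])
have k': "k : Kcar (r + (s + t))" using k by(simp add: add.assoc)
have "tassocU M N Q (crossK (r + s) t (M ** N) Q (crossK r s M N f g) h k)
 = DeltaK (r + s) t k >> (x,z). crossK r s M N f g x >> (m,n). tnsU M (N ** Q) m (tnsU N Q n (h z))"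
 unfolding crossK_def[of "r + s"] tassoc_def bind_assoc2
  tns_bind[OF bal_tensor_left[OF T bim_rclosed[OF M] bim_lclosed[OF N]]] ..
also have "... = DeltaK (r + s) t k >> (x,z). DeltaK r s x >> (x,y). \<Phi> x y z"
proof(rule bind_cong2)
 fix x z assume "(x, z) : keys (DeltaK (r + s) t k)"
 hence "h z : car Q" by(intro hom_in[OF h]) (rule DeltaK_keys[OF _ k])
 with T have "balU M N (%m n. tnsU M (N ** Q) m (tnsU N Q n (h z)))" by(simp add: tribal_def)
 from tns_bind[OF this]
 show "crossK r s M N f g x >> (m,n). tnsU M (N ** Q) m (tnsU N Q n (h z)) = DeltaK r s x >> (x,y). \<Phi> x y z"
  unfolding crossK_def \<Phi>_def bind_assoc2 by simp
qed
also have "... = DeltaK r (s + t) k >> (x,z). DeltaK s t z >> (y,z). \<Phi> x y z"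
 unfolding \<Phi>_def by(rule DeltaK_coassoc[OF tribal_cross[OF hom_rhom[OF f] g hom_lhom[OF h] N] k])
also have "... = crossK r (s + t) M (N ** Q) f (crossK s t N Q g h) k"
 unfolding crossK_def[of r "s + t"] \<Phi>_def
proof(rule bind_cong2)
 fix x z assume "(x, z) : keys (DeltaK r (s + t) k)"
 note xz = DeltaK_keys[OF this k']
 have lin: "lin_on (N ** Q) (tnsU M (N ** Q) (f x))" by(rule lin_tns_right[OF hom_in[OF f xz(1)]])
 show "DeltaK s t z >> (y,z). tnsU M (N ** Q) (f x) (tnsU N Q (g y) (h z)) = tnsU M (N ** Q) (f x) (crossK s t N Q g h z)"
  unfolding crossK_def
  by(rule lin_on_bind_out2[OF _ _ lin, symmetric])(auto intro!: tns_in hom_in[OF g] hom_in[OF h] dest: DeltaK_keys[OF _ xz(2)])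
qed
finally show ?thesis .
qed

subsection \<open>The \<open>H\<close>-action\<close>

lemma tribal_hom_act:
assumes M: "bimodule M" and f: "Ahom r M f" and k: "k : Kcar r" and phi: "lin_on M phi"
shows "tribal Breg A GamA A Breg (%b w c. phi (lac M b (rac M (f (Kact r w k)) c)))"
proof -
note bl = bim_plus[OF M] bim_bs[OF M] bim_lac_lac[OF M] bim_rac_rac[OF M] bim_lac_in[OF M] bim_rac_in[OF M] bim_lac_rac[OF M]
have i: "f (Kact r w k) : car M" if "w : Gam" for w using that k by(intro hom_in[OF f]) simp
have 1: "lin_on Breg (%b. phi (lac M b (rac M (f (Kact r w k)) c)))" if "w : Gam" for w c
 using lin_on_add[OF phi] lin_on_scale[OF phi] i[OF that] by(simp add: lin_on_Breg bl)
have 2: "lin_on Breg (%c. phi (lac M b (rac M (f (Kact r w k)) c)))" if "w : Gam" for w b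
 unfolding bim_lac_rac[OF M i[OF that], symmetric]
 using lin_on_add[OF phi] lin_on_scale[OF phi] bim_lac_in[OF M i[OF that]] by(simp add: lin_on_Breg bim_plus[OF M] bim_bs[OF M] bim_rac_in[OF M])
have 3: "lin_on GamA (%w. phi (lac M b (rac M (f (Kact r w k)) c)))" for b c
proof(rule lin_Kact_left[OF _ k])
 have "klin M M (%m. lac M b (rac M m c))"
  by(rule klin_comp[of M M "lac M b"])(use bim_lhom[OF M, of "{}" c] bim_rhom[OF M, of "{}" b] in "simp_all add: lhom_def rhom_def")
 from lin_on_comp[OF lin_on_comp[OF phi this] hom_klin[OF f]]
 show "lin_on (K_cx r) (%x. phi (lac M b (rac M (f x) c)))" .
qed
have L: "f (Kact r (be a 1 *~ w) k) = lac M a (f (Kact r w k))"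
 and R: "f (Kact r (be 1 a *~ w) k) = rac M (f (Kact r w k)) a" if "w : Gam" "a : A" for w a
 using that Ahom_lac[OF f] Ahom_rac[OF f] k by(simp_all add: Kact_Kact[OF k, symmetric] A_one)
show ?thesis
 by(intro tribalI balI)(use 1 2 3 i in "simp_all add: L R bl")
qed

lemma
assumes M: "bimodule M" and f: "Ahom r M f" and k: "k : Kcar r"
shows hom_act_in: "hom_act r M f h k : car M"
 and lin_hom_act: "lin_on M phi ==> phi (hom_act r M f h k) = tau h >> (b,t). t >> (w,c). phi (lac M b (rac M (f (Kact r w k)) c))"
proof -
have i: "lac M b (rac M (f (Kact r w k)) c) : car M" if "(b, t) : keys (tau h)" "(w, c) : keys t" for b t w c
 using tau_keys(1)[OF that(1)] tau_keys(2)[OF that(2)] k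
 by(intro bim_lac_in[OF M] bim_rac_in[OF M] hom_in[OF f]) simp
have i2: "linext (scl M) t (%(w,c). lac M b (rac M (f (Kact r w k)) c)) : car M" if "(b, t) : keys (tau h)" for b t
 by(rule linext_in[OF bim_kclosed[OF M]])(use i[OF that] in auto)
show "hom_act r M f h k : car M"
 unfolding hom_act_def by(rule linext_in[OF bim_kclosed[OF M]])(use i2 in auto)
assume phi: "lin_on M phi"
note lin = lin_on_linext[OF bim_kclosed[OF M] phi]
have "phi (hom_act r M f h k) = tau h >> (b,t). phi (linext (scl M) t (%(w,c). lac M b (rac M (f (Kact r w k)) c)))"
 unfolding hom_act_def by(subst lin)(use i2 in "auto intro!: bind_cong")
also have "... = tau h >> (b,t). t >> (w,c). phi (lac M b (rac M (f (Kact r w k)) c))"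
 by(intro bind_cong2, subst lin)(use i in "auto intro!: bind_cong")
finally show "phi (hom_act r M f h k) = ..." .
qed

lemma hom_act_tensor: "hom_act r (tensor M R N) F h k =
 (tau h >> (b,t). t >> (w,c). lac (tensor M R N) b (rac (tensor M R N) (F (Kact r w k)) c))"
by(simp add: hom_act_def bind_def)

text \<open>By \<open>tau_comul\<close> the left side is the action of \<open>\<tau>(h)\<close> in which \<open>\<Gamma>\<close> acts through \<open>\<Delta>\<^sub>\<Gamma>\<close> on the two factors
of \<open>DeltaK\<close>; this is the action on \<open>K\<close> by \<open>DeltaK_act\<close>.\<close>

lemma crossK_act:
assumes M: "bimodule M" and N: "bimodule N" and f: "Ahom r M f" and g: "Ahom s N g" and k: "k : Kcar (r + s)"
shows "comul h >> (h1,h2). crossK r s M N (hom_act r M f h1) (hom_act s N g h2) k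
 = hom_act (r + s) (M ** N) (crossK r s M N f g) h k"
proof -
define P where "P x y b w e w' c = tnsU M N (lac M b (f (Kact r w x))) (lac N e (rac N (g (Kact s w' y)) c))" for x y b w e w' c
have fi: "f (Kact r w x) : car M" if "x : Kcar r" "w : Gam" for x w using that by(intro hom_in[OF f]) simp
have gi: "g (Kact s w x) : car N" if "x : Kcar s" "w : Gam" for x w using that by(intro hom_in[OF g]) simp
note in_simps = bim_lac_in[OF M] bim_rac_in[OF M] bim_lac_in[OF N] bim_rac_in[OF N] fi gi
have main: "comul h >> (h1,h2). tnsU M N (hom_act r M f h1 x) (hom_act s N g h2 y)
 = tau h >> (b,t). t >> (w,c). Gcomul w >> (w1,w2). P x y b w1 1 w2 c"
 if x: "x : Kcar r" and y: "y : Kcar s" for x y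
proof -
 have P: "tnsU M N (lac M b (rac M (f (Kact r w x)) b')) (lac N c (rac N (g (Kact s w' y)) c')) = P x y b w (b' * c) w' c'"
  if "w : Gam" "w' : Gam" for b w b' c w' c'
  using tns_bal[of "lac M b (f (Kact r w x))" M b' UNIV "lac N c (rac N (g (Kact s w' y)) c')" N] that x y
  by(simp add: P_def bim_lac_rac[OF M] bim_lac_lac[OF N] in_simps)
 have "tnsU M N (hom_act r M f h1 x) (hom_act s N g h2 y)
  = tau h1 >> (b,t). t >> (w,b'). tau h2 >> (c,t'). t' >> (w',c'). P x y b w (b' * c) w' c'" for h1 h2
 proof -
  have "tnsU M N (hom_act r M f h1 x) (hom_act s N g h2 y)
   = tau h1 >> (b,t). t >> (w,b'). tnsU M N (lac M b (rac M (f (Kact r w x)) b')) (hom_act s N g h2 y)"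
   by(rule lin_hom_act[OF M f x lin_tns_left[OF hom_act_in[OF N g y]]])
  also have "... = tau h1 >> (b,t). t >> (w,b'). tau h2 >> (c,t'). t' >> (w',c').
    tnsU M N (lac M b (rac M (f (Kact r w x)) b')) (lac N c (rac N (g (Kact s w' y)) c'))"
   by(intro bind_cong2 lin_hom_act[OF N g y lin_tns_right])(auto simp: in_simps x dest: tau_keys)
  finally show ?thesis by(auto intro!: bind_cong2 P dest: tau_keys simp del: split_paired_All)
 qed
 moreover have "tribal Breg A GamA A Breg (%b w e. P x y b w e w' c)" if w': "w' : Gam" for w' c
 proof(rule tribal_cong)
  show "tribal Breg A GamA A Breg (%b w e. tnsU M N (lac M b (rac M (f (Kact r w x)) e)) (rac N (g (Kact s w' y)) c))"
   by(rule tribal_hom_act[OF M f x lin_tns_left])(simp add: in_simps w' y)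
  show "tnsU M N (lac M b (rac M (f (Kact r w x)) e)) (rac N (g (Kact s w' y)) c) = P x y b w e w' c"
   if "w : car GamA" for b w e
   using tns_bal[of "lac M b (f (Kact r w x))" M e UNIV "rac N (g (Kact s w' y)) c" N] w' that x y
   by(simp add: P_def bim_lac_rac[OF M] in_simps)
 qed simp_all
 moreover have "tribal Breg A GamA A Breg (%e w' c. P x y b w e w' c)" if w: "w : Gam" for b w
  unfolding P_def by(rule tribal_hom_act[OF N g y lin_tns_right])(simp add: in_simps w x)
 ultimately show ?thesis by(simp add: tau_comul)
qed
have "comul h >> (h1,h2). crossK r s M N (hom_act r M f h1) (hom_act s N g h2) k
 = DeltaK r s k >> (x,y). comul h >> (h1,h2). tnsU M N (hom_act r M f h1 x) (hom_act s N g h2 y)"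
 unfolding crossK_def by(rule bind_commute2)
also have "... = DeltaK r s k >> (x,y). tau h >> (b,t). t >> (w,c). Gcomul w >> (w1,w2). P x y b w1 1 w2 c"
 by(intro bind_cong2 main DeltaK_keys[OF _ k])
also have "... = tau h >> (b,t). t >> (w,c). DeltaK r s k >> (x,y). Gcomul w >> (w1,w2). P x y b w1 1 w2 c"
 by(rule bind_pull, rule bind_commute2)
also have "... = hom_act (r + s) (M ** N) (crossK r s M N f g) h k"
 unfolding hom_act_tensor
proof(rule bind_cong2, rule bind_cong2)
 fix b t w c assume "(b, t) : keys (tau h)" "(w, c) : keys t"
 hence w: "w : Gam" using tau_keys by blast
 note B = bal_cross[OF rhom_comp[OF bim_rhom[OF M] hom_rhom[OF f]] lhom_comp[OF bim_lhom[OF N] hom_lhom[OF g]]]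
 have "DeltaK r s k >> (x,y). Gcomul w >> (w1,w2). P x y b w1 1 w2 c
  = DeltaK r s k >> (x,y). Gcomul w >> (w1,w2). tnsU M N (lac M b (f (Kact r w1 x))) (rac N (g (Kact s w2 y)) c)"
  unfolding P_def
  by(intro bind_cong2, subst bim_one(1)[OF N])(auto intro!: bim_rac_in[OF N] gi intro: DeltaK_keys[OF _ k] Gcomul_keys[OF _ w])
 also have "... = DeltaK r s (Kact (r + s) w k) >> (x,y). tnsU M N (lac M b (f x)) (rac N (g y) c)"
  by(rule DeltaK_act[OF B k w, symmetric])
 also have "... = lac (M ** N) b (rac (M ** N) (crossK r s M N f g (Kact (r + s) w k)) c)"
  unfolding crossK_def rac_tensor_bind lac_tensor_bind
  by(auto intro!: bind_cong simp: rac_cross[OF M N] lac_cross[OF M N])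
 finally show "DeltaK r s k >> (x,y). Gcomul w >> (w1,w2). P x y b w1 1 w2 c
  = lac (M ** N) b (rac (M ** N) (crossK r s M N f g (Kact (r + s) w k)) c)" .
qed
finally show ?thesis .
qed

lemma hom_act_hom:
assumes M: "bimodule M" and f: "Ahom r M f" and F: "bihom M M' F" and k: "k : Kcar r"
shows "F (hom_act r M f h k) = hom_act r M' (%x. F (f x)) h k"
proof -
have i: "lac M b (rac M (f (Kact r w k)) c) : car M" "f (Kact r w k) : car M" "rac M (f (Kact r w k)) c : car M" if "(b, t) : keys (tau h)" "(w, c) : keys t" for b t w c
 using tau_keys(1)[OF that(1)] tau_keys(2)[OF that(2)] k
 by(auto intro!: bim_lac_in[OF M] bim_rac_in[OF M] hom_in[OF f])
have i2: "linext (scl M) t (%(w,c). lac M b (rac M (f (Kact r w k)) c)) : car M" if "(b, t) : keys (tau h)" for b t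
 by(rule linext_in[OF bim_kclosed[OF M]])(use i[OF that] in auto)
have cong: "linext (scl M') v f = linext (scl M') v g" if "!!x. x : keys v ==> f x = g x" for v :: "'z =>0 'k" and f g
 using that by(simp add: linext_def)
note L = klin_linext[OF bim_kclosed[OF M] hom_klin[OF F]]
show ?thesis
 unfolding hom_act_def
 by(subst L, use i2 in force, rule cong, clarify, subst L, use i in force, rule cong)
  (use i in "auto simp: hom_lac[OF F] hom_rac[OF F]")
qed

subsection \<open>The product \<open>\<times>\<^sub>\<ell>\<close>\<close>

lemma
assumes "f : HomL p r M" and l: "l : Lcar p"
shows HomL_hom: "Ahom r M (f l)"
 and HomL_add: "l' : Lcar p ==> k : Kcar r ==> f (l + l') k = f l k + f l' k"
 and HomL_scl: "k : Kcar r ==> f (c*.l) k = scl M c (f l k)"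
 and HomL_act: "k : Kcar r ==> f (Lact p l h) k = hom_act r M (f l) h k"
using assms by(auto simp: HomL_def)

lemma HomLI:
assumes "!!l. l : Lcar p ==> Ahom r M (f l)"
 "!!l l' k. l : Lcar p ==> l' : Lcar p ==> k : Kcar r ==> f (l + l') k = f l k + f l' k"
 "!!c l k. l : Lcar p ==> k : Kcar r ==> f (c*.l) k = scl M c (f l k)"
 "!!h l k. l : Lcar p ==> k : Kcar r ==> f (Lact p l h) k = hom_act r M (f l) h k"
shows "f : HomL p r M"
using assms by(simp add: HomL_def)

definition crossLK where
"crossLK p r q s M N f g l k = DeltaL p q l >> (a,b). crossK r s M N (f a) (g b) k"

text \<open>The sign of \<open>\<times>\<^sub>\<ell>\<close> is kept apart, so that naturality, the chain rules and associativity can also be used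
for the products of universal elements, which enter \<open>\<Delta>\<^sup>P\<close> with a different sign.\<close>

definition csign :: "nat => nat => nat => nat => 'k" where
"csign p r q s = (-1) ^ (p * q + p * s + r * s)"

lemma crossL_crossLK: "crossL p r q s M N f g l k = csign p r q s *. crossLK p r q s M N f g l k"
by(simp add: crossL_def crossLK_def crossK_def csign_def bind_scale_right2)

lemma HomL_klin: "f : HomL p r M ==> k : Kcar r ==> klin (Lk p) M (%a. f a k)"
by(simp add: klin_def HomL_add HomL_scl hom_in[OF HomL_hom])

lemma lin_crossK:
assumes k: "k : Kcar (r + s)"
shows "(!!x. x : Kcar r ==> klin L M (%a. f a x)) ==> (!!y. y : Kcar s ==> h y : car N) ==> lin_on L (%a. crossK r s M N (f a) h k)"
 and "(!!y. y : Kcar s ==> klin L N (%a. f' a y)) ==> (!!x. x : Kcar r ==> h' x : car M) ==> lin_on L (%a. crossK r s M N h' (f' a) k)"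
unfolding crossK_def
by(rule lin_on_bind2, rule lin_on_comp[OF lin_tns_left]; use DeltaK_keys[OF _ k] in blast)
 (rule lin_on_bind2, rule lin_on_comp[OF lin_tns_right]; use DeltaK_keys[OF _ k] in blast)

lemma crossK_bind:
assumes k: "k : Kcar (r + s)"
shows "kclosed M ==> scl M = fscale ==> (!!a b x. (a, b) : keys v ==> x : Kcar r ==> f a b x : car M) ==> (!!y. y : Kcar s ==> h y : car N) ==>
  crossK r s M N (%x. v >> (a,b). f a b x) h k = v >> (a,b). crossK r s M N (f a b) h k"
 and "kclosed N' ==> scl N' = fscale ==> (!!a b y. (a, b) : keys v ==> y : Kcar s ==> f' a b y : car N') ==> (!!x. x : Kcar r ==> h' x : car M') ==>
  crossK r s M' N' h' (%y. v >> (a,b). f' a b y) k = v >> (a,b). crossK r s M' N' h' (f' a b) k"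
unfolding crossK_def bind_commute2[of v]
by(rule bind_cong2, rule lin_on_bind_out2[OF _ _ lin_tns_left]; use DeltaK_keys[OF _ k] in blast)
 (rule bind_cong2, rule lin_on_bind_out2[OF _ _ lin_tns_right]; use DeltaK_keys[OF _ k] in blast)

context
fixes p r q s and M :: "('k, 'b, 'm::ab_group_add, 'b) bimod" and N :: "('k, 'b, 'n::ab_group_add, 'b) bimod" and f g
assumes M: "bimodule M" and N: "bimodule N" and f: "f : HomL p r M" and g: "g : HomL q s N"
begin

abbreviation "fg == crossLK p r q s M N f g"

lemma crossK_lin:
assumes "k : Kcar (r + s)"
shows "b : Lcar q ==> lin_on (Lk p) (%a. crossK r s M N (f a) (g b) k)"
 and "a : Lcar p ==> lin_on (Lk q) (%b. crossK r s M N (f a) (g b) k)"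
by(intro lin_crossK[OF assms] HomL_klin[OF f] HomL_klin[OF g] hom_in[OF HomL_hom[OF f]] hom_in[OF HomL_hom[OF g]]; assumption)+

lemma bal_crossK_L: "k : Kcar (r + s) ==> balL p q (%a b. crossK r s M N (f a) (g b) k)"
unfolding bal_L using crossK_lin by blast

lemma crossK_Ahom: "a : Lcar p ==> b : Lcar q ==> Ahom (r + s) (M ** N) (crossK r s M N (f a) (g b))"
by(intro crossK_hom M N HomL_hom[OF f] HomL_hom[OF g])

lemma crossLK_Ahom: "l : Lcar (p + q) ==> Ahom (r + s) (M ** N) (fg l)"
unfolding bimod_hom_def scl_tensor K_cx_simps
proof(intro conjI ballI allI)
fix k assume l: "l : Lcar (p + q)" and k: "k : Kcar (r + s)"
note h = crossK_Ahom[OF DeltaL_keys[OF _ l]]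
note hh = hom_add[OF h] Ahom_fscale[OF h] Ahom_lac[OF h] Ahom_rac[OF h] hom_in[OF h]
show "fg l k : car (M ** N)"
 unfolding crossLK_def by(rule tensor_bind_in) (rule hh(5); assumption?; rule k)
show "fg l (k + k') = fg l k + fg l k'" if "k' : Kcar (r + s)" for k'
 unfolding crossLK_def bind_add_right2[symmetric] using k that hh(1) by(intro bind_cong2) auto
show "fg l (c*.k) = c *. fg l k" for c
 unfolding crossLK_def crossK_def by(simp add: bind_linear)
fix a assume a: "a : A"
show "fg l (Kact (r + s) (be a 1) k) = lac (M ** N) a (fg l k)"
 unfolding crossLK_def lac_tensor_bind using hh(3) a k by(auto intro!: bind_cong split: prod.splits)
show "fg l (Kact (r + s) (be 1 a) k) = rac (M ** N) (fg l k) a"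
 unfolding crossLK_def rac_tensor_bind using hh(4) a k by(auto intro!: bind_cong split: prod.splits)
qed

lemma crossLK_HomL: "fg : HomL (p + q) (r + s) (M ** N)"
proof(rule HomLI)
fix l k h assume l: "l : Lcar (p + q)" and k: "k : Kcar (r + s)"
show "fg (l + l') k = fg l k + fg l' k" for l'
 by(simp add: crossLK_def bind_linear)
show "fg (c*.l) k = scl (M ** N) c (fg l k)" for c
 by(simp add: crossLK_def bind_linear)
have "fg (Lact (p + q) l h) k
 = DeltaL p q l >> (a,b). comul h >> (h1,h2). crossK r s M N (f (Lact p a h1)) (g (Lact q b h2)) k"
 unfolding crossLK_def DeltaL_Lact[OF bal_crossK_L[OF k] l] by(rule bind_commute2)
also have "... = DeltaL p q l >> (a,b). hom_act (r + s) (M ** N) (crossK r s M N (f a) (g b)) h k"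
proof(rule bind_cong2)
 fix a b assume "(a, b) : keys (DeltaL p q l)"
 note ab = DeltaL_keys[OF this l]
 have "crossK r s M N (f (Lact p a h1)) (g (Lact q b h2)) k = crossK r s M N (hom_act r M (f a) h1) (hom_act s N (g b) h2) k" for h1 h2
  by(rule crossK_cong[OF k])(simp_all add: HomL_act[OF f ab(1)] HomL_act[OF g ab(2)])
 thus "comul h >> (h1,h2). crossK r s M N (f (Lact p a h1)) (g (Lact q b h2)) k
  = hom_act (r + s) (M ** N) (crossK r s M N (f a) (g b)) h k"
  using crossK_act[OF M N HomL_hom[OF f ab(1)] HomL_hom[OF g ab(2)] k] by simp
qed
also have "... = tau h >> (b,t). t >> (w,c). DeltaL p q l >> (x,y).
   lac (M ** N) b (rac (M ** N) (crossK r s M N (f x) (g y) (Kact (r + s) w k)) c)"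
 unfolding hom_act_tensor by(rule bind_pull, rule bind_commute2)
finally show "fg (Lact (p + q) l h) k = hom_act (r + s) (M ** N) (fg l) h k"
 unfolding hom_act_tensor crossLK_def rac_tensor_bind lac_tensor_bind by(simp add: split_def)
qed (rule crossLK_Ahom)

lemma crossLK_chain_h:
assumes l: "l : Lcar (p + q + 1)" and k: "k : Kcar (r + s)"
shows "fg (dL (p + q + 1) l) k = crossLK (p + 1) r q s M N (%a. f (dL (p + 1) a)) g l k +
  ((-1) ^ p) *. crossLK p r (q + 1) s M N f (%b. g (dL (q + 1) b)) l k"
unfolding crossLK_def by(rule DeltaL_chain[OF bal_crossK_L[OF k] l])

lemma crossLK_chain_v:
assumes l: "l : Lcar (p + q)" and k: "k : Kcar (r + s + 1)"
shows "fg l (dK (r + s + 1) k) = crossLK p (r + 1) q s M N (%a x. f a (dK (r + 1) x)) g l k +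
  ((-1) ^ r) *. crossLK p r q (s + 1) M N f (%b y. g b (dK (s + 1) y)) l k"
unfolding crossLK_def bind_add_right2[symmetric] bind_scale_right2[symmetric]
by(rule bind_cong2, rule crossK_chain[OF HomL_hom[OF f] HomL_hom[OF g] k]; erule DeltaL_keys[OF _ l])

end

lemma crossLK_cong:
assumes "l : Lcar (p + q)" "k : Kcar (r + s)" "!!a x. a : Lcar p ==> x : Kcar r ==> f a x = f' a x" "!!b y. b : Lcar q ==> y : Kcar s ==> g b y = g' b y"
shows "crossLK p r q s M N f g l k = crossLK p r q s M N f' g' l k"
unfolding crossLK_def by(intro bind_cong2 crossK_cong)(use assms DeltaL_keys[OF _ assms(1)] in blast)+

lemma crossLK_scale:
assumes "l : Lcar (p + q)" "k : Kcar (r + s)" "!!a x. a : Lcar p ==> x : Kcar r ==> f a x : car M" "!!b y. b : Lcar q ==> y : Kcar s ==> g b y : car N"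
shows "crossLK p r q s M N (%a x. scl M c (f a x)) g l k = c *. crossLK p r q s M N f g l k"
 and "crossLK p r q s M N f (%b y. scl N c (g b y)) l k = c *. crossLK p r q s M N f g l k"
unfolding crossLK_def crossK_def bind_scale_right2[symmetric]
by(rule bind_cong2, rule bind_cong2, rule tns_scl_left tns_scl_right; use assms(3,4) DeltaL_keys[OF _ assms(1)] DeltaK_keys[OF _ assms(2)] in blast)+

lemma crossLK_assoc:
assumes M: "bimodule M" and N: "bimodule N" and Q: "bimodule Q"
 and f: "f : HomL p r M" and g: "g : HomL q s N" and h: "h : HomL p' r' Q"
 and l: "l : Lcar (p + q + p')" and k: "k : Kcar (r + s + r')"
shows "tassocU M N Q
  (crossLK (p + q) (r + s) p' r' (M ** N) Q (crossLK p r q s M N f g) h l k) =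
 crossLK p r (q + p') (s + r') M (N ** Q) f (crossLK q s p' r' N Q g h) l k"
proof -
define F where "F a b c = crossK r (s + r') M (N ** Q) (f a) (crossK s r' N Q (g b) (h c)) k" for a b c
note fi = hom_in[OF HomL_hom[OF f]] and hi = hom_in[OF HomL_hom[OF h]]
note ghi = hom_in[OF crossK_Ahom[OF N Q g h]] and fgi = hom_in[OF crossK_Ahom[OF M N f g]]
have k': "k : Kcar (r + (s + r'))" and l': "l : Lcar (p + (q + p'))" using k l by(simp_all add: add.assoc)
have tb: "tassocU M N Q (v >> (a,b). X a b) = v >> (a,b). tassocU M N Q (X a b)"
 for v :: "('x \<times> 'y) =>0 'k" and X by(simp add: tassoc_def bind_assoc2)
have "tassocU M N Q (crossLK (p + q) (r + s) p' r' (M ** N) Q (crossLK p r q s M N f g) h l k)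
 = DeltaL (p + q) p' l >> (a,c). DeltaL p q a >> (a,b). F a b c"
 unfolding crossLK_def[of "p + q"] tb
proof(rule bind_cong2)
 fix a c assume "(a, c) : keys (DeltaL (p + q) p' l)"
 note ac = DeltaL_keys[OF this l]
 have "crossK (r + s) r' (M ** N) Q (crossLK p r q s M N f g a) (h c) k
  = DeltaL p q a >> (a,b). crossK (r + s) r' (M ** N) Q (crossK r s M N (f a) (g b)) (h c) k"
  unfolding crossLK_def by(rule crossK_bind(1)[OF k, where f="%a b. crossK r s M N (f a) (g b)"])
   (use fgi DeltaL_keys[OF _ ac(1)] hi[OF ac(2)] in "auto intro: kclosed_tensor")
 also have "tassocU M N Q ... = DeltaL p q a >> (a,b). F a b c"
  unfolding tb F_def
  by(rule bind_cong2, rule crossK_assoc[OF M N HomL_hom[OF f] HomL_hom[OF g] HomL_hom[OF h ac(2)] k]; erule DeltaL_keys[OF _ ac(1)])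
 finally show "tassocU M N Q (crossK (r + s) r' (M ** N) Q (crossLK p r q s M N f g a) (h c) k) = DeltaL p q a >> (a,b). F a b c" .
qed
also have "... = DeltaL p (q + p') l >> (a,c). DeltaL q p' c >> (b,c). F a b c"
proof(rule DeltaL_coassoc[OF _ l])
 have kl: "c : Lcar p' ==> klin (Lk q) (N ** Q) (%b. crossK s r' N Q (g b) (h c) z)"
  "b : Lcar q ==> klin (Lk p') (N ** Q) (%c. crossK s r' N Q (g b) (h c) z)" if "z : Kcar (s + r')" for b c z
  using crossK_lin[OF N Q g h that] ghi[OF _ _ that] by(simp_all add: klin_def lin_on_def)
 have "lin_on (Lk p) (%a. F a b c)" if "b : Lcar q" "c : Lcar p'" for b c
  unfolding F_def by(rule lin_crossK(1)[OF k' HomL_klin[OF f]], assumption, rule ghi[OF that], assumption)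
 moreover have "lin_on (Lk q) (%b. F a b c)" if "a : Lcar p" "c : Lcar p'" for a c
  unfolding F_def by(rule lin_crossK(2)[OF k', where f'="%b. crossK s r' N Q (g b) (h c)"])(use kl(1) that fi in blast)+
 moreover have "lin_on (Lk p') (%c. F a b c)" if "a : Lcar p" "b : Lcar q" for a b
  unfolding F_def by(rule lin_crossK(2)[OF k', where f'="%c. crossK s r' N Q (g b) (h c)"])(use kl(2) that fi in blast)+
 ultimately show "tribal (Lk p) UNIV (Lk q) UNIV (Lk p') F" by(simp add: tribal_def bal_L)
qed
also have "... = crossLK p r (q + p') (s + r') M (N ** Q) f (crossLK q s p' r' N Q g h) l k"
 unfolding crossLK_def[of p r "q + p'"]
proof(rule bind_cong2)
 fix a c assume "(a, c) : keys (DeltaL p (q + p') l)"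
 note ac = DeltaL_keys[OF this l']
 show "DeltaL q p' c >> (b,c). F a b c = crossK r (s + r') M (N ** Q) (f a) (crossLK q s p' r' N Q g h c) k"
  unfolding crossLK_def F_def by(rule crossK_bind(2)[OF k', symmetric, where f'="%b c. crossK s r' N Q (g b) (h c)"])
   (use ghi DeltaL_keys[OF _ ac(2)] fi[OF ac(1)] in "auto intro: kclosed_tensor")
qed
finally show ?thesis .
qed

subsection \<open>Signs\<close>

lemma HomL_comp:
assumes M: "bimodule M" and f: "f : HomL p r M" and F: "bihom M M' F"
shows "(%l k. F (f l k)) : HomL p r M'"
proof(rule HomLI)
have F': "bimod_hom A A M M' F" using F by(simp add: bimod_hom_def)
note i = hom_in[OF HomL_hom[OF f]]
show "Ahom r M' (%k. F (f l k))" if "l : Lcar p" for l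
 by(rule hom_comp[OF F' HomL_hom[OF f that]])
show "F (f (l + l') k) = F (f l k) + F (f l' k)" if "l : Lcar p" "l' : Lcar p" "k : Kcar r" for l l' k
 using that i by(simp add: HomL_add[OF f] hom_add[OF F])
show "F (f (c*.l) k) = scl M' c (F (f l k))" if "l : Lcar p" "k : Kcar r" for c l k
 using that i by(simp add: HomL_scl[OF f] hom_scl[OF F])
show "F (f (Lact p l h) k) = hom_act r M' (%k. F (f l k)) h k" if "l : Lcar p" "k : Kcar r" for l k h
 using that by(simp add: HomL_act[OF f] hom_act_hom[OF M HomL_hom[OF f] F])
qed

lemma crossL_HomL:
assumes "bimodule M" "bimodule N" "f : HomL p r M" "g : HomL q s N"
shows "crossL p r q s M N f g : HomL (p + q) (r + s) (M ** N)"
proof -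
note T = bim_tensor[OF assms(1,2)]
show ?thesis
 using HomL_comp[OF T crossLK_HomL[OF assms] hom_scale[OF T scl_tensor hom_id(1)]] by(simp add: crossL_crossLK[abs_def])
qed

lemma crossL_Leibniz_h:
assumes "bimodule M" "bimodule N" and f: "f : HomL p r M" and g: "g : HomL q s N" and l: "l : Lcar (p + q + 1)" and k: "k : Kcar (r + s)"
shows "dL_h (p + q) (r + s) (M ** N) (crossL p r q s M N f g) l k =
  crossL (p + 1) r q s M N (dL_h p r M f) g l k +
  ((-1) ^ (p + r)) *. crossL p r (q + 1) s M N f (dL_h q s N g) l k"
proof -
note i = hom_in[OF HomL_hom[OF f]] hom_in[OF HomL_hom[OF g]]
have l': "l : Lcar (p + 1 + q)" "l : Lcar (p + (q + 1))" using l by(simp_all add: ac_simps)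
have dLi: "dL (n + 1) a : Lcar n" if "a : Lcar (n + 1)" for n a using that by simp
have e: "(-1) ^ (p + q + (r + s)) * csign p r q s = csign (p + 1) r q s * (-1) ^ (p + r)"
 "(-1) ^ (p + q + (r + s)) * (csign p r q s * (-1) ^ p) = (-1) ^ (p + r) * (csign p r (q + 1) s * (-1) ^ (q + s))"
 unfolding csign_def power_add[symmetric] by(rule neg1_pow_eq; simp; blast)+
have 1: "crossLK (p + 1) r q s M N (dL_h p r M f) g l k = ((-1) ^ (p + r)) *. crossLK (p + 1) r q s M N (%a. f (dL (p + 1) a)) g l k"
 "crossLK p r (q + 1) s M N f (dL_h q s N g) l k = ((-1) ^ (q + s)) *. crossLK p r (q + 1) s M N f (%b. g (dL (q + 1) b)) l k"
 unfolding dL_h_def[abs_def] by(rule crossLK_scale[OF l'(1) k], blast intro: i dLi, blast intro: i)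
  (rule crossLK_scale[OF l'(2) k], blast intro: i, blast intro: i dLi)
show ?thesis
 unfolding crossL_crossLK 1
 unfolding dL_h_def[of _ "p + q"] scl_tensor crossL_crossLK crossLK_chain_h[OF assms] fscale_plus fv.scale_scale e ..
qed

lemma crossL_Leibniz_v:
assumes "bimodule M" "bimodule N" and f: "f : HomL p r M" and g: "g : HomL q s N" and l: "l : Lcar (p + q)" and k: "k : Kcar (r + s + 1)"
shows "dL_v (p + q) (r + s) (M ** N) (crossL p r q s M N f g) l k =
  crossL p (r + 1) q s M N (dL_v p r M f) g l k +
  ((-1) ^ (p + r)) *. crossL p r q (s + 1) M N f (dL_v q s N g) l k"
proof -
note i = hom_in[OF HomL_hom[OF f]] hom_in[OF HomL_hom[OF g]]
have k': "k : Kcar (r + 1 + s)" "k : Kcar (r + (s + 1))" using k by(simp_all add: ac_simps)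
have dKi: "dK (n + 1) a : Kcar n" if "a : Kcar (n + 1)" for n a using that by simp
have e: "(-1) ^ (r + s) * csign p r q s = csign p (r + 1) q s * (-1) ^ r"
 "(-1) ^ (r + s) * (csign p r q s * (-1) ^ r) = (-1) ^ (p + r) * (csign p r q (s + 1) * (-1) ^ s)"
 unfolding csign_def power_add[symmetric] by(rule neg1_pow_eq; simp; blast)+
have 1: "crossLK p (r + 1) q s M N (dL_v p r M f) g l k = ((-1) ^ r) *. crossLK p (r + 1) q s M N (%a x. f a (dK (r + 1) x)) g l k"
 "crossLK p r q (s + 1) M N f (dL_v q s N g) l k = ((-1) ^ s) *. crossLK p r q (s + 1) M N f (%b y. g b (dK (s + 1) y)) l k"
 unfolding dL_v_def[abs_def] by(rule crossLK_scale[OF l k'(1)], blast intro: i dKi, blast intro: i)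
  (rule crossLK_scale[OF l k'(2)], blast intro: i, blast intro: i dKi)
show ?thesis
 unfolding crossL_crossLK 1
 unfolding dL_v_def[of _ _ "r + s"] scl_tensor crossL_crossLK crossLK_chain_v[OF assms] fscale_plus fv.scale_scale e ..
qed

lemma crossL_assoc:
assumes M: "bimodule M" and N: "bimodule N" and Q: "bimodule Q"
 and f: "f : HomL p r M" and g: "g : HomL q s N" and h: "h : HomL p' r' Q"
 and l: "l : Lcar (p + q + p')" and k: "k : Kcar (r + s + r')"
shows "tassocU M N Q
  (crossL (p + q) (r + s) p' r' (M ** N) Q (crossL p r q s M N f g) h l k) =
 crossL p r (q + p') (s + r') M (N ** Q) f (crossL q s p' r' N Q g h) l k"
proof -
note ghi = hom_in[OF HomL_hom[OF crossLK_HomL[OF N Q g h]]] and fgi = hom_in[OF HomL_hom[OF crossLK_HomL[OF M N f g]]]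
note fi = hom_in[OF HomL_hom[OF f]] and hi = hom_in[OF HomL_hom[OF h]]
have k': "k : Kcar (r + (s + r'))" and l': "l : Lcar (p + (q + p'))" using k l by(simp_all add: add.assoc)
have e: "csign (p + q) (r + s) p' r' * csign p r q s = csign p r (q + p') (s + r') * csign q s p' r'"
 unfolding csign_def power_add[symmetric] by(rule neg1_pow_eq) (simp, blast)
have ts: "tassocU M N Q (c*.t) = c *. tassocU M N Q t" for c t by(simp add: tassoc_def bind_scale_left)
have 1: "crossLK (p + q) (r + s) p' r' (M ** N) Q (%a x. c *. crossLK p r q s M N f g a x) h l k
  = c *. crossLK (p + q) (r + s) p' r' (M ** N) Q (crossLK p r q s M N f g) h l k"
 "crossLK p r (q + p') (s + r') M (N ** Q) f (%b y. c *. crossLK q s p' r' N Q g h b y) l k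
  = c *. crossLK p r (q + p') (s + r') M (N ** Q) f (crossLK q s p' r' N Q g h) l k" for c
 by(rule crossLK_scale(1)[OF l k fgi hi, unfolded scl_tensor] crossLK_scale(2)[OF l' k' fi ghi, unfolded scl_tensor]; assumption)+
show ?thesis
 unfolding crossL_crossLK[abs_def] 1 ts crossLK_assoc[OF assms] fv.scale_scale e ..
qed

end

section \<open>The complex \<open>K' = B\<^sup>e \<otimes>\<^sub>A\<^sub>e K\<close>\<close>

lemma klin_eq_linext:
assumes f: "klin M N f" and g: "klin M N g" and M: "kclosed M" "scl M = fscale"
 and u: "!!x. x : keys v ==> F x : car M" "!!x. x : keys v ==> f (F x) = g (F x)"
shows "f (v >> F) = g (v >> F)"
proof -
have "h (v >> F) = linext (scl N) v (%x. h (F x))" if "klin M N h" for h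
 by(rule klin_bind[OF M that]) (rule u(1))
from this[OF f] this[OF g] show ?thesis unfolding linext_def using u(2) by simp
qed

lemma tmap_tmap:
assumes "rhom R M M' f'" "lhom R N N' g'"
shows "tmap M' R N' f' g' (tmap M R N f g t) = tmap M' R N' (%x. f' (f x)) (%y. g' (g y)) t"
unfolding tmap_def[of M] tmap_def[of M' R N' f'] bind_assoc2 tns_bind[OF bal_tns_comp[OF assms]] by(simp add: tmap_def)

lemma tmap_cong: "(!!x y. (x, y) : keys t ==> f x = f' x & g y = g' y) ==> tmap M R N f g t = tmap M R N f' g' t"
unfolding tmap_def by(rule bind_cong2) simp

lemma tmap_sum: "tmap M R N f g (\<Sum>i\<in>I. t i) = (\<Sum>i\<in>I. tmap M R N f g (t i))"
by(simp add: tmap_def bind_sum_left)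

lemma tmap_linear: "tmap M R N f g (t + u) = tmap M R N f g t + tmap M R N f g u" "tmap M R N f g (c*.t) = c *. tmap M R N f g t"
by(simp_all add: tmap_def bind_linear)

lemma
assumes "!!m n. (m, n) : keys t ==> f m : car M & g n : car N"
shows tmap_scale_left: "tmap M R N (%x. scl M c (f x)) g t = c *. tmap M R N f g t"
 and tmap_scale_right: "tmap M R N f (%x. scl N c (g x)) t = c *. tmap M R N f g t"
unfolding tmap_def bind_scale_right2[symmetric]
by(intro bind_cong2, use assms in "simp add: tns_scl_left tns_scl_right")+

lemma tassoc_scale: "tassoc M R N S Q (c*.t) = c *. tassoc M R N S Q t"
by(simp add: tassoc_def bind_scale_left)

context hopf_galois_ext
begin

lemma tmap_hom:
assumes M: "bimodule M" "bimodule N" "bimodule M'" "bimodule N'"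
 and f: "bihom M M' f" and g: "bihom N N' g"
shows "bihom (M ** N) (M' ** N') (tmapU M' N' f g)"
 and "tmapU M' N' f g (tnsU M N m n) = tnsU M' N' (f m) (g n)"
proof -
note h = hom_rhom[OF f] hom_lhom[OF g]
show t: "tmapU M' N' f g (tnsU M N m n) = tnsU M' N' (f m) (g n)" for m n
 by(rule tmap_tns_hom[OF h])
have tb: "tmapU M' N' f g (v >> F) = v >> x. tmapU M' N' f g (F x)" for v F
 by(simp add: tmap_def bind_assoc)
show "bihom (M ** N) (M' ** N') (tmapU M' N' f g)"
 unfolding bimod_hom_def scl_tensor
proof(intro conjI ballI allI)
 fix x assume x: "x : car (M ** N)"
 have k: "m : car M" "n : car N" if "(m, n) : keys x" for m n
  using tensor_keysD[OF that x bim_rclosed[OF M(1)] bim_lclosed[OF M(2)]] by auto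
 show "tmapU M' N' f g x : car (M' ** N')" by(rule tmap_in[OF h x])
 show "tmapU M' N' f g (x + y) = tmapU M' N' f g x + tmapU M' N' f g y" for y
  by(simp add: tmap_def bind_linear)
 show "tmapU M' N' f g (c*.x) = c *. tmapU M' N' f g x" for c
  by(simp add: tmap_def bind_linear)
 show "tmapU M' N' f g (lac (M ** N) b x) = lac (M' ** N') b (tmapU M' N' f g x)" for b
  unfolding lac_tensor[of _ _ _ _ x] tmap_def[of _ _ _ _ _ x] tb lac_tensor_bind
  by(auto intro!: bind_cong simp: t lac_cross[OF M(3,4)] hom_lac[OF f] k)
 show "tmapU M' N' f g (rac (M ** N) x b) = rac (M' ** N') (tmapU M' N' f g x) b" for b
  unfolding rac_tensor[of _ _ _ x] tmap_def[of _ _ _ _ _ x] tb rac_tensor_bind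
  by(auto intro!: bind_cong simp: t rac_cross[OF M(3,4)] hom_rac[OF g] k)
qed
qed

lemma hom_plus:
assumes N: "bimodule N" "scl N = fscale" and f: "bimod_hom R S M N f" and g: "bimod_hom R S M N g"
shows "bimod_hom R S M N (%x. f x + g x)"
proof -
have "klin N N (lac N b)" "klin N N (%m. rac N m b)" for b
 using bim_rhom[OF N(1), of "{}" b] bim_lhom[OF N(1), of "{}" b] by(simp_all add: rhom_def lhom_def)
thus ?thesis
 using f g N(2) kclosed_add[OF bim_kclosed[OF N(1)]] by(simp add: bimod_hom_def klin_def fscale_plus)
qed

subsection \<open>Maps out of \<open>K'\<close>\<close>

abbreviation "KKt n == tensor Be_reg Ae (K_left n)"
abbreviation "KKcar n == car (KK n)"

lemma Be_reg_simps [simp]: "car Be_reg = Be_car" "scl Be_reg = fscale" "lac Be_reg = bemul" "rac Be_reg = bemul"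
and K_left_simps [simp]: "car (K_left n) = Kcar n" "scl (K_left n) = fscale" "lac (K_left n) = Kact n"
by(simp_all add: Be_reg_def K_left_def)

lemma Ae_Gam: "e : Ae ==> e : Gam"
proof -
have "fv.span {be a a' | a a'. a : A & a' : A} <= Gam"
 by(rule fv.span_minimal[OF _ subspace_Gam]) auto
thus "e : Ae ==> e : Gam" unfolding Ae_def by blast
qed

text \<open>The maps of \<open>b \<otimes> k \<otimes> b'\<close> that factor through \<open>B\<^sup>e \<otimes>\<^sub>A\<^sub>e K\<^sub>n\<close>.\<close>

definition kkbal where
"kkbal n F == (ALL k:Kcar n. balU Bk Bk (%b b'. F b k b')) & (ALL b b'. lin_on (K_cx n) (%k. F b k b')) &
  (ALL b b'. ALL k:Kcar n. ALL a:A. F (b * a) k b' = F b (Kact n (be a 1) k) b' & F b k (a * b') = F b (Kact n (be 1 a) k) b')"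

lemma bal_kkbal:
assumes F: "kkbal n F"
shows "bal Be_reg Ae (K_left n) (%u k. u >> (b,b'). F b k b')"
proof(rule balI)
show "lin_on Be_reg (%u. u >> (b,b'). F b k b')" for k
 by(simp add: lin_on_def bind_linear)
show "lin_on (K_left n) (%k. u >> (b,b'). F b k b')" for u
 by(rule lin_on_bind2)(use F in "simp add: kkbal_def lin_on_def")
fix u e k assume u: "u : car Be_reg" and e: "e : Ae" and "k : car (K_left n)"
hence k: "k : Kcar n" by simp
have B: "balU Bk Bk (%b b'. F b k b')" and l: "lin_on (K_cx n) (%k. F b k b')" for b b'
 using F k by(auto simp: kkbal_def)
have "e : Gam & (u*~e >> (b,b'). F b k b') = u >> (b,b'). F b (Kact n e k) b'"
 using e unfolding Ae_def
proof(induction rule: fv.span_induct_alt)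
 case base
 have "bemul u 0 = 0" "Kact n 0 k = 0" using bemul_lin(4)[of u 0 0] Kact_scale[OF k Gam_closed(1), of 0] by simp_all
 thus ?case using lin_on_zero[OF kclosed_K l] by(simp add: bind_linear)
next
 case (step c x y)
 then obtain a a' where x: "x = be a a'" "a : A" "a' : A" by blast
 have "be a a' = be 1 a' *~ be a 1" by simp
 hence "u*~x >> (b,b'). F b k b' = u >> (b,b'). F b (Kact n x k) b'"
  unfolding bemul_bind[OF B] x(1) using F x k
  by(subst be_bind)(use B in "simp_all add: kkbal_def Kact_Kact A_one bal_Bk_Bk lin_on_Bk distrib_left distrib_right")
 moreover have "x : Gam" using x by simp
 moreover from this have "F b (Kact n (c*.x + y) k) b' = c *. F b (Kact n x k) b' + F b (Kact n y k) b'" for b b'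
  using step.IH lin_on_add[OF l] lin_on_scale[OF l] k by(simp add: Kact_add Kact_scale)
 ultimately show ?case
  using step.IH by(simp add: bind_linear)
qed
thus "rac Be_reg u e >> (b,b'). F b k b' = u >> (b,b'). F b (lac (K_left n) e k) b'" by simp
qed

lemma KKp_bind:
assumes F: "kkbal n F" and k: "k : Kcar n"
shows "KKp n (be b b') k >> (u,k). u >> (b,b'). F b k b' = F b k b'"
unfolding KKp_def tns_bind[OF bal_kkbal[OF F]] by(rule be_bind)(use F k in "simp add: kkbal_def")

lemma KK_simps [simp]: "scl (KK n) = fscale"
by(simp add: KK_def)

lemma KK_car: "KKcar n = car (KKt n)"
by(simp add: KK_def)

lemma subspace_KK: "fv.subspace (KKcar n)"
unfolding KK_car by(rule subspace_tensor)

lemma kclosed_KK [simp]: "kclosed (KK n)"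
using subspace_KK[of n] fv.subspace_diff by(auto simp: kclosed_def fv.subspace_def)

lemma KKp_in: "u : Be_car ==> k : Kcar n ==> KKp n u k : KKcar n"
unfolding KK_car KKp_def by(rule tns_in) simp_all

lemma KKp_lin: "k : Kcar n ==> klin Be_reg (KK n) (%u. KKp n u k)" "u : Be_car ==> klin (K_cx n) (KK n) (KKp n u)"
using tns_add_left[of _ "Be_reg" _ k "K_left n"] tns_scl_left[of _ "Be_reg" k "K_left n"]
 tns_add_right[of u "Be_reg" _ "K_left n"] tns_scl_right[of u "Be_reg" _ "K_left n"]
by(simp_all add: klin_def KKp_in)(simp_all add: KKp_def)

lemma KKp_Gam: "u : Be_car ==> k : Kcar n ==> a : A ==> a' : A ==> KKp n (u *~ be a a') k = KKp n u (Kact n (be a a') k)"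
unfolding KKp_def using tns_bal[of u "Be_reg" "be a a'" "Ae" k "K_left n"] by(auto simp: Ae_def intro: fv.span_base)

lemma KK_eqI:
assumes f: "klin (KK n) Q f" and g: "klin (KK n) Q g" and x: "x : KKcar n"
 and eq: "!!b b' k. k : Kcar n ==> f (KKp n (be b b') k) = g (KKp n (be b b') k)"
shows "f x = g x"
proof -
have T: "klin (KKt n) Q h" if "klin (KK n) Q h" for h using that by(simp add: klin_def KK_car)
show ?thesis
proof(rule tensor_klin_eqI[OF x[unfolded KK_car] T[OF f] T[OF g]])
 fix u k assume u: "u : car Be_reg" and "k : car (K_left n)"
 hence k: "k : Kcar n" by simp
 note kl = klin_comp[OF _ KKp_lin(1)[OF k]]
 have "f (KKp n (u >> (b,b'). be b b') k) = g (KKp n (u >> (b,b'). be b b') k)"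
  by(rule klin_eq_linext[OF kl[OF f] kl[OF g]])(auto simp: kclosed_def eq[OF k])
 thus "f (tns Be_reg Ae (K_left n) u k) = g (tns Be_reg Ae (K_left n) u k)"
  using be_self u by(simp add: KKp_def)
qed
qed

lemma KK_lin_eqI:
assumes f: "lin_on (KK n) f" and g: "lin_on (KK n) g" and x: "x : KKcar n"
 and eq: "!!b b' k. k : Kcar n ==> f (KKp n (be b b') k) = g (KKp n (be b b') k)"
shows "f x = g x"
by(rule KK_eqI[where Q = "vsp UNIV fscale" and f = f and g = g, OF _ _ x])(use f g eq in "auto simp: lin_on_def klin_def")

lemma KK_keys: "(u, k) : keys x ==> x : KKcar n ==> u : Be_car & k : Kcar n"
using tensor_keysD[of u k x "Be_reg" "Ae" "K_left n"]
by(simp add: KK_car rclosed_def lclosed_def kclosed_def Ae_Gam)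

lemma KK_op:
shows "lac (KK n) c (KKp n u k) = KKp n (be c 1 *~ u) k" "rac (KK n) (KKp n u k) c = KKp n (be 1 c *~ u) k"
proof -
have "lac (KKt n) v (KKp n u k) = KKp n (v*~u) k" for v
 unfolding KKp_def using lac_tns[of "Ae" "Be_reg" v] by(simp add: rhom_def klin_def bemul_assoc)
thus "lac (KK n) c (KKp n u k) = KKp n (be c 1 *~ u) k" "rac (KK n) (KKp n u k) c = KKp n (be 1 c *~ u) k"
 by(simp_all add: KK_def)
qed

lemma KK_op_be [simp]: "lac (KK n) c (KKp n (be b b') k) = KKp n (be (c * b) b') k"
"rac (KK n) (KKp n (be b b') k) c = KKp n (be b (b' * c)) k"
by(simp_all add: KK_op)

lemma KK_op_lin [simp]: "lac (KK n) c (x + y) = lac (KK n) c x + lac (KK n) c y" "lac (KK n) c (z*.x) = z *. lac (KK n) c x"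
"rac (KK n) (x + y) c = rac (KK n) x c + rac (KK n) y c" "rac (KK n) (z*.x) c = z *. rac (KK n) x c"
by(simp_all add: KK_def lac_tensor_lin)

lemma KK_op_in [simp]: "x : KKcar n ==> lac (KK n) c x : KKcar n" "x : KKcar n ==> rac (KK n) x c : KKcar n"
using lac_in[of "Ae" "Be_reg" _ x "K_left n"] by(auto simp: KK_def rhom_def klin_def bemul_assoc)

lemma bim_KK: "bimodule (KK n)"
proof -
note kl = klin_add[OF KKp_lin(1)] klin_scale[OF KKp_lin(1), simplified]
have eqI: "ALL x:KKcar n. f x = g x" if "lin_on (KK n) f" "lin_on (KK n) g"
 "!!b b' k. k : Kcar n ==> f (KKp n (be b b') k) = g (KKp n (be b b') k)" for f g :: "('b, 'k) KKelt => ('b, 'k) KKelt"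
 using KK_lin_eqI[OF that(1,2) _ that(3)] by blast
have "ALL x:KKcar n. c*.x = lac (KK n) (bs c 1) x" "ALL x:KKcar n. c*.x = rac (KK n) x (bs c 1)"
 "ALL x:KKcar n. lac (KK n) (b + b') x = lac (KK n) b x + lac (KK n) b' x" "ALL x:KKcar n. rac (KK n) x (b + b') = rac (KK n) x b + rac (KK n) x b'"
 "ALL x:KKcar n. lac (KK n) (b * b') x = lac (KK n) b (lac (KK n) b' x)" "ALL x:KKcar n. rac (KK n) x (b * b') = rac (KK n) (rac (KK n) x b) b'"
 "ALL x:KKcar n. lac (KK n) 1 x = x" "ALL x:KKcar n. rac (KK n) x 1 = x"
 "ALL x:KKcar n. rac (KK n) (lac (KK n) b x) b' = lac (KK n) b (rac (KK n) x b')" for b b' c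
 by(rule eqI; simp add: lin_on_def kl mult.assoc distrib_left distrib_right mult.commute fscale_plus)+
thus ?thesis
 by(simp add: bimodule_def kclosed_zero kclosed_diff)
qed

definition uK where "uK n k = KKp n (be 1 1) k"

lemma uK_be: "KKp n (be b b') k = lac (KK n) b (rac (KK n) (uK n k) b')"
by(simp add: uK_def)

lemma uK_in: "k : Kcar n ==> uK n k : KKcar n"
by(simp add: uK_def KKp_in)

lemma uK_hom: "Ahom n (KK n) (uK n)"
proof -
have "KKp n (be 1 1) (Kact n (be a a') k) = KKp n (be a a') k" if "a : A" "a' : A" "k : Kcar n" for a a' k
 using KKp_Gam[OF be_in that(3,1,2), of 1 1] by simp
with KKp_lin(2)[OF be_in] show ?thesis
 by(simp add: bimod_hom_def uK_def KKp_in klin_def A_one)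
qed

text \<open>Induction along \<open>A\<^sup>e \<subseteq> B\<^sup>e\<close>: the element \<open>uK\<close> is universal among the maps of \<open>A\<close>-bimodules from \<open>K\<^sub>n\<close> to
\<open>(B,B)\<close>-bimodules, and \<open>KKext\<close> extends such a map to \<open>K'\<^sub>n\<close>.\<close>

lemma KK_hom_eqI:
assumes f: "bihom (KK n) M f" and g: "bihom (KK n) M g" and x: "x : KKcar n"
 and eq: "!!k. k : Kcar n ==> f (uK n k) = g (uK n k)"
shows "f x = g x"
by(rule KK_eqI[OF hom_klin[OF f] hom_klin[OF g] x])
 (simp add: uK_be hom_lac[OF f] hom_lac[OF g] hom_rac[OF f] hom_rac[OF g] uK_in eq)

definition KKext where
"KKext X phi x = x >> (u,k). u >> (b,b'). lac X b (rac X (phi k) b')"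

lemma
assumes X: "bimodule X" "scl X = fscale" and phi: "Ahom n X phi"
shows KKext_KKp: "k : Kcar n ==> KKext X phi (KKp n (be b b') k) = lac X b (rac X (phi k) b')"
 and KKext_hom: "bihom (KK n) X (KKext X phi)"
 and KKext_uK: "k : Kcar n ==> KKext X phi (uK n k) = phi k"
proof -
note bl = bim_lac_in[OF X(1)] bim_rac_in[OF X(1)] bim_lac_rac[OF X(1)] bim_lac_lac[OF X(1)] bim_rac_rac[OF X(1)] bim_plus[OF X(1)] bim_bs[OF X(1), unfolded X(2)] bim_one[OF X(1)]
have kl: "klin X X (lac X b)" "klin X X (%m. rac X m b)" for b
 using bim_rhom[OF X(1), of "{}" b] bim_lhom[OF X(1), of "{}" b] by(simp_all add: rhom_def lhom_def)
note i = hom_in[OF phi]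
have "lin_on Bk (%b. lac X b (rac X (phi k) b'))" "lin_on Bk (%b. lac X b' (rac X (phi k) b))" if "k : Kcar n" for k b'
 using i[OF that] klin_add[OF kl(1)] klin_scale[OF kl(1)] X(2) by(simp_all add: lin_on_Bk bl)
moreover have "lin_on (K_cx n) (%k. lac X b (rac X (phi k) b'))" for b b'
 using klin_comp[OF klin_comp[OF kl(1) kl(2)] hom_klin[OF phi]] X(2) by(rule klin_lin)
ultimately have F: "kkbal n (%b k b'. lac X b (rac X (phi k) b'))"
 unfolding kkbal_def bal_Bk_Bk using i by(simp add: Ahom_lac[OF phi] Ahom_rac[OF phi] bl)
note * = KKp_bind[OF F]
show 1: "KKext X phi (KKp n (be b b') k) = lac X b (rac X (phi k) b')" if "k : Kcar n" for k b b'
 unfolding KKext_def by(rule *[OF that])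
show "KKext X phi (uK n k) = phi k" if "k : Kcar n" for k
 using 1[OF that] i[OF that] by(simp add: uK_def bl)
have lin: "lin_on (KK n) (KKext X phi)" by(simp add: lin_on_def KKext_def bind_linear)
have lX: "lin_on X (lac X b)" "lin_on X (%m. rac X m b)" for b by(rule klin_lin[OF kl(1) X(2)], rule klin_lin[OF kl(2) X(2)])
have Xin: "KKext X phi x : car X" if "x : KKcar n" for x
 unfolding KKext_def using subspace_car[OF bim_kclosed[OF X(1)] X(2)]
 by(intro bind_in_subspace)(auto dest!: KK_keys[OF _ that] intro!: bind_in_subspace bl i)
hence kk: "klin (KK n) X (KKext X phi)" using lin by(simp add: klin_def lin_on_def X(2))
have kop: "klin (KK n) (KK n) (lac (KK n) c)" "klin (KK n) (KK n) (%x. rac (KK n) x c)" for c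
 by(simp_all add: klin_def)
have "KKext X phi (lac (KK n) c x) = lac X c (KKext X phi x)" "KKext X phi (rac (KK n) x c) = rac X (KKext X phi x) c" if x: "x : KKcar n" for c x
 by(rule KK_lin_eqI[OF lin_on_comp[OF lin kop(1)] lin_on_comp[OF lX(1) kk] x], simp add: 1 i bl,
   rule KK_lin_eqI[OF lin_on_comp[OF lin kop(2)] lin_on_comp[OF lX(2) kk] x], simp add: 1 i bl)
thus "bihom (KK n) X (KKext X phi)"
 using kk by(simp add: bimod_hom_def klin_def)
qed

subsection \<open>The diagonal on \<open>K'\<close>\<close>

lemma crossK_tmap:
assumes "bihom M M' F" "bihom N N' F'"
shows "tmapU M' N' F F' (crossK r s M N f g k) = crossK r s M' N' (%x. F (f x)) (%y. F' (g y)) k"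
unfolding crossK_def tmap_def bind_assoc2 tns_bind[OF bal_tns_comp[OF hom_rhom[OF assms(1)] hom_lhom[OF assms(2)]]] ..

lemma tassoc_hom:
assumes M: "bimodule M" and N: "bimodule N" and Q: "bimodule Q"
shows "bihom ((M ** N) ** Q) (M ** (N ** Q)) (tassocU M N Q)"
proof -
let ?T = "M ** N" and ?T' = "N ** Q"
note BT = bim_tensor[OF M N] and BT' = bim_tensor[OF N Q]
have t: "tassocU M N Q (tnsU ?T Q u q) = u >> (m,n). tnsU M ?T' m (tnsU N Q n q)" for u q
 by(rule tassoc_tns[OF bim_rhom[OF N] bim_rclosed[OF M] bim_lclosed[OF N]])
have tb: "tassocU M N Q (v >> F) = v >> x. tassocU M N Q (F x)" for v F
 by(simp add: tassoc_def bind_assoc)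
have bT: "tnsU M N m n >> (%(m,n). tnsU M ?T' m (tnsU N Q n q)) = tnsU M ?T' m (tnsU N Q n q)" if "q : car Q" for m n q
 using tns_bind tribal_tns[where M = M and R = UNIV and N = N and S = UNIV and Q = Q, OF bim_rhom[OF N], unfolded tribal_def] that by fastforce
show ?thesis
 unfolding bimod_hom_def scl_tensor
proof(intro conjI ballI allI)
 fix x assume x: "x : car (?T ** Q)"
 have k: "u : car ?T" "q : car Q" if "(u, q) : keys x" for u q
  using tensor_keysD[OF that x bim_rclosed[OF BT] bim_lclosed[OF Q]] by auto
 have k2: "m : car M" "n : car N" if "(u, q) : keys x" "(m, n) : keys u" for u q m n
  using tensor_keysD[OF that(2) k(1)[OF that(1)] bim_rclosed[OF M] bim_lclosed[OF N]] by auto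
 show "tassocU M N Q x : car (M ** ?T')"
  unfolding tassoc_def by(intro tensor_bind_in bind_in_subspace2[OF subspace_tensor] tns_in)(use k k2 in blast)+
 show "tassocU M N Q (x + y) = tassocU M N Q x + tassocU M N Q y" for y
  by(simp add: tassoc_def bind_linear)
 show "tassocU M N Q (c*.x) = c *. tassocU M N Q x" for c
  by(simp add: tassoc_def bind_linear)
 show "tassocU M N Q (lac (?T ** Q) b x) = lac (M ** ?T') b (tassocU M N Q x)" for b
  unfolding lac_tensor[of ?T UNIV Q _ x] tassoc_def[of _ _ _ _ _ x] tb lac_tensor_bind
  by(auto intro!: bind_cong simp: t lac_cross[OF M BT'] lac_tensor_bind lac_tensor[of M UNIV N] bind_assoc2 bT k)
 show "tassocU M N Q (rac (?T ** Q) x b) = rac (M ** ?T') (tassocU M N Q x) b" for b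
  unfolding rac_tensor[of ?T UNIV Q x] tassoc_def[of _ _ _ _ _ x] tb rac_tensor_bind
  by(auto intro!: bind_cong simp: t rac_cross[OF M BT'] rac_cross[OF N Q] rac_tensor_bind split_def)
qed
qed

lemma tassoc_natural:
assumes M: "bimodule M" "bimodule N" "bimodule Q" "bimodule M'" "bimodule N'" "bimodule Q'"
 and f: "bihom M M' f" and g: "bihom N N' g" and h: "bihom Q Q' h"
 and t: "t : car ((M ** N) ** Q)"
shows "tassocU M' N' Q' (tmapU (M' ** N') Q' (tmapU M' N' f g) h t) =
 tmapU M' (N' ** Q') f (tmapU N' Q' g h) (tassocU M N Q t)"
proof -
have T: "tribal M' UNIV N' UNIV Q' (%m n q. tnsU M' (N' ** Q') m (tnsU N' Q' n q))"
 by(rule tribal_tns[OF bim_rhom[OF M(5)]])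
have "tassocU M' N' Q' (tmapU (M' ** N') Q' (tmapU M' N' f g) h t)
 = t >> (u,q). tmapU M' N' f g u >> (m,n). tnsU M' (N' ** Q') m (tnsU N' Q' n (h q))"
 unfolding tassoc_def tmap_def[of "M' ** N'"] bind_assoc2
  tns_bind[OF bal_tensor_left[OF T bim_rclosed[OF M(4)] bim_lclosed[OF M(5)]]] ..
also have "... = t >> (u,q). u >> (m,n). tnsU M' (N' ** Q') (f m) (tnsU N' Q' (g n) (h q))"
proof(rule bind_cong2)
 fix u q assume "(u, q) : keys t"
 hence "q : car Q" using tensor_keysD[OF _ t bim_rclosed[OF bim_tensor[OF M(1,2)]] bim_lclosed[OF M(3)]] by blast
 hence "balU M' N' (%m n. tnsU M' (N' ** Q') m (tnsU N' Q' n (h q)))"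
  using T hom_in[OF h] by(simp add: tribal_def)
 from tns_bind[OF this]
 show "tmapU M' N' f g u >> (m,n). tnsU M' (N' ** Q') m (tnsU N' Q' n (h q))
  = u >> (m,n). tnsU M' (N' ** Q') (f m) (tnsU N' Q' (g n) (h q))"
  unfolding tmap_def bind_assoc2 by simp
qed
also have "... = tmapU M' (N' ** Q') f (tmapU N' Q' g h) (tassocU M N Q t)"
 unfolding tassoc_def tmap_def[of M'] bind_assoc2
  tns_bind[OF bal_tns_comp[OF hom_rhom[OF f] hom_lhom[OF tmap_hom(1)[OF M(2,3,5,6) g h]]]]
  tmap_hom(2)[OF M(2,3,5,6) g h] ..
finally show ?thesis .
qed

abbreviation "KT r s == tensor (KK r) UNIV (KK s)"
abbreviation "cK r s == crossK r s (KK r) (KK s) (uK r) (uK s)"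

lemma bim_KT: "bimodule (KT r s)"
by(intro bim_tensor bim_KK)

lemma cK_hom: "Ahom (r + s) (KT r s) (cK r s)"
by(intro crossK_hom bim_KK uK_hom)

lemma DeltaKK_form_eq: "DeltaKK_form r s b b' k = lac (KT r s) b (rac (KT r s) (cK r s k) b')"
unfolding DeltaKK_form_def crossK_def rac_tensor_bind lac_tensor_bind
by(auto intro!: bind_cong simp: lac_cross[OF bim_KK bim_KK] rac_cross[OF bim_KK bim_KK] uK_def)

text \<open>The universal property turns statements about the diagonal of \<open>K'\<close> into statements about the product
of universal elements.\<close>

lemma DeltaKK_ext: "DeltaKK r s x = KKext (KT r s) (cK r s) x"
by(simp add: DeltaKK_def KKext_def DeltaKK_form_eq)

lemma DeltaKK_KKp: "k : Kcar (r + s) ==> DeltaKK r s (KKp (r + s) (be b b') k) = DeltaKK_form r s b b' k"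
unfolding DeltaKK_ext DeltaKK_form_eq by(rule KKext_KKp[OF bim_KT scl_tensor cK_hom])

lemma DeltaKK_hom: "bihom (KK (r + s)) (KT r s) (DeltaKK r s)"
unfolding DeltaKK_ext[abs_def] by(rule KKext_hom[OF bim_KT scl_tensor cK_hom])

lemma DeltaKK_uK: "k : Kcar (r + s) ==> DeltaKK r s (uK (r + s) k) = cK r s k"
unfolding DeltaKK_ext by(rule KKext_uK[OF bim_KT scl_tensor cK_hom])

lemma dKK_KKp: "dKK (Suc n) (KKp (Suc n) u k) = KKp n u (dK (Suc n) k)"
unfolding dKK_def KKp_def diff_Suc_1
by(rule tns_bind[OF bal_tns_comp])(auto simp: rhom_def lhom_def klin_def dK_Kact Ae_Gam)

lemma dKK_hom: "bihom (KK (Suc n)) (KK n) (dKK (Suc n))"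
proof -
have lin: "dKK m (x + y) = dKK m x + dKK m y" "dKK m (c*.x) = c *. dKK m x" for m x y c
 by(simp_all add: dKK_def bind_linear)
have i: "dKK (Suc n) x : KKcar n" if "x : KKcar (Suc n)" for x
 unfolding dKK_def diff_Suc_1 by(intro bind_in_subspace2[OF subspace_KK] KKp_in dK_in)(auto dest: KK_keys[OF _ that])
have "dKK (Suc n) (lac (KK (Suc n)) c x) = lac (KK n) c (dKK (Suc n) x)"
 "dKK (Suc n) (rac (KK (Suc n)) x c) = rac (KK n) (dKK (Suc n) x) c" if x: "x : KKcar (Suc n)" for c x
 by(rule KK_lin_eqI[OF _ _ x]; simp add: lin_on_def lin dKK_KKp)+
thus ?thesis by(simp add: bimod_hom_def lin i)
qed

lemma dKK_uK: "dKK (Suc n) (uK (Suc n) k) = uK n (dK (Suc n) k)"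
by(simp add: uK_def dKK_KKp)

lemma KK_chain: "diagonal_chain_map KK dKK DeltaKK"
unfolding diagonal_chain_map_def
proof(intro conjI allI ballI)
fix u v x assume x: "x : KKcar (u + v + 1)"
have x': "x : KKcar (Suc (u + v))" using x by simp
have h1: "bihom (KK (Suc (u + v))) (KT u v) (%x. tmapU (KK u) (KK v) (dKK (Suc u)) id (DeltaKK (Suc u) v x))"
 using hom_comp[OF tmap_hom(1)[OF bim_KK bim_KK bim_KK bim_KK dKK_hom hom_id(2)] DeltaKK_hom[of "Suc u" v]] by simp
have h2: "bihom (KK (Suc (u + v))) (KT u v) (%x. tmapU (KK u) (KK v) id (dKK (Suc v)) (DeltaKK u (Suc v) x))"
 using hom_comp[OF tmap_hom(1)[OF bim_KK bim_KK bim_KK bim_KK hom_id(2) dKK_hom] DeltaKK_hom[of u "Suc v"]] by simp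
have "DeltaKK u v (dKK (Suc (u + v)) x) = tmapU (KK u) (KK v) (dKK (Suc u)) id (DeltaKK (Suc u) v x) +
  ((-1) ^ u) *. tmapU (KK u) (KK v) id (dKK (Suc v)) (DeltaKK u (Suc v) x)"
proof(rule KK_hom_eqI[OF hom_comp[OF DeltaKK_hom dKK_hom]
   hom_plus[OF bim_KT scl_tensor h1 hom_scale[OF bim_KT scl_tensor h2]] x'])
 fix k assume k: "k : Kcar (Suc (u + v))"
 have "DeltaKK u v (dKK (Suc (u + v)) (uK (Suc (u + v)) k)) = cK u v (dK (u + v + 1) k)"
  using k by(simp add: dKK_uK DeltaKK_uK)
 also have "... = tmapU (KK u) (KK v) (dKK (Suc u)) id (cK (Suc u) v k) + ((-1) ^ u) *. tmapU (KK u) (KK v) id (dKK (Suc v)) (cK u (Suc v) k)"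
  using crossK_chain[OF uK_hom uK_hom, of k u v] k by(simp add: crossK_tmap[OF dKK_hom hom_id(2)] crossK_tmap[OF hom_id(2) dKK_hom] dKK_uK)
 finally show "DeltaKK u v (dKK (Suc (u + v)) (uK (Suc (u + v)) k)) = tmapU (KK u) (KK v) (dKK (Suc u)) id (DeltaKK (Suc u) v (uK (Suc (u + v)) k)) +
  ((-1) ^ u) *. tmapU (KK u) (KK v) id (dKK (Suc v)) (DeltaKK u (Suc v) (uK (Suc (u + v)) k))"
  using DeltaKK_uK[of k "Suc u" v] DeltaKK_uK[of k u "Suc v"] k by simp
qed
thus "DeltaKK u v (dKK (u + v + 1) x) = tmapU (KK u) (KK v) (dKK (u + 1)) id (DeltaKK (u + 1) v x) +
  ((-1) ^ u) *. tmapU (KK u) (KK v) id (dKK (v + 1)) (DeltaKK u (v + 1) x)" by simp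
qed (rule DeltaKK_hom)

lemma KK_coassoc: "coassociative KK DeltaKK"
unfolding coassociative_def
proof(intro allI ballI)
fix u v w x assume x: "x : KKcar (u + v + w)"
note B = bim_KK bim_KT
have h1: "bihom (KK (u + v + w)) ((KK u) ** (KT v w))
 (%x. tassocU (KK u) (KK v) (KK w) (tmapU (KT u v) (KK w) (DeltaKK u v) id (DeltaKK (u + v) w x)))"
 by(rule hom_comp[OF tassoc_hom hom_comp[OF tmap_hom(1) DeltaKK_hom]]) (intro B DeltaKK_hom hom_id)+
have h2: "bihom (KK (u + v + w)) ((KK u) ** (KT v w))
 (%x. tmapU (KK u) (KT v w) id (DeltaKK v w) (DeltaKK u (v + w) x))"
 unfolding add.assoc
 by(rule hom_comp[OF tmap_hom(1) DeltaKK_hom]) (intro B DeltaKK_hom hom_id)+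
show "tassocU (KK u) (KK v) (KK w) (tmapU (KT u v) (KK w) (DeltaKK u v) id (DeltaKK (u + v) w x))
 = tmapU (KK u) (KT v w) id (DeltaKK v w) (DeltaKK u (v + w) x)"
proof(rule KK_hom_eqI[OF h1 h2 x])
 fix k assume k: "k : Kcar (u + v + w)"
 hence k': "k : Kcar (u + (v + w))" by(simp add: add.assoc)
 have "tmapU (KT u v) (KK w) (DeltaKK u v) id (DeltaKK (u + v) w (uK (u + v + w) k)) = crossK (u + v) w (KT u v) (KK w) (cK u v) (uK w) k"
  unfolding DeltaKK_uK[OF k] crossK_tmap[OF DeltaKK_hom hom_id(2)] by(rule crossK_cong[OF k])(simp_all add: DeltaKK_uK)
 moreover have "tmapU (KK u) (KT v w) id (DeltaKK v w) (DeltaKK u (v + w) (uK (u + (v + w)) k)) = crossK u (v + w) (KK u) (KT v w) (uK u) (cK v w) k"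
  unfolding DeltaKK_uK[OF k'] crossK_tmap[OF hom_id(2) DeltaKK_hom] by(rule crossK_cong[OF k'])(simp_all add: DeltaKK_uK)
 ultimately show "tassocU (KK u) (KK v) (KK w) (tmapU (KT u v) (KK w) (DeltaKK u v) id (DeltaKK (u + v) w (uK (u + v + w) k)))
  = tmapU (KK u) (KT v w) id (DeltaKK v w) (DeltaKK u (v + w) (uK (u + v + w) k))"
  using crossK_assoc[OF B(1) B(1) uK_hom uK_hom uK_hom k] by(simp add: add.assoc)
qed
qed

section \<open>The bicomplex \<open>L \<otimes>\<^sub>H K'\<close>\<close>

lemma KKact_kkbal: "kkbal n (%b k b'. tau h >> (l,t). t >> (w,r). KKp n (be (b * l) (r * b')) (Kact n w k))"
proof -
note kl = klin_add[OF KKp_lin(1)] klin_scale[OF KKp_lin(1), simplified]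
have T: "tribal Breg A GamA A Breg (%l w r. KKp n (be (b * l) (r * b')) (Kact n w k))" if k: "k : Kcar n" for b k b'
proof -
 have "lin_on (KK n) (%x. lac (KK n) b (rac (KK n) x b'))" by(simp add: lin_on_def)
 from tribal_hom_act[OF bim_KK uK_hom k this] show ?thesis by(simp add: uK_def)
qed
show ?thesis
 unfolding kkbal_def bal_Bk_Bk
proof(intro conjI ballI allI)
 fix b b' k a assume k: "k : Kcar n" and a: "a : A"
 have *: "tau h >> (l,t). t >> (w,r). KKp n (be (b * l) (r * b')) (Kact n w (Kact n (be a a') k))
   = tau h >> (l,t). t >> (w,r). KKp n (be (b * l) (r * b')) (Kact n (w *~ be a a') k)"
  if "a : A" "a' : A" for a a'
  by(rule bind_cong2, rule bind_cong2, subst Kact_Kact[OF k])(use that tau_keys in "blast intro: be_Gam", simp_all add: that)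
 show "tau h >> (l,t). t >> (w,r). KKp n (be (b * a * l) (r * b')) (Kact n w k)
   = tau h >> (l,t). t >> (w,r). KKp n (be (b * l) (r * b')) (Kact n w (Kact n (be a 1) k))"
  unfolding *[OF a A_one] using tau_central(1)[OF T[OF k] a] by(simp add: mult.assoc)
 show "tau h >> (l,t). t >> (w,r). KKp n (be (b * l) (r * (a * b'))) (Kact n w k)
   = tau h >> (l,t). t >> (w,r). KKp n (be (b * l) (r * b')) (Kact n w (Kact n (be 1 a) k))"
  unfolding *[OF A_one a] using tau_central(2)[OF T[OF k] a] by(simp add: mult.assoc)
next
 fix k b' assume k: "k : Kcar n"
 show "lin_on Bk (%b. tau h >> (l,t). t >> (w,r). KKp n (be (b * l) (r * b')) (Kact n w k))"
  "lin_on Bk (%b. tau h >> (l,t). t >> (w,r). KKp n (be (b' * l) (r * b)) (Kact n w k))"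
  by(intro lin_on_bind2; use k tau_keys in "simp add: lin_on_Bk distrib_left distrib_right kl")+
next
 fix b b'
 show "lin_on (K_cx n) (%k. tau h >> (l,t). t >> (w,r). KKp n (be (b * l) (r * b')) (Kact n w k))"
  by(intro lin_on_bind2 lin_on_comp[OF _ klin_Kact] klin_lin[OF KKp_lin(2)])(use tau_keys in auto)
qed
qed

lemma KKact_KKp: "k : Kcar n ==> KKact n h (KKp n (be b b') k) = tau h >> (l,t). t >> (w,r). KKp n (be (b * l) (r * b')) (Kact n w k)"
unfolding KKact_def by(rule KKp_bind[OF KKact_kkbal])

lemma
shows KK_lac_bind: "lac (KK n) c (v >> f) = v >> x. lac (KK n) c (f x)"
 and KK_rac_bind: "rac (KK n) (v >> f) c = v >> x. rac (KK n) (f x) c"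
by(simp_all add: KK_def lac_tensor_bind)

lemma KKact_hom: "bihom (KK n) (KK n) (KKact n h)"
proof -
have lin: "KKact n h (x + y) = KKact n h x + KKact n h y" "KKact n h (c*.x) = c *. KKact n h x" for x y c
 by(simp_all add: KKact_def bind_linear)
have i: "KKact n h x : KKcar n" if "x : KKcar n" for x
 unfolding KKact_def
 by(intro bind_in_subspace2[OF subspace_KK] KKp_in Kact_in)(use KK_keys[OF _ that] tau_keys in auto)
have "KKact n h (lac (KK n) c x) = lac (KK n) c (KKact n h x)" "KKact n h (rac (KK n) x c) = rac (KK n) (KKact n h x) c"
 if x: "x : KKcar n" for x c
 by(rule KK_lin_eqI[OF _ _ x]; simp add: lin_on_def lin KKact_KKp KK_lac_bind KK_rac_bind mult.assoc split_def)+
thus ?thesis by(simp add: bimod_hom_def lin i)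
qed

lemma KK_H_simps [simp]: "car (KK_H n) = KKcar n" "scl (KK_H n) = fscale" "lac (KK_H n) = KKact n"
by(simp_all add: KK_H_def)

abbreviation "LKt p r == tensor (L_cx p) UNIV (KK_H r)"
abbreviation "LKcar p r == car (LK p r)"

lemma LK_simps [simp]: "scl (LK p r) = fscale"
by(simp add: LK_def)

lemma LK_car: "LKcar p r = car (LKt p r)"
by(simp add: LK_def)

lemma subspace_LK: "fv.subspace (LKcar p r)"
unfolding LK_car by(rule subspace_tensor)

lemma kclosed_LK [simp]: "kclosed (LK p r)"
using subspace_LK[of p r] fv.subspace_diff by(auto simp: kclosed_def fv.subspace_def)

lemma LKp_in: "l : Lcar p ==> x : KKcar r ==> LKp p r l x : LKcar p r"
unfolding LK_car LKp_def by(rule tns_in) simp_all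

lemma LK_keys: "(l, x) : keys y ==> y : LKcar p r ==> l : Lcar p & x : KKcar r"
using tensor_keysD[of l x y "L_cx p" UNIV "KK_H r"] hom_in[OF KKact_hom]
by(simp add: LK_car rclosed_def lclosed_def kclosed_def kclosed_zero[OF kclosed_KK] kclosed_diff[OF kclosed_KK] kclosed_scl[OF kclosed_KK, simplified])

lemma
shows LKp_add_left: "l : Lcar p ==> l' : Lcar p ==> x : KKcar r ==> LKp p r (l + l') x = LKp p r l x + LKp p r l' x"
 and LKp_scale_left: "l : Lcar p ==> x : KKcar r ==> LKp p r (c*.l) x = c *. LKp p r l x"
 and LKp_add_right: "l : Lcar p ==> x : KKcar r ==> x' : KKcar r ==> LKp p r l (x + x') = LKp p r l x + LKp p r l x'"
 and LKp_scale_right: "l : Lcar p ==> x : KKcar r ==> LKp p r l (c*.x) = c *. LKp p r l x"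
 and LKp_act: "l : Lcar p ==> x : KKcar r ==> LKp p r (Lact p l h) x = LKp p r l (KKact r h x)"
unfolding LKp_def using tns_add_left[of l "L_cx p" l' x "KK_H r"] tns_scl_left[of l "L_cx p" x "KK_H r"]
 tns_add_right[of l "L_cx p" x "KK_H r"] tns_scl_right[of l "L_cx p" x "KK_H r"] tns_bal[of l "L_cx p" h UNIV x "KK_H r"]
by simp_all

lemma LK_eqI:
assumes f: "klin (LK p r) Q f" and g: "klin (LK p r) Q g" and y: "y : LKcar p r"
 and eq: "!!l x. l : Lcar p ==> x : KKcar r ==> f (LKp p r l x) = g (LKp p r l x)"
shows "f y = g y"
proof -
have T: "klin (LKt p r) Q h" if "klin (LK p r) Q h" for h using that by(simp add: klin_def LK_car)
show ?thesis
 by(rule tensor_klin_eqI[OF y[unfolded LK_car] T[OF f] T[OF g]])(use eq in "simp add: LKp_def")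
qed

lemma LK_lin_eqI:
assumes f: "lin_on (LK p r) f" and g: "lin_on (LK p r) g" and y: "y : LKcar p r"
 and eq: "!!l x. l : Lcar p ==> x : KKcar r ==> f (LKp p r l x) = g (LKp p r l x)"
shows "f y = g y"
by(rule LK_eqI[where Q = "vsp UNIV fscale" and f = f and g = g, OF _ _ y])(use f g eq in "auto simp: lin_on_def klin_def")

lemma LKp_map:
assumes "bihom (KK r) (KK s) f" "!!h x. x : KKcar r ==> f (KKact r h x) = KKact s h (f x)"
 and "rhom UNIV (L_cx p) (L_cx q) g"
shows "LKp p r l x >> (l,x). LKp q s (g l) (f x) = LKp q s (g l) (f x)"
unfolding LKp_def
by(rule tns_bind[OF bal_tns_comp[OF assms(3)]])(use hom_klin[OF assms(1)] assms(2) in "simp add: lhom_def klin_def")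

lemma LK_op [simp]: "lac (LK p r) c (LKp p r l x) = LKp p r l (lac (KK r) c x)" "rac (LK p r) (LKp p r l x) c = LKp p r l (rac (KK r) x c)"
unfolding LK_def LKp_def
by(auto intro!: tns_bind[OF bal_tns_comp[OF rhom_id(1)]] simp: lhom_def klin_def hom_lac[OF KKact_hom] hom_rac[OF KKact_hom])

lemma
shows LK_lac_bind: "lac (LK p r) c (v >> f) = v >> x. lac (LK p r) c (f x)"
 and LK_rac_bind: "rac (LK p r) (v >> f) c = v >> x. rac (LK p r) (f x) c"
by(simp_all add: LK_def bind_assoc)

lemma LK_op_lin [simp]: "lac (LK p r) c (x + y) = lac (LK p r) c x + lac (LK p r) c y" "lac (LK p r) c (z*.x) = z *. lac (LK p r) c x"
"rac (LK p r) (x + y) c = rac (LK p r) x c + rac (LK p r) y c" "rac (LK p r) (z*.x) c = z *. rac (LK p r) x c"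
by(simp_all add: LK_def bind_linear)

lemma LK_op_in [simp]: "y : LKcar p r ==> lac (LK p r) c y : LKcar p r" "y : LKcar p r ==> rac (LK p r) y c : LKcar p r"
by(auto simp: LK_def[of G p r, THEN arg_cong[of _ _ lac]] LK_def[of G p r, THEN arg_cong[of _ _ rac]]
  intro!: bind_in_subspace[OF subspace_LK] LKp_in dest!: LK_keys)

lemma bim_LK: "bimodule (LK p r)"
proof -
have eqI: "ALL x:LKcar p r. f x = g x" if "lin_on (LK p r) f" "lin_on (LK p r) g"
 "!!l x. l : Lcar p ==> x : KKcar r ==> f (LKp p r l x) = g (LKp p r l x)" for f g :: "('h, 'b, 'k) LKelt => ('h, 'b, 'k) LKelt"
 using LK_lin_eqI[OF that(1,2) _ that(3)] by blast
have "ALL x:LKcar p r. c*.x = lac (LK p r) (bs c 1) x" "ALL x:LKcar p r. c*.x = rac (LK p r) x (bs c 1)"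
 "ALL x:LKcar p r. lac (LK p r) (b + b') x = lac (LK p r) b x + lac (LK p r) b' x" "ALL x:LKcar p r. rac (LK p r) x (b + b') = rac (LK p r) x b + rac (LK p r) x b'"
 "ALL x:LKcar p r. lac (LK p r) (b * b') x = lac (LK p r) b (lac (LK p r) b' x)" "ALL x:LKcar p r. rac (LK p r) x (b * b') = rac (LK p r) (rac (LK p r) x b) b'"
 "ALL x:LKcar p r. lac (LK p r) 1 x = x" "ALL x:LKcar p r. rac (LK p r) x 1 = x"
 "ALL x:LKcar p r. rac (LK p r) (lac (LK p r) b x) b' = lac (LK p r) b (rac (LK p r) x b')" for b b' c
 by(rule eqI; simp add: lin_on_def fscale_plus mult.commute bim_lac_lac[OF bim_KK] bim_rac_rac[OF bim_KK]
   bim_one[OF bim_KK] bim_plus[OF bim_KK] bim_bs[OF bim_KK] bim_lac_rac[OF bim_KK] LKp_add_right LKp_scale_right)+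
thus ?thesis
 by(simp add: bimodule_def kclosed_zero kclosed_diff)
qed

text \<open>The universal element of \<open>Hom\<^sub>H(L\<^sub>p, Hom\<^sub>A\<^sub>e(K\<^sub>r, M))\<close>, with \<open>M = L\<^sub>p \<otimes>\<^sub>H K'\<^sub>r\<close>.\<close>

definition uL where "uL p r l k = LKp p r l (uK r k)"

lemma LKp_hom: "l : Lcar p ==> bihom (KK r) (LK p r) (LKp p r l)"
by(simp add: bimod_hom_def LKp_in LKp_add_right LKp_scale_right)

lemma LK_hom_eqI:
assumes f: "bihom (LK p r) M f" and g: "bihom (LK p r) M g" and y: "y : LKcar p r"
 and eq: "!!l k. l : Lcar p ==> k : Kcar r ==> f (uL p r l k) = g (uL p r l k)"
shows "f y = g y"
proof(rule LK_eqI[OF hom_klin[OF f] hom_klin[OF g] y])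
fix l x assume l: "l : Lcar p" and x: "x : KKcar r"
show "f (LKp p r l x) = g (LKp p r l x)"
 by(rule KK_hom_eqI[OF hom_comp[OF f LKp_hom[OF l]] hom_comp[OF g LKp_hom[OF l]] x])
  (use eq l in "simp add: uL_def")
qed

lemma KKact_uK: "k : Kcar n ==> KKact n h (uK n k) = hom_act n (KK n) (uK n) h k"
by(simp add: uK_def KKact_KKp hom_act_def bind_def)

lemma uL_HomL: "uL p r : HomL p r (LK p r)"
proof(rule HomLI)
fix l h k assume l: "l : Lcar p" and k: "k : Kcar r"
show "uL p r (Lact p l h) k = hom_act r (LK p r) (uL p r l) h k"
 using hom_act_hom[OF bim_KK uK_hom LKp_hom[OF l] k] l k by(simp add: uL_def[abs_def] LKp_act uK_in KKact_uK)
next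
have "bimod_hom A A (KK r) (LK p r) (LKp p r l)" if "l : Lcar p" for l using LKp_hom[OF that] by(simp add: bimod_hom_def)
from hom_comp[OF this uK_hom] show "Ahom r (LK p r) (uL p r l)" if "l : Lcar p" for l
 using that by(simp add: uL_def[abs_def])
qed (simp_all add: uL_def LKp_add_left LKp_scale_left uK_in)

definition LKext where
"LKext X phi y = y >> (l,x). KKext X (phi l) x"

lemma
assumes X: "bimodule X" "scl X = fscale" and phi: "phi : HomL p r X"
shows LKext_LKp: "l : Lcar p ==> x : KKcar r ==> LKext X phi (LKp p r l x) = KKext X (phi l) x"
 and LKext_hom: "bihom (LK p r) X (LKext X phi)"
 and LKext_uL: "l : Lcar p ==> k : Kcar r ==> LKext X phi (uL p r l k) = phi l k"
proof -
note h = HomL_hom[OF phi]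
note e = KKext_hom[OF X h]
have kl: "klin X X (lac X b)" "klin X X (%m. rac X m b)" for b
 using bim_rhom[OF X(1), of "{}" b] bim_lhom[OF X(1), of "{}" b] by(simp_all add: rhom_def lhom_def)
have B: "balU (L_cx p) (KK_H r) (%l x. KKext X (phi l) x)"
proof(rule balI)
 fix x assume "x : car (KK_H r)"
 hence x: "x : KKcar r" by simp
 show "lin_on (L_cx p) (%l. KKext X (phi l) x)"
  unfolding KKext_def
 proof(intro lin_on_bind2 lin_on_comp[OF klin_lin[OF klin_comp[OF kl(1) kl(2)] X(2)]])
  fix u k assume "(u, k) : keys x"
  hence "k : Kcar r" using KK_keys[OF _ x] by auto
  thus "klin (L_cx p) X (%l. phi l k)" using hom_in[OF h] HomL_add[OF phi] HomL_scl[OF phi] by(simp add: klin_def)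
 qed
next
 fix l assume "l : car (L_cx p)"
 thus "lin_on (KK_H r) (KKext X (phi l))" using klin_lin[OF hom_klin[OF e] X(2)] by(simp add: lin_on_def)
next
 fix l z x assume l: "l : car (L_cx p)" and "x : car (KK_H r)"
 hence x: "x : KKcar r" by simp
 have "KKext X (phi (Lact p l z)) x = KKext X (phi l) (KKact r z x)"
 proof(rule KK_hom_eqI[OF e[OF Lact_in[OF l]] hom_comp[OF e[OF l] KKact_hom] x])
  fix k assume k: "k : Kcar r"
  have c: "hom_act r X (phi l) z k = hom_act r X (%x. KKext X (phi l) (uK r x)) z k"
   unfolding hom_act_def linext_def
   by(intro sum.cong refl arg_cong2[of _ _ _ _ "scl X"])
    (use tau_keys k in "auto simp: KKext_uK[OF X h[OF l]] intro!: sum.cong")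
  show "KKext X (phi (Lact p l z)) (uK r k) = KKext X (phi l) (KKact r z (uK r k))"
   using k l by(simp add: KKext_uK[OF X h] HomL_act[OF phi] KKact_uK hom_act_hom[OF bim_KK uK_hom e[OF l] k] c)
 qed
 thus "KKext X (phi (rac (L_cx p) l z)) x = KKext X (phi l) (lac (KK_H r) z x)" by simp
qed
show 1: "LKext X phi (LKp p r l x) = KKext X (phi l) x" if "l : Lcar p" "x : KKcar r" for l x
 unfolding LKext_def LKp_def by(rule tns_bind[OF B])
show "LKext X phi (uL p r l k) = phi l k" if "l : Lcar p" "k : Kcar r" for l k
 using 1 that by(simp add: uL_def uK_in KKext_uK[OF X h])
have lin: "lin_on (LK p r) (LKext X phi)" by(simp add: lin_on_def LKext_def bind_linear)
have lX: "lin_on X (lac X b)" "lin_on X (%m. rac X m b)" for b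
 by(rule klin_lin[OF kl(1) X(2)], rule klin_lin[OF kl(2) X(2)])
have "LKext X phi y : car X" if "y : LKcar p r" for y
 unfolding LKext_def using subspace_car[OF bim_kclosed[OF X(1)] X(2)]
 by(rule bind_in_subspace2)(auto dest!: LK_keys[OF _ that] intro!: hom_in[OF e])
hence kk: "klin (LK p r) X (LKext X phi)" using lin by(simp add: klin_def lin_on_def X(2))
have kop: "klin (LK p r) (LK p r) (lac (LK p r) c)" "klin (LK p r) (LK p r) (%x. rac (LK p r) x c)" for c
 by(simp_all add: klin_def)
have "LKext X phi (lac (LK p r) c y) = lac X c (LKext X phi y)" "LKext X phi (rac (LK p r) y c) = rac X (LKext X phi y) c" if y: "y : LKcar p r" for c y
 by(rule LK_lin_eqI[OF lin_on_comp[OF lin kop(1)] lin_on_comp[OF lX(1) kk] y], simp add: 1 hom_lac[OF e],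
   rule LK_lin_eqI[OF lin_on_comp[OF lin kop(2)] lin_on_comp[OF lX(2) kk] y], simp add: 1 hom_rac[OF e])
thus "bihom (LK p r) X (LKext X phi)"
 using kk by(simp add: bimod_hom_def klin_def)
qed

subsection \<open>Differentials and diagonal\<close>

lemma dLK_lin: "dLK_h p r (x + y) = dLK_h p r x + dLK_h p r y" "dLK_h p r (c*.x) = c *. dLK_h p r x"
"dLK_v p r (x + y) = dLK_v p r x + dLK_v p r y" "dLK_v p r (c*.x) = c *. dLK_v p r x"
by(simp_all add: dLK_h_def dLK_v_def bind_linear)

lemma dLK_h_LKp: "dLK_h (Suc p) r (LKp (Suc p) r l x) = LKp p r (dL (Suc p) l) x"
unfolding dLK_h_def diff_Suc_1 by(rule LKp_map[OF hom_id(1)])(simp_all add: rhom_def klin_def dL_Lact)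

lemma dLK_h_uL: "dLK_h (p + 1) r (uL (p + 1) r l k) = uL p r (dL (p + 1) l) k"
using dLK_h_LKp by(simp add: uL_def)

lemma dKK_act: "x : KKcar (Suc r) ==> dKK (Suc r) (KKact (Suc r) h x) = KKact r h (dKK (Suc r) x)"
proof(rule KK_hom_eqI[OF hom_comp[OF dKK_hom KKact_hom] hom_comp[OF KKact_hom dKK_hom]])
fix k assume k: "k : Kcar (Suc r)"
have c: "hom_act (Suc r) (KK r) (%x. uK r (dK (Suc r) x)) h k = hom_act r (KK r) (uK r) h (dK (Suc r) k)"
 unfolding hom_act_def linext_def
 by(intro sum.cong refl arg_cong2[of _ _ _ _ "scl (KK r)"])
  (use tau_keys k in "auto simp: dK_Kact intro!: sum.cong")
show "dKK (Suc r) (KKact (Suc r) h (uK (Suc r) k)) = KKact r h (dKK (Suc r) (uK (Suc r) k))"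
 using k by(simp add: KKact_uK hom_act_hom[OF bim_KK uK_hom dKK_hom k] dKK_uK c)
qed

lemma dLK_v_LKp: "dLK_v p (Suc r) (LKp p (Suc r) l x) = LKp p r l (dKK (Suc r) x)"
unfolding dLK_v_def diff_Suc_1 by(rule LKp_map[OF dKK_hom dKK_act rhom_id(1)])

lemma dLK_v_uL: "dLK_v p (r + 1) (uL p (r + 1) l k) = uL p r l (dK (r + 1) k)"
using dLK_v_LKp by(simp add: uL_def dKK_uK)

lemma dLK_h_hom: "bihom (LK (Suc p) r) (LK p r) (dLK_h (Suc p) r)"
and dLK_v_hom: "bihom (LK p (Suc r)) (LK p r) (dLK_v p (Suc r))"
proof -
have "dLK_h (Suc p) r (lac (LK (Suc p) r) c y) = lac (LK p r) c (dLK_h (Suc p) r y)"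
 "dLK_h (Suc p) r (rac (LK (Suc p) r) y c) = rac (LK p r) (dLK_h (Suc p) r y) c" if y: "y : LKcar (Suc p) r" for c y
 by(rule LK_lin_eqI[OF _ _ y]; simp add: lin_on_def dLK_lin dLK_h_LKp)+
moreover have "dLK_h (Suc p) r y : LKcar p r" if y: "y : LKcar (Suc p) r" for y
 unfolding dLK_h_def diff_Suc_1 by(intro bind_in_subspace2[OF subspace_LK] LKp_in dL_in)(auto dest: LK_keys[OF _ that])
ultimately show "bihom (LK (Suc p) r) (LK p r) (dLK_h (Suc p) r)" by(simp add: bimod_hom_def dLK_lin)
have "dLK_v p (Suc r) (lac (LK p (Suc r)) c y) = lac (LK p r) c (dLK_v p (Suc r) y)"
 "dLK_v p (Suc r) (rac (LK p (Suc r)) y c) = rac (LK p r) (dLK_v p (Suc r) y) c" if y: "y : LKcar p (Suc r)" for c y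
 by(rule LK_lin_eqI[OF _ _ y]; simp add: lin_on_def dLK_lin dLK_v_LKp hom_lac[OF dKK_hom] hom_rac[OF dKK_hom])+
moreover have "dLK_v p (Suc r) y : LKcar p r" if y: "y : LKcar p (Suc r)" for y
 unfolding dLK_v_def diff_Suc_1 by(intro bind_in_subspace2[OF subspace_LK] LKp_in hom_in[OF dKK_hom])(auto dest: LK_keys[OF _ that])
ultimately show "bihom (LK p (Suc r)) (LK p r) (dLK_v p (Suc r))" by(simp add: bimod_hom_def dLK_lin)
qed

abbreviation "LT p r q s == tensor (LK p r) UNIV (LK q s)"
abbreviation "cL p r q s == crossLK p r q s (LK p r) (LK q s) (uL p r) (uL q s)"

lemma bim_LT: "bimodule (LT p r q s)"
by(intro bim_tensor bim_LK)

lemma cL_HomL: "cL p r q s : HomL (p + q) (r + s) (LT p r q s)"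
by(intro crossLK_HomL bim_LK uL_HomL)

lemma DeltaLK_form_eq: "DeltaLK_form p r q s l b b' k = ((-1) ^ (q * r)) *. lac (LT p r q s) b (rac (LT p r q s) (cL p r q s l k) b')"
unfolding DeltaLK_form_def crossLK_def crossK_def rac_tensor_bind lac_tensor_bind bind_scale_right2
by(auto intro!: arg_cong[of _ _ "fscale _"] bind_cong simp: lac_tensor_bind rac_tensor_bind lac_cross[OF bim_LK bim_LK] rac_cross[OF bim_LK bim_LK] uK_def uL_def)

lemma DeltaLK_ext: "DeltaLK p r q s y = ((-1) ^ (q * r)) *. LKext (LT p r q s) (cL p r q s) y"
by(simp add: DeltaLK_def LKext_def KKext_def DeltaLK_form_eq bind_scale_right bind_scale_right2)

lemma DeltaLK_LKp:
assumes l: "l : Lcar (p + q)" and k: "k : Kcar (r + s)"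
shows "DeltaLK p r q s (LKp (p + q) (r + s) l (KKp (r + s) (be b b') k)) = DeltaLK_form p r q s l b b' k"
unfolding DeltaLK_ext DeltaLK_form_eq LKext_LKp[OF bim_LT scl_tensor cL_HomL l KKp_in[OF be_in k]]
 KKext_KKp[OF bim_LT scl_tensor HomL_hom[OF cL_HomL l] k] ..

lemma DeltaLK_hom: "bihom (LK (p + q) (r + s)) (LT p r q s) (DeltaLK p r q s)"
unfolding DeltaLK_ext[abs_def] by(rule hom_scale[OF bim_LT scl_tensor LKext_hom[OF bim_LT scl_tensor cL_HomL]])

lemma DeltaLK_uL: "l : Lcar (p + q) ==> k : Kcar (r + s) ==> DeltaLK p r q s (uL (p + q) (r + s) l k) = ((-1) ^ (q * r)) *. cL p r q s l k"
unfolding DeltaLK_ext by(simp add: LKext_uL[OF bim_LT scl_tensor cL_HomL])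

lemma DeltaLK_in: "y : LKcar (p + q) (r + s) ==> DeltaLK p r q s y : car (LT p r q s)"
by(rule hom_in[OF DeltaLK_hom])

lemma DeltaLK_keys: "(a, b) : keys (DeltaLK p r q s y) ==> y : LKcar (p + q) (r + s) ==> a : LKcar p r & b : LKcar q s"
using tensor_keysD[OF _ DeltaLK_in bim_rclosed[OF bim_LK] bim_lclosed[OF bim_LK]] by blast

lemma tmap_DeltaLK_hom:
"bimodule M ==> bimodule N ==> bihom (LK p r) M F ==> bihom (LK q s) N F' ==>
 bihom (LK (p + q) (r + s)) (M ** N) (%y. tmapU M N F F' (DeltaLK p r q s y))"
by(rule hom_comp[OF tmap_hom(1)[OF bim_LK bim_LK] DeltaLK_hom])

lemma tmap_DeltaLK_uL:
assumes "bihom (LK p r) M F" "bihom (LK q s) N F'" "l : Lcar (p + q)" "k : Kcar (r + s)"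
shows "tmapU M N F F' (DeltaLK p r q s (uL (p + q) (r + s) l k)) =
 ((-1) ^ (q * r)) *. crossLK p r q s M N (%a x. F (uL p r a x)) (%b y. F' (uL q s b y)) l k"
unfolding DeltaLK_uL[OF assms(3,4)] tmap_linear crossLK_def crossK_tmap[OF assms(1,2), symmetric] unfolding tmap_def bind_assoc2 ..

text \<open>On \<open>uL\<close> this is the chain rule for the product of two universal elements; only the signs \<open>(-1)\<^sup>q\<^sup>r\<close> have
to be compared.\<close>

lemma DeltaLK_chain_h:
assumes y: "y : LKcar (p + q + 1) (r + s)"
shows "DeltaLK p r q s (dLK_h (p + q + 1) (r + s) y) = tmapU (LK p r) (LK q s) (dLK_h (p + 1) r) id (DeltaLK (p + 1) r q s y)
 + ((-1) ^ (p + r)) *. tmapU (LK p r) (LK q s) id (dLK_h (q + 1) s) (DeltaLK p r (q + 1) s y)"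
proof -
note d = dLK_h_hom[unfolded Suc_eq_plus1] and t = tmap_DeltaLK_hom[OF bim_LK bim_LK]
have e: "(-1) ^ (q * r) * (-1) ^ p = ((-1) ^ (p + r) * (-1) ^ ((q + 1) * r) :: 'k)"
 unfolding power_add[symmetric] by(rule neg1_pow_eq) (simp; blast)
have a: "p + 1 + q = p + q + 1" "p + (q + 1) = p + q + 1" by simp_all
show ?thesis
proof(rule LK_hom_eqI[OF hom_comp[OF DeltaLK_hom d] hom_plus[OF bim_LT scl_tensor t[OF d[of p] hom_id(2)[where M = "LK q s"], where r = r, unfolded a]
   hom_scale[OF bim_LT scl_tensor t[OF hom_id(2)[where M = "LK p r"] d[of q], where s = s, unfolded a]]] y])
 fix l k assume l: "l : Lcar (p + q + 1)" and k: "k : Kcar (r + s)"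
 have l': "l : Lcar (p + 1 + q)" "l : Lcar (p + (q + 1))" "dL (p + q + 1) l : Lcar (p + q)" using l by simp_all
 show "DeltaLK p r q s (dLK_h (p + q + 1) (r + s) (uL (p + q + 1) (r + s) l k)) =
  tmapU (LK p r) (LK q s) (dLK_h (p + 1) r) id (DeltaLK (p + 1) r q s (uL (p + q + 1) (r + s) l k)) +
  ((-1) ^ (p + r)) *. tmapU (LK p r) (LK q s) id (dLK_h (q + 1) s) (DeltaLK p r (q + 1) s (uL (p + q + 1) (r + s) l k))"
  unfolding tmap_DeltaLK_uL[OF d hom_id(2) l'(1) k, unfolded a] tmap_DeltaLK_uL[OF hom_id(2) d l'(2) k, unfolded a] dLK_h_uL DeltaLK_uL[OF l'(3) k]
   crossLK_chain_h[OF bim_LK bim_LK uL_HomL uL_HomL l k] fscale_plus fv.scale_scale e id_apply ..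
qed
qed

lemma DeltaLK_chain_v:
assumes y: "y : LKcar (p + q) (r + s + 1)"
shows "DeltaLK p r q s (dLK_v (p + q) (r + s + 1) y) = ((-1) ^ q) *. tmapU (LK p r) (LK q s) (dLK_v p (r + 1)) id (DeltaLK p (r + 1) q s y)
 + ((-1) ^ r) *. tmapU (LK p r) (LK q s) id (dLK_v q (s + 1)) (DeltaLK p r q (s + 1) y)"
proof -
note d = dLK_v_hom[unfolded Suc_eq_plus1] and t = tmap_DeltaLK_hom[OF bim_LK bim_LK] and B = hom_scale[OF bim_LT scl_tensor]
have e: "(-1) ^ (q * r) = ((-1) ^ q * (-1) ^ (q * (r + 1)) :: 'k)"
 unfolding power_add[symmetric] by(rule neg1_pow_eq) (simp; blast)
have a: "r + 1 + s = r + s + 1" "r + (s + 1) = r + s + 1" by simp_all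
show ?thesis
proof(rule LK_hom_eqI[OF hom_comp[OF DeltaLK_hom d] hom_plus[OF bim_LT scl_tensor B[OF t[OF d[of p r] hom_id(2)[where M = "LK q s"], unfolded a]]
   B[OF t[OF hom_id(2)[where M = "LK p r"] d[of q s], unfolded a]]] y])
 fix l k assume l: "l : Lcar (p + q)" and k: "k : Kcar (r + s + 1)"
 have k': "k : Kcar (r + 1 + s)" "k : Kcar (r + (s + 1))" "dK (r + s + 1) k : Kcar (r + s)" using k by simp_all
 show "DeltaLK p r q s (dLK_v (p + q) (r + s + 1) (uL (p + q) (r + s + 1) l k)) =
  ((-1) ^ q) *. tmapU (LK p r) (LK q s) (dLK_v p (r + 1)) id (DeltaLK p (r + 1) q s (uL (p + q) (r + s + 1) l k)) +
  ((-1) ^ r) *. tmapU (LK p r) (LK q s) id (dLK_v q (s + 1)) (DeltaLK p r q (s + 1) (uL (p + q) (r + s + 1) l k))"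
  unfolding tmap_DeltaLK_uL[OF d hom_id(2) l k'(1), unfolded a] tmap_DeltaLK_uL[OF hom_id(2) d l k'(2), unfolded a] dLK_v_uL DeltaLK_uL[OF l k'(3)]
   crossLK_chain_v[OF bim_LK bim_LK uL_HomL uL_HomL l k] fscale_plus fv.scale_scale e id_apply by(simp add: ac_simps)
qed
qed

lemma DeltaLK_coassoc:
assumes y: "y : LKcar (p + q + p') (r + s + r')"
shows "tassocU (LK p r) (LK q s) (LK p' r') (tmapU (LT p r q s) (LK p' r') (DeltaLK p r q s) id (DeltaLK (p + q) (r + s) p' r' y))
 = tmapU (LK p r) (LT q s p' r') id (DeltaLK q s p' r') (DeltaLK p r (q + p') (s + r') y)"
proof -
let ?M = "LK p r" and ?N = "LK q s" and ?Q = "LK p' r'"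
note B = bim_LK bim_LT
have e: "(-1) ^ (p' * (r + s)) * (-1) ^ (q * r) = ((-1) ^ ((q + p') * r) * (-1) ^ (p' * s) :: 'k)"
 unfolding power_add[symmetric] by(rule neg1_pow_eq) (simp; blast)
show ?thesis
proof(rule LK_hom_eqI[OF hom_comp[OF tassoc_hom[OF B(1) B(1) B(1)] tmap_DeltaLK_hom[OF B(2,1) DeltaLK_hom hom_id(2)]]
   tmap_DeltaLK_hom[OF B(1,2) hom_id(2) DeltaLK_hom, folded add.assoc] y])
 fix l k assume l: "l : Lcar (p + q + p')" and k: "k : Kcar (r + s + r')"
 have l': "l : Lcar (p + (q + p'))" and k': "k : Kcar (r + (s + r'))" using l k by(simp_all add: add.assoc)
 note i = hom_in[OF HomL_hom[OF uL_HomL]] hom_in[OF HomL_hom[OF cL_HomL]]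
 have 1: "crossLK (p + q) (r + s) p' r' (LT p r q s) ?Q (%a x. DeltaLK p r q s (uL (p + q) (r + s) a x)) (uL p' r') l k =
  ((-1) ^ (q * r)) *. crossLK (p + q) (r + s) p' r' (LT p r q s) ?Q (cL p r q s) (uL p' r') l k"
  by(rule trans[OF crossLK_cong[OF l k] crossLK_scale(1)[OF l k, where M = "LT p r q s", unfolded scl_tensor]])(auto intro: i simp: DeltaLK_uL)
 have 2: "crossLK p r (q + p') (s + r') ?M (LT q s p' r') (uL p r) (%b y. DeltaLK q s p' r' (uL (q + p') (s + r') b y)) l k =
  ((-1) ^ (p' * s)) *. crossLK p r (q + p') (s + r') ?M (LT q s p' r') (uL p r) (cL q s p' r') l k"
  by(rule trans[OF crossLK_cong[OF l' k'] crossLK_scale(2)[OF l' k', where N = "LT q s p' r'", unfolded scl_tensor]])(auto intro: i simp: DeltaLK_uL)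
 show "tassocU ?M ?N ?Q (tmapU (LT p r q s) ?Q (DeltaLK p r q s) id (DeltaLK (p + q) (r + s) p' r' (uL (p + q + p') (r + s + r') l k)))
  = tmapU ?M (LT q s p' r') id (DeltaLK q s p' r') (DeltaLK p r (q + p') (s + r') (uL (p + q + p') (r + s + r') l k))"
  unfolding tmap_DeltaLK_uL[OF DeltaLK_hom hom_id(2) l k] tmap_DeltaLK_uL[OF hom_id(2) DeltaLK_hom l' k', folded add.assoc] id_apply
   1 2 tassoc_scale fv.scale_scale e crossLK_assoc[OF B(1) B(1) B(1) uL_HomL uL_HomL uL_HomL l k] ..
qed
qed

subsection \<open>The product \<open>\<times>\<^sub>r\<close>\<close>

context
fixes p r q s and M :: "('k, 'b, 'm::ab_group_add, 'b) bimod" and N :: "('k, 'b, 'n::ab_group_add, 'b) bimod" and f g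
assumes M: "bimodule M" and N: "bimodule N" and f: "bihom (LK p r) M f" and g: "bihom (LK q s) N g"
begin

lemma crossR_hom: "bihom (LK (p + q) (r + s)) (M ** N) (crossR p r q s M N f g)"
unfolding crossR_def[abs_def] by(rule hom_scale[OF bim_tensor[OF M N] scl_tensor tmap_DeltaLK_hom[OF M N f g]])

lemma tmap_precomp:
"tmapU M N f g (tmapU (LK p r) (LK q s) F id t) = tmapU M N (%x. f (F x)) g t"
"tmapU M N f g (tmapU (LK p r) (LK q s) id F' t) = tmapU M N f (%y. g (F' y)) t"
by(simp_all add: tmap_tmap[OF hom_rhom[OF f] hom_lhom[OF g]])

lemma crossR_Leibniz_h:
assumes y: "y : LKcar (p + q + 1) (r + s)"
shows "dR_h (p + q) (r + s) (M ** N) (crossR p r q s M N f g) y =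
  crossR (p + 1) r q s M N (dR_h p r M f) g y + ((-1) ^ (p + r)) *. crossR p r (q + 1) s M N f (dR_h q s N g) y"
proof -
have y': "y : LKcar (p + 1 + q) (r + s)" "y : LKcar (p + (q + 1)) (r + s)" using y by(simp_all add: ac_simps)
note i = hom_in[OF f] hom_in[OF g] hom_in[OF dLK_h_hom, unfolded Suc_eq_plus1]
have e: "(-1) ^ (p + q + (r + s)) * (-1) ^ ((p + r) * (q + s)) = ((-1) ^ ((p + 1 + r) * (q + s)) * (-1) ^ (p + r) :: 'k)"
 "(-1) ^ ((p + 1 + r) * (q + s)) * (-1) ^ (p + r) * (-1) ^ (p + r) = ((-1) ^ (p + r) * ((-1) ^ ((p + r) * (q + 1 + s)) * (-1) ^ (q + s)) :: 'k)"
 unfolding power_add[symmetric] by(rule neg1_pow_eq; simp; blast)+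
have 1: "tmapU M N (%y. scl M c (f (dLK_h (p + 1) r y))) g (DeltaLK (p + 1) r q s y) = c *. tmapU M N (%y. f (dLK_h (p + 1) r y)) g (DeltaLK (p + 1) r q s y)"
 "tmapU M N f (%y. scl N c (g (dLK_h (q + 1) s y))) (DeltaLK p r (q + 1) s y) = c *. tmapU M N f (%y. g (dLK_h (q + 1) s y)) (DeltaLK p r (q + 1) s y)" for c
 by(rule tmap_scale_left, use DeltaLK_keys[OF _ y'(1)] i in blast, rule tmap_scale_right, use DeltaLK_keys[OF _ y'(2)] i in blast)
show ?thesis
 unfolding dR_h_def[abs_def] crossR_def scl_tensor DeltaLK_chain_h[OF y] tmap_linear tmap_precomp 1 fscale_plus fv.scale_scale e ..
qed

lemma crossR_Leibniz_v:
assumes y: "y : LKcar (p + q) (r + s + 1)"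
shows "dR_v (p + q) (r + s) (M ** N) (crossR p r q s M N f g) y =
  crossR p (r + 1) q s M N (dR_v p r M f) g y + ((-1) ^ (p + r)) *. crossR p r q (s + 1) M N f (dR_v q s N g) y"
proof -
have y': "y : LKcar (p + q) (r + 1 + s)" "y : LKcar (p + q) (r + (s + 1))" using y by(simp_all add: ac_simps)
note i = hom_in[OF f] hom_in[OF g] hom_in[OF dLK_v_hom, unfolded Suc_eq_plus1]
have e: "(-1) ^ (r + s) * (-1) ^ ((p + r) * (q + s)) * (-1) ^ q = ((-1) ^ ((p + (r + 1)) * (q + s)) * (-1) ^ r :: 'k)"
 "(-1) ^ (r + s) * (-1) ^ ((p + r) * (q + s)) * (-1) ^ r = ((-1) ^ (p + r) * ((-1) ^ ((p + r) * (q + (s + 1))) * (-1) ^ s) :: 'k)"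
 unfolding power_add[symmetric] by(rule neg1_pow_eq; simp; blast)+
have 1: "tmapU M N (%y. scl M c (f (dLK_v p (r + 1) y))) g (DeltaLK p (r + 1) q s y) = c *. tmapU M N (%y. f (dLK_v p (r + 1) y)) g (DeltaLK p (r + 1) q s y)"
 "tmapU M N f (%y. scl N c (g (dLK_v q (s + 1) y))) (DeltaLK p r q (s + 1) y) = c *. tmapU M N f (%y. g (dLK_v q (s + 1) y)) (DeltaLK p r q (s + 1) y)" for c
 by(rule tmap_scale_left, use DeltaLK_keys[OF _ y'(1)] i in blast, rule tmap_scale_right, use DeltaLK_keys[OF _ y'(2)] i in blast)
show ?thesis
 unfolding dR_v_def[abs_def] crossR_def scl_tensor DeltaLK_chain_v[OF y] tmap_linear tmap_precomp 1 fscale_plus fv.scale_scale e ..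
qed

end

lemma crossR_assoc:
assumes M: "bimodule M" and N: "bimodule N" and Q: "bimodule Q"
 and f: "bihom (LK p r) M f" and g: "bihom (LK q s) N g" and h: "bihom (LK p' r') Q h"
 and y: "y : LKcar (p + q + p') (r + s + r')"
shows "tassocU M N Q (crossR (p + q) (r + s) p' r' (M ** N) Q (crossR p r q s M N f g) h y) =
  crossR p r (q + p') (s + r') M (N ** Q) f (crossR q s p' r' N Q g h) y"
proof -
have y': "y : LKcar (p + (q + p')) (r + (s + r'))" using y by(simp add: add.assoc)
note B = bim_LK bim_LT
note i = hom_in[OF f] hom_in[OF h] hom_in[OF tmap_DeltaLK_hom[OF M N f g]] hom_in[OF tmap_DeltaLK_hom[OF N Q g h]]
have e: "(-1) ^ ((p + q + (r + s)) * (p' + r')) * (-1) ^ ((p + r) * (q + s)) = ((-1) ^ ((p + r) * (q + p' + (s + r'))) * (-1) ^ ((q + s) * (p' + r')) :: 'k)"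
 unfolding power_add[symmetric] by(rule neg1_pow_eq) (simp; blast)
let ?t = "tmapU (LT p r q s) (LK p' r') (DeltaLK p r q s) id (DeltaLK (p + q) (r + s) p' r' y)"
have t: "?t : car ((LT p r q s) ** (LK p' r'))"
 by(rule hom_in[OF tmap_DeltaLK_hom[OF B(2,1) DeltaLK_hom hom_id(2)] y])
have "tassocU M N Q (crossR (p + q) (r + s) p' r' (M ** N) Q (crossR p r q s M N f g) h y)
 = ((-1) ^ ((p + q + (r + s)) * (p' + r')) * (-1) ^ ((p + r) * (q + s))) *. tassocU M N Q (tmapU (M ** N) Q (%x. tmapU M N f g (DeltaLK p r q s x)) h (DeltaLK (p + q) (r + s) p' r' y))"
 unfolding crossR_def by(subst tmap_scale_left[where M = "M ** N", unfolded scl_tensor])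
  (use DeltaLK_keys[OF _ y] i in blast, simp add: tassoc_scale)
also have "tmapU (M ** N) Q (%x. tmapU M N f g (DeltaLK p r q s x)) h (DeltaLK (p + q) (r + s) p' r' y) = tmapU (M ** N) Q (tmapU M N f g) h ?t"
 by(simp add: tmap_tmap[OF hom_rhom[OF tmap_hom(1)[OF B(1,1) M N f g]] hom_lhom[OF h]])
also have "tassocU M N Q ... = tmapU M (N ** Q) f (tmapU N Q g h) (tmapU (LK p r) (LT q s p' r') id (DeltaLK q s p' r') (DeltaLK p r (q + p') (s + r') y))"
 unfolding tassoc_natural[OF B(1,1,1) M N Q f g h t] DeltaLK_coassoc[OF y] ..
also have "... = tmapU M (N ** Q) f (%x. tmapU N Q g h (DeltaLK q s p' r' x)) (DeltaLK p r (q + p') (s + r') y)"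
 by(simp add: tmap_tmap[OF hom_rhom[OF f] hom_lhom[OF tmap_hom(1)[OF B(1,1) N Q g h]]])
also have "fscale ((-1) ^ ((p + q + (r + s)) * (p' + r')) * (-1) ^ ((p + r) * (q + s))) ... = crossR p r (q + p') (s + r') M (N ** Q) f (crossR q s p' r' N Q g h) y"
 unfolding crossR_def e by(subst tmap_scale_right[where N = "N ** Q", unfolded scl_tensor])
  (use DeltaLK_keys[OF _ y'] i in blast, simp)
finally show ?thesis .
qed

end

section \<open>The total complex \<open>P\<close>\<close>

lemma sum_lookup_single:
assumes "f k 0 = 0"
shows "lookup (\<Sum>k\<in>keys x. Poly_Mapping.single k (f k (lookup x k))) k = f k (lookup x k)"
proof -
have "(\<Sum>j\<in>keys x. lookup (Poly_Mapping.single j (f j (lookup x j))) k) = (\<Sum>j\<in>keys x. if j = k then f k (lookup x k) else 0)"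
 by(intro sum.cong)(auto simp: lookup_single when_def)
thus ?thesis using assms by(simp add: lookup_sum in_keys_iff)
qed

definition bideg :: "nat => (nat \<times> nat) set" where
"bideg u = {(p,r). p + r = u}"

lemma bideg_iff [simp]: "(p, r) : bideg u <-> p + r = u"
by(simp add: bideg_def)

lemma finite_bideg [simp]: "finite (bideg u)"
by(rule finite_subset[of _ "{..u} \<times> {..u}"]) auto

lemma
assumes "kclosed M" "kclosed N"
shows tmap_sum_left: "(!!m n. (m, n) : keys t ==> h n : car N) ==> (!!k m n. k : K ==> (m, n) : keys t ==> f k m : car M) ==> tmap M R N (%x. \<Sum>k\<in>K. f k x) h t = (\<Sum>k\<in>K. tmap M R N (f k) h t)"
 and tmap_sum_right: "(!!m n. (m, n) : keys t ==> g m : car M) ==> (!!k m n. k : K ==> (m, n) : keys t ==> f' k n : car N) ==> tmap M R N g (%x. \<Sum>k\<in>K. f' k x) t = (\<Sum>k\<in>K. tmap M R N g (f' k) t)"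
unfolding tmap_def bind_sum_right2[symmetric]
by(rule bind_cong2, rule lin_on_sum[OF assms(1) lin_tns_left]; blast) (rule bind_cong2, rule lin_on_sum[OF assms(2) lin_tns_right]; blast)

lemma tmap_zero_map:
assumes "kclosed M" "kclosed N" "(ALL x. f x = 0) \<or> (ALL y. g y = 0)" "!!m n. (m, n) : keys t ==> f m : car M & g n : car N"
shows "tmap M R N f g t = 0"
unfolding tmap_def
by(subst bind_zero_right2[of t, symmetric], rule bind_cong2)
 (use assms lin_on_zero[OF assms(1) lin_tns_left] lin_on_zero[OF assms(2) lin_tns_right] in metis)

lemma tmap_add_left:
assumes "!!m n. (m, n) : keys t ==> f m : car M & f' m : car M & g n : car N"
shows "tmap M R N (%x. f x + f' x) g t = tmap M R N f g t + tmap M R N f' g t"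
unfolding tmap_def bind_add_right2[symmetric] by(rule bind_cong2)(use assms in "simp add: tns_add_left")

lemma tmap_add_right:
assumes "!!m n. (m, n) : keys t ==> f m : car M & g n : car N & g' n : car N"
shows "tmap M R N f (%y. g y + g' y) t = tmap M R N f g t + tmap M R N f g' t"
unfolding tmap_def bind_add_right2[symmetric] by(rule bind_cong2)(use assms in "simp add: tns_add_right")

context hopf_galois_ext
begin

abbreviation "Pc u == car (P_cx u)"
abbreviation "PT u v == tensor (P_cx u) UNIV (P_cx v)"
abbreviation "sg p r == Poly_Mapping.single (p, r)"

lemma LK_zero: "lac (LK p r) b 0 = 0" "rac (LK p r) 0 b = 0" "0 : LKcar p r"
using kclosed_zero[OF kclosed_LK] by(simp_all add: LK_def bind_zero_left)

lemma P_car: "x : Pc u <-> (ALL p r. lookup x (p, r) : LKcar p r & (p + r ~= u --> lookup x (p, r) = 0))"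
proof -
have "x : Pc u <-> (ALL p r. (p, r) : keys x --> p + r = u & lookup x (p, r) : LKcar p r)"
 by(auto simp: P_cx_def)
thus ?thesis using LK_zero(3) unfolding in_keys_iff by metis
qed

lemma P_scl: "lookup (scl (P_cx u) c x) (p, r) = c *. lookup x (p, r)"
by(simp add: P_cx_def map.rep_eq when_def)

lemma P_op: "lookup (lac (P_cx u) b x) (p, r) = lac (LK p r) b (lookup x (p, r))"
 "lookup (rac (P_cx u) x b) (p, r) = rac (LK p r) (lookup x (p, r)) b"
using sum_lookup_single[of "%(p,r). lac (LK p r) b" "(p, r)" x] sum_lookup_single[of "%(p, r) y. rac (LK p r) y b" "(p, r)" x]
by(simp_all add: P_cx_def LK_zero split_def)

lemma P_eqI: "(!!p r. lookup x (p, r) = lookup y (p, r)) ==> x = y"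
by(auto intro!: poly_mapping_eqI)

lemma bim_P: "bimodule (P_cx u)"
unfolding bimodule_def
by(intro conjI ballI allI P_eqI; simp add: P_car P_op P_scl lookup_add lookup_minus LK_zero
  bim_lac_lac[OF bim_LK] bim_rac_rac[OF bim_LK] bim_one[OF bim_LK] bim_plus[OF bim_LK]
  bim_bs[OF bim_LK] bim_lac_rac[OF bim_LK] kclosed_diff[OF kclosed_LK])

lemma bim_PT: "bimodule (PT u v)"
by(intro bim_tensor bim_P)

lemma P_lookup_hom: "bihom (P_cx u) (LK p r) (%x. lookup x (p, r))"
by(simp add: bimod_hom_def P_car P_op P_scl lookup_add)

lemma P_single_hom: "p + r = u ==> bihom (LK p r) (P_cx u) (sg p r)"
by(auto simp: bimod_hom_def P_car lookup_single when_def LK_zero P_op P_scl single_add intro!: P_eqI)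

lemma hom_sum:
assumes N: "bimodule N" "scl N = fscale" and f: "!!i. i : I ==> bimod_hom R S M N (f i)"
shows "bimod_hom R S M N (%x. \<Sum>i\<in>I. f i x)"
proof -
have "lac N b 0 = 0" "rac N 0 b = 0" for b
 using klin_zero[OF bim_kclosed[OF N(1)], of N "lac N b"] klin_zero[OF bim_kclosed[OF N(1)], of N "%m. rac N m b"]
  bim_rhom[OF N(1), of "{}" b] bim_lhom[OF N(1), of "{}" b] by(simp_all add: rhom_def lhom_def)
hence Z: "bimod_hom R S M N (%x. 0)"
 using N(2) kclosed_zero[OF bim_kclosed[OF N(1)]] by(simp add: bimod_hom_def)
show ?thesis
 using f
proof(induction I rule: infinite_finite_induct)
 case (insert i I)
 show ?case unfolding sum.insert[OF insert(1,2)]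
  by(rule hom_plus[OF N insert(4) insert(3)])(use insert(4) in auto)
qed (simp_all add: Z)
qed

text \<open>Equations in \<open>M\<close> can be checked on components, and \<open>decomp_tensor\<close> extends this to tensor products.\<close>

definition decomp where
"decomp I M M' \<pi> \<sigma> == bimodule M & (ALL i:I. bimodule (M' i) & bihom M (M' i) (\<pi> i) & bihom (M' i) M (\<sigma> i))
 & (ALL x:car M. x = (\<Sum>i\<in>I. \<sigma> i (\<pi> i x)))"

lemma decomp_eqI: "decomp I M M' \<pi> \<sigma> ==> x : car M ==> y : car M ==> (!!i. i : I ==> \<pi> i x = \<pi> i y) ==> x = y"
unfolding decomp_def by(metis (no_types, lifting) sum.cong)

lemma decomp_tensor:
assumes M: "decomp I M M' \<pi> \<sigma>" and N: "decomp J N N' \<rho> \<tau>"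
shows "decomp (I \<times> J) (M ** N) (%(i,j). tensor (M' i) UNIV (N' j)) (%(i,j). tmapU (M' i) (N' j) (\<pi> i) (\<rho> j))
 (%(i,j). tmapU M N (\<sigma> i) (\<tau> j))"
unfolding decomp_def
proof(intro conjI ballI)
show B: "bimodule (M ** N)" using M N by(auto simp: decomp_def intro: bim_tensor)
note m = M[unfolded decomp_def] and n = N[unfolded decomp_def]
fix t assume t: "t : car (M ** N)"
have k: "x : car M" "y : car N" if "(x, y) : keys t" for x y
 using tensor_keysD[OF that t bim_rclosed bim_lclosed] m n by auto
have i: "(x, y) : keys t ==> i : I ==> \<sigma> i (\<pi> i x) : car M" "(x, y) : keys t ==> j : J ==> \<tau> j (\<rho> j y) : car N" for x y i j
 using k m n hom_in by metis+
have s: "(\<Sum>i\<in>I. \<sigma> i (\<pi> i x)) = x" "(\<Sum>j\<in>J. \<tau> j (\<rho> j y)) = y" "(\<Sum>j\<in>J. \<tau> j (\<rho> j y)) : car N" if "(x, y) : keys t" for x y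
 using k[OF that] m n by metis+
have C: "kclosed M" "kclosed N" using m n bim_kclosed by blast+
have "t = tmapU M N (%x. x) (%y. y) t" using t by(simp add: tmap_def tensor_self)
also have "... = tmapU M N (%x. \<Sum>i\<in>I. \<sigma> i (\<pi> i x)) (%y. \<Sum>j\<in>J. \<tau> j (\<rho> j y)) t"
 by(rule tmap_cong)(simp add: s)
also have "... = (\<Sum>i\<in>I. \<Sum>j\<in>J. tmapU M N (%x. \<sigma> i (\<pi> i x)) (%y. \<tau> j (\<rho> j y)) t)"
 by(rule trans[OF tmap_sum_left[OF C] sum.cong[OF refl tmap_sum_right[OF C]]])(use i s(3) in blast)+
also have "... = (\<Sum>i\<in>I. \<Sum>j\<in>J. tmapU M N (\<sigma> i) (\<tau> j) (tmapU (M' i) (N' j) (\<pi> i) (\<rho> j) t))"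
 by(intro sum.cong refl tmap_tmap[symmetric])(use m n hom_rhom hom_lhom in blast)+
finally show "t = (\<Sum>i\<in>I \<times> J. (case i of (i, j) => tmapU M N (\<sigma> i) (\<tau> j)) ((case i of (i, j) => tmapU (M' i) (N' j) (\<pi> i) (\<rho> j)) t))"
 by(simp add: sum.cartesian_product split_def)
qed (use M N in "auto simp: decomp_def intro: tmap_hom(1) bim_tensor")

lemma decomp_P: "decomp (bideg u) (P_cx u) (%(p,r). LK p r) (%k x. lookup x k) Poly_Mapping.single"
unfolding decomp_def
proof(intro conjI ballI)
fix x assume x: "x : Pc u"
show "x = (\<Sum>k\<in>bideg u. Poly_Mapping.single k (lookup x k))"
 by(rule poly_mapping_eqI)(use x in "auto simp: lookup_sum lookup_single when_def P_car split: prod.splits")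
qed (auto simp: bim_P bim_LK P_lookup_hom intro: P_single_hom)

definition PI where "PI u v p r q s = tmapU (P_cx u) (P_cx v) (sg p r) (sg q s)"

lemma PI_hom: "p + r = u ==> q + s = v ==> bihom (LT p r q s) (PT u v) (PI u v p r q s)"
unfolding PI_def by(intro tmap_hom(1) bim_LK bim_P P_single_hom)

lemma DeltaP_PI: "DeltaP u v x = (\<Sum>(p,r)\<in>bideg u. \<Sum>(q,s)\<in>bideg v. PI u v p r q s (DeltaLK p r q s (lookup x (p + q, r + s))))"
by(simp add: DeltaP_def PI_def bideg_def)

lemma DeltaP_hom: "bihom (P_cx (u + v)) (PT u v) (DeltaP u v)"
unfolding DeltaP_PI[abs_def] split_def
by(intro hom_sum[OF bim_PT scl_tensor] hom_comp[OF PI_hom hom_comp[OF DeltaLK_hom P_lookup_hom]])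
 (auto simp: bideg_def)

abbreviation "pj p r q s == tmapU (LK p r) (LK q s) (%x. lookup x (p, r)) (%x. lookup x (q, s))"

lemma PT_eqI:
assumes "t : car (PT u v)" "t' : car (PT u v)" "!!p r q s. p + r = u ==> q + s = v ==> pj p r q s t = pj p r q s t'"
shows "t = t'"
by(rule decomp_eqI[OF decomp_tensor[OF decomp_P decomp_P] assms(1,2)])(use assms(3) in auto)

lemma pj_DeltaP:
assumes p: "p + r = u" "q + s = v" and x: "x : Pc (u + v)"
shows "pj p r q s (DeltaP u v x) = DeltaLK p r q s (lookup x (p + q, r + s))"
proof -
let ?D = "%p r q s. DeltaLK p r q s (lookup x (p + q, r + s))"
have D: "?D p r q s : car (LT p r q s)" for p r q s
 by(rule DeltaLK_in)(use x in "simp add: P_car")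
have "pj p r q s (PI u v p' r' q' s' (?D p' r' q' s')) = (if p' = p & r' = r then if q' = q & s' = s then ?D p r q s else 0 else 0)"
 if e: "p' + r' = u" "q' + s' = v" for p' r' q' s'
proof -
 have k: "a : LKcar p' r' & b : LKcar q' s'" if "(a, b) : keys (?D p' r' q' s')" for a b
  using tensor_keysD[OF that D bim_rclosed[OF bim_LK] bim_lclosed[OF bim_LK]] by auto
 have "pj p r q s (PI u v p' r' q' s' (?D p' r' q' s')) = tmapU (LK p r) (LK q s) (%a. if p' = p & r' = r then a else 0) (%b. if q' = q & s' = s then b else 0) (?D p' r' q' s')"
  unfolding PI_def tmap_tmap[OF hom_rhom[OF P_lookup_hom] hom_lhom[OF P_lookup_hom]] by(simp add: lookup_single when_def)
 also have "... = (if p' = p & r' = r then if q' = q & s' = s then ?D p r q s else 0 else 0)"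
 proof(cases "p' = p & r' = r & q' = q & s' = s")
  case True
  thus ?thesis using D[of p r q s] by(simp add: tmap_def tensor_self)
 next
  case False
  have "tmapU (LK p r) (LK q s) (%a. if p' = p & r' = r then a else 0) (%b. if q' = q & s' = s then b else 0) (?D p' r' q' s') = 0"
   by(rule tmap_zero_map[OF kclosed_LK kclosed_LK])(use False in "auto simp: LK_zero(3) dest!: k")
  thus ?thesis using False by auto
 qed
 finally show ?thesis .
qed
hence "pj p r q s (DeltaP u v x) = (\<Sum>k\<in>bideg u. \<Sum>m\<in>bideg v. if k = (p, r) then if m = (q, s) then ?D p r q s else 0 else 0)"
 unfolding DeltaP_PI tmap_sum split_def by(intro sum.cong refl)(simp add: bideg_def prod_eq_iff split_def)
moreover have "(\<Sum>m\<in>bideg v. if k = (p, r) then if m = (q, s) then ?D p r q s else 0 else 0) = (if k = (p, r) then ?D p r q s else 0)" for k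
 using p by(simp add: sum.delta)
ultimately show ?thesis
 using p by(simp add: sum.delta)
qed

lemma dLK_0: "y : LKcar 0 r ==> dLK_h 0 r y = 0" "y : LKcar p 0 ==> dLK_v p 0 y = 0"
proof -
have 1: "LKp 0 r 0 x = 0" if "x : KKcar r" for r x using LKp_scale_left[OF L_closed(1) that, of 0 0] by simp
have 2: "LKp p 0 l 0 = 0" if "l : Lcar p" for l using LKp_scale_right[OF that kclosed_zero[OF kclosed_KK], of 0 0] by simp
have 3: "KKp 0 u 0 = 0" if "u : Be_car" for u using klin_zero[OF kclosed_K KKp_lin(2)[OF that]] by simp
have 4: "dKK 0 x = 0" if "x : KKcar 0" for x
 unfolding dKK_def by(subst bind_zero_right2[of x, symmetric], rule bind_cong2)(use KK_keys[OF _ that] 3 in auto)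
show "dLK_h 0 r y = 0" if "y : LKcar 0 r"
 unfolding dLK_h_def by(subst bind_zero_right2[of y, symmetric], rule bind_cong2)(use LK_keys[OF _ that] 1 in auto)
show "dLK_v p 0 y = 0" if "y : LKcar p 0"
 unfolding dLK_v_def by(subst bind_zero_right2[of y, symmetric], rule bind_cong2)(use LK_keys[OF _ that] 2 4 in auto)
qed

lemma dLK_zero: "dLK_h p r 0 = 0" "dLK_v p r 0 = 0"
by(simp_all add: dLK_h_def dLK_v_def bind_zero_left)

lemma lookup_dP:
assumes x: "x : Pc u"
shows "lookup (dP u x) (p, r) = dLK_h (Suc p) r (lookup x (Suc p, r)) + ((-1) ^ p) *. dLK_v p (Suc r) (lookup x (p, Suc r))"
proof -
have i: "lookup x (p, r) : LKcar p r" for p r using x by(simp add: P_car)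
have "lookup (dP u x) (p, r) = (\<Sum>k\<in>keys x. (if k = (Suc p, r) then dLK_h (Suc p) r (lookup x (Suc p, r)) else 0) +
 (if k = (p, Suc r) then ((-1) ^ p) *. dLK_v p (Suc r) (lookup x (p, Suc r)) else 0))"
 unfolding dP_def lookup_sum
proof(rule sum.cong[OF refl], clarify)
 fix a b
 have 1: "lookup (sg (a - 1) b (dLK_h a b (lookup x (a, b)))) (p, r) = (if (a, b) = (Suc p, r) then dLK_h (Suc p) r (lookup x (Suc p, r)) else 0)"
  by(cases a)(auto simp: lookup_single when_def dLK_0(1)[OF i])
 have 2: "lookup (sg a (b - 1) (((-1) ^ a) *. dLK_v a b (lookup x (a, b)))) (p, r)
  = (if (a, b) = (p, Suc r) then ((-1) ^ p) *. dLK_v p (Suc r) (lookup x (p, Suc r)) else 0)"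
  by(cases b)(auto simp: lookup_single when_def dLK_0(2)[OF i])
 show "lookup (sg (a - 1) b (dLK_h a b (lookup x (a, b))) + sg a (b - 1) (((-1) ^ a) *. dLK_v a b (lookup x (a, b)))) (p, r)
  = (if (a, b) = (Suc p, r) then dLK_h (Suc p) r (lookup x (Suc p, r)) else 0) +
   (if (a, b) = (p, Suc r) then ((-1) ^ p) *. dLK_v p (Suc r) (lookup x (p, Suc r)) else 0)"
  unfolding lookup_add 1 2 ..
qed
thus ?thesis by(simp add: sum.distrib in_keys_iff dLK_zero)
qed

lemma dP_hom: "bihom (P_cx (Suc u)) (P_cx u) (dP (Suc u))"
proof -
note h = hom_in[OF dLK_h_hom] hom_in[OF dLK_v_hom] hom_lac[OF dLK_h_hom] hom_rac[OF dLK_h_hom] hom_lac[OF dLK_v_hom] hom_rac[OF dLK_v_hom]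
have cl: "x : LKcar p r ==> y : LKcar p r ==> x + y : LKcar p r" "x : LKcar p r ==> c*.x : LKcar p r" for p r x y c
 using kclosed_add[OF kclosed_LK] kclosed_scl[OF kclosed_LK] by auto
have i: "lookup x (p, r) : LKcar p r" if "x : Pc (Suc u)" for x p r using that by(simp add: P_car)
have in': "dP (Suc u) x : Pc u" if x: "x : Pc (Suc u)" for x
proof -
 have "lookup x (Suc p, r) = 0" "lookup x (p, Suc r) = 0" if "p + r ~= u" for p r using x that by(auto simp: P_car)
 thus ?thesis unfolding P_car by(auto simp: lookup_dP[OF x] dLK_zero intro!: cl h i[OF x])
qed
note bm = bim_P[of "Suc u"]
note PC = kclosed_add[OF bim_kclosed[OF bm]] kclosed_scl[OF bim_kclosed[OF bm]] bim_lac_in[OF bm] bim_rac_in[OF bm]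
show ?thesis
 unfolding bimod_hom_def
 by(intro conjI ballI allI P_eqI in')
  (simp_all add: lookup_dP PC lookup_add P_scl P_op dLK_lin fscale_plus mult.commute h i)
qed

text \<open>On each component the claim is the sum of the rules for the horizontal and the vertical differential,
the latter taken with the sign \<open>(-1)\<^sup>p\<close> that it has in the differential of \<open>P\<close>.\<close>

lemma P_chain: "diagonal_chain_map P_cx dP DeltaP"
unfolding diagonal_chain_map_def
proof(intro conjI allI ballI)
fix u v x assume x: "x : Pc (u + v + 1)"
note B = bim_P bim_LK
note d = dP_hom[unfolded Suc_eq_plus1]
have x': "x : Pc (u + 1 + v)" "x : Pc (u + (v + 1))" using x by(simp_all add: ac_simps)
have xi: "lookup x (p, r) : LKcar p r" for p r using x by(simp add: P_car)
let ?L = "tmapU (P_cx u) (P_cx v) (dP (u + 1)) id (DeltaP (u + 1) v x)"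
let ?R = "tmapU (P_cx u) (P_cx v) id (dP (v + 1)) (DeltaP u (v + 1) x)"
note D = hom_in[OF DeltaP_hom x'(1)] hom_in[OF DeltaP_hom x'(2)]
have in': "?L : car (PT u v)" "?R : car (PT u v)"
 by(rule hom_in[OF tmap_hom(1)[OF B(1,1,1,1) d hom_id(2)] D(1)], rule hom_in[OF tmap_hom(1)[OF B(1,1,1,1) hom_id(2) d] D(2)])
have k: "a : Pc (u + 1) & b : Pc v" if "(a, b) : keys (DeltaP (u + 1) v x)" for a b
 using tensor_keysD[OF that D(1) bim_rclosed[OF B(1)] bim_lclosed[OF B(1)]] by auto
have k': "a : Pc u & b : Pc (v + 1)" if "(a, b) : keys (DeltaP u (v + 1) x)" for a b
 using tensor_keysD[OF that D(2) bim_rclosed[OF B(1)] bim_lclosed[OF B(1)]] by auto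
note PC = bim_kclosed[OF bim_PT, of u v]
show "DeltaP u v (dP (u + v + 1) x) = ?L + ((-1) ^ u) *. ?R"
proof(rule PT_eqI)
 show "DeltaP u v (dP (u + v + 1) x) : car (PT u v)" by(rule hom_in[OF DeltaP_hom hom_in[OF d x]])
 show "?L + ((-1) ^ u) *. ?R : car (PT u v)" using kclosed_add[OF PC] kclosed_scl[OF PC] in' by simp
 fix p r q s assume e: "p + r = u" "q + s = v"
 let ?l = "%p r x. lookup x (p, r)" and ?t = "tmapU (LK p r) (LK q s)"
 have dl: "lookup (dP (w + 1) y) (p, r) = dLK_h (p + 1) r (?l (p + 1) r y) + ((-1) ^ p) *. dLK_v p (r + 1) (?l p (r + 1) y)"
  "?l p r y : LKcar p r" "dLK_h (p + 1) r (?l (p + 1) r y) : LKcar p r" "dLK_v p (r + 1) (?l p (r + 1) y) : LKcar p r"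
  if "y : Pc (w + 1)" for p r w y
  using that lookup_dP[of y "w + 1" p r] hom_in[OF dLK_h_hom] hom_in[OF dLK_v_hom] by(auto simp: P_car)
 have i: "c*.y : LKcar p r" if "y : LKcar p r" for c y p r using kclosed_scl[OF kclosed_LK[of p r] that] by simp
 have li: "y : Pc w ==> ?l p r y : LKcar p r" for y w p r by(simp add: P_car)
 have "pj p r q s ?L = ?t (dLK_h (p + 1) r) id (pj (p + 1) r q s (DeltaP (u + 1) v x)) + ((-1) ^ p) *. ?t (dLK_v p (r + 1)) id (pj p (r + 1) q s (DeltaP (u + 1) v x))"
 proof -
  have "pj p r q s ?L = ?t (%y. lookup (dP (u + 1) y) (p, r)) (?l q s) (DeltaP (u + 1) v x)"
   by(simp add: tmap_tmap[OF hom_rhom[OF P_lookup_hom] hom_lhom[OF P_lookup_hom]])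
  also have "... = ?t (%y. dLK_h (p + 1) r (?l (p + 1) r y) + scl (LK p r) ((-1) ^ p) (dLK_v p (r + 1) (?l p (r + 1) y))) (?l q s) (DeltaP (u + 1) v x)"
   by(rule tmap_cong)(use k dl(1) in auto)
  also have "... = ?t (%y. dLK_h (p + 1) r (?l (p + 1) r y)) (?l q s) (DeltaP (u + 1) v x) + ((-1) ^ p) *. ?t (%y. dLK_v p (r + 1) (?l p (r + 1) y)) (?l q s) (DeltaP (u + 1) v x)"
   by(rule trans[OF tmap_add_left arg_cong2[of _ _ _ _ "(+)", OF refl tmap_scale_left]], unfold LK_simps)(use k dl(3,4) li i in blast)+
  finally show ?thesis
   by(simp add: tmap_tmap[OF hom_rhom[OF dLK_h_hom] lhom_id(2)] tmap_tmap[OF hom_rhom[OF dLK_v_hom] lhom_id(2)])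
 qed
 moreover have "pj p r q s ?R = ?t id (dLK_h (q + 1) s) (pj p r (q + 1) s (DeltaP u (v + 1) x)) + ((-1) ^ q) *. ?t id (dLK_v q (s + 1)) (pj p r q (s + 1) (DeltaP u (v + 1) x))"
 proof -
  have "pj p r q s ?R = ?t (?l p r) (%y. lookup (dP (v + 1) y) (q, s)) (DeltaP u (v + 1) x)"
   by(simp add: tmap_tmap[OF hom_rhom[OF P_lookup_hom] hom_lhom[OF P_lookup_hom]])
  also have "... = ?t (?l p r) (%y. dLK_h (q + 1) s (?l (q + 1) s y) + scl (LK q s) ((-1) ^ q) (dLK_v q (s + 1) (?l q (s + 1) y))) (DeltaP u (v + 1) x)"
   by(rule tmap_cong)(use k' dl(1) in auto)
  also have "... = ?t (?l p r) (%y. dLK_h (q + 1) s (?l (q + 1) s y)) (DeltaP u (v + 1) x) + ((-1) ^ q) *. ?t (?l p r) (%y. dLK_v q (s + 1) (?l q (s + 1) y)) (DeltaP u (v + 1) x)"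
   by(rule trans[OF tmap_add_right arg_cong2[of _ _ _ _ "(+)", OF refl tmap_scale_right]], unfold LK_simps)(use k' dl(3,4) li i in blast)+
  finally show ?thesis
   by(simp add: tmap_tmap[OF rhom_id(2) hom_lhom[OF dLK_h_hom]] tmap_tmap[OF rhom_id(2) hom_lhom[OF dLK_v_hom]])
 qed
 moreover have "pj (p + 1) r q s (DeltaP (u + 1) v x) = DeltaLK (p + 1) r q s (?l (p + q + 1) (r + s) x)"
  "pj p (r + 1) q s (DeltaP (u + 1) v x) = DeltaLK p (r + 1) q s (?l (p + q) (r + s + 1) x)"
  "pj p r (q + 1) s (DeltaP u (v + 1) x) = DeltaLK p r (q + 1) s (?l (p + q + 1) (r + s) x)"
  "pj p r q (s + 1) (DeltaP u (v + 1) x) = DeltaLK p r q (s + 1) (?l (p + q) (r + s + 1) x)"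
  using pj_DeltaP[OF _ _ x'(1)] pj_DeltaP[OF _ _ x'(2)] e by simp_all
 moreover have "pj p r q s (DeltaP u v (dP (u + v + 1) x)) = DeltaLK p r q s (dLK_h (p + q + 1) (r + s) (?l (p + q + 1) (r + s) x))
   + ((-1) ^ (p + q)) *. DeltaLK p r q s (dLK_v (p + q) (r + s + 1) (?l (p + q) (r + s + 1) x))"
  unfolding pj_DeltaP[OF e hom_in[OF d x]] dl(1)[OF x] by(simp add: DeltaLK_def bind_linear)
 moreover have "(-1) ^ (p + q) * (-1) ^ q = ((-1) ^ p :: 'k)" "(-1) ^ (p + q) * (-1) ^ r = ((-1) ^ u * (-1) ^ q :: 'k)"
  unfolding e(1)[symmetric] power_add[symmetric] by(rule neg1_pow_eq; simp; blast)+
 ultimately show "pj p r q s (DeltaP u v (dP (u + v + 1) x)) = pj p r q s (?L + ((-1) ^ u) *. ?R)"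
  by(simp only: tmap_linear DeltaLK_chain_h[OF xi] DeltaLK_chain_v[OF xi] e(1) fscale_plus fv.scale_scale)(simp only: ac_simps)
qed
qed (rule DeltaP_hom)

lemma P_coassoc: "coassociative P_cx DeltaP"
unfolding coassociative_def
proof(intro allI ballI)
fix u v w x assume x: "x : Pc (u + v + w)"
note B = bim_P bim_PT
have x': "x : Pc (u + (v + w))" using x by(simp add: add.assoc)
have xi: "lookup x (p, r) : LKcar p r" for p r using x by(simp add: P_car)
let ?L = "tmapU (PT u v) (P_cx w) (DeltaP u v) id (DeltaP (u + v) w x)"
let ?R = "tmapU (P_cx u) (PT v w) id (DeltaP v w) (DeltaP u (v + w) x)"
note D = hom_in[OF DeltaP_hom x] hom_in[OF DeltaP_hom x']
have L: "?L : car ((PT u v) ** (P_cx w))" and R: "?R : car ((P_cx u) ** (PT v w))"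
 by(rule hom_in[OF tmap_hom(1)[OF B(1,1,2,1) DeltaP_hom hom_id(2)] D(1)], rule hom_in[OF tmap_hom(1)[OF B(1,1,1,2) hom_id(2) DeltaP_hom] D(2)])
have k: "a : Pc (u + v)" if "(a, b) : keys (DeltaP (u + v) w x)" for a b
 using tensor_keysD[OF that D(1) bim_rclosed[OF B(1)] bim_lclosed[OF B(1)]] by auto
have k': "b : Pc (v + w)" if "(a, b) : keys (DeltaP u (v + w) x)" for a b
 using tensor_keysD[OF that D(2) bim_rclosed[OF B(1)] bim_lclosed[OF B(1)]] by auto
have "tmapU (LK p r) (LT q s i j) (%x. lookup x (p, r)) (pj q s i j) (tassocU (P_cx u) (P_cx v) (P_cx w) ?L)
  = tmapU (LK p r) (LT q s i j) (%x. lookup x (p, r)) (pj q s i j) ?R"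
 if e: "p + r = u" "q + s = v" "i + j = w" for p r q s i j
proof -
 let ?l = "%p r x. lookup x (p, r)"
 note h = P_lookup_hom[of u p r] P_lookup_hom[of v q s] P_lookup_hom[of w i j]
 have "tmapU (LK p r) (LT q s i j) (?l p r) (pj q s i j) (tassocU (P_cx u) (P_cx v) (P_cx w) ?L)
  = tassocU (LK p r) (LK q s) (LK i j) (tmapU (LT p r q s) (LK i j) (pj p r q s) (?l i j) ?L)"
  by(rule tassoc_natural[OF B(1,1,1) bim_LK bim_LK bim_LK h L, symmetric])
 also have "tmapU (LT p r q s) (LK i j) (pj p r q s) (?l i j) ?L
  = tmapU (LT p r q s) (LK i j) (%y. DeltaLK p r q s (?l (p + q) (r + s) y)) (?l i j) (DeltaP (u + v) w x)"
  unfolding tmap_tmap[OF hom_rhom[OF tmap_hom(1)[OF B(1,1) bim_LK bim_LK h(1,2)]] hom_lhom[OF h(3)]]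
  by(rule tmap_cong)(use k pj_DeltaP[OF e(1,2)] in auto)
 also have "... = tmapU (LT p r q s) (LK i j) (DeltaLK p r q s) id (pj (p + q) (r + s) i j (DeltaP (u + v) w x))"
  by(simp add: tmap_tmap[OF hom_rhom[OF DeltaLK_hom] lhom_id(2)])
 also have "pj (p + q) (r + s) i j (DeltaP (u + v) w x) = DeltaLK (p + q) (r + s) i j (?l (p + q + i) (r + s + j) x)"
  by(rule pj_DeltaP[OF _ e(3) x])(use e in simp)
 also have "tassocU (LK p r) (LK q s) (LK i j) (tmapU (LT p r q s) (LK i j) (DeltaLK p r q s) id ...)
  = tmapU (LK p r) (LT q s i j) id (DeltaLK q s i j) (DeltaLK p r (q + i) (s + j) (?l (p + q + i) (r + s + j) x))"
  by(rule DeltaLK_coassoc[OF xi])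
 also have "DeltaLK p r (q + i) (s + j) (?l (p + q + i) (r + s + j) x) = pj p r (q + i) (s + j) (DeltaP u (v + w) x)"
  unfolding add.assoc by(rule pj_DeltaP[OF e(1) _ x', symmetric])(use e in simp)
 also have "tmapU (LK p r) (LT q s i j) id (DeltaLK q s i j) ... = tmapU (LK p r) (LT q s i j) (?l p r) (%y. DeltaLK q s i j (?l (q + i) (s + j) y)) (DeltaP u (v + w) x)"
  by(simp add: tmap_tmap[OF rhom_id(2) hom_lhom[OF DeltaLK_hom]])
 also have "... = tmapU (LK p r) (LT q s i j) (?l p r) (pj q s i j) ?R"
  unfolding tmap_tmap[OF hom_rhom[OF h(1)] hom_lhom[OF tmap_hom(1)[OF B(1,1) bim_LK bim_LK h(2,3)]]]
  by(rule tmap_cong)(use k' pj_DeltaP[OF e(2,3)] in auto)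
 finally show ?thesis .
qed
thus "tassocU (P_cx u) (P_cx v) (P_cx w) ?L = ?R"
 by(intro decomp_eqI[OF decomp_tensor[OF decomp_P decomp_tensor[OF decomp_P decomp_P]] hom_in[OF tassoc_hom[OF B(1,1,1)] L] R]) auto
qed

end

theorem corollary4p6:
  fixes G :: "('k::field, 'h::ring_1, 'b::{ring,monoid_mult}) ext_data"
  assumes hopf: "hopf_algebra G"
    and antipode: "bij (antip G)"
    and galois: "faithfully_flat_galois G"
  shows
    "((\<forall>r s b b'. \<forall>k\<in>car (K_cx G (r + s)).
        DeltaKK G r s (KKp G (r + s) (be G b b') k) = DeltaKK_form G r s b b' k)
     \<and> diagonal_chain_map (KK G) (dKK G) (DeltaKK G) \<and> coassociative (KK G) (DeltaKK G)) \<and>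
     ((\<forall>p r q s b b'. \<forall>l\<in>car (L_cx G (p + q)). \<forall>k\<in>car (K_cx G (r + s)).
        DeltaLK G p r q s (LKp G (p + q) (r + s) l (KKp G (r + s) (be G b b') k))
          = DeltaLK_form G p r q s l b b' k)
     \<and> diagonal_chain_map (P_cx G) (dP G) (DeltaP G) \<and> coassociative (P_cx G) (DeltaP G)) \<and>
     (\<forall>(M :: ('k, 'b, 'm::ab_group_add, 'b) bimod) (N :: ('k, 'b, 'n::ab_group_add, 'b) bimod) p r q s.
       bimodule G M \<and> bimodule G N \<longrightarrow>
       (\<forall>f\<in>HomL G p r M. \<forall>g\<in>HomL G q s N.
          crossL G p r q s M N f g \<in> HomL G (p + q) (r + s) (tensor M UNIV N) \<and>
          (\<forall>l\<in>car (L_cx G (p + q + 1)). \<forall>k\<in>car (K_cx G (r + s)).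
             dL_h G (p + q) (r + s) (tensor M UNIV N) (crossL G p r q s M N f g) l k =
               crossL G (p + 1) r q s M N (dL_h G p r M f) g l k +
               fscale ((-1) ^ (p + r)) (crossL G p r (q + 1) s M N f (dL_h G q s N g) l k)) \<and>
          (\<forall>l\<in>car (L_cx G (p + q)). \<forall>k\<in>car (K_cx G (r + s + 1)).
             dL_v G (p + q) (r + s) (tensor M UNIV N) (crossL G p r q s M N f g) l k =
               crossL G p (r + 1) q s M N (dL_v G p r M f) g l k +
               fscale ((-1) ^ (p + r)) (crossL G p r q (s + 1) M N f (dL_v G q s N g) l k)))) \<and>
     (\<forall>(M :: ('k, 'b, 'm, 'b) bimod) (N :: ('k, 'b, 'n, 'b) bimod)
        (Q :: ('k, 'b, 'q::ab_group_add, 'b) bimod) p r q s p' r'.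
       bimodule G M \<and> bimodule G N \<and> bimodule G Q \<longrightarrow>
       (\<forall>f\<in>HomL G p r M. \<forall>g\<in>HomL G q s N. \<forall>h\<in>HomL G p' r' Q.
          \<forall>l\<in>car (L_cx G (p + q + p')). \<forall>k\<in>car (K_cx G (r + s + r')).
            tassoc M UNIV N UNIV Q
              (crossL G (p + q) (r + s) p' r' (tensor M UNIV N) Q (crossL G p r q s M N f g) h l k) =
            crossL G p r (q + p') (s + r') M (tensor N UNIV Q) f (crossL G q s p' r' N Q g h) l k)) \<and>
     (\<forall>(M :: ('k, 'b, 'm, 'b) bimod) (N :: ('k, 'b, 'n, 'b) bimod) p r q s.
       bimodule G M \<and> bimodule G N \<longrightarrow>
       (\<forall>f\<in>HomR G p r M. \<forall>g\<in>HomR G q s N.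
          crossR G p r q s M N f g \<in> HomR G (p + q) (r + s) (tensor M UNIV N) \<and>
          (\<forall>y\<in>car (LK G (p + q + 1) (r + s)).
             dR_h G (p + q) (r + s) (tensor M UNIV N) (crossR G p r q s M N f g) y =
               crossR G (p + 1) r q s M N (dR_h G p r M f) g y +
               fscale ((-1) ^ (p + r)) (crossR G p r (q + 1) s M N f (dR_h G q s N g) y)) \<and>
          (\<forall>y\<in>car (LK G (p + q) (r + s + 1)).
             dR_v G (p + q) (r + s) (tensor M UNIV N) (crossR G p r q s M N f g) y =
               crossR G p (r + 1) q s M N (dR_v G p r M f) g y +
               fscale ((-1) ^ (p + r)) (crossR G p r q (s + 1) M N f (dR_v G q s N g) y)))) \<and>
     (\<forall>(M :: ('k, 'b, 'm, 'b) bimod) (N :: ('k, 'b, 'n, 'b) bimod) (Q :: ('k, 'b, 'q, 'b) bimod)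
        p r q s p' r'.
       bimodule G M \<and> bimodule G N \<and> bimodule G Q \<longrightarrow>
       (\<forall>f\<in>HomR G p r M. \<forall>g\<in>HomR G q s N. \<forall>h\<in>HomR G p' r' Q.
          \<forall>y\<in>car (LK G (p + q + p') (r + s + r')).
            tassoc M UNIV N UNIV Q
              (crossR G (p + q) (r + s) p' r' (tensor M UNIV N) Q (crossR G p r q s M N f g) h y) =
            crossR G p r (q + p') (s + r') M (tensor N UNIV Q) f (crossR G q s p' r' N Q g h) y))"
proof -
  interpret hopf_galois_ext G by standard (fact hopf galois)+
  have R: "f \<in> HomR G p r M <-> bimod_hom UNIV UNIV (LK p r) M f" for p r M f
    by(simp add: HomR_def)
  show ?thesis
    by(intro conjI allI ballI impI; (elim conjE)?; (unfold R)?;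
        rule DeltaKK_KKp KK_chain KK_coassoc DeltaLK_LKp P_chain P_coassoc crossL_HomL crossL_Leibniz_h crossL_Leibniz_v
          crossL_assoc crossR_hom crossR_Leibniz_h crossR_Leibniz_v crossR_assoc; assumption)
qed

end
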